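(* Let $n\ge 2$, $p\ge 2$, let $M^{n+p}(c)$ be an $(n+p)$-dimensional Riemannian space of constant curvature $c$, and let $F^n\subset M^{n+p}(c)$ be a smooth $n$-dimensional submanifold belonging to the set $\mathcal{R}_b$, i.e. whose second fundamental form $b$ is recurrent. If $\overline\nabla b\neq 0$ at a point $x\in F^n$, then $x$ belongs to some domain $U\subset F^n$ in which the following hold: 1) $F^n$ carries an orthogonal conjugate system $\{L_1^1, L_2^{n-1}\}$ (with $\dim L_1^1=1$, $\dim L_2^{n-1}=n-1$); 2) $F^n$ is a direct Riemannian product $F_1^1\times F_2^{n-1}$ of maximal integral submanifolds $F_1^1$, $F_2^{n-1}$ of the distributions $L_1^1$, $L_2^{n-1}$, respectively; 3) $F_1^1$ (and also $F_2^{1}$ if $n=2$) is a line of curvature of $F^n$ in $M^{n+p}(c)$, and, if $n>2$, $F_2^{n-1}$ is a surface of curvature of $F^n$ in $M^{n+p}(c)$.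
   Context: $\widetilde g$ is the metric of $M^{n+p}(c)$, $g$ the induced metric on $F^n$; $\widetilde\nabla,\nabla$ are their Levi-Civita connections, and $D$ is the normal connection. $TF^n$ and $T^\bot F^n$ are the tangent and normal bundles. The second fundamental form $b$ is given by $\widetilde\nabla_X Y=\nabla_X Y+b(X,Y)$ for tangent fields $X,Y$, and for a normal field $\xi$ the shape operator $A_\xi$ is given by $\widetilde\nabla_X\xi=-A_\xi X+D_X\xi$, so $\widetilde g(b(X,Y),\xi)=g(A_\xi X,Y)$. The van der Waerden–Bortolotti derivative of $b$ is $(\overline\nabla_X b)(Y,Z)=D_X(b(Y,Z))-b(\nabla_XY,Z)-b(Y,\nabla_XZ)$. $b$ is recurrent if it is nonzero and there is a 1-form $\mu$ on $F^n$ with $\overline\nabla b=\mu\otimes b$, i.e. $(\overline\nabla_Xb)(Y,Z)=\mu(X)b(Y,Z)$ for all $X,Y,Z\in TF^n$. $\mathcal{R}_b$ is the set of submanifolds with recurrent second fundamental form. $F^n$ carries in a domain $U\subset F^n$ a conjugate system $\{L_1^{k_1},\dots,L_m^{k_m}\}$ ($k_1+\dots+k_m=n$, $\dim L_i^{k_i}=k_i$) if $T_yF^n=L_1^{k_1}(y)\oplus\dots\oplus L_m^{k_m}(y)$ at each $y\in U$ and the distributions $L_i^{k_i}$ are smooth, involutive and mutually conjugate, the last meaning $b(X,Y)=0$ for $X\in L_i^{k_i}$, $Y\in L_j^{k_j}$, $i\ne j$. The system is orthogonal if moreover the $L_i^{k_i}$ are mutually orthogonal. A submanifold $F\subset F^n$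 is a surface of curvature of $F^n$ if at every $x\in F$ and for every normal $\xi\in T_x^\bot F^n$ the space $T_xF$ is an eigen-subspace of $A_\xi$ (i.e. $A_\xi$ acts on $T_xF$ as multiplication by a scalar depending on $\xi$ and $x$). A line of curvature is a one-dimensional such submanifold. A domain is a connected open subset. *)

theory Defs
  imports "HOL-Analysis.Analysis"
begin

section \<open>Smooth manifolds\<close>

primrec Ck_on ::
  "nat \<Rightarrow> 'a::real_normed_vector set \<Rightarrow> ('a \<Rightarrow> 'b::real_normed_vector) \<Rightarrow> bool" where
  "Ck_on 0 S f \<longleftrightarrow> continuous_on S f"
| "Ck_on (Suc k) S f \<longleftrightarrow>
     (\<forall>x\<in>S. f differentiable (at x)) \<and>
     (\<forall>v. Ck_on k S (\<lambda>x. frechet_derivative f (at x) v))"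

text \<open>Only used for open sets \<open>S\<close>.\<close>

definition smooth_on ::
  "'a::real_normed_vector set \<Rightarrow> ('a \<Rightarrow> 'b::real_normed_vector) \<Rightarrow> bool" where
  "smooth_on S f \<longleftrightarrow> (\<forall>k. Ck_on k S f)"

text \<open>A manifold of dimension \<open>DIM('e)\<close> is a topology on a set of points of type \<open>'p\<close>
  (not necessarily on the whole type) with an atlas of charts; a chart is a pair of its domain
  and its coordinate map.\<close>

record ('p, 'e) mfd =
  mfd_top :: "'p topology"
  mfd_atlas :: "('p set \<times> ('p \<Rightarrow> 'e)) set"

abbreviation points :: "('p, 'e, 'z) mfd_scheme \<Rightarrow> 'p set" where
  "points M \<equiv> topspace (mfd_top M)"

abbreviation open_in :: "('p, 'e, 'z) mfd_scheme \<Rightarrow> 'p set \<Rightarrow> bool" where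
  "open_in M U \<equiv> openin (mfd_top M) U"

definition chart_inv :: "'p set \<times> ('p \<Rightarrow> 'e) \<Rightarrow> 'e \<Rightarrow> 'p" where
  "chart_inv c = inv_into (fst c) (snd c)"

definition smooth_manifold :: "('p, 'e::euclidean_space, 'z) mfd_scheme \<Rightarrow> bool" where
  "smooth_manifold M \<longleftrightarrow>
     Hausdorff_space (mfd_top M) \<and> second_countable (mfd_top M) \<and>
     (\<Union>c\<in>mfd_atlas M. fst c) = points M \<and>
     (\<forall>c\<in>mfd_atlas M. open_in M (fst c) \<and> open (snd c ` fst c) \<and>
        homeomorphic_map (subtopology (mfd_top M) (fst c)) (top_of_set (snd c ` fst c)) (snd c)) \<and>
     (\<forall>c\<in>mfd_atlas M. \<forall>d\<in>mfd_atlas M.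
        smooth_on (snd c ` (fst c \<inter> fst d)) (snd d \<circ> chart_inv c))"

definition smooth_map ::
  "('p, 'e::euclidean_space, 'y) mfd_scheme \<Rightarrow> ('q, 'd::euclidean_space, 'z) mfd_scheme \<Rightarrow>
   ('p \<Rightarrow> 'q) \<Rightarrow> bool" where
  "smooth_map M N f \<longleftrightarrow>
     continuous_map (mfd_top M) (mfd_top N) f \<and>
     (\<forall>c\<in>mfd_atlas M. \<forall>d\<in>mfd_atlas N.
        smooth_on (snd c ` (fst c \<inter> f -` fst d)) (snd d \<circ> f \<circ> chart_inv c))"

definition diffeomorphism ::
  "('p, 'e::euclidean_space, 'y) mfd_scheme \<Rightarrow> ('q, 'd::euclidean_space, 'z) mfd_scheme \<Rightarrow>
   ('p \<Rightarrow> 'q) \<Rightarrow> bool" where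
  "diffeomorphism M N f \<longleftrightarrow>
     bij_betw f (points M) (points N) \<and> smooth_map M N f \<and>
     smooth_map N M (inv_into (points M) f)"

definition smooth_fun ::
  "('p, 'e::euclidean_space, 'z) mfd_scheme \<Rightarrow> 'p set \<Rightarrow> ('p \<Rightarrow> real) \<Rightarrow> bool" where
  "smooth_fun M U f \<longleftrightarrow>
     (\<forall>c\<in>mfd_atlas M. smooth_on (snd c ` (U \<inter> fst c)) (f \<circ> chart_inv c))"

definition open_submfd :: "('p, 'e, 'z) mfd_scheme \<Rightarrow> 'p set \<Rightarrow> ('p, 'e) mfd" where
  "open_submfd M U =
     \<lparr>mfd_top = subtopology (mfd_top M) U,
      mfd_atlas = (\<lambda>c. (fst c \<inter> U, snd c)) ` mfd_atlas M\<rparr>"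

definition prod_mfd ::
  "('p, 'e, 'y) mfd_scheme \<Rightarrow> ('q, 'd, 'z) mfd_scheme \<Rightarrow> ('p \<times> 'q, 'e \<times> 'd) mfd" where
  "prod_mfd M N =
     \<lparr>mfd_top = prod_topology (mfd_top M) (mfd_top N),
      mfd_atlas = {(fst c \<times> fst d, map_prod (snd c) (snd d)) |c d.
                     c \<in> mfd_atlas M \<and> d \<in> mfd_atlas N}\<rparr>"


section \<open>Tangent vectors, differentials, sections\<close>

text \<open>At every point \<open>y\<close> one chart \<open>chart_at M y\<close> is chosen, and the tangent space at \<open>y\<close> is
  the coordinate space \<open>'e\<close> of that chart: \<open>v :: 'e\<close> stands for the tangent vector whose
  components in \<open>chart_at M y\<close> are \<open>v\<close>.  As \<open>chart_at M y\<close> may jump when \<open>y\<close> moves,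
  smoothness of a field always means smoothness of its components in a fixed chart.\<close>

definition chart_at :: "('p, 'e, 'z) mfd_scheme \<Rightarrow> 'p \<Rightarrow> 'p set \<times> ('p \<Rightarrow> 'e)" where
  "chart_at M y = (SOME c. c \<in> mfd_atlas M \<and> y \<in> fst c)"

text \<open>\<open>vderiv M f y v\<close> is the derivative \<open>v(f)\<close> of a vector-valued function \<open>f\<close>.  In particular
  \<open>vderiv M (snd d) y v\<close> are the components of \<open>v\<close> in the chart \<open>d\<close>.\<close>

definition vderiv ::
  "('p, 'e::euclidean_space, 'z) mfd_scheme \<Rightarrow> ('p \<Rightarrow> 'b::real_normed_vector) \<Rightarrow> 'p \<Rightarrow> 'e \<Rightarrow> 'b"
  where
  "vderiv M f y v =
     frechet_derivative (f \<circ> chart_inv (chart_at M y)) (at (snd (chart_at M y) y)) v"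

definition mderiv ::
  "('p, 'e::euclidean_space, 'y) mfd_scheme \<Rightarrow> ('q, 'd::euclidean_space, 'z) mfd_scheme \<Rightarrow>
   ('p \<Rightarrow> 'q) \<Rightarrow> 'p \<Rightarrow> 'e \<Rightarrow> 'd" where
  "mderiv M N f y v = vderiv M (snd (chart_at N (f y)) \<circ> f) y v"

text \<open>\<open>S\<close> is an immersed submanifold of \<open>M\<close>: a subset with its own topology and smooth
  structure for which the inclusion is a smooth immersion.\<close>

abbreviation incl_deriv ::
  "('p, 'f::euclidean_space, 'y) mfd_scheme \<Rightarrow> ('p, 'e::euclidean_space, 'z) mfd_scheme \<Rightarrow>
   'p \<Rightarrow> 'f \<Rightarrow> 'e" where
  "incl_deriv S M \<equiv> mderiv S M (\<lambda>z. z)"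

definition submanifold ::
  "('p, 'f::euclidean_space, 'y) mfd_scheme \<Rightarrow> ('p, 'e::euclidean_space, 'z) mfd_scheme \<Rightarrow> bool"
  where
  "submanifold S M \<longleftrightarrow>
     smooth_manifold S \<and> smooth_manifold M \<and> points S \<subseteq> points M \<and>
     smooth_map S M (\<lambda>z. z) \<and> (\<forall>y\<in>points S. inj (incl_deriv S M y))"

text \<open>\<open>smooth_section S M U \<xi>\<close>: \<open>\<xi>\<close> is smooth on the open set \<open>U\<close> of the submanifold \<open>S\<close>, as a
  field along \<open>S\<close> of tangent vectors of \<open>M\<close>.  For \<open>S = M\<close> these are the smooth vector
  fields on \<open>U\<close>.\<close>

definition smooth_section ::
  "('p, 'f::euclidean_space, 'y) mfd_scheme \<Rightarrow> ('p, 'e::euclidean_space, 'z) mfd_scheme \<Rightarrow>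
   'p set \<Rightarrow> ('p \<Rightarrow> 'e) \<Rightarrow> bool" where
  "smooth_section S M U \<xi> \<longleftrightarrow>
     (\<forall>c\<in>mfd_atlas S. \<forall>d\<in>mfd_atlas M.
        smooth_on (snd c ` (U \<inter> fst c \<inter> fst d))
          ((\<lambda>z. vderiv M (snd d) z (\<xi> z)) \<circ> chart_inv c))"

abbreviation vector_field ::
  "('p, 'e::euclidean_space, 'z) mfd_scheme \<Rightarrow> 'p set \<Rightarrow> ('p \<Rightarrow> 'e) \<Rightarrow> bool" where
  "vector_field M U X \<equiv> smooth_section M M U X"

text \<open>The coordinate formula \<open>[X,Y] = DY(X) - DX(Y)\<close>, evaluated in the chart chosen at \<open>y\<close>.\<close>

definition lie_bracket ::
  "('p, 'e::euclidean_space, 'z) mfd_scheme \<Rightarrow> ('p \<Rightarrow> 'e) \<Rightarrow> ('p \<Rightarrow> 'e) \<Rightarrow> 'p \<Rightarrow> 'e" where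
  "lie_bracket M X Y y =
     (let \<phi> = snd (chart_at M y) in
        vderiv M (\<lambda>z. vderiv M \<phi> z (Y z)) y (X y) - vderiv M (\<lambda>z. vderiv M \<phi> z (X z)) y (Y y))"

definition one_form ::
  "('p, 'e::euclidean_space, 'z) mfd_scheme \<Rightarrow> ('p \<Rightarrow> 'e \<Rightarrow> real) \<Rightarrow> bool" where
  "one_form M \<mu> \<longleftrightarrow>
     (\<forall>y\<in>points M. linear (\<mu> y)) \<and>
     (\<forall>U X. open_in M U \<and> vector_field M U X \<longrightarrow> smooth_fun M U (\<lambda>y. \<mu> y (X y)))"


section \<open>Riemannian manifolds and submanifolds\<close>

definition riemannian_metric ::
  "('p, 'e::euclidean_space, 'z) mfd_scheme \<Rightarrow> ('p \<Rightarrow> 'e \<Rightarrow> 'e \<Rightarrow> real) \<Rightarrow> bool" where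
  "riemannian_metric M g \<longleftrightarrow>
     (\<forall>y\<in>points M. bilinear (g y) \<and> (\<forall>u v. g y u v = g y v u) \<and> (\<forall>u. u \<noteq> 0 \<longrightarrow> g y u u > 0)) \<and>
     (\<forall>U X Y. open_in M U \<and> vector_field M U X \<and> vector_field M U Y \<longrightarrow>
        smooth_fun M U (\<lambda>y. g y (X y) (Y y)))"

definition induced_metric ::
  "('p, 'f::euclidean_space, 'y) mfd_scheme \<Rightarrow> ('p, 'e::euclidean_space, 'z) mfd_scheme \<Rightarrow>
   ('p \<Rightarrow> 'e \<Rightarrow> 'e \<Rightarrow> real) \<Rightarrow> 'p \<Rightarrow> 'f \<Rightarrow> 'f \<Rightarrow> real" where
  "induced_metric S M g y u v = g y (incl_deriv S M y u) (incl_deriv S M y v)"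

text \<open>A connection \<open>\<nabla>\<close> is a map \<open>nab\<close> with \<open>nab y v Y\<close> the derivative at \<open>y\<close> in direction \<open>v\<close>
  of a field \<open>Y\<close> that is smooth near \<open>y\<close>.  Locality is a consequence: the Leibniz rule also
  covers functions \<open>f\<close> that equal \<open>1\<close> near \<open>y\<close> and \<open>0\<close> elsewhere.\<close>

definition connection ::
  "('p, 'e::euclidean_space, 'z) mfd_scheme \<Rightarrow> ('p \<Rightarrow> 'e \<Rightarrow> ('p \<Rightarrow> 'e) \<Rightarrow> 'e) \<Rightarrow> bool" where
  "connection M nab \<longleftrightarrow>
     (\<forall>U X Y. open_in M U \<and> vector_field M U X \<and> vector_field M U Y \<longrightarrow>
        vector_field M U (\<lambda>y. nab y (X y) Y)) \<and>
     (\<forall>U Y y. open_in M U \<and> y \<in> U \<and> vector_field M U Y \<longrightarrow> linear (\<lambda>v. nab y v Y)) \<and>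
     (\<forall>U Y Z y v. open_in M U \<and> y \<in> U \<and> vector_field M U Y \<and> vector_field M U Z \<longrightarrow>
        nab y v (\<lambda>z. Y z + Z z) = nab y v Y + nab y v Z) \<and>
     (\<forall>U f Y y v. open_in M U \<and> y \<in> U \<and> smooth_fun M U f \<and> vector_field M U Y \<longrightarrow>
        nab y v (\<lambda>z. f z *\<^sub>R Y z) = vderiv M f y v *\<^sub>R Y y + f y *\<^sub>R nab y v Y)"

definition levi_civita ::
  "('p, 'e::euclidean_space, 'z) mfd_scheme \<Rightarrow> ('p \<Rightarrow> 'e \<Rightarrow> 'e \<Rightarrow> real) \<Rightarrow>
   ('p \<Rightarrow> 'e \<Rightarrow> ('p \<Rightarrow> 'e) \<Rightarrow> 'e) \<Rightarrow> bool" where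
  "levi_civita M g nab \<longleftrightarrow>
     connection M nab \<and>
     (\<forall>U X Y y. open_in M U \<and> y \<in> U \<and> vector_field M U X \<and> vector_field M U Y \<longrightarrow>
        nab y (X y) Y - nab y (Y y) X = lie_bracket M X Y y) \<and>
     (\<forall>U Y Z y v. open_in M U \<and> y \<in> U \<and> vector_field M U Y \<and> vector_field M U Z \<longrightarrow>
        vderiv M (\<lambda>z. g z (Y z) (Z z)) y v = g y (nab y v Y) (Z y) + g y (Y y) (nab y v Z))"

record ('p, 'e) riem = "('p, 'e) mfd" +
  rmetric :: "'p \<Rightarrow> 'e \<Rightarrow> 'e \<Rightarrow> real"
  conn :: "'p \<Rightarrow> 'e \<Rightarrow> ('p \<Rightarrow> 'e) \<Rightarrow> 'e"

definition riemannian_manifold :: "('p, 'e::euclidean_space) riem \<Rightarrow> bool" where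
  "riemannian_manifold M \<longleftrightarrow>
     smooth_manifold M \<and> riemannian_metric M (rmetric M) \<and> levi_civita M (rmetric M) (conn M)"

definition curvature ::
  "('p, 'e::euclidean_space) riem \<Rightarrow> ('p \<Rightarrow> 'e) \<Rightarrow> ('p \<Rightarrow> 'e) \<Rightarrow> ('p \<Rightarrow> 'e) \<Rightarrow> 'p \<Rightarrow> 'e" where
  "curvature M X Y Z y =
     conn M y (X y) (\<lambda>z. conn M z (Y z) Z) - conn M y (Y y) (\<lambda>z. conn M z (X z) Z)
     - conn M y (lie_bracket M X Y y) Z"

definition sectional_curvature ::
  "('p, 'e::euclidean_space) riem \<Rightarrow> ('p \<Rightarrow> 'e) \<Rightarrow> ('p \<Rightarrow> 'e) \<Rightarrow> 'p \<Rightarrow> real" where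
  "sectional_curvature M X Y y =
     rmetric M y (curvature M X Y Y y) (X y) /
     (rmetric M y (X y) (X y) * rmetric M y (Y y) (Y y) - (rmetric M y (X y) (Y y))\<^sup>2)"

definition constant_curvature :: "('p, 'e::euclidean_space) riem \<Rightarrow> real \<Rightarrow> bool" where
  "constant_curvature M c \<longleftrightarrow>
     (\<forall>U X Y y. open_in M U \<and> y \<in> U \<and> vector_field M U X \<and> vector_field M U Y \<and>
        X y \<noteq> Y y \<and> independent {X y, Y y} \<longrightarrow> sectional_curvature M X Y y = c)"

definition riemannian_submanifold ::
  "('p, 'f::euclidean_space) riem \<Rightarrow> ('p, 'e::euclidean_space) riem \<Rightarrow> bool" where
  "riemannian_submanifold F M \<longleftrightarrow>
     riemannian_manifold F \<and> riemannian_manifold M \<and> submanifold F M \<and>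
     (\<forall>y\<in>points F. rmetric F y = induced_metric F M (rmetric M) y)"


section \<open>Second fundamental form\<close>

text \<open>The derivative, by the connection of \<open>M\<close>, of a field \<open>\<xi>\<close> along \<open>F\<close> in a direction \<open>u\<close> tangent
  to \<open>F\<close>: extend \<open>\<xi>\<close> near \<open>y\<close> to a smooth field \<open>\<Xi>\<close> on an open set of \<open>M\<close>.  The value does not
  depend on the extension.\<close>

definition conn_along ::
  "('p, 'f::euclidean_space) riem \<Rightarrow> ('p, 'e::euclidean_space) riem \<Rightarrow>
   'p \<Rightarrow> 'f \<Rightarrow> ('p \<Rightarrow> 'e) \<Rightarrow> 'e" where
  "conn_along F M y u \<xi> =
     (SOME w. \<exists>U V \<Xi>. open_in F U \<and> y \<in> U \<and> open_in M V \<and> U \<subseteq> V \<and> vector_field M V \<Xi> \<and>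
        (\<forall>z\<in>U. \<Xi> z = \<xi> z) \<and> w = conn M y (incl_deriv F M y u) \<Xi>)"

text \<open>\<open>sff F M y u Y\<close> is \<open>b(u, Y)\<close> at \<open>y\<close>, where \<open>Y\<close> is a tangent field of \<open>F\<close> near \<open>y\<close>.\<close>

definition sff ::
  "('p, 'f::euclidean_space) riem \<Rightarrow> ('p, 'e::euclidean_space) riem \<Rightarrow>
   'p \<Rightarrow> 'f \<Rightarrow> ('p \<Rightarrow> 'f) \<Rightarrow> 'e" where
  "sff F M y u Y =
     conn_along F M y u (\<lambda>z. incl_deriv F M z (Y z)) - incl_deriv F M y (conn F y u Y)"

definition normal_space ::
  "('p, 'f::euclidean_space) riem \<Rightarrow> ('p, 'e::euclidean_space) riem \<Rightarrow> 'p \<Rightarrow> 'e set" where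
  "normal_space F M y = {\<xi>. \<forall>u. rmetric M y \<xi> (incl_deriv F M y u) = 0}"

definition normal_field ::
  "('p, 'f::euclidean_space) riem \<Rightarrow> ('p, 'e::euclidean_space) riem \<Rightarrow>
   'p set \<Rightarrow> ('p \<Rightarrow> 'e) \<Rightarrow> bool" where
  "normal_field F M U \<xi> \<longleftrightarrow> smooth_section F M U \<xi> \<and> (\<forall>y\<in>U. \<xi> y \<in> normal_space F M y)"

definition tangent_part ::
  "('p, 'f::euclidean_space) riem \<Rightarrow> ('p, 'e::euclidean_space) riem \<Rightarrow> 'p \<Rightarrow> 'e \<Rightarrow> 'f" where
  "tangent_part F M y w = (THE u. w - incl_deriv F M y u \<in> normal_space F M y)"

definition shape_operator ::
  "('p, 'f::euclidean_space) riem \<Rightarrow> ('p, 'e::euclidean_space) riem \<Rightarrow>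
   'p \<Rightarrow> ('p \<Rightarrow> 'e) \<Rightarrow> 'f \<Rightarrow> 'f" where
  "shape_operator F M y \<xi> u = - tangent_part F M y (conn_along F M y u \<xi>)"

definition normal_conn ::
  "('p, 'f::euclidean_space) riem \<Rightarrow> ('p, 'e::euclidean_space) riem \<Rightarrow>
   'p \<Rightarrow> 'f \<Rightarrow> ('p \<Rightarrow> 'e) \<Rightarrow> 'e" where
  "normal_conn F M y u \<xi> =
     conn_along F M y u \<xi> + incl_deriv F M y (shape_operator F M y \<xi> u)"

text \<open>The van der Waerden--Bortolotti derivative of the second fundamental form at \<open>y\<close>.\<close>

definition sff_deriv ::
  "('p, 'f::euclidean_space) riem \<Rightarrow> ('p, 'e::euclidean_space) riem \<Rightarrow>
   ('p \<Rightarrow> 'f) \<Rightarrow> ('p \<Rightarrow> 'f) \<Rightarrow> ('p \<Rightarrow> 'f) \<Rightarrow> 'p \<Rightarrow> 'e" where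
  "sff_deriv F M X Y Z y =
     normal_conn F M y (X y) (\<lambda>z. sff F M z (Y z) Z)
     - sff F M y (conn F y (X y) Y) Z
     - sff F M y (Y y) (\<lambda>z. conn F z (X z) Z)"

definition recurrent_sff ::
  "('p, 'f::euclidean_space) riem \<Rightarrow> ('p, 'e::euclidean_space) riem \<Rightarrow> bool" where
  "recurrent_sff F M \<longleftrightarrow>
     (\<exists>U Y y u. open_in F U \<and> y \<in> U \<and> vector_field F U Y \<and> sff F M y u Y \<noteq> 0) \<and>
     (\<exists>\<mu>. one_form F \<mu> \<and>
        (\<forall>U X Y Z y. open_in F U \<and> y \<in> U \<and>
           vector_field F U X \<and> vector_field F U Y \<and> vector_field F U Z \<longrightarrow>
           sff_deriv F M X Y Z y = \<mu> y (X y) *\<^sub>R sff F M y (Y y) Z))"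

definition sff_deriv_nonzero_at ::
  "('p, 'f::euclidean_space) riem \<Rightarrow> ('p, 'e::euclidean_space) riem \<Rightarrow> 'p \<Rightarrow> bool" where
  "sff_deriv_nonzero_at F M x \<longleftrightarrow>
     (\<exists>U X Y Z. open_in F U \<and> x \<in> U \<and>
        vector_field F U X \<and> vector_field F U Y \<and> vector_field F U Z \<and>
        sff_deriv F M X Y Z x \<noteq> 0)"


section \<open>Distributions and conjugate systems\<close>

definition domain_in :: "('p, 'e, 'z) mfd_scheme \<Rightarrow> 'p set \<Rightarrow> bool" where
  "domain_in M U \<longleftrightarrow> open_in M U \<and> connectedin (mfd_top M) U"

definition smooth_distribution ::
  "('p, 'e::euclidean_space, 'z) mfd_scheme \<Rightarrow> 'p set \<Rightarrow> nat \<Rightarrow> ('p \<Rightarrow> 'e set) \<Rightarrow> bool" where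
  "smooth_distribution M U k L \<longleftrightarrow>
     (\<forall>y\<in>U. subspace (L y) \<and> dim (L y) = k) \<and>
     (\<forall>y\<in>U. \<exists>V E. open_in M V \<and> y \<in> V \<and> V \<subseteq> U \<and>
        (\<forall>i<k. vector_field M V (E i)) \<and> (\<forall>z\<in>V. L z = span ((\<lambda>i. E i z) ` {..<k})))"

definition tangent_field ::
  "('p, 'e::euclidean_space, 'z) mfd_scheme \<Rightarrow> 'p set \<Rightarrow> ('p \<Rightarrow> 'e set) \<Rightarrow> ('p \<Rightarrow> 'e) \<Rightarrow> bool" where
  "tangent_field M V L X \<longleftrightarrow> vector_field M V X \<and> (\<forall>z\<in>V. X z \<in> L z)"

definition involutive ::
  "('p, 'e::euclidean_space, 'z) mfd_scheme \<Rightarrow> 'p set \<Rightarrow> ('p \<Rightarrow> 'e set) \<Rightarrow> bool" where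
  "involutive M U L \<longleftrightarrow>
     (\<forall>V X Y. open_in M V \<and> V \<subseteq> U \<and> tangent_field M V L X \<and> tangent_field M V L Y \<longrightarrow>
        (\<forall>y\<in>V. lie_bracket M X Y y \<in> L y))"

definition conjugate ::
  "('p, 'f::euclidean_space) riem \<Rightarrow> ('p, 'e::euclidean_space) riem \<Rightarrow> 'p set \<Rightarrow>
   ('p \<Rightarrow> 'f set) \<Rightarrow> ('p \<Rightarrow> 'f set) \<Rightarrow> bool" where
  "conjugate F M U L L' \<longleftrightarrow>
     (\<forall>V X Y. open_in F V \<and> V \<subseteq> U \<and> tangent_field F V L X \<and> tangent_field F V L' Y \<longrightarrow>
        (\<forall>y\<in>V. sff F M y (X y) Y = 0))"

definition direct_sum :: "'e::real_vector set list \<Rightarrow> bool" where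
  "direct_sum Ws \<longleftrightarrow>
     (\<forall>v. \<exists>!vs. length vs = length Ws \<and> (\<forall>i<length Ws. vs ! i \<in> Ws ! i) \<and> v = sum_list vs)"

text \<open>\<open>conjugate_system F M U Ls ks\<close>: the distributions \<open>Ls = [L\<^sub>1, \<dots>, L\<^sub>m]\<close> of ranks
  \<open>ks = [k\<^sub>1, \<dots>, k\<^sub>m]\<close> form a conjugate system in \<open>U\<close>.\<close>

definition conjugate_system ::
  "('p, 'f::euclidean_space) riem \<Rightarrow> ('p, 'e::euclidean_space) riem \<Rightarrow> 'p set \<Rightarrow>
   ('p \<Rightarrow> 'f set) list \<Rightarrow> nat list \<Rightarrow> bool" where
  "conjugate_system F M U Ls ks \<longleftrightarrow>
     length Ls = length ks \<and> sum_list ks = DIM('f) \<and>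
     (\<forall>y\<in>U. direct_sum (map (\<lambda>L. L y) Ls)) \<and>
     (\<forall>i<length Ls. smooth_distribution F U (ks ! i) (Ls ! i) \<and> involutive F U (Ls ! i)) \<and>
     (\<forall>i<length Ls. \<forall>j<length Ls. i \<noteq> j \<longrightarrow> conjugate F M U (Ls ! i) (Ls ! j))"

definition orthogonal_conjugate_system ::
  "('p, 'f::euclidean_space) riem \<Rightarrow> ('p, 'e::euclidean_space) riem \<Rightarrow> 'p set \<Rightarrow>
   ('p \<Rightarrow> 'f set) list \<Rightarrow> nat list \<Rightarrow> bool" where
  "orthogonal_conjugate_system F M U Ls ks \<longleftrightarrow>
     conjugate_system F M U Ls ks \<and>
     (\<forall>i<length Ls. \<forall>j<length Ls. i \<noteq> j \<longrightarrow>
        (\<forall>y\<in>U. \<forall>u\<in>(Ls ! i) y. \<forall>v\<in>(Ls ! j) y. rmetric F y u v = 0))"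

definition integral_submanifold ::
  "('p, 'e::euclidean_space, 'z) mfd_scheme \<Rightarrow> 'p set \<Rightarrow> ('p \<Rightarrow> 'e set) \<Rightarrow>
   ('p, 'k::euclidean_space) mfd \<Rightarrow> bool" where
  "integral_submanifold M U L S \<longleftrightarrow>
     submanifold S M \<and> points S \<subseteq> U \<and> points S \<noteq> {} \<and> connected_space (mfd_top S) \<and>
     (\<forall>y\<in>points S. range (incl_deriv S M y) = L y)"

definition maximal_integral_submanifold ::
  "('p, 'e::euclidean_space, 'z) mfd_scheme \<Rightarrow> 'p set \<Rightarrow> ('p \<Rightarrow> 'e set) \<Rightarrow>
   ('p, 'k::euclidean_space) mfd \<Rightarrow> bool" where
  "maximal_integral_submanifold M U L S \<longleftrightarrow>
     integral_submanifold M U L S \<and>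
     (\<forall>S'::('p, 'k) mfd. integral_submanifold M U L S' \<and> points S \<subseteq> points S' \<longrightarrow>
        points S' = points S)"


section \<open>Riemannian products\<close>

definition isometry ::
  "('p, 'e::euclidean_space, 'y) mfd_scheme \<Rightarrow> ('p \<Rightarrow> 'e \<Rightarrow> 'e \<Rightarrow> real) \<Rightarrow>
   ('q, 'd::euclidean_space, 'z) mfd_scheme \<Rightarrow> ('q \<Rightarrow> 'd \<Rightarrow> 'd \<Rightarrow> real) \<Rightarrow> ('p \<Rightarrow> 'q) \<Rightarrow> bool" where
  "isometry M g N h f \<longleftrightarrow>
     diffeomorphism M N f \<and>
     (\<forall>y\<in>points M. \<forall>u v. h (f y) (mderiv M N f y u) (mderiv M N f y v) = g y u v)"

text \<open>The metric \<open>\<pi>\<^sub>1\<^sup>*g + \<pi>\<^sub>2\<^sup>*h\<close>.\<close>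

definition prod_metric ::
  "('p, 'e::euclidean_space, 'y) mfd_scheme \<Rightarrow> ('p \<Rightarrow> 'e \<Rightarrow> 'e \<Rightarrow> real) \<Rightarrow>
   ('q, 'd::euclidean_space, 'z) mfd_scheme \<Rightarrow> ('q \<Rightarrow> 'd \<Rightarrow> 'd \<Rightarrow> real) \<Rightarrow>
   'p \<times> 'q \<Rightarrow> 'e \<times> 'd \<Rightarrow> 'e \<times> 'd \<Rightarrow> real" where
  "prod_metric M g N h q u v =
     g (fst q) (mderiv (prod_mfd M N) M fst q u) (mderiv (prod_mfd M N) M fst q v) +
     h (snd q) (mderiv (prod_mfd M N) N snd q u) (mderiv (prod_mfd M N) N snd q v)"

text \<open>\<open>F\<close> is, in \<open>U\<close>, the direct Riemannian product of the integral submanifolds \<open>F1\<close>, \<open>F2\<close> of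
  \<open>L1\<close>, \<open>L2\<close> through \<open>a\<close>: the identification \<open>\<Phi>\<close> of \<open>F1 \<times> F2\<close> with \<open>U\<close> is an isometry, it is the
  identity on the factors \<open>F1 \<times> {a}\<close> and \<open>{a} \<times> F2\<close>, and it takes the two product foliations
  to the foliations defined by \<open>L1\<close> and \<open>L2\<close>.\<close>

definition riemannian_product_at ::
  "('p, 'f::euclidean_space) riem \<Rightarrow> 'p set \<Rightarrow> ('p \<Rightarrow> 'f set) \<Rightarrow> ('p \<Rightarrow> 'f set) \<Rightarrow> 'p \<Rightarrow>
   ('p, 'j::euclidean_space) mfd \<Rightarrow> ('p, 'k::euclidean_space) mfd \<Rightarrow> bool" where
  "riemannian_product_at F U L1 L2 a F1 F2 \<longleftrightarrow>
     a \<in> points F1 \<and> a \<in> points F2 \<and>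
     (\<exists>\<Phi>. isometry
            (prod_mfd F1 F2)
            (prod_metric F1 (induced_metric F1 F (rmetric F)) F2 (induced_metric F2 F (rmetric F)))
            (open_submfd F U)
            (induced_metric (open_submfd F U) F (rmetric F)) \<Phi> \<and>
          (\<forall>y\<in>points F1. \<Phi> (y, a) = y) \<and> (\<forall>z\<in>points F2. \<Phi> (a, z) = z) \<and>
          (\<forall>y\<in>points F1. \<forall>z\<in>points F2.
             range (mderiv F1 F (\<lambda>y'. \<Phi> (y', z)) y) = L1 (\<Phi> (y, z)) \<and>
             range (mderiv F2 F (\<lambda>z'. \<Phi> (y, z')) z) = L2 (\<Phi> (y, z))))"


section \<open>Surfaces and lines of curvature\<close>

text \<open>Normal vectors at \<open>y\<close> are given by normal fields near \<open>y\<close>; \<open>A\<^sub>\<xi>\<close> at \<open>y\<close> depends only on the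
  value of \<open>\<xi>\<close> at \<open>y\<close>.\<close>

definition surface_of_curvature ::
  "('p, 'f::euclidean_space) riem \<Rightarrow> ('p, 'e::euclidean_space) riem \<Rightarrow>
   ('p, 'k::euclidean_space) mfd \<Rightarrow> bool" where
  "surface_of_curvature F M S \<longleftrightarrow>
     submanifold S F \<and>
     (\<forall>y\<in>points S. \<forall>U \<xi>. open_in F U \<and> y \<in> U \<and> normal_field F M U \<xi> \<longrightarrow>
        (\<exists>\<kappa>. \<forall>u\<in>range (incl_deriv S F y). shape_operator F M y \<xi> u = \<kappa> *\<^sub>R u))"

definition line_of_curvature ::
  "('p, 'f::euclidean_space) riem \<Rightarrow> ('p, 'e::euclidean_space) riem \<Rightarrow>
   ('p, 'k::euclidean_space) mfd \<Rightarrow> bool" where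
  "line_of_curvature F M S \<longleftrightarrow> surface_of_curvature F M S \<and> DIM('k) = 1"

end

theory Submission
  imports Defs
begin

text \<open>Codazzi's equation in a space of constant curvature makes \<open>\<mu>(X) b(Y,Z)\<close> symmetric in \<open>X, Y\<close>.
  Hence \<open>b\<close> has rank one, \<open>b(X,Y) = \<langle>E,X\<rangle>\<langle>E,Y\<rangle> b(E,E)\<close> with \<open>E\<close> the unit field of the dual of
  \<open>\<mu>\<close>, wherever \<open>\<mu>\<close> and \<open>b\<close> do not vanish.  Differentiating the symmetry once more and using
  recurrence shows that the kernel of \<open>\<mu>\<close> is parallel, so \<open>E\<close> is a parallel field.  Its dual form
  is closed, thus \<open>du\<close> locally; the flow of \<open>E\<close> started on a level of \<open>u\<close> gives coordinates
  \<open>(u, t)\<close> in which the metric is \<open>du\<^sup>2 + h(t)\<close>.  The line field of \<open>E\<close> and its orthogonal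
  complement are the two factors, and \<open>A\<^sub>\<xi>\<close> is a multiple of the identity on the first and zero
  on the second.

  Fields and tensors are handled by their components in a fixed chart; existence and smooth
  dependence for the flow of \<open>E\<close> are obtained from a fixed point argument and linear variational
  equations.\<close>

section \<open>Smooth maps between Euclidean spaces\<close>

text \<open>The form \<mu> itself is not shown to be parallel. Covariant differentiation of
  \<open>\<mu>(u) B(v,w) = \<mu>(v) B(u,w)\<close>, with the derivative of B replaced by recurrence,
  leaves the same identity with \<open>\<nabla>\<^sub>a \<mu>\<close> in place of \<mu>. So
  \<open>\<nabla>\<^sub>a \<mu>\<close> vanishes on the kernel of \<mu>, hence is a multiple of
  \<mu>, and normalisation removes the factor.

  Recurrence prescribes a derivative in the normal bundle, so identities between values of B are
  tested against normal vectors. Constant curvature enters once: the ambient curvature applied to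
  three tangent vectors is orthogonal to all normals.

  The main obstacle is the encoding. A tangent vector is stored by its components in a chart that
  may jump from point to point, and derivatives along a submanifold are values of a choice operator.
  Everything is therefore moved by the isomorphisms \<open>cmp\<close> to one fixed pair of charts,
  where the geometry is calculus of Christoffel maps.

  The final domain is the image of an interval times a ball, which makes the leaves connected
  coordinate slices with a single chart and turns the product map into the identity of
  coordinates.\<close>

abbreviation FD :: "('a::real_normed_vector \<Rightarrow> 'b::real_normed_vector) \<Rightarrow> 'a \<Rightarrow> 'a \<Rightarrow> 'b" where
  "FD f x \<equiv> frechet_derivative f (at x)"

lemma FD_works: "f differentiable (at x) \<Longrightarrow> (f has_derivative FD f x) (at x)"
  by (simp add: frechet_derivative_works)

lemma FD_eq: "(f has_derivative f') (at x) \<Longrightarrow> FD f x = f'"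
  by (metis frechet_derivative_at)

text \<open>No differentiability is assumed: \<open>frechet_derivative\<close> is a choice, and the
  predicates from which the two sides choose coincide, so the chosen values agree even where no
  derivative exists.\<close>

lemma FD_cong:
  assumes "open S" "x \<in> S" "\<And>y. y \<in> S \<Longrightarrow> f y = g y"
  shows "FD f x = FD g x"
proof -
  have "(f has_derivative f') (at x) \<longleftrightarrow> (g has_derivative f') (at x)" for f'
    using has_derivative_transform_within_open[OF _ assms(1,2), of f f' UNIV g]
      has_derivative_transform_within_open[OF _ assms(1,2), of g f' UNIV f] assms(3) by auto
  then show ?thesis unfolding frechet_derivative_def by simp
qed

lemma differentiable_cong_open:
  assumes "open S" "x \<in> S" "\<And>y. y \<in> S \<Longrightarrow> f y = g y"
  shows "f differentiable (at x) \<longleftrightarrow> g differentiable (at x)"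
  using has_derivative_transform_within_open[OF _ assms(1,2), of f _ UNIV g]
      has_derivative_transform_within_open[OF _ assms(1,2), of g _ UNIV f] assms(3)
  unfolding differentiable_def by (metis)

section \<open>Closure properties of the classes C^k\<close>

lemma Ck_on_cong:
  "open S \<Longrightarrow> (\<And>x. x \<in> S \<Longrightarrow> f x = g x) \<Longrightarrow> Ck_on k S f = Ck_on k S g"
proof (induction k arbitrary: f g)
  case 0
  then show ?case by (auto intro: continuous_on_cong)
next
  case (Suc k)
  have 1: "(\<forall>x\<in>S. f differentiable at x) \<longleftrightarrow> (\<forall>x\<in>S. g differentiable at x)"
    using differentiable_cong_open[OF Suc.prems(1), of _ f g] Suc.prems(2) by blast
  have 2: "Ck_on k S (\<lambda>x. FD f x v) = Ck_on k S (\<lambda>x. FD g x v)" for v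
    by (rule Suc.IH[OF Suc.prems(1)]) (metis FD_cong Suc.prems)
  show ?case by (simp only: Ck_on.simps 1 2)
qed

lemma Ck_on_subset: "Ck_on k S f \<Longrightarrow> T \<subseteq> S \<Longrightarrow> Ck_on k T f"
  by (induction k arbitrary: f) (auto intro: continuous_on_subset)

text \<open>\<open>Ck_on\<close> refers to the chosen derivative; this rule lets any explicit
  formula take its place. It carries nearly all inductions on the order of differentiability
  below.\<close>

lemma Ck_on_SucI:
  assumes "open S" "\<And>x. x \<in> S \<Longrightarrow> (f has_derivative f' x) (at x)"
    "\<And>v. Ck_on k S (\<lambda>x. f' x v)"
  shows "Ck_on (Suc k) S f"
proof -
  have "FD f x v = f' x v" if "x \<in> S" for x v using FD_eq assms(2) that by metis
  then have "Ck_on k S (\<lambda>x. FD f x v)" for v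
    using Ck_on_cong[OF assms(1), of "\<lambda>x. FD f x v" "\<lambda>x. f' x v"] assms(3) by blast
  moreover have "\<forall>x\<in>S. f differentiable at x" using assms(2) differentiable_def by blast
  ultimately show ?thesis by simp
qed

lemma Ck_on_continuous: "Ck_on k S f \<Longrightarrow> continuous_on S f"
proof (cases k)
  case (Suc j)
  moreover assume "Ck_on k S f"
  ultimately have "\<forall>x\<in>S. f differentiable at x" by simp
  then show ?thesis
    by (meson continuous_at_imp_continuous_on differentiable_imp_continuous_within)
qed simp

lemma Ck_on_SucD: "Ck_on (Suc k) S f \<Longrightarrow> Ck_on k S f"
proof (induction k arbitrary: f)
  case 0
  then show ?case using Ck_on_continuous by (metis Ck_on.simps(1))
next
  case (Suc k)
  then show ?case by (metis Ck_on.simps(2))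
qed

lemma Ck_on_le: "j \<le> k \<Longrightarrow> Ck_on k S f \<Longrightarrow> Ck_on j S f"
  by (induction k rule: dec_induct) (blast dest: Ck_on_SucD)+

lemma Ck_on_const: "Ck_on k S (\<lambda>x. c)"
proof (induction k arbitrary: c)
  case (Suc k)
  then show ?case by simp
qed simp

lemma Ck_on_bounded_linear:
  assumes "bounded_linear L" "open S" shows "Ck_on k S f \<Longrightarrow> Ck_on k S (\<lambda>x. L (f x))"
proof (induction k arbitrary: f)
  case 0
  then show ?case using assms by (simp add: bounded_linear.continuous_on)
next
  case (Suc k)
  show ?case
  proof (rule Ck_on_SucI[OF assms(2), where f' = "\<lambda>x v. L (FD f x v)"])
    show "((\<lambda>x. L (f x)) has_derivative (\<lambda>v. L (FD f x v))) (at x)" if "x \<in> S" for x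
      using Suc.prems that by (auto intro!: bounded_linear.has_derivative[OF assms(1)] FD_works)
  qed (use Suc in auto)
qed

lemma Ck_on_minus: "open S \<Longrightarrow> Ck_on k S f \<Longrightarrow> Ck_on k S (\<lambda>x. - f x)"
  by (rule Ck_on_bounded_linear[OF bounded_linear_minus[OF bounded_linear_ident]])

lemma Ck_on_ident: "open S \<Longrightarrow> Ck_on k S (\<lambda>x. x)"
proof (cases k)
  case (Suc j)
  assume S: "open S"
  have "Ck_on (Suc j) S (\<lambda>x. x)"
    by (rule Ck_on_SucI[OF S, where f' = "\<lambda>x v. v"]) (auto intro: Ck_on_const)
  with Suc show ?thesis by simp
qed (simp add: continuous_on_id)

lemma Ck_on_add:
  assumes "open S" shows "Ck_on k S f \<Longrightarrow> Ck_on k S g \<Longrightarrow> Ck_on k S (\<lambda>x. f x + g x)"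
proof (induction k arbitrary: f g)
  case 0
  then show ?case by (simp add: continuous_on_add)
next
  case (Suc k)
  show ?case
    by (rule Ck_on_SucI[OF assms, where f' = "\<lambda>x v. FD f x v + FD g x v"])
      (use Suc in \<open>auto intro!: has_derivative_add FD_works\<close>)
qed

lemma Ck_on_diff:
  assumes "open S" "Ck_on k S f" "Ck_on k S g" shows "Ck_on k S (\<lambda>x. f x - g x)"
  using Ck_on_add[OF assms(1,2) Ck_on_minus[OF assms(1,3)]] by simp

lemma Ck_on_sum:
  assumes "open S" shows "(\<And>i. i \<in> I \<Longrightarrow> Ck_on k S (f i)) \<Longrightarrow> Ck_on k S (\<lambda>x. \<Sum>i\<in>I. f i x)"
proof (induction I rule: infinite_finite_induct)
  case (insert i I)
  then show ?case using Ck_on_add[OF assms, of k "f i" "\<lambda>x. \<Sum>i\<in>I. f i x"] by auto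
qed (auto intro: Ck_on_const)

lemma Ck_on_bilinear:
  assumes "bounded_bilinear B" "open S"
  shows "Ck_on k S f \<Longrightarrow> Ck_on k S g \<Longrightarrow> Ck_on k S (\<lambda>x. B (f x) (g x))"
proof (induction k arbitrary: f g)
  case 0
  then show ?case using assms by (simp add: bounded_bilinear.continuous_on)
next
  case (Suc k)
  show ?case
  proof (rule Ck_on_SucI[OF assms(2), where f' = "\<lambda>x v. B (f x) (FD g x v) + B (FD f x v) (g x)"])
    show "((\<lambda>x. B (f x) (g x)) has_derivative (\<lambda>v. B (f x) (FD g x v) + B (FD f x v) (g x))) (at x)"
      if "x \<in> S" for x
      using Suc.prems that by (auto intro!: bounded_bilinear.FDERIV[OF assms(1)] FD_works)
    show "Ck_on k S (\<lambda>x. B (f x) (FD g x v) + B (FD f x v) (g x))" for v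
      using Suc Ck_on_SucD[of k S f] Ck_on_SucD[of k S g]
      by (intro Ck_on_add[OF assms(2)] Suc.IH) auto
  qed
qed

lemmas Ck_on_scaleR = Ck_on_bilinear[OF bounded_bilinear_scaleR]
lemmas Ck_on_mult = Ck_on_bilinear[OF bounded_bilinear_mult]
lemmas Ck_on_inner = Ck_on_bilinear[OF bounded_bilinear_inner]

lemma linear_expand:
  fixes L :: "'a::euclidean_space \<Rightarrow> 'b::real_vector"
  assumes "linear L" shows "L v = (\<Sum>b\<in>Basis. (v \<bullet> b) *\<^sub>R L b)"
proof -
  have "L v = L (\<Sum>b\<in>Basis. (v \<bullet> b) *\<^sub>R b)" by (simp add: euclidean_representation)
  also have "\<dots> = (\<Sum>b\<in>Basis. (v \<bullet> b) *\<^sub>R L b)"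
    using assms by (simp add: linear_sum linear_cmul)
  finally show ?thesis .
qed

lemma FD_linear: "f differentiable (at x) \<Longrightarrow> linear (FD f x)"
  by (rule linear_frechet_derivative)

text \<open>In \<open>FD g (f x) (FD f x v)\<close> the direction moves with x, while
  \<open>Ck_on\<close> controls fixed directions only. Expanding the direction in the basis of the
  middle space, which is Euclidean for this purpose, separates the two dependences.\<close>

lemma Ck_on_compose:
  fixes f :: "'a::real_normed_vector \<Rightarrow> 'b::euclidean_space" and g :: "'b \<Rightarrow> 'c::real_normed_vector"
  assumes "open S" "open T" "f ` S \<subseteq> T"
  shows "Ck_on k S f \<Longrightarrow> Ck_on k T g \<Longrightarrow> Ck_on k S (\<lambda>x. g (f x))"
proof (induction k arbitrary: g)
  case 0
  then show ?case using assms by (auto intro: continuous_on_compose2)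
next
  case (Suc k)
  have df: "f differentiable at x" if "x \<in> S" for x using Suc.prems(1) that by simp
  have dg: "g differentiable at (f x)" if "x \<in> S" for x using Suc.prems(2) that assms(3) by auto
  show ?case
  proof (rule Ck_on_SucI[OF assms(1), where f' = "\<lambda>x v. \<Sum>b\<in>Basis. (FD f x v \<bullet> b) *\<^sub>R FD g (f x) b"])
    fix x assume x: "x \<in> S"
    have "((\<lambda>x. g (f x)) has_derivative (\<lambda>v. FD g (f x) (FD f x v))) (at x)"
      using has_derivative_compose[OF FD_works[OF df[OF x]] FD_works[OF dg[OF x]]] .
    then show "((\<lambda>x. g (f x)) has_derivative (\<lambda>v. \<Sum>b\<in>Basis. (FD f x v \<bullet> b) *\<^sub>R FD g (f x) b)) (at x)"
      by (simp add: linear_expand[OF FD_linear[OF dg[OF x]], symmetric])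
  next
    fix v
    have "Ck_on k S (\<lambda>x. FD f x v)" using Suc.prems(1) by simp
    moreover have "Ck_on k S (\<lambda>x. FD g (f x) b)" for b
      by (rule Suc.IH[OF Ck_on_SucD[OF Suc.prems(1)], of "\<lambda>y. FD g y b"]) (use Suc.prems(2) in simp)
    ultimately show "Ck_on k S (\<lambda>x. \<Sum>b\<in>Basis. (FD f x v \<bullet> b) *\<^sub>R FD g (f x) b)"
      by (intro Ck_on_sum[OF assms(1)] Ck_on_scaleR[OF assms(1)] Ck_on_inner[OF assms(1)] Ck_on_const)
  qed
qed

lemma Ck_on_Pair:
  assumes "open S" "Ck_on k S f" "Ck_on k S g" shows "Ck_on k S (\<lambda>x. (f x, g x))"
proof -
  have "Ck_on k S (\<lambda>x. (f x, 0) + (0, g x))"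
    by (intro Ck_on_add Ck_on_bounded_linear[where L = "\<lambda>y. (y, 0)"]
        Ck_on_bounded_linear[where L = "\<lambda>y. (0, y)"] assms bounded_linear_Pair
        bounded_linear_ident bounded_linear_zero)
  then show ?thesis by simp
qed

section \<open>Families of linear maps and their inverses\<close>

lemma Ck_on_linfam:
  fixes A :: "'a::real_normed_vector \<Rightarrow> 'b::euclidean_space \<Rightarrow> 'c::real_normed_vector"
  assumes "open S" "\<And>x. x \<in> S \<Longrightarrow> linear (A x)" "\<And>v. Ck_on k S (\<lambda>x. A x v)" "Ck_on k S a"
  shows "Ck_on k S (\<lambda>x. A x (a x))"
proof -
  have "Ck_on k S (\<lambda>x. \<Sum>b\<in>Basis. (a x \<bullet> b) *\<^sub>R A x b)"
    using assms by (intro Ck_on_sum Ck_on_scaleR Ck_on_inner Ck_on_const) auto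
  then show ?thesis
    using Ck_on_cong[OF assms(1), of "\<lambda>x. \<Sum>b\<in>Basis. (a x \<bullet> b) *\<^sub>R A x b" "\<lambda>x. A x (a x)" k]
      linear_expand[OF assms(2)] by metis
qed

text \<open>The product rule at a zero of the scalar factor asks only for continuity of the other
  factor. This turns a factorisation of an increment, with merely continuous cofactors, into
  differentiability; the inverse family and both flow theorems rest on it.\<close>

lemma has_derivative_scaleR_zero:
  fixes s :: "'a::real_normed_vector \<Rightarrow> real" and p :: "'a \<Rightarrow> 'b::real_normed_vector"
  assumes s: "(s has_derivative s') (at x)" and s0: "s x = 0" and p: "isCont p x"
  shows "((\<lambda>y. s y *\<^sub>R p y) has_derivative (\<lambda>h. s' h *\<^sub>R p x)) (at x)"
proof -
  interpret bl: bounded_linear s' using s by (rule has_derivative_bounded_linear)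
  obtain K where K: "K > 0" "\<And>h. norm (s' h) \<le> norm h * K" using bl.pos_bounded by blast
  have lim: "((\<lambda>y. norm (s y - s x - s' (y - x)) / norm (y - x)) \<longlongrightarrow> 0) (at x)"
    using s unfolding has_derivative_iff_norm by simp
  have p': "((\<lambda>y. norm (p y)) \<longlongrightarrow> norm (p x)) (at x)"
    using p by (intro tendsto_intros) (simp add: isCont_def)
  have p'': "((\<lambda>y. norm (p y - p x)) \<longlongrightarrow> norm (p x - p x)) (at x)"
    using p by (intro tendsto_intros) (simp add: isCont_def)
  show ?thesis
    unfolding has_derivative_iff_norm
  proof (intro conjI)
    show "bounded_linear (\<lambda>h. s' h *\<^sub>R p x)"
      using bl.bounded_linear_axioms by (rule bounded_linear_scaleR_const)
    have "((\<lambda>y. norm (s y - s x - s' (y - x)) / norm (y - x) * norm (p y) + K * norm (p y - p x))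
        \<longlongrightarrow> 0 * norm (p x) + K * norm (p x - p x)) (at x)"
      by (intro tendsto_intros lim p' p'')
    then have *: "((\<lambda>y. norm (s y - s x - s' (y - x)) / norm (y - x) * norm (p y) + K * norm (p y - p x))
        \<longlongrightarrow> 0) (at x)" by simp
    show "((\<lambda>y. norm (s y *\<^sub>R p y - s x *\<^sub>R p x - s' (y - x) *\<^sub>R p x) / norm (y - x)) \<longlongrightarrow> 0) (at x)"
    proof (rule tendsto_0_le[OF *, where K = 1], rule always_eventually, rule allI)
      fix y
      have "s y *\<^sub>R p y - s x *\<^sub>R p x - s' (y - x) *\<^sub>R p x
          = (s y - s x - s' (y - x)) *\<^sub>R p y + s' (y - x) *\<^sub>R (p y - p x)"
        using s0 by (simp add: algebra_simps)
      then have "norm (s y *\<^sub>R p y - s x *\<^sub>R p x - s' (y - x) *\<^sub>R p x)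
          \<le> norm (s y - s x - s' (y - x)) * norm (p y) + norm (s' (y - x)) * norm (p y - p x)"
        by (metis norm_scaleR norm_triangle_ineq real_norm_def)
      also have "\<dots> \<le> norm (s y - s x - s' (y - x)) * norm (p y) + norm (y - x) * K * norm (p y - p x)"
        using K(2) by (simp add: mult_right_mono)
      finally have le: "norm (s y *\<^sub>R p y - s x *\<^sub>R p x - s' (y - x) *\<^sub>R p x) / norm (y - x)
          \<le> (norm (s y - s x - s' (y - x)) * norm (p y) + norm (y - x) * K * norm (p y - p x)) / norm (y - x)"
        by (simp add: divide_right_mono)
      also have "\<dots> \<le> norm (s y - s x - s' (y - x)) / norm (y - x) * norm (p y) + K * norm (p y - p x)"
        using K(1) by (cases "y = x") (simp_all add: field_simps)
      finally show "norm (norm (s y *\<^sub>R p y - s x *\<^sub>R p x - s' (y - x) *\<^sub>R p x) / norm (y - x)) \<le>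
          norm (norm (s y - s x - s' (y - x)) / norm (y - x) * norm (p y) + K * norm (p y - p x)) * 1"
        by simp
    qed
  qed
qed

lemma has_derivative_linfam_zero:
  fixes P :: "'a::real_normed_vector \<Rightarrow> 'b::euclidean_space \<Rightarrow> 'c::real_normed_vector"
  assumes "open S" "x \<in> S" "\<And>y. y \<in> S \<Longrightarrow> linear (P y)" "\<And>v. isCont (\<lambda>y. P y v) x"
    "(d has_derivative d') (at x)" "d x = 0"
  shows "((\<lambda>y. P y (d y)) has_derivative (\<lambda>h. P x (d' h))) (at x)"
proof -
  have "((\<lambda>y. \<Sum>b\<in>Basis. (d y \<bullet> b) *\<^sub>R P y b) has_derivative (\<lambda>h. \<Sum>b\<in>Basis. (d' h \<bullet> b) *\<^sub>R P x b)) (at x)"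
    using assms by (intro has_derivative_sum has_derivative_scaleR_zero has_derivative_inner_left) auto
  then have "((\<lambda>y. \<Sum>b\<in>Basis. (d y \<bullet> b) *\<^sub>R P y b) has_derivative (\<lambda>h. P x (d' h))) (at x)"
    by (simp add: linear_expand[OF assms(3)[OF assms(2)], symmetric])
  then show ?thesis
    by (rule has_derivative_transform_within_open[OF _ assms(1,2)])
      (simp add: linear_expand[OF assms(3), symmetric])
qed

text \<open>Split \<open>a y\<close> into \<open>a x\<close> and \<open>a y - a x\<close>. On the
  first the family is differentiated at a fixed vector; the second vanishes at x, so there
  continuity of the family is enough.\<close>

lemma has_derivative_linfam:
  fixes A :: "'a::real_normed_vector \<Rightarrow> 'b::euclidean_space \<Rightarrow> 'c::real_normed_vector"
  assumes "open S" "x \<in> S" "\<And>y. y \<in> S \<Longrightarrow> linear (A y)"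
    "\<And>v. ((\<lambda>y. A y v) has_derivative A' v) (at x)" "(a has_derivative a') (at x)"
  shows "((\<lambda>y. A y (a y)) has_derivative (\<lambda>h. A' (a x) h + A x (a' h))) (at x)"
proof -
  have c: "isCont (\<lambda>y. A y v) x" for v using assms(4) has_derivative_continuous by blast
  have d: "((\<lambda>y. a y - a x) has_derivative a') (at x)"
    using has_derivative_diff[OF assms(5) has_derivative_const[of "a x"]] by simp
  have "((\<lambda>y. A y (a y - a x)) has_derivative (\<lambda>h. A x (a' h))) (at x)"
    by (rule has_derivative_linfam_zero[OF assms(1,2,3) c d]) auto
  from has_derivative_add[OF assms(4)[of "a x"] this]
  show ?thesis
    by (rule has_derivative_transform_within_open[OF _ assms(1,2)])
      (simp add: assms(3) linear_diff)
qed

text \<open>\<open>A x\<close> is bounded below by some c > 0, and \<epsilon> dominates the operator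
  norm of \<open>A y - A x\<close>. Once \<epsilon> y < c/2, \<open>A y\<close> is bounded below by
  c/2, and applying it to the difference of the inverse images bounds that difference by a multiple
  of \<epsilon> y.\<close>

lemma isCont_inv_linfam:
  fixes A :: "'a::real_normed_vector \<Rightarrow> 'b::euclidean_space \<Rightarrow> 'b"
  assumes "open S" "x \<in> S" "\<And>y. y \<in> S \<Longrightarrow> linear (A y)" "\<And>y. y \<in> S \<Longrightarrow> bij (A y)"
    "\<And>v. isCont (\<lambda>y. A y v) x"
  shows "isCont (\<lambda>y. inv (A y) w) x"
proof -
  define w0 where "w0 = inv (A x) w"
  obtain c where c: "c > 0" "\<And>v. c * norm v \<le> norm (A x v)"
    using linear_inj_bounded_below_pos[of "A x"] assms(2,3,4) bij_is_inj
    by (metis mult.commute)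
  define \<epsilon> where "\<epsilon> y = (\<Sum>b\<in>Basis. norm (A y b - A x b))" for y
  have e: "norm (A y v - A x v) \<le> norm v * \<epsilon> y" if "y \<in> S" for y v
  proof -
    have "A y v - A x v = (\<Sum>b\<in>Basis. (v \<bullet> b) *\<^sub>R (A y b - A x b))"
      using linear_expand[OF assms(3)[OF that], of v] linear_expand[OF assms(3)[OF assms(2)], of v]
      by (simp add: scaleR_diff_right sum_subtractf)
    then have "norm (A y v - A x v) \<le> (\<Sum>b\<in>Basis. norm ((v \<bullet> b) *\<^sub>R (A y b - A x b)))"
      by (metis norm_sum)
    also have "\<dots> \<le> (\<Sum>b\<in>Basis. norm v * norm (A y b - A x b))"
      by (intro sum_mono) (simp add: Basis_le_norm mult_right_mono)
    finally show ?thesis by (simp add: \<epsilon>_def sum_distrib_left)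
  qed
  have "(\<epsilon> \<longlongrightarrow> (\<Sum>b\<in>Basis. norm (A x b - A x b))) (at x)"
    unfolding \<epsilon>_def using assms(5) by (intro tendsto_intros) (simp add: isCont_def)
  then have e0: "(\<epsilon> \<longlongrightarrow> 0) (at x)" by simp
  have ev1: "\<forall>\<^sub>F y in at x. y \<in> S" using assms(1,2) by (rule eventually_at_in_open')
  have ev2: "\<forall>\<^sub>F y in at x. \<epsilon> y < c / 2" using e0 c(1) by (intro order_tendstoD) auto
  have "((\<lambda>y. inv (A y) w - w0) \<longlongrightarrow> 0) (at x)"
  proof (rule tendsto_0_le[where f = \<epsilon> and K = "2 * norm w0 / c"])
    show "(\<epsilon> \<longlongrightarrow> 0) (at x)" by (rule e0)
    show "\<forall>\<^sub>F y in at x. norm (inv (A y) w - w0) \<le> norm (\<epsilon> y) * (2 * norm w0 / c)"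
      using ev1 ev2
    proof eventually_elim
      case (elim y)
      define d where "d = inv (A y) w - w0"
      have "A y d = w - A y w0" unfolding d_def
        using elim assms(3,4) by (simp add: linear_diff bij_is_surj surj_f_inv_f)
      also have "\<dots> = A x w0 - A y w0" unfolding w0_def
        using assms(2,4) by (simp add: bij_is_surj surj_f_inv_f)
      finally have 1: "norm (A y d) \<le> norm w0 * \<epsilon> y" using e[OF elim(1), of w0]
        by (simp add: norm_minus_commute)
      have "c * norm d \<le> norm (A x d)" by (rule c(2))
      also have "\<dots> \<le> norm (A y d) + norm (A y d - A x d)"
        by (metis norm_minus_commute norm_triangle_sub)
      also have "\<dots> \<le> norm w0 * \<epsilon> y + norm d * (c / 2)"
        using 1 e[OF elim(1), of d] elim(2) mult_left_mono[of "\<epsilon> y" "c/2" "norm d"] norm_ge_zero[of d]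
        by linarith
      finally have "norm d * (c / 2) \<le> norm w0 * \<epsilon> y" by (simp add: field_simps)
      moreover have "\<epsilon> y \<ge> 0" unfolding \<epsilon>_def by (simp add: sum_nonneg)
      ultimately show ?case using c(1) unfolding d_def[symmetric] by (simp add: field_simps)
    qed
  qed
  then show ?thesis unfolding isCont_def w0_def using Lim_null by blast
qed

lemma linear_inv_bij:
  fixes A :: "'a::real_vector \<Rightarrow> 'b::real_vector"
  assumes "linear A" "bij A" shows "linear (inv A)"
proof (rule linearI)
  interpret linear A by fact
  have 1: "A (inv A y) = y" for y using assms(2) by (simp add: bij_is_surj surj_f_inv_f)
  have 2: "inv A (A y) = y" for y using assms(2) by (simp add: bij_is_inj)
  fix u v and r :: real
  have "inv A (u + v) = inv A (A (inv A u + inv A v))" by (simp only: add 1)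
  then show "inv A (u + v) = inv A u + inv A v" by (simp only: 2)
  have "inv A (r *\<^sub>R v) = inv A (A (r *\<^sub>R inv A v))" by (simp only: scale 1)
  then show "inv A (r *\<^sub>R v) = r *\<^sub>R inv A v" by (simp only: 2)
qed

text \<open>With \<open>w0 = inv (A x) w\<close> one has
  \<open>inv (A y) w = inv (A y) (w - A y w0) + w0\<close>. The inner argument vanishes at y = x, so
  continuity of the inverse family already yields its derivative, minus the inverse composed with A'
  composed with the inverse. This expression has one order less, which closes the induction.\<close>

lemma Ck_on_inv_linfam:
  fixes A :: "'a::real_normed_vector \<Rightarrow> 'b::euclidean_space \<Rightarrow> 'b"
  assumes "open S" and lin: "\<And>y. y \<in> S \<Longrightarrow> linear (A y)" and bij: "\<And>y. y \<in> S \<Longrightarrow> bij (A y)"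
  shows "(\<And>v. Ck_on k S (\<lambda>x. A x v)) \<Longrightarrow> Ck_on k S (\<lambda>x. inv (A x) w)"
proof (induction k arbitrary: w)
  case 0
  have c: "isCont (\<lambda>x. A x v) x" if "x \<in> S" for x v
    using 0 that assms(1) by (simp add: continuous_on_eq_continuous_at)
  have "isCont (\<lambda>x. inv (A x) w) x" if "x \<in> S" for x
    by (rule isCont_inv_linfam[OF assms(1) that lin bij c[OF that]])
  then show ?case by (simp add: continuous_at_imp_continuous_on)
next
  case (Suc k)
  have dA: "(\<lambda>x. A x v) differentiable at x" if "x \<in> S" for x v using Suc.prems that by simp
  have c: "isCont (\<lambda>x. A x v) x" if "x \<in> S" for x v
    using dA[OF that] differentiable_imp_continuous_within by blast
  have ci: "isCont (\<lambda>x. inv (A x) w) x" if "x \<in> S" for x w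
    by (rule isCont_inv_linfam[OF assms(1) that lin bij c[OF that]])
  have IH: "Ck_on k S (\<lambda>x. inv (A x) w)" for w
    by (rule Suc.IH) (use Suc.prems Ck_on_SucD in blast)
  have linv: "linear (inv (A x))" if "x \<in> S" for x using lin bij linear_inv_bij that by blast
  have AL: "linear (\<lambda>v. FD (\<lambda>x. A x v) x h)" if x: "x \<in> S" for x h
  proof (rule linearI)
    fix u v and r :: real
    have "FD (\<lambda>x. A x (u + v)) x = FD (\<lambda>x. A x u + A x v) x"
      by (rule FD_cong[OF assms(1) x]) (simp add: lin linear_add)
    also have "\<dots> = (\<lambda>h. FD (\<lambda>x. A x u) x h + FD (\<lambda>x. A x v) x h)"
      by (intro FD_eq has_derivative_add FD_works dA x)
    finally show "FD (\<lambda>x. A x (u + v)) x h = FD (\<lambda>x. A x u) x h + FD (\<lambda>x. A x v) x h" by simp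
    have "FD (\<lambda>x. A x (r *\<^sub>R v)) x = FD (\<lambda>x. r *\<^sub>R A x v) x"
      by (rule FD_cong[OF assms(1) x]) (simp add: lin linear_cmul)
    also have "\<dots> = (\<lambda>h. r *\<^sub>R FD (\<lambda>x. A x v) x h)"
      by (intro FD_eq has_derivative_scaleR_right FD_works dA x)
    finally show "FD (\<lambda>x. A x (r *\<^sub>R v)) x h = r *\<^sub>R FD (\<lambda>x. A x v) x h" by simp
  qed
  show ?case
  proof (rule Ck_on_SucI[OF assms(1), where f' = "\<lambda>x h. - inv (A x) (FD (\<lambda>x'. A x' (inv (A x) w)) x h)"])
    fix x assume x: "x \<in> S"
    define w0 where "w0 = inv (A x) w"
    have Aw0: "A x w0 = w" unfolding w0_def using bij[OF x] by (simp add: bij_is_surj surj_f_inv_f)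
    have "((\<lambda>y. w - A y w0) has_derivative (\<lambda>h. - FD (\<lambda>x'. A x' w0) x h)) (at x)"
      using has_derivative_diff[OF has_derivative_const FD_works[OF dA[OF x, of w0]], of w] by simp
    from has_derivative_linfam_zero[OF assms(1) x linv ci[OF x] this]
    have "((\<lambda>y. inv (A y) (w - A y w0)) has_derivative (\<lambda>h. inv (A x) (- FD (\<lambda>x'. A x' w0) x h))) (at x)"
      using Aw0 by simp
    then have "((\<lambda>y. inv (A y) (w - A y w0) + w0) has_derivative (\<lambda>h. inv (A x) (- FD (\<lambda>x'. A x' w0) x h))) (at x)"
      using has_derivative_add[OF _ has_derivative_const[of w0]] by fastforce
    then have "((\<lambda>y. inv (A y) w) has_derivative (\<lambda>h. inv (A x) (- FD (\<lambda>x'. A x' w0) x h))) (at x)"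
      by (rule has_derivative_transform_within_open[OF _ assms(1) x])
        (simp add: linv linear_diff bij bij_is_inj)
    then show "((\<lambda>y. inv (A y) w) has_derivative
        (\<lambda>h. - inv (A x) (FD (\<lambda>x'. A x' (inv (A x) w)) x h))) (at x)"
      unfolding w0_def[symmetric] using linv[OF x] by (simp add: linear_neg)
  next
    fix h
    have A1: "Ck_on k S (\<lambda>x. FD (\<lambda>x'. A x' v) x h)" for v using Suc.prems[of v] by simp
    have "Ck_on k S (\<lambda>x. FD (\<lambda>x'. A x' (inv (A x) w)) x h)"
      by (rule Ck_on_linfam[of S "\<lambda>x v. FD (\<lambda>x'. A x' v) x h", OF assms(1) AL A1 IH])
    then have "Ck_on k S (\<lambda>x. inv (A x) (FD (\<lambda>x'. A x' (inv (A x) w)) x h))"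
      by (intro Ck_on_linfam[of S "\<lambda>x. inv (A x)", OF assms(1) linv IH])
    then show "Ck_on k S (\<lambda>x. - inv (A x) (FD (\<lambda>x'. A x' (inv (A x) w)) x h))"
      by (rule Ck_on_minus[OF assms(1)])
  qed
qed

lemma Ck_on_inverse: "Ck_on k (- {0::real}) inverse"
proof (induction k)
  case 0
  show ?case by (auto intro: continuous_intros)
next
  case (Suc k)
  show ?case
    by (rule Ck_on_SucI[where f' = "\<lambda>x h. - (inverse x * h * inverse x)"])
      (auto intro!: has_derivative_inverse' Ck_on_minus Ck_on_mult Suc Ck_on_const)
qed

lemma Ck_on_sqrt: "Ck_on k {0::real<..} sqrt"
proof (induction k)
  case 0
  show ?case by (auto intro: continuous_intros)
next
  case (Suc k)
  have i: "Ck_on k {0<..} (\<lambda>x. inverse (sqrt x))"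
    by (rule Ck_on_compose[OF _ _ _ Suc Ck_on_inverse]) auto
  show ?case
  proof (rule Ck_on_SucI[where f' = "\<lambda>x h. h * (inverse (sqrt x) * (1/2))"])
    show "(sqrt has_derivative (\<lambda>h. h * (inverse (sqrt x) * (1/2)))) (at x)" if "x \<in> {0<..}" for x
    proof -
      have "(sqrt has_derivative (*) (inverse (sqrt x) / 2)) (at x)"
        using DERIV_real_sqrt[of x] that unfolding has_field_derivative_def by simp
      then show ?thesis by (rule has_derivative_eq_rhs) (auto simp: field_simps)
    qed
    show "Ck_on k {0<..} (\<lambda>x. h * (inverse (sqrt x) * (1/2)))" for h
      by (intro Ck_on_mult i Ck_on_const) auto
  qed simp
qed

section \<open>Integrals depending on a parameter\<close>

lemma Ck_on_integral:
  fixes K :: "real \<times> 'b::euclidean_space \<Rightarrow> 'c::euclidean_space"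
  assumes "open T" "open S" "\<And>r z. r \<in> {0..1} \<Longrightarrow> z \<in> S \<Longrightarrow> (r, z) \<in> T"
  shows "Ck_on k T K \<Longrightarrow> Ck_on k S (\<lambda>z. integral {0..1} (\<lambda>r. K (r, z)))"
    and "Ck_on (Suc 0) T K \<Longrightarrow> z \<in> S \<Longrightarrow> ((\<lambda>z. integral {0..1} (\<lambda>r. K (r, z))) has_derivative
           (\<lambda>h. integral {0..1} (\<lambda>r. FD K (r, z) (0, h)))) (at z)"
proof -
  \<comment> \<open>Differentiation under the integral sign, for every K because the induction below
    replaces K by its directional derivatives. The Leibniz rule wants the derivative as an element
    of the space of bounded linear maps, hence \<open>Blinfun\<close>; its continuity is checked on
    basis vectors.\<close>
  have deriv: "((\<lambda>z. integral {0..1} (\<lambda>r. K (r, z))) has_derivative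
           (\<lambda>h. integral {0..1} (\<lambda>r. FD K (r, z) (0, h)))) (at z)"
    if K: "Ck_on (Suc 0) T K" and z: "z \<in> S" for K :: "real \<times> 'b \<Rightarrow> 'c" and z
  proof -
    obtain e where e: "e > 0" "ball z e \<subseteq> S" using assms(2) z openE by blast
    have dK: "K differentiable at q" if "q \<in> T" for q using K that by simp
    have cK: "continuous_on T (\<lambda>q. FD K q v)" for v using K by (cases v) simp
    have bl: "bounded_linear (\<lambda>h. FD K (r, y) (0, h))" if "(r, y) \<in> T" for r y
      using bounded_linear_compose[OF has_derivative_bounded_linear[OF FD_works[OF dK[OF that]]]
          bounded_linear_Pair[OF bounded_linear_zero bounded_linear_ident]] by simp
    define k where "k y r = Blinfun (\<lambda>h. FD K (r, y) (0, h))" for y r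
    have k: "blinfun_apply (k y r) = (\<lambda>h. FD K (r, y) (0, h))" if "y \<in> S" "r \<in> {0..1}" for y r
      unfolding k_def using bl[OF assms(3)] that by (simp add: bounded_linear_Blinfun_apply)
    have "((\<lambda>z. integral (cbox 0 1) (\<lambda>r. K (r, z))) has_derivative integral (cbox 0 1) (k z)) (at z within ball z e)"
    proof (rule leibniz_rule)
      fix y and r :: real assume y: "y \<in> ball z e" and r: "r \<in> cbox 0 1"
      have "(K has_derivative FD K (r, y)) (at (r, y))"
        using y r e assms(3) by (intro FD_works dK) auto
      then have "((\<lambda>y. K (r, y)) has_derivative (\<lambda>h. FD K (r, y) (0, h))) (at y)"
        by (rule has_derivative_compose[OF has_derivative_Pair[OF has_derivative_const has_derivative_ident]])
      then show "((\<lambda>x. K (r, x)) has_derivative blinfun_apply (k y r)) (at y within ball z e)"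
        using k[of y r] y r e(2) by (metis (no_types) atLeastAtMost_iff box_real(2) has_derivative_at_withinI subsetD)
    next
      fix y assume "y \<in> ball z e"
      then have "continuous_on {0..1} (\<lambda>r. K (r, y))"
        using e(2) assms(3) by (intro continuous_on_compose2[OF Ck_on_continuous[OF K]] continuous_intros) auto
      then show "(\<lambda>r. K (r, y)) integrable_on cbox 0 1" by (simp add: integrable_continuous_real)
    next
      have "continuous_on (ball z e \<times> {0..1}) (\<lambda>p. k (fst p) (snd p))"
      proof (rule continuous_on_blinfun_componentwise)
        fix i :: 'b
        have "continuous_on (ball z e \<times> {0..1}) (\<lambda>p. FD K (snd p, fst p) (0, i))"
          using e(2) assms(3) by (intro continuous_on_compose2[OF cK] continuous_intros) auto
        then show "continuous_on (ball z e \<times> {0..1}) (\<lambda>p. blinfun_apply (k (fst p) (snd p)) i)"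
          by (rule continuous_on_eq) (use k e(2) in auto)
      qed
      then show "continuous_on (ball z e \<times> cbox 0 1) (\<lambda>(x, t). k x t)"
        by (simp add: split_beta)
    qed (use e in auto)
    then have der: "((\<lambda>z. integral {0..1} (\<lambda>r. K (r, z))) has_derivative integral {0..1} (k z)) (at z)"
      using e(1) by (simp add: at_within_open[of z "ball z e"])
    have "continuous_on {0..1} (k z)"
    proof (rule continuous_on_blinfun_componentwise)
      fix i :: 'b
      have "continuous_on {0..1} (\<lambda>r. FD K (r, z) (0, i))"
        using z assms(3) by (intro continuous_on_compose2[OF cK] continuous_intros) auto
      then show "continuous_on {0..1} (\<lambda>r. blinfun_apply (k z r) i)"
        by (rule continuous_on_eq) (use k z in auto)
    qed
    then have "k z integrable_on {0..1}" by (rule integrable_continuous_real)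
    then have "blinfun_apply (integral {0..1} (k z)) h = integral {0..1} (\<lambda>r. blinfun_apply (k z r) h)" for h
      by (rule blinfun_apply_integral)
    also have "\<dots> h = integral {0..1} (\<lambda>r. FD K (r, z) (0, h))" for h
      by (rule integral_cong) (use k z in auto)
    finally have "blinfun_apply (integral {0..1} (k z)) = (\<lambda>h. integral {0..1} (\<lambda>r. FD K (r, z) (0, h)))"
      by blast
    then show ?thesis using der by simp
  qed
  then show "Ck_on (Suc 0) T K \<Longrightarrow> z \<in> S \<Longrightarrow> ((\<lambda>z. integral {0..1} (\<lambda>r. K (r, z))) has_derivative
           (\<lambda>h. integral {0..1} (\<lambda>r. FD K (r, z) (0, h)))) (at z)" by blast
  show "Ck_on k T K \<Longrightarrow> Ck_on k S (\<lambda>z. integral {0..1} (\<lambda>r. K (r, z)))"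
  proof (induction k arbitrary: K)
    case 0
    have "continuous_on (S \<times> cbox 0 1) (\<lambda>p. K (snd p, fst p))"
    proof (rule continuous_on_compose2[of T K])
      show "continuous_on T K" using 0 by simp
    qed (use assms(3) in \<open>auto intro!: continuous_intros\<close>)
    then have "continuous_on S (\<lambda>z. integral (cbox 0 1) (\<lambda>r. K (r, z)))"
      using integral_continuous_on_param[of S 0 1 "\<lambda>z r. K (r, z)"] unfolding split_beta by blast
    then show ?case by simp
  next
    case (Suc k)
    have "Ck_on (Suc 0) T K" by (rule Ck_on_le[OF _ Suc.prems]) simp
    note der = deriv[OF this]
    have "Ck_on k T (\<lambda>q. FD K q (0, h))" for h using Suc.prems by (simp del: split_paired_All)
    note IH = Suc.IH[OF this]
    show ?case by (rule Ck_on_SucI[OF assms(2) der IH])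
  qed
qed

lemma segment_integral:
  fixes f :: "'a::real_normed_vector \<Rightarrow> 'b::euclidean_space"
  assumes "open S" "Ck_on (Suc 0) S f" "\<And>r. r \<in> {0..1} \<Longrightarrow> x + r *\<^sub>R v \<in> S"
  shows "f (x + v) - f x = integral {0..1} (\<lambda>r. FD f (x + r *\<^sub>R v) v)"
proof -
  have "((\<lambda>r. FD f (x + r *\<^sub>R v) v) has_integral f (x + 1 *\<^sub>R v) - f (x + 0 *\<^sub>R v)) {0..1}"
  proof (rule fundamental_theorem_of_calculus)
    fix r :: real assume r: "r \<in> {0..1}"
    have d: "(f has_derivative FD f (x + r *\<^sub>R v)) (at (x + r *\<^sub>R v))"
      using assms(2) assms(3)[OF r] by (intro FD_works) simp
    have "((\<lambda>r. x + r *\<^sub>R v) has_derivative (\<lambda>t. t *\<^sub>R v)) (at r)"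
      by (auto intro!: derivative_eq_intros)
    from has_derivative_compose[OF this d]
    have "((\<lambda>r. f (x + r *\<^sub>R v)) has_derivative (\<lambda>t. t *\<^sub>R FD f (x + r *\<^sub>R v) v)) (at r)"
      using has_derivative_linear[OF d] by (simp add: linear_cmul)
    then show "((\<lambda>r. f (x + r *\<^sub>R v)) has_vector_derivative FD f (x + r *\<^sub>R v) v) (at r within {0..1})"
      unfolding has_vector_derivative_def by (rule has_derivative_at_withinI)
  qed simp
  then show ?thesis by (simp add: integral_unique)
qed

text \<open>The derivative of the directional difference quotient, written as an integral over the
  segment, tends to the continuous second derivative.\<close>

lemma FD_commute:
  fixes f :: "'a::euclidean_space \<Rightarrow> 'b::euclidean_space"
  assumes "open S" "Ck_on (Suc (Suc 0)) S f" "x \<in> S"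
  shows "FD (\<lambda>y. FD f y v) x u = FD (\<lambda>y. FD f y u) x v"
proof -
  have C1: "Ck_on (Suc 0) S f" and C1': "Ck_on (Suc 0) S (\<lambda>y. FD f y w)" for w
    using assms(2) Ck_on_SucD by (metis, metis Ck_on.simps(2))
  \<comment> \<open>The triple (r, y, t) goes to the point y + r t v of the segment from y to y + t
    v, along which the increment of f is written as an integral.\<close>
  define m where "m = (\<lambda>p::real \<times> 'a \<times> real. fst (snd p) + (fst p * snd (snd p)) *\<^sub>R v)"
  have cm: "Ck_on k X m" if "open X" for k X
    unfolding m_def using that
    by (intro Ck_on_add Ck_on_scaleR Ck_on_mult Ck_on_const
        Ck_on_bounded_linear[where L = "\<lambda>p. fst (snd p)"] Ck_on_bounded_linear[where L = "\<lambda>p. snd (snd p)"]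
        Ck_on_bounded_linear[where L = fst] Ck_on_ident
        bounded_linear_compose[OF bounded_linear_fst bounded_linear_snd]
        bounded_linear_compose[OF bounded_linear_snd bounded_linear_snd] bounded_linear_fst)
  have contm: "continuous_on UNIV m" using Ck_on_continuous[OF cm[of UNIV 0]] by simp
  define T where "T = m -` S"
  have oT: "open T" unfolding T_def using contm assms(1) by (simp add: continuous_on_open_vimage open_vimage)
  obtain e where e: "e > 0" "ball x e \<subseteq> S" using assms(1,3) openE by blast
  \<comment> \<open>For |t| < d the shift t v has length at most e/2, so y + t v stays in the ball
    of radius e when y is within e/2 of x. The summand 1 avoids division by zero for v = 0.\<close>
  define d where "d = e / (2 * (norm v + 1))"
  have nv: "norm v + 1 > 0" by (smt (verit) norm_ge_zero)
  have d: "d > 0" unfolding d_def using e nv by simp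
  have dv: "d * norm v \<le> e / 2"
  proof -
    have "d * norm v \<le> d * (norm v + 1)" using d by simp
    also have "\<dots> = e / 2" unfolding d_def using nv by (simp add: field_simps)
    finally show ?thesis .
  qed
  define X where "X = ball x (e / 2) \<times> {-d<..<d}"
  have oX: "open X" unfolding X_def by (intro open_Times) auto
  have XT: "(r, z) \<in> T" if "r \<in> {0..1}" "z \<in> X" for r z
  proof -
    have "norm ((r * snd z) *\<^sub>R v) \<le> e / 2"
    proof -
      have "\<bar>r * snd z\<bar> \<le> 1 * d" using that unfolding X_def abs_mult by (intro mult_mono) auto
      then have "\<bar>r * snd z\<bar> * norm v \<le> d * norm v" by (simp add: mult_right_mono)
      then show ?thesis using dv by simp
    qed
    moreover have "norm (fst z - x) < e / 2" using that unfolding X_def by (auto simp: dist_norm norm_minus_commute)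
    ultimately have "norm (fst z + (r * snd z) *\<^sub>R v - x) < e"
      by (smt (verit, best) add.commute add_diff_eq norm_triangle_ineq field_sum_of_halves)
    then have "m (r, z) \<in> ball x e" unfolding m_def by (simp add: dist_norm norm_minus_commute)
    then show ?thesis unfolding T_def using e by auto
  qed
  \<comment> \<open>The difference quotient of f in direction v, extended to t = 0 by the derivative
    there. As an integral it is C^1 in (y, t) jointly, the value t = 0 included.\<close>
  define q where "q z = integral {0..1} (\<lambda>r. FD f (m (r, z)) v)" for z
  have "Ck_on (Suc 0) T (\<lambda>p. FD f (m p) v)"
    by (rule Ck_on_compose[OF oT assms(1) _ cm[OF oT] C1']) (auto simp: T_def)
  then have qC: "Ck_on (Suc 0) X q" unfolding q_def using Ck_on_integral(1)[OF oT oX XT] by blast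
  have hd: "f (y + t *\<^sub>R v) - f y = t *\<^sub>R q (y, t)" if "(y, t) \<in> X" for y t
  proof -
    have "f (y + t *\<^sub>R v) - f y = integral {0..1} (\<lambda>r. FD f (y + r *\<^sub>R t *\<^sub>R v) (t *\<^sub>R v))"
      using XT[OF _ that] unfolding T_def m_def by (intro segment_integral[OF assms(1) C1]) auto
    also have "\<dots> = integral {0..1} (\<lambda>r. t *\<^sub>R FD f (m (r, y, t)) v)"
    proof (rule integral_cong)
      fix r :: real assume "r \<in> {0..1}"
      then have "m (r, y, t) \<in> S" using XT that T_def by auto
      then have "linear (FD f (m (r, y, t)))" using C1 by (intro FD_linear) simp
      then show "FD f (y + r *\<^sub>R t *\<^sub>R v) (t *\<^sub>R v) = t *\<^sub>R FD f (m (r, y, t)) v"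
        unfolding m_def by (simp add: linear_cmul)
    qed
    finally show ?thesis by (simp add: q_def)
  qed
  have xX: "(x, t) \<in> X" if "\<bar>t\<bar> < d" for t unfolding X_def using that e d by auto
  \<comment> \<open>Both sides are the derivative in y, in direction u, of
    \<open>f (y + t v) - f y = t q (y, t)\<close>. Differentiating this identity once more at t = 0
    gives the symmetry.\<close>
  have key: "FD f (x + t *\<^sub>R v) u - FD f x u = t *\<^sub>R FD q (x, t) (u, 0)" if t: "\<bar>t\<bar> < d" for t
  proof -
    have m1: "m (1, x, t) \<in> S" using XT[OF _ xX[OF t], of 1] unfolding T_def by auto
    have 1: "(f has_derivative FD f (x + t *\<^sub>R v)) (at (x + t *\<^sub>R v))"
      using m1 C1 unfolding m_def by (intro FD_works) simp
    have 2: "(f has_derivative FD f x) (at x)" using C1 assms(3) by (intro FD_works) simp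
    have "((\<lambda>y. f (y + t *\<^sub>R v)) has_derivative FD f (x + t *\<^sub>R v)) (at x)"
      using has_derivative_compose[OF has_derivative_add[OF has_derivative_ident has_derivative_const] 1]
      by simp
    from has_derivative_diff[OF this 2]
    have L: "((\<lambda>y. f (y + t *\<^sub>R v) - f y) has_derivative (\<lambda>h. FD f (x + t *\<^sub>R v) h - FD f x h)) (at x)" .
    have "(q has_derivative FD q (x, t)) (at (x, t))"
      using qC xX[OF t] by (intro FD_works) simp
    then have "((\<lambda>y. q (y, t)) has_derivative (\<lambda>h. FD q (x, t) (h, 0))) (at x)"
      by (rule has_derivative_compose[OF has_derivative_Pair[OF has_derivative_ident has_derivative_const]])
    then have "((\<lambda>y. t *\<^sub>R q (y, t)) has_derivative (\<lambda>h. t *\<^sub>R FD q (x, t) (h, 0))) (at x)"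
      by (rule has_derivative_scaleR_right)
    then have "((\<lambda>y. f (y + t *\<^sub>R v) - f y) has_derivative (\<lambda>h. t *\<^sub>R FD q (x, t) (h, 0))) (at x)"
    proof (rule has_derivative_transform_within_open[where s = "ball x (e/2)"])
      fix y assume "y \<in> ball x (e/2)"
      then have "(y, t) \<in> X" using t unfolding X_def by auto
      then show "t *\<^sub>R q (y, t) = f (y + t *\<^sub>R v) - f y" using hd by simp
    qed (use e in auto)
    from has_derivative_unique[OF L this] show ?thesis by meson
  qed
  have "continuous_on X (\<lambda>z. FD q z (u, 0))" using qC by simp
  then have "continuous_on {-d<..<d} (\<lambda>t. FD q (x, t) (u, 0))"
    by (rule continuous_on_compose2) (use xX in \<open>auto intro!: continuous_intros\<close>)
  then have ct: "isCont (\<lambda>t. FD q (x, t) (u, 0)) 0"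
    using d by (simp add: continuous_on_eq_continuous_at)
  have "((\<lambda>t. t *\<^sub>R FD q (x, t) (u, 0)) has_derivative (\<lambda>h. h *\<^sub>R FD q (x, 0) (u, 0))) (at 0)"
    by (rule has_derivative_scaleR_zero[OF _ _ ct]) (auto intro!: derivative_eq_intros)
  then have A: "((\<lambda>t. FD f (x + t *\<^sub>R v) u - FD f x u) has_derivative (\<lambda>h. h *\<^sub>R FD q (x, 0) (u, 0))) (at 0)"
    by (rule has_derivative_transform_within_open[where s = "{-d<..<d}"]) (use key d in auto)
  have "((\<lambda>y. FD f y u) has_derivative FD (\<lambda>y. FD f y u) x) (at (x + 0 *\<^sub>R v))"
    using C1' assms(3) by (auto intro: FD_works)
  moreover have "((\<lambda>t. x + t *\<^sub>R v) has_derivative (\<lambda>t. t *\<^sub>R v)) (at 0)" by (auto intro!: derivative_eq_intros)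
  ultimately have "((\<lambda>t. FD f (x + t *\<^sub>R v) u) has_derivative (\<lambda>t. FD (\<lambda>y. FD f y u) x (t *\<^sub>R v))) (at 0)"
    using has_derivative_compose[of "\<lambda>t. x + t *\<^sub>R v" "\<lambda>t. t *\<^sub>R v" 0 UNIV "\<lambda>y. FD f y u"]
    by blast
  from has_derivative_diff[OF this has_derivative_const[of "FD f x u"]]
  have "(\<lambda>h. h *\<^sub>R FD q (x, 0) (u, 0)) = (\<lambda>t. FD (\<lambda>y. FD f y u) x (t *\<^sub>R v))"
    using has_derivative_unique[OF A] by simp
  from fun_cong[OF this, of 1] have B: "FD q (x, 0) (u, 0) = FD (\<lambda>y. FD f y u) x v" by simp
  have "(q has_derivative FD q (x, 0)) (at (x, 0))"
    using qC xX[of 0] d by (intro FD_works) simp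
  then have "((\<lambda>y. q (y, 0)) has_derivative (\<lambda>h. FD q (x, 0) (h, 0))) (at x)"
    using has_derivative_compose[OF has_derivative_Pair[OF has_derivative_ident has_derivative_const]] by blast
  moreover have "q (y, 0) = FD f y v" for y unfolding q_def m_def by simp
  ultimately have "FD (\<lambda>y. FD f y v) x = (\<lambda>h. FD q (x, 0) (h, 0))" using FD_eq by simp
  then show ?thesis using B by simp
qed

section \<open>Smooth functions and the inverse function theorem\<close>

lemma smooth_onD: "smooth_on S f \<Longrightarrow> Ck_on k S f" by (simp add: smooth_on_def)
lemma smooth_onI: "(\<And>k. Ck_on k S f) \<Longrightarrow> smooth_on S f" by (simp add: smooth_on_def)

lemma smooth_on_cong: "open S \<Longrightarrow> (\<And>x. x \<in> S \<Longrightarrow> f x = g x) \<Longrightarrow> smooth_on S f = smooth_on S g"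
  unfolding smooth_on_def using Ck_on_cong[of S f g] by simp

lemma smooth_on_subset: "smooth_on S f \<Longrightarrow> T \<subseteq> S \<Longrightarrow> smooth_on T f"
  unfolding smooth_on_def using Ck_on_subset by blast

lemma smooth_on_const: "smooth_on S (\<lambda>x. c)" by (intro smooth_onI Ck_on_const)
lemma smooth_on_ident: "open S \<Longrightarrow> smooth_on S (\<lambda>x. x)" by (intro smooth_onI Ck_on_ident)

lemma smooth_on_bounded_linear:
  "bounded_linear L \<Longrightarrow> open S \<Longrightarrow> smooth_on S f \<Longrightarrow> smooth_on S (\<lambda>x. L (f x))"
  by (rule smooth_onI, rule Ck_on_bounded_linear[of L S _ f]) (auto simp: smooth_onD)

lemma smooth_on_add:
  "open S \<Longrightarrow> smooth_on S f \<Longrightarrow> smooth_on S g \<Longrightarrow> smooth_on S (\<lambda>x. f x + g x)"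
  by (rule smooth_onI, rule Ck_on_add[of S _ f g]) (auto simp: smooth_onD)

lemma smooth_on_diff:
  "open S \<Longrightarrow> smooth_on S f \<Longrightarrow> smooth_on S g \<Longrightarrow> smooth_on S (\<lambda>x. f x - g x)"
  by (rule smooth_onI, rule Ck_on_diff[of S _ f g]) (auto simp: smooth_onD)

lemma smooth_on_sum:
  "open S \<Longrightarrow> (\<And>i. i \<in> I \<Longrightarrow> smooth_on S (f i)) \<Longrightarrow> smooth_on S (\<lambda>x. \<Sum>i\<in>I. f i x)"
  by (rule smooth_onI, rule Ck_on_sum[of S I _ f]) (auto simp: smooth_onD)

lemma smooth_on_scaleR:
  "open S \<Longrightarrow> smooth_on S f \<Longrightarrow> smooth_on S g \<Longrightarrow> smooth_on S (\<lambda>x. f x *\<^sub>R g x)"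
  by (rule smooth_onI, rule Ck_on_scaleR[of S _ f g]) (auto simp: smooth_onD)

lemma smooth_on_inner:
  "open S \<Longrightarrow> smooth_on S f \<Longrightarrow> smooth_on S g \<Longrightarrow> smooth_on S (\<lambda>x. f x \<bullet> g x)"
  by (rule smooth_onI, rule Ck_on_inner[of S _ f g]) (auto simp: smooth_onD)

lemma smooth_on_Pair:
  "open S \<Longrightarrow> smooth_on S f \<Longrightarrow> smooth_on S g \<Longrightarrow> smooth_on S (\<lambda>x. (f x, g x))"
  by (rule smooth_onI, rule Ck_on_Pair[of S _ f g]) (auto simp: smooth_onD)

lemma smooth_on_fst: "open S \<Longrightarrow> smooth_on S f \<Longrightarrow> smooth_on S (\<lambda>x. fst (f x))"
  by (rule smooth_on_bounded_linear[OF bounded_linear_fst])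

lemma smooth_on_snd: "open S \<Longrightarrow> smooth_on S f \<Longrightarrow> smooth_on S (\<lambda>x. snd (f x))"
  by (rule smooth_on_bounded_linear[OF bounded_linear_snd])

lemma smooth_on_compose:
  fixes f :: "'a::real_normed_vector \<Rightarrow> 'b::euclidean_space" and g :: "'b \<Rightarrow> 'c::real_normed_vector"
  assumes "open S" "open T" "\<And>x. x \<in> S \<Longrightarrow> f x \<in> T" "smooth_on S f" "smooth_on T g"
  shows "smooth_on S (\<lambda>x. g (f x))"
proof (rule smooth_onI)
  show "Ck_on k S (\<lambda>x. g (f x))" for k
    by (rule Ck_on_compose[OF assms(1,2) _ smooth_onD[OF assms(4)] smooth_onD[OF assms(5)]]) (use assms(3) in blast)
qed

lemma smooth_on_linfam:
  fixes A :: "'a::real_normed_vector \<Rightarrow> 'b::euclidean_space \<Rightarrow> 'c::real_normed_vector"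
  assumes "open S" "\<And>x. x \<in> S \<Longrightarrow> linear (A x)" "\<And>v. smooth_on S (\<lambda>x. A x v)" "smooth_on S a"
  shows "smooth_on S (\<lambda>x. A x (a x))"
  by (rule smooth_onI, rule Ck_on_linfam[of S A _ a]) (simp_all add: assms smooth_onD)

lemma smooth_on_inv_linfam:
  fixes A :: "'a::real_normed_vector \<Rightarrow> 'b::euclidean_space \<Rightarrow> 'b"
  assumes "open S" "\<And>y. y \<in> S \<Longrightarrow> linear (A y)" "\<And>y. y \<in> S \<Longrightarrow> bij (A y)"
    "\<And>v. smooth_on S (\<lambda>x. A x v)"
  shows "smooth_on S (\<lambda>x. inv (A x) w)"
  by (rule smooth_onI, rule Ck_on_inv_linfam) (simp_all add: assms smooth_onD)

lemma smooth_on_inverse: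
  fixes f :: "'a::real_normed_vector \<Rightarrow> real"
  assumes "open S" "smooth_on S f" "\<And>x. x \<in> S \<Longrightarrow> f x \<noteq> 0"
  shows "smooth_on S (\<lambda>x. inverse (f x))"
proof (rule smooth_on_compose[OF assms(1) _ _ assms(2), of "-{0}"])
  show "smooth_on (- {0::real}) inverse" by (rule smooth_onI[OF Ck_on_inverse])
qed (use assms(3) in auto)

lemma smooth_on_sqrt:
  fixes f :: "'a::real_normed_vector \<Rightarrow> real"
  assumes "open S" "smooth_on S f" "\<And>x. x \<in> S \<Longrightarrow> f x > 0"
  shows "smooth_on S (\<lambda>x. sqrt (f x))"
proof (rule smooth_on_compose[OF assms(1) _ _ assms(2), of "{0<..}"])
  show "smooth_on {0::real<..} sqrt" by (rule smooth_onI[OF Ck_on_sqrt])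
qed (use assms(3) in auto)

lemma smooth_on_differentiable: "smooth_on S f \<Longrightarrow> x \<in> S \<Longrightarrow> f differentiable (at x)"
  using smooth_onD[of S f "Suc 0"] by simp

lemma smooth_on_has_derivative: "smooth_on S f \<Longrightarrow> x \<in> S \<Longrightarrow> (f has_derivative FD f x) (at x)"
  by (intro FD_works smooth_on_differentiable)

lemma smooth_on_continuous: "smooth_on S f \<Longrightarrow> continuous_on S f"
  using smooth_onD Ck_on_continuous by blast

lemma smooth_on_linear: "smooth_on S f \<Longrightarrow> x \<in> S \<Longrightarrow> linear (FD f x)"
  by (intro FD_linear smooth_on_differentiable)

lemma smooth_on_FD: "smooth_on S f \<Longrightarrow> smooth_on S (\<lambda>x. FD f x v)"
  unfolding smooth_on_def by (metis Ck_on.simps(2))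

lemma smooth_on_FD_compose:
  fixes h :: "'a::real_normed_vector \<Rightarrow> 'b::euclidean_space" and f :: "'b \<Rightarrow> 'c::real_normed_vector"
  assumes "open S" "open T" "\<And>x. x \<in> S \<Longrightarrow> h x \<in> T" "smooth_on T f" "smooth_on S h" "smooth_on S a"
  shows "smooth_on S (\<lambda>x. FD f (h x) (a x))"
proof (rule smooth_on_linfam[of S "\<lambda>x. FD f (h x)", OF assms(1) _ _ assms(6)])
  show "linear (FD f (h x))" if "x \<in> S" for x by (rule smooth_on_linear[OF assms(4) assms(3)[OF that]])
  show "smooth_on S (\<lambda>x. FD f (h x) v)" for v
    by (rule smooth_on_compose[OF assms(1,2,3,5) smooth_on_FD[OF assms(4)]])
qed

lemma smooth_on_integral:
  fixes K :: "real \<times> 'b::euclidean_space \<Rightarrow> 'c::euclidean_space"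
  assumes "open T" "open S" "\<And>r z. r \<in> {0..1} \<Longrightarrow> z \<in> S \<Longrightarrow> (r, z) \<in> T" "smooth_on T K"
  shows "smooth_on S (\<lambda>z. integral {0..1} (\<lambda>r. K (r, z)))"
  by (rule smooth_onI, rule Ck_on_integral(1)[OF assms(1,2,3) smooth_onD[OF assms(4)]])

lemma FD_compose:
  assumes "f differentiable (at x)" "g differentiable (at (f x))"
  shows "FD (\<lambda>y. g (f y)) x = (\<lambda>v. FD g (f x) (FD f x v))"
  by (rule FD_eq[OF has_derivative_compose[OF FD_works[OF assms(1)] FD_works[OF assms(2)]]])

lemma smooth_FD_commute:
  fixes f :: "'a::euclidean_space \<Rightarrow> 'b::euclidean_space"
  assumes "open S" "smooth_on S f" "x \<in> S"
  shows "FD (\<lambda>y. FD f y v) x u = FD (\<lambda>y. FD f y u) x v"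
  using FD_commute[OF assms(1) smooth_onD[OF assms(2)] assms(3)] .

text \<open>The spaces are different types of equal dimension. A linear isomorphism J makes f a
  self-map \<open>f1\<close>, to which the C^1 inverse function theorem applies. Smoothness is a
  bootstrap: the derivative of g is the inverse of \<open>FD f1 (g y)\<close>, which is C^k as soon
  as g is C^k.\<close>

lemma smooth_inverse_function:
  fixes f :: "'a::euclidean_space \<Rightarrow> 'b::euclidean_space"
  assumes S: "open S" "x0 \<in> S" "smooth_on S f" and dim: "DIM('a) = DIM('b)" and inj: "inj (FD f x0)"
  obtains U V g where "open U" "x0 \<in> U" "U \<subseteq> S" "open V" "f ` U = V" "smooth_on V g"
    "\<And>x. x \<in> U \<Longrightarrow> g (f x) = x" "\<And>y. y \<in> V \<Longrightarrow> g y \<in> U \<and> f (g y) = y"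
proof -
  obtain J :: "'b \<Rightarrow> 'a" where J: "linear J" "J ` UNIV = UNIV" "inj J"
    using subspace_isomorphism[OF subspace_UNIV subspace_UNIV, where 'a = 'b and 'b = 'a] dim by auto
  have bJ: "bij J" using J by (simp add: bij_def)
  note lJ = linear_conv_bounded_linear[THEN iffD1, OF J(1)]
  have lJi: "linear (inv J)" by (rule linear_inv_bij[OF J(1) bJ])
  define S' where "S' = J -` S"
  define f1 where "f1 y = f (J y)" for y
  have oS: "open S'" unfolding S'_def using S(1) linear_continuous_on[OF lJ] by (simp add: open_vimage)
  have f1: "smooth_on S' f1" unfolding f1_def
    by (rule smooth_on_compose[OF oS S(1) _ smooth_on_bounded_linear[OF lJ oS smooth_on_ident[OF oS]] S(3)])
      (auto simp: S'_def)
  have FD1: "FD f1 y = (\<lambda>v. FD f (J y) (J v))" if "y \<in> S'" for y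
    unfolding f1_def using that smooth_on_differentiable[OF S(3)] FD_compose[of J y f]
      bounded_linear_imp_differentiable[OF lJ] FD_eq[OF bounded_linear_imp_has_derivative[OF lJ]]
    by (auto simp: S'_def)
  define y0 where "y0 = inv J x0"
  have Jy0: "J y0 = x0" "y0 \<in> S'" unfolding y0_def S'_def using bJ S(2) by (auto simp: bij_is_surj surj_f_inv_f)
  define f' where "f' x = Blinfun (FD f1 x)" for x
  have bl: "bounded_linear (FD f1 x)" if "x \<in> S'" for x
    using smooth_on_linear[OF f1 that] linear_conv_bounded_linear by blast
  have f': "blinfun_apply (f' x) = FD f1 x" if "x \<in> S'" for x
    unfolding f'_def by (rule bounded_linear_Blinfun_apply[OF bl[OF that]])
  have injy: "inj (FD f1 y0)" unfolding FD1[OF Jy0(2)] Jy0(1)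
    using inj_compose[OF inj J(3)] by (simp add: o_def)
  have bij0: "bij (FD f1 y0)"
    using linear_inj_imp_surj[OF smooth_on_linear[OF f1 Jy0(2)] injy] injy by (simp add: bij_def)
  have bli: "bounded_linear (inv (FD f1 y0))"
    using linear_inv_bij[OF smooth_on_linear[OF f1 Jy0(2)] bij0] linear_conv_bounded_linear by blast
  obtain U V g g' where UV: "open U" "U \<subseteq> S'" "y0 \<in> U" "open V" "homeomorphism U V f1 g"
    and g: "\<And>y. y \<in> V \<Longrightarrow> (g has_derivative (g' y)) (at y)"
    and g': "\<And>y. y \<in> V \<Longrightarrow> g' y = inv (blinfun_apply (f' (g y)))"
    and bij: "\<And>y. y \<in> V \<Longrightarrow> bij (blinfun_apply (f' (g y)))"
  proof (rule inverse_function_theorem[OF oS, of f1 f' y0 "Blinfun (inv (FD f1 y0))"])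
    show "(f1 has_derivative blinfun_apply (f' x)) (at x)" if "x \<in> S'" for x
      unfolding f'[OF that] by (rule smooth_on_has_derivative[OF f1 that])
    show "continuous_on S' f'"
    proof (rule continuous_on_blinfun_componentwise)
      fix i
      have "continuous_on S' (\<lambda>x. FD f1 x i)" by (intro smooth_on_continuous smooth_on_FD f1)
      then show "continuous_on S' (\<lambda>x. blinfun_apply (f' x) i)"
        by (rule continuous_on_eq) (simp add: f')
    qed
    show "y0 \<in> S'" by fact
    show "Blinfun (inv (FD f1 y0)) o\<^sub>L f' y0 = id_blinfun"
      by (rule blinfun_eqI) (simp add: f'[OF Jy0(2)] bounded_linear_Blinfun_apply[OF bli] injy)
  qed blast
  have gV: "g y \<in> U" "f1 (g y) = y" if "y \<in> V" for y
    using UV(5) that unfolding homeomorphism_def by auto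
  have gf: "g (f1 x) = x" "f1 x \<in> V" if "x \<in> U" for x
    using UV(5) that unfolding homeomorphism_def by auto
  have fg: "blinfun_apply (f' (g y)) = FD f1 (g y)" if "y \<in> V" for y using f' gV(1)[OF that] UV(2) by blast
  have "Ck_on k V g" for k
  proof (induction k)
    case 0
    have "continuous_on V g" using UV(5) by (simp add: homeomorphism_def)
    then show ?case by simp
  next
    case (Suc k)
    have c: "Ck_on k V (\<lambda>y. FD f1 (g y) v)" for v
      by (rule Ck_on_compose[OF UV(4) oS _ Suc, of "\<lambda>y. FD f1 y v"])
        (use gV(1) UV(2) smooth_onD[OF smooth_on_FD[OF f1]] in auto)
    have l: "linear (FD f1 (g y))" "bij (FD f1 (g y))" if "y \<in> V" for y
      using that gV(1) UV(2) bij[OF that] fg[OF that] by (auto intro: smooth_on_linear[OF f1])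
    show ?case
    proof (rule Ck_on_SucI[OF UV(4), where f' = "\<lambda>y. inv (FD f1 (g y))"])
      show "(g has_derivative inv (FD f1 (g y))) (at y)" if "y \<in> V" for y
        using g[OF that] g'[OF that] fg[OF that] by simp
    qed (rule Ck_on_inv_linfam[OF UV(4) l c])
  qed
  then have sg: "smooth_on V g" by (rule smooth_onI)
  have lJ': "bounded_linear (inv J)" using lJi linear_conv_bounded_linear by blast
  show thesis
  proof (rule that[of "J ` U" V "\<lambda>y. J (g y)"])
    show "open (J ` U)" using open_surjective_linear_image[OF UV(1) J(1)] J(2) by blast
    show "smooth_on V (\<lambda>y. J (g y))" by (rule smooth_on_bounded_linear[OF lJ UV(4) sg])
    show "x0 \<in> J ` U" using UV(3) Jy0(1) by blast
    show "J ` U \<subseteq> S" using UV(2) by (auto simp: S'_def)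
    show "f ` (J ` U) = V" using gV gf(2) by (force simp: f1_def)
    show "J (g (f x)) = x" if "x \<in> J ` U" for x using that gf(1) by (auto simp: f1_def)
    show "J (g y) \<in> J ` U \<and> f (J (g y)) = y" if "y \<in> V" for y using gV[OF that] by (auto simp: f1_def)
  qed (fact UV(4))
qed

section \<open>Ordinary differential equations\<close>

text \<open>A substitute for Gronwall's inequality on short intervals. At the point m where the norm
  of r is largest, the mean value estimate gives norm (r m) \<le> \<tau> L norm (r m) + \<tau>
  \<epsilon>, and \<tau> L \<le> 1/2 absorbs the first term. With \<epsilon> = 0 this is uniqueness,
  with \<epsilon> > 0 continuous dependence.\<close>

lemma short_time_bound:
  fixes r :: "real \<Rightarrow> 'a::real_normed_vector"
  assumes "L \<ge> 0" "\<tau> * L \<le> 1/2" "r 0 = 0"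
    and der: "\<And>s. \<bar>s\<bar> < \<tau> \<Longrightarrow> (r has_vector_derivative r' s) (at s)"
    and le: "\<And>s. \<bar>s\<bar> < \<tau> \<Longrightarrow> norm (r' s) \<le> L * norm (r s) + \<epsilon>" and s: "\<bar>s\<bar> < \<tau>"
  shows "norm (r s) \<le> 2 * \<tau> * \<epsilon>"
proof -
  define I where "I = {-\<bar>s\<bar>..\<bar>s\<bar>}"
  have I: "\<bar>t\<bar> < \<tau>" if "t \<in> I" for t using that s unfolding I_def by auto
  have dI: "(r has_derivative (\<lambda>h. h *\<^sub>R r' t)) (at t within I)" if "t \<in> I" for t
    using der[OF I[OF that]] unfolding has_vector_derivative_def by (rule has_derivative_at_withinI)
  have "continuous_on I (\<lambda>t. norm (r t))"
    by (intro continuous_on_norm has_derivative_continuous_on[OF dI])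
  moreover have "compact I" "I \<noteq> {}" by (auto simp: I_def)
  ultimately obtain m where m: "m \<in> I" "\<And>t. t \<in> I \<Longrightarrow> norm (r t) \<le> norm (r m)"
    using continuous_attains_sup[of I "\<lambda>t. norm (r t)"] by blast
  define B where "B = L * norm (r m) + \<epsilon>"
  have B: "norm (r' t) \<le> B" if "t \<in> I" for t
    using le[OF I[OF that]] m(2)[OF that] mult_left_mono[OF m(2)[OF that] assms(1)] unfolding B_def by linarith
  have 0: "0 \<in> I" by (auto simp: I_def)
  have B0: "B \<ge> 0" using B[OF 0] norm_ge_zero order_trans by blast
  have "norm (r m - r 0) \<le> B * norm (m - 0)"
  proof (rule differentiable_bound[OF _ dI _ m(1) 0])
    show "onorm (\<lambda>h. h *\<^sub>R r' t) \<le> B" if "t \<in> I" for t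
    proof (rule onorm_le)
      show "norm (x *\<^sub>R r' t) \<le> B * norm x" for x
        using mult_left_mono[OF B[OF that] abs_ge_zero[of x]] by (simp add: mult.commute[of B])
    qed
  qed (auto simp: I_def)
  also have "\<dots> \<le> B * \<tau>" using I[OF m(1)] B0 by (intro mult_left_mono) auto
  also have "\<dots> = (\<tau> * L) * norm (r m) + \<tau> * \<epsilon>" unfolding B_def by (simp add: algebra_simps)
  also have "\<dots> \<le> 1/2 * norm (r m) + \<tau> * \<epsilon>"
    by (rule add_right_mono[OF mult_right_mono[OF assms(2) norm_ge_zero]])
  finally have "norm (r m) \<le> 2 * \<tau> * \<epsilon>" using assms(3) by simp
  moreover have "norm (r s) \<le> norm (r m)" by (rule m(2)) (auto simp: I_def)
  ultimately show ?thesis by simp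
qed

text \<open>The integral of h from 0 to s is rescaled to the fixed interval from 0 to 1. This form
  treats both signs of s alike and is the one to which the results on parameter integrals
  apply.\<close>

lemma scaled_integral_antiderivative:
  fixes h :: "real \<Rightarrow> 'a::euclidean_space"
  assumes "continuous_on {-\<tau>..\<tau>} h"
  obtains H where "\<And>s. s \<in> {-\<tau>..\<tau>} \<Longrightarrow> (H has_vector_derivative h s) (at s within {-\<tau>..\<tau>})"
    "\<And>s. s \<in> {-\<tau>..\<tau>} \<Longrightarrow> s *\<^sub>R integral {0..1} (\<lambda>r. h (r * s)) = H s - H 0"
proof -
  obtain H where H: "\<And>s. s \<in> {-\<tau>..\<tau>} \<Longrightarrow> (H has_vector_derivative h s) (at s within {-\<tau>..\<tau>})"
    using antiderivative_continuous[OF assms] by blast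
  have mem: "r * s \<in> {-\<tau>..\<tau>}" if "r \<in> {0..1}" "s \<in> {-\<tau>..\<tau>}" for r s
  proof -
    have "\<bar>r * s\<bar> \<le> 1 * \<tau>" using that unfolding abs_mult by (intro mult_mono) auto
    then show ?thesis by auto
  qed
  have "s *\<^sub>R integral {0..1} (\<lambda>r. h (r * s)) = H s - H 0" if s: "s \<in> {-\<tau>..\<tau>}" for s
  proof -
    have "((\<lambda>r. s *\<^sub>R h (r * s)) has_integral (H (1 * s) - H (0 * s))) {0..1}"
    proof (rule fundamental_theorem_of_calculus)
      fix r :: real assume r: "r \<in> {0..1}"
      have 1: "((\<lambda>r. r * s) has_vector_derivative s) (at r within {0..1})"
        by (auto intro!: derivative_eq_intros)
      have 2: "(H has_vector_derivative h (r * s)) (at (r * s) within (\<lambda>r. r * s) ` {0..1})"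
        by (rule has_vector_derivative_within_subset[OF H[OF mem[OF r s]]]) (use mem s in auto)
      show "((\<lambda>r. H (r * s)) has_vector_derivative s *\<^sub>R h (r * s)) (at r within {0..1})"
        using vector_diff_chain_within[OF 1 2] by (simp add: o_def)
    qed simp
    from integral_unique[OF this] show ?thesis by simp
  qed
  with H that show thesis by blast
qed

lemma scaled_integral_has_vector_derivative:
  fixes h :: "real \<Rightarrow> 'a::euclidean_space"
  assumes "continuous_on {-\<tau><..<\<tau>} h" "\<bar>s\<bar> < \<tau>"
  shows "((\<lambda>s. s *\<^sub>R integral {0..1} (\<lambda>r. h (r * s))) has_vector_derivative h s) (at s)"
proof -
  obtain \<sigma> where \<sigma>: "\<bar>s\<bar> < \<sigma>" "\<sigma> < \<tau>" using assms(2) dense by blast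
  have "continuous_on {-\<sigma>..\<sigma>} h" by (rule continuous_on_subset[OF assms(1)]) (use \<sigma> in auto)
  then obtain H where H: "\<And>s. s \<in> {-\<sigma>..\<sigma>} \<Longrightarrow> (H has_vector_derivative h s) (at s within {-\<sigma>..\<sigma>})"
    "\<And>s. s \<in> {-\<sigma>..\<sigma>} \<Longrightarrow> s *\<^sub>R integral {0..1} (\<lambda>r. h (r * s)) = H s - H 0"
    using scaled_integral_antiderivative by blast
  have s: "s \<in> {-\<sigma><..<\<sigma>}" "s \<in> {-\<sigma>..\<sigma>}" using \<sigma> by auto
  have "(H has_vector_derivative h s) (at s within {-\<sigma><..<\<sigma>})"
    by (rule has_vector_derivative_within_subset[OF H(1)[OF s(2)]]) auto
  then have "(H has_vector_derivative h s) (at s)" using s by (simp add: at_within_open[of s "{-\<sigma><..<\<sigma>}"])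
  from has_vector_derivative_diff[OF this has_vector_derivative_const[of "H 0"]]
  have "((\<lambda>s. H s - H 0) has_vector_derivative h s) (at s)" by simp
  then show ?thesis
    by (rule has_vector_derivative_transform_within_open[where S = "{-\<sigma><..<\<sigma>}"]) (use H(2) s in auto)
qed

text \<open>Picard's fixed point in the complete space of bounded continuous functions. The global
  Lipschitz bound and \<tau> L \<le> 1/2 make the integral operator a contraction with constant
  1/2.\<close>

lemma ode_exists:
  fixes F :: "real \<Rightarrow> 'a::euclidean_space \<Rightarrow> 'a"
  assumes "\<tau> > 0" "L \<ge> 0" "\<tau> * L \<le> 1/2"
    and cont: "continuous_on ({-\<tau>..\<tau>} \<times> UNIV) (\<lambda>p. F (fst p) (snd p))"
    and lip: "\<And>s y z. s \<in> {-\<tau>..\<tau>} \<Longrightarrow> norm (F s y - F s z) \<le> L * norm (y - z)"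
  obtains y where "y 0 = x" "\<And>s. \<bar>s\<bar> < \<tau> \<Longrightarrow> (y has_vector_derivative F s (y s)) (at s)"
proof -
  \<comment> \<open>Elements of \<open>bcontfun\<close> live on the whole line, so time is clamped
    to the interval. Beyond it the iterates are constant, which makes them bounded.\<close>
  define cl where "cl s = max (-\<tau>) (min \<tau> s)" for s
  have cl: "cl s \<in> {-\<tau>..\<tau>}" for s unfolding cl_def using assms(1) by auto
  have cl2: "\<bar>cl s\<bar> \<le> \<tau>" for s using cl[of s] by auto
  have clid: "cl s = s" if "s \<in> {-\<tau>..\<tau>}" for s using that unfolding cl_def by auto
  have clc: "continuous_on UNIV cl" unfolding cl_def by (intro continuous_intros)
  have mem: "r * cl s \<in> {-\<tau>..\<tau>}" if "r \<in> {0..1}" for r s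
  proof -
    have "\<bar>r * cl s\<bar> \<le> 1 * \<tau>" using that cl2[of s] unfolding abs_mult by (intro mult_mono) auto
    then show ?thesis by auto
  qed
  have cF: "continuous_on {-\<tau>..\<tau>} (\<lambda>s. F s (y s))" if "continuous_on UNIV y" for y
  proof -
    have "continuous_on {-\<tau>..\<tau>} (\<lambda>s. (s, y s))"
      by (intro continuous_on_Pair continuous_on_id continuous_on_subset[OF that]) auto
    from continuous_on_compose2[OF cont this] show ?thesis by auto
  qed
  define T where "T y s = x + cl s *\<^sub>R integral {0..1} (\<lambda>r. F (r * cl s) (y (r * cl s)))" for y s
  have cont_int: "continuous_on {0..1} (\<lambda>r. F (r * cl s) (y (r * cl s)))" if "continuous_on UNIV y" for y s
    by (rule continuous_on_compose2[OF cF[OF that], of "{0..1}" "\<lambda>r. r * cl s"])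
      (use mem in \<open>auto intro!: continuous_intros\<close>)
  have Tb: "T y \<in> bcontfun" if yc: "continuous_on UNIV y" for y
  proof -
    obtain H where H: "\<And>s. s \<in> {-\<tau>..\<tau>} \<Longrightarrow> (H has_vector_derivative F s (y s)) (at s within {-\<tau>..\<tau>})"
      "\<And>s. s \<in> {-\<tau>..\<tau>} \<Longrightarrow> s *\<^sub>R integral {0..1} (\<lambda>r. F (r * s) (y (r * s))) = H s - H 0"
      using scaled_integral_antiderivative[OF cF[OF yc]] by blast
    have Hc: "continuous_on {-\<tau>..\<tau>} H"
      using H(1) has_vector_derivative_continuous continuous_on_eq_continuous_within by blast
    have T: "T y s = x + (H (cl s) - H 0)" for s unfolding T_def using H(2)[OF cl] by simp
    have "continuous_on UNIV (\<lambda>s. H (cl s))"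
      by (rule continuous_on_compose2[OF Hc clc]) (use cl in blast)
    then have c: "continuous_on UNIV (T y)" unfolding T by (intro continuous_intros)
    have "bounded (H ` {-\<tau>..\<tau>})" using compact_continuous_image[OF Hc] compact_imp_bounded by blast
    then obtain B where B: "\<And>s. s \<in> {-\<tau>..\<tau>} \<Longrightarrow> norm (H s) \<le> B" unfolding bounded_iff by blast
    have "norm (T y s) \<le> norm x + (B + norm (H 0))" for s
      unfolding T using B[OF cl[of s]]
      by (smt (verit) norm_triangle_ineq norm_triangle_ineq4)
    then show ?thesis using c bcontfun_normI by blast
  qed
  define TT where "TT y = Bcontfun (T (apply_bcontfun y))" for y
  have TT: "apply_bcontfun (TT y) = T (apply_bcontfun y)" for y
    unfolding TT_def by (rule Bcontfun_inverse[OF Tb]) auto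
  have "\<exists>!y. TT y = y"
  proof (rule banach_fix_type[of "1/2"])
    show "\<forall>y z. dist (TT y) (TT z) \<le> 1/2 * dist y z"
    proof (intro allI dist_bound)
      fix y z :: "real \<Rightarrow>\<^sub>C 'a" and s
      define g where "g r = F (r * cl s) (y (r * cl s)) - F (r * cl s) (z (r * cl s))" for r
      have cy: "continuous_on {0..1} (\<lambda>r. F (r * cl s) (y (r * cl s)))" for y :: "real \<Rightarrow>\<^sub>C 'a"
        by (rule cont_int) auto
      have gb: "norm (g r) \<le> L * dist y z" if "r \<in> {0..1}" for r
      proof -
        have "norm (g r) \<le> L * norm (y (r * cl s) - z (r * cl s))"
          unfolding g_def by (rule lip[OF mem[OF that]])
        also have "\<dots> \<le> L * dist y z"
          using dist_bounded[of y "r * cl s" z] assms(2) by (intro mult_left_mono) (auto simp: dist_norm)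
        finally show ?thesis .
      qed
      have "norm (integral {0..1} g) \<le> L * dist y z * (1 - 0)"
        by (rule integral_bound) (use gb in \<open>auto simp: g_def intro!: continuous_intros cy\<close>)
      then have ib: "norm (integral {0..1} g) \<le> L * dist y z" by simp
      have "TT y s - TT z s = cl s *\<^sub>R integral {0..1} g"
        unfolding TT T_def g_def
        by (subst integral_diff) (auto intro!: integrable_continuous_real cy simp: scaleR_diff_right)
      then have "dist (TT y s) (TT z s) = \<bar>cl s\<bar> * norm (integral {0..1} g)" by (simp add: dist_norm)
      also have "\<dots> \<le> \<tau> * (L * dist y z)" using ib cl2 assms(1) by (intro mult_mono) auto
      also have "\<dots> = (\<tau> * L) * dist y z" by simp
      also have "\<dots> \<le> 1/2 * dist y z" by (rule mult_right_mono[OF assms(3) zero_le_dist])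
      finally show "dist (TT y s) (TT z s) \<le> 1/2 * dist y z" .
    qed
  qed auto
  then obtain y where y: "TT y = y" by blast
  have ys: "y s = x + s *\<^sub>R integral {0..1} (\<lambda>r. F (r * s) (y (r * s)))" if "\<bar>s\<bar> < \<tau>" for s
  proof -
    have "cl s = s" by (rule clid) (use that in auto)
    moreover have "y s = T (apply_bcontfun y) s" using TT[of y] unfolding y by (rule fun_cong)
    ultimately show ?thesis unfolding T_def by (simp only:)
  qed
  show thesis
  proof (rule that[of "apply_bcontfun y"])
    show "y 0 = x" using ys[of 0] assms(1) by simp
    fix s :: real assume s: "\<bar>s\<bar> < \<tau>"
    have "continuous_on {-\<tau><..<\<tau>} (\<lambda>s. F s (y s))"
      by (rule continuous_on_subset[OF cF]) auto
    from scaled_integral_has_vector_derivative[OF this s]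
    have "((\<lambda>s. x + s *\<^sub>R integral {0..1} (\<lambda>r. F (r * s) (y (r * s)))) has_vector_derivative 0 + F s (y s)) (at s)"
      by (intro has_vector_derivative_add has_vector_derivative_const)
    then have "((\<lambda>s. x + s *\<^sub>R integral {0..1} (\<lambda>r. F (r * s) (y (r * s)))) has_vector_derivative F s (y s)) (at s)"
      by simp
    then show "(y has_vector_derivative F s (y s)) (at s)"
      by (rule has_vector_derivative_transform_within_open[where S = "{-\<tau><..<\<tau>}"])
        (use s ys in auto)
  qed
qed

section \<open>Linear equations depending on a parameter\<close>

lemma linear_bound_Basis:
  fixes B :: "'a::euclidean_space \<Rightarrow> 'b::real_normed_vector"
  assumes "linear B" shows "norm (B v) \<le> norm v * (\<Sum>b\<in>Basis. norm (B b))"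
proof -
  have "norm (B v) \<le> (\<Sum>b\<in>Basis. norm ((v \<bullet> b) *\<^sub>R B b))"
    unfolding linear_expand[OF assms, of v] by (rule norm_sum)
  also have "\<dots> \<le> (\<Sum>b\<in>Basis. norm v * norm (B b))"
    by (intro sum_mono) (simp add: Basis_le_norm mult_right_mono)
  finally show ?thesis by (simp add: sum_distrib_left)
qed

lemma linear_FD_parameter:
  fixes A :: "'a::real_normed_vector \<Rightarrow> 'b::real_vector \<Rightarrow> 'c::real_normed_vector"
  assumes "open S" "x \<in> S" and lin: "\<And>y. y \<in> S \<Longrightarrow> linear (A y)"
    and d: "\<And>v. (\<lambda>y. A y v) differentiable (at x)"
  shows "linear (\<lambda>v. FD (\<lambda>y. A y v) x h)"
proof (rule linearI)
  fix u v and r :: real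
  have "FD (\<lambda>y. A y (u + v)) x = FD (\<lambda>y. A y u + A y v) x"
    by (rule FD_cong[OF assms(1,2)]) (simp add: lin linear_add)
  also have "\<dots> = (\<lambda>h. FD (\<lambda>y. A y u) x h + FD (\<lambda>y. A y v) x h)"
    by (intro FD_eq has_derivative_add FD_works d)
  finally show "FD (\<lambda>y. A y (u + v)) x h = FD (\<lambda>y. A y u) x h + FD (\<lambda>y. A y v) x h" by simp
  have "FD (\<lambda>y. A y (r *\<^sub>R v)) x = FD (\<lambda>y. r *\<^sub>R A y v) x"
    by (rule FD_cong[OF assms(1,2)]) (simp add: lin linear_cmul)
  also have "\<dots> = (\<lambda>h. r *\<^sub>R FD (\<lambda>y. A y v) x h)"
    by (intro FD_eq has_derivative_scaleR_right FD_works d)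
  finally show "FD (\<lambda>y. A y (r *\<^sub>R v)) x h = r *\<^sub>R FD (\<lambda>y. A y v) x h" by simp
qed

lemma Ck_on_Suc_differentiable: "Ck_on (Suc k) S f \<Longrightarrow> x \<in> S \<Longrightarrow> f differentiable (at x)"
  by simp

text \<open>Z is the fundamental solution: \<open>Z (x, s) v\<close> is the value at time s of the
  solution that starts at v. The constant 1/4 instead of 1/2 keeps \<open>Z (x, s)\<close> within
  distance 1/2 of the identity (\<open>Z_near\<close>), hence bijective; variation of constants
  needs its inverse.\<close>

locale linear_flow =
  fixes X :: "'b::euclidean_space set" and \<tau> L :: real
    and A Z :: "'b \<times> real \<Rightarrow> 'a::euclidean_space \<Rightarrow> 'a"
  assumes oX: "open X" and L0: "L \<ge> 0" and tL: "\<tau> * L \<le> 1/4"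
    and linA: "\<And>x s. x \<in> X \<Longrightarrow> \<bar>s\<bar> < \<tau> \<Longrightarrow> linear (A (x, s))"
    and bndA: "\<And>x s v. x \<in> X \<Longrightarrow> \<bar>s\<bar> < \<tau> \<Longrightarrow> norm (A (x, s) v) \<le> L * norm v"
    and Z0: "\<And>x v. x \<in> X \<Longrightarrow> Z (x, 0) v = v"
    and derZ: "\<And>x s v. x \<in> X \<Longrightarrow> \<bar>s\<bar> < \<tau> \<Longrightarrow>
      ((\<lambda>s. Z (x, s) v) has_vector_derivative A (x, s) (Z (x, s) v)) (at s)"
begin

abbreviation "I \<equiv> {-\<tau><..<\<tau>}"
abbreviation "D \<equiv> X \<times> I"

lemma oD: "open D" by (intro open_Times oX) auto
lemma tL2: "\<tau> * L \<le> 1/2" using tL by simp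

lemma unique:
  assumes "x \<in> X" "r 0 = 0" "\<And>s. \<bar>s\<bar> < \<tau> \<Longrightarrow> (r has_vector_derivative A (x, s) (r s)) (at s)" "\<bar>s\<bar> < \<tau>"
  shows "r s = 0"
proof -
  have "norm (r s) \<le> 2 * \<tau> * 0"
    by (rule short_time_bound[OF L0 tL2 assms(2,3) _ assms(4)]) (use bndA[OF assms(1)] in auto)
  then show ?thesis by simp
qed

lemma linZ: assumes x: "x \<in> X" "\<bar>s\<bar> < \<tau>" shows "linear (Z (x, s))"
proof (rule linearI)
  fix u v and c :: real
  have "Z (x, s) (u + v) - (Z (x, s) u + Z (x, s) v) = 0"
  proof (rule unique[OF x(1) _ _ x(2), where r = "\<lambda>s. Z (x, s) (u + v) - (Z (x, s) u + Z (x, s) v)"])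
    fix s assume s: "\<bar>s\<bar> < \<tau>"
    show "((\<lambda>s. Z (x, s) (u + v) - (Z (x, s) u + Z (x, s) v)) has_vector_derivative
      A (x, s) (Z (x, s) (u + v) - (Z (x, s) u + Z (x, s) v))) (at s)"
      unfolding linear_diff[OF linA[OF x(1) s]] linear_add[OF linA[OF x(1) s]]
      by (intro has_vector_derivative_diff has_vector_derivative_add derZ x s)
  qed (simp add: Z0[OF x(1)])
  then show "Z (x, s) (u + v) = Z (x, s) u + Z (x, s) v" by simp
  have "Z (x, s) (c *\<^sub>R v) - c *\<^sub>R Z (x, s) v = 0"
  proof (rule unique[OF x(1) _ _ x(2), where r = "\<lambda>s. Z (x, s) (c *\<^sub>R v) - c *\<^sub>R Z (x, s) v"])
    fix s assume s: "\<bar>s\<bar> < \<tau>"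
    show "((\<lambda>s. Z (x, s) (c *\<^sub>R v) - c *\<^sub>R Z (x, s) v) has_vector_derivative
      A (x, s) (Z (x, s) (c *\<^sub>R v) - c *\<^sub>R Z (x, s) v)) (at s)"
      unfolding linear_diff[OF linA[OF x(1) s]] linear_cmul[OF linA[OF x(1) s]]
      by (intro has_vector_derivative_diff derZ x s bounded_linear.has_vector_derivative[OF bounded_linear_scaleR_right])
  qed (simp add: Z0[OF x(1)])
  then show "Z (x, s) (c *\<^sub>R v) = c *\<^sub>R Z (x, s) v" by simp
qed

lemma Z_near: assumes x: "x \<in> X" "\<bar>s\<bar> < \<tau>" shows "norm (Z (x, s) v - v) \<le> 1/2 * norm v"
proof -
  have "norm (Z (x, s) v - v) \<le> 2 * \<tau> * (L * norm v)"
  proof (rule short_time_bound[OF L0 tL2 _ _ _ x(2), where r = "\<lambda>s. Z (x, s) v - v" and r' = "\<lambda>s. A (x, s) (Z (x, s) v)"])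
    fix s assume s: "\<bar>s\<bar> < \<tau>"
    show "((\<lambda>s. Z (x, s) v - v) has_vector_derivative A (x, s) (Z (x, s) v)) (at s)"
      using has_vector_derivative_diff[OF derZ[OF x(1) s] has_vector_derivative_const[of v]] by simp
    have "norm (A (x, s) (Z (x, s) v)) \<le> L * norm (Z (x, s) v)" by (rule bndA[OF x(1) s])
    also have "\<dots> \<le> L * (norm (Z (x, s) v - v) + norm v)"
      by (intro mult_left_mono L0) (metis diff_add_cancel norm_triangle_ineq)
    finally show "norm (A (x, s) (Z (x, s) v)) \<le> L * norm (Z (x, s) v - v) + L * norm v"
      by (simp add: distrib_left)
  qed (simp add: Z0[OF x(1)])
  also have "\<dots> = 2 * (\<tau> * L) * norm v" by simp
  also have "\<dots> \<le> 1/2 * norm v" using tL by (intro mult_right_mono) auto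
  finally show ?thesis .
qed

lemma bndZ: assumes "x \<in> X" "\<bar>s\<bar> < \<tau>" shows "norm (Z (x, s) v) \<le> 2 * norm v"
  using Z_near[OF assms, of v] norm_triangle_sub[of "Z (x, s) v" v] norm_ge_zero[of v] by linarith

lemma bijZ: assumes "x \<in> X" "\<bar>s\<bar> < \<tau>" shows "bij (Z (x, s))"
proof -
  have "v = 0" if "Z (x, s) v = 0" for v using Z_near[OF assms, of v] that by simp
  then have "inj (Z (x, s))" using linear_injective_0[OF linZ[OF assms]] by blast
  then show ?thesis using linear_inj_imp_surj[OF linZ[OF assms]] by (simp add: bij_def)
qed

lemma linZi: assumes "x \<in> X" "\<bar>s\<bar> < \<tau>" shows "linear (inv (Z (x, s)))"
  by (rule linear_inv_bij[OF linZ[OF assms] bijZ[OF assms]])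

text \<open>The difference of the solutions for x and x0 solves the equation for x with the error
  term \<open>(A (x, t) - A (x0, t)) (Z (x0, t) v)\<close>. On a compact time interval this is
  uniformly small for x near x0, so \<open>short_time_bound\<close> gives closeness uniformly in
  time; continuity in s alone is clear from the equation.\<close>

lemma contZ:
  assumes cA: "\<And>v. continuous_on D (\<lambda>z. A z v)"
  shows "continuous_on D (\<lambda>z. Z z v)"
proof -
  have "isCont (\<lambda>z. Z z v) (x0, s0)" if x0: "x0 \<in> X" and s0: "\<bar>s0\<bar> < \<tau>" for x0 s0
  proof -
    obtain \<sigma> where \<sigma>: "\<bar>s0\<bar> < \<sigma>" "\<sigma> < \<tau>" using s0 dense by blast
    have \<sigma>0: "\<sigma> > 0" using \<sigma>(1) by linarith
    have sL: "\<sigma> * L \<le> 1/2" using tL2 mult_right_mono[OF less_imp_le[OF \<sigma>(2)] L0] by linarith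
    define C where "C = {-\<sigma>..\<sigma>}"
    have Ct: "\<bar>t\<bar> < \<tau>" if "t \<in> C" for t using that \<sigma> by (auto simp: C_def)
    \<comment> \<open>Up to the factor norm v this bounds the difference of the coefficients at v;
      it vanishes for x = x0. Compactness of C makes the smallness uniform in time.\<close>
    define f where "f p = (\<Sum>b\<in>Basis. norm (A p b - A (x0, snd p) b))" for p
    have cf: "continuous_on (X \<times> C) f"
      unfolding f_def
    proof (intro continuous_on_sum continuous_on_norm continuous_on_diff)
      fix b
      show "continuous_on (X \<times> C) (\<lambda>p. A p b)" by (rule continuous_on_subset[OF cA]) (use Ct in force)
      show "continuous_on (X \<times> C) (\<lambda>p. A (x0, snd p) b)"
        by (rule continuous_on_compose2[OF cA]) (use Ct x0 in \<open>force intro!: continuous_intros\<close>)+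
    qed
    have cC: "compact C" by (simp add: C_def)
    have unif: "\<exists>N. open N \<and> x0 \<in> N \<and> (\<forall>x\<in>N. \<forall>s. \<bar>s\<bar> < \<sigma> \<longrightarrow> norm (Z (x, s) v - Z (x0, s) v) < e)"
      if "e > 0" for e
    proof -
      \<comment> \<open>Chosen so that the bound 2 \<sigma> (2 norm v e1) coming from
        \<open>short_time_bound\<close> is less than e.\<close>
      define e1 where "e1 = e / (4 * \<sigma> * (norm v + 1))"
      have nv: "norm v + 1 > 0" by (smt (verit) norm_ge_zero)
      have e1: "e1 > 0" unfolding e1_def using that \<sigma>0 nv by simp
      obtain N where N: "x0 \<in> N" "open N" "\<forall>x\<in>N \<inter> X. \<forall>t\<in>C. dist (f (x, t)) (f (x0, t)) \<le> e1"
        using continuous_on_prod_compactE[OF cf cC x0 e1] by metis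
      have f0: "f (x0, t) = 0" for t by (simp add: f_def)
      have fN: "f (x, t) \<le> e1" if "x \<in> N" "x \<in> X" "t \<in> C" for x t
      proof -
        have "dist (f (x, t)) (f (x0, t)) \<le> e1" using N(3) that by blast
        then show ?thesis by (simp add: f0 dist_real_def)
      qed
      have "norm (Z (x, s) v - Z (x0, s) v) < e" if x: "x \<in> N" "x \<in> X" and s: "\<bar>s\<bar> < \<sigma>" for x s
      proof -
        have "norm (Z (x, s) v - Z (x0, s) v) \<le> 2 * \<sigma> * (2 * norm v * e1)"
        proof (rule short_time_bound[OF L0 sL _ _ _ s, where r = "\<lambda>s. Z (x, s) v - Z (x0, s) v"
              and r' = "\<lambda>s. A (x, s) (Z (x, s) v) - A (x0, s) (Z (x0, s) v)"])
          fix t assume "\<bar>t\<bar> < \<sigma>"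
          then have t: "\<bar>t\<bar> < \<tau>" and tC: "t \<in> C" using \<sigma> by (auto simp: C_def)
          show "((\<lambda>s. Z (x, s) v - Z (x0, s) v) has_vector_derivative A (x, t) (Z (x, t) v) - A (x0, t) (Z (x0, t) v)) (at t)"
            by (intro has_vector_derivative_diff derZ x x0 t)
          have lin: "linear (\<lambda>w. A (x, t) w - A (x0, t) w)"
            by (intro linear_compose_sub linA x x0 t)
          have "norm (A (x, t) (Z (x0, t) v) - A (x0, t) (Z (x0, t) v)) \<le> norm (Z (x0, t) v) * f (x, t)"
            using linear_bound_Basis[OF lin, of "Z (x0, t) v"] by (simp add: f_def)
          also have "\<dots> \<le> 2 * norm v * e1"
            using bndZ[OF x0 t, of v] fN[OF x tC] by (intro mult_mono) (auto simp: f_def sum_nonneg)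
          finally have 1: "norm (A (x, t) (Z (x0, t) v) - A (x0, t) (Z (x0, t) v)) \<le> 2 * norm v * e1" .
          have "A (x, t) (Z (x, t) v) - A (x0, t) (Z (x0, t) v) =
            A (x, t) (Z (x, t) v - Z (x0, t) v) + (A (x, t) (Z (x0, t) v) - A (x0, t) (Z (x0, t) v))"
            using linear_diff[OF linA[OF x(2) t]] by simp
          then have "norm (A (x, t) (Z (x, t) v) - A (x0, t) (Z (x0, t) v)) \<le>
            norm (A (x, t) (Z (x, t) v - Z (x0, t) v)) + norm (A (x, t) (Z (x0, t) v) - A (x0, t) (Z (x0, t) v))"
            by (metis norm_triangle_ineq)
          then show "norm (A (x, t) (Z (x, t) v) - A (x0, t) (Z (x0, t) v)) \<le>
            L * norm (Z (x, t) v - Z (x0, t) v) + 2 * norm v * e1"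
            using 1 bndA[OF x(2) t, of "Z (x, t) v - Z (x0, t) v"] by linarith
        qed (simp add: Z0 x x0)
        also have "\<dots> = (4 * \<sigma> * e1) * norm v" by simp
        also have "\<dots> < (4 * \<sigma> * e1) * (norm v + 1)" using \<sigma>0 e1 by (intro mult_strict_left_mono) auto
        also have "\<dots> = e1 * (4 * \<sigma> * (norm v + 1))" by simp
        also have "\<dots> = e" unfolding e1_def using \<sigma>0 nv by (intro nonzero_eq_divide_eq[THEN iffD1]) auto
        finally show ?thesis .
      qed
      then show ?thesis using N oX x0 by (intro exI[of _ "N \<inter> X"]) auto
    qed
    have t1: "((\<lambda>z. Z z v - Z (x0, snd z) v) \<longlongrightarrow> 0) (at (x0, s0))"
    proof (rule tendstoI)
      fix e :: real assume "e > 0"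
      from unif[OF this] obtain N where N: "open N" "x0 \<in> N"
        "\<forall>x\<in>N. \<forall>s. \<bar>s\<bar> < \<sigma> \<longrightarrow> norm (Z (x, s) v - Z (x0, s) v) < e" by blast
      have "\<forall>\<^sub>F z in at (x0, s0). z \<in> N \<times> {-\<sigma><..<\<sigma>}"
        by (rule eventually_at_in_open') (use N \<sigma> in \<open>auto intro!: open_Times\<close>)
      then show "\<forall>\<^sub>F z in at (x0, s0). dist (Z z v - Z (x0, snd z) v) 0 < e"
        by eventually_elim (use N(3) in auto)
    qed
    have c0: "isCont (\<lambda>s. Z (x0, s) v) s0"
      using derZ[OF x0 s0, of v] has_vector_derivative_continuous by blast
    have "isCont (\<lambda>z. Z (x0, snd z) v) (x0, s0)"
      by (rule isCont_o2[where f = snd and g = "\<lambda>s. Z (x0, s) v"])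
        (simp_all add: c0 isCont_snd)
    then have t2: "((\<lambda>z. Z (x0, snd z) v) \<longlongrightarrow> Z (x0, s0) v) (at (x0, s0))" by (simp add: isCont_def)
    show ?thesis unfolding isCont_def using tendsto_add[OF t1 t2] by simp
  qed
  then show ?thesis by (auto simp: continuous_on_eq_continuous_at[OF oD])
qed

text \<open>Variation of constants for the derivative of Z in the parameter direction b: Z(s)
  applied to the integral from 0 to s of the inverse of Z, times the b-derivative of A, times Z v,
  with the integral rescaled to the unit interval.\<close>

definition dZ where
  "dZ b v z = Z z (snd z *\<^sub>R integral {0..1} (\<lambda>r. inv (Z (fst z, r * snd z))
     (FD (\<lambda>q. A q (Z (fst z, r * snd z) v)) (fst z, r * snd z) (b, 0))))"

text \<open>Duhamel's formula applied to the difference of two solutions, with Hadamard's factorization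
  of the difference of the coefficients, exhibits \<open>Z (x', s) v - Z (x, s) v\<close> as a linear
  combination of the coordinates of \<open>x' - x\<close> with continuous coefficients.\<close>

lemma Z_has_derivative:
  assumes C1: "\<And>v. Ck_on (Suc 0) D (\<lambda>z. A z v)" and z: "z \<in> D"
  shows "((\<lambda>z. Z z v) has_derivative
    (\<lambda>h. (\<Sum>b\<in>Basis. (fst h \<bullet> b) *\<^sub>R dZ b v z) + snd h *\<^sub>R A z (Z z v))) (at z)"
proof -
  obtain x s0 where xz: "z = (x, s0)" by (cases z)
  have x: "x \<in> X" and s0: "\<bar>s0\<bar> < \<tau>" using z xz by auto
  obtain e where e: "e > 0" "ball x e \<subseteq> X" using oX x openE by blast
  define B where "B = ball x e"
  have BX: "y \<in> X" if "y \<in> B" for y using that e(2) by (auto simp: B_def)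
  have xB: "x \<in> B" using e(1) by (simp add: B_def)
  define W where "W = B \<times> I"
  have oW: "open W" unfolding W_def B_def by (intro open_Times) auto
  have WD: "W \<subseteq> D" using BX by (auto simp: W_def)
  have cA: "continuous_on D (\<lambda>z. A z v)" for v by (rule Ck_on_continuous[OF C1])
  have cZ: "continuous_on D (\<lambda>z. Z z v)" for v by (rule contZ[OF cA])
  have dA: "(\<lambda>z. A z w) differentiable at q" if "q \<in> D" for w q
    by (rule Ck_on_Suc_differentiable[OF C1 that])
  have cFA: "continuous_on D (\<lambda>q. FD (\<lambda>z. A z w) q h)" for w h using C1[of w] by (cases h) simp
  have linFA: "linear (\<lambda>w. FD (\<lambda>z. A z w) q h)" if "q \<in> D" for q h
    by (rule linear_FD_parameter[OF oD that _ dA[OF that]]) (use linA in auto)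
  have seg: "x + \<theta> *\<^sub>R (y - x) \<in> B" if "y \<in> B" "\<theta> \<in> {0..1}" for y \<theta>
  proof -
    have "x + \<theta> *\<^sub>R (y - x) = (1 - \<theta>) *\<^sub>R x + \<theta> *\<^sub>R y" by (simp add: algebra_simps)
    also have "\<dots> \<in> B" using that xB convex_ball[of x e] unfolding B_def convex_alt by auto
    finally show ?thesis .
  qed
  \<comment> \<open>Hadamard's factors, averages of the b-derivative of A over the segment from x to
    the current parameter. They are continuous because A is C^1.\<close>
  define G where "G b q w = integral {0..1} (\<lambda>\<theta>. FD (\<lambda>z. A z w) (x + \<theta> *\<^sub>R (fst q - x), snd q) (b, 0))" for b q w
  have Gint: "(\<lambda>\<theta>. FD (\<lambda>z. A z w) (x + \<theta> *\<^sub>R (y - x), s) h) integrable_on {0..1}"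
    if "y \<in> B" "\<bar>s\<bar> < \<tau>" for y s w h
    by (intro integrable_continuous_real continuous_on_compose2[OF cFA, of "{0..1}" "\<lambda>\<theta>. (x + \<theta> *\<^sub>R (y - x), s)"])
      (use seg that BX in \<open>auto intro!: continuous_intros\<close>)
  have had: "A (y, s) w - A (x, s) w = (\<Sum>b\<in>Basis. ((y - x) \<bullet> b) *\<^sub>R G b (y, s) w)"
    if y: "y \<in> B" and s: "\<bar>s\<bar> < \<tau>" for y s w
  proof -
    have "A ((x, s) + (y - x, 0)) w - A (x, s) w =
        integral {0..1} (\<lambda>\<theta>. FD (\<lambda>z. A z w) ((x, s) + \<theta> *\<^sub>R (y - x, 0)) (y - x, 0))"
      by (rule segment_integral[OF oD C1]) (use seg y s BX in auto)
    also have "\<dots> = integral {0..1} (\<lambda>\<theta>. \<Sum>b\<in>Basis. ((y - x) \<bullet> b) *\<^sub>R FD (\<lambda>z. A z w) (x + \<theta> *\<^sub>R (y - x), s) (b, 0))"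
    proof (rule integral_cong)
      fix \<theta> :: real assume "\<theta> \<in> {0..1}"
      then have q: "(x + \<theta> *\<^sub>R (y - x), s) \<in> D" using seg y s BX by auto
      have "linear (\<lambda>h. FD (\<lambda>z. A z w) (x + \<theta> *\<^sub>R (y - x), s) (h, 0))"
        using linear_compose[OF linear_conv_bounded_linear[THEN iffD2, OF bounded_linear_Pair[OF bounded_linear_ident bounded_linear_zero]]
          FD_linear[OF dA[OF q]]] by (simp add: o_def)
      from linear_expand[OF this, of "y - x"]
      show "FD (\<lambda>z. A z w) ((x, s) + \<theta> *\<^sub>R (y - x, 0)) (y - x, 0) =
          (\<Sum>b\<in>Basis. ((y - x) \<bullet> b) *\<^sub>R FD (\<lambda>z. A z w) (x + \<theta> *\<^sub>R (y - x), s) (b, 0))" by simp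
    qed
    also have "\<dots> = (\<Sum>b\<in>Basis. ((y - x) \<bullet> b) *\<^sub>R G b (y, s) w)"
      unfolding G_def using Gint[OF y s] by (subst integral_sum) (auto intro!: integrable_cmul)
    finally show ?thesis by simp
  qed
  have Gcont: "continuous_on W (\<lambda>q. G b q w)" for b w
  proof -
    define m where "m = (\<lambda>p::real \<times> 'b \<times> real. (x + fst p *\<^sub>R (fst (snd p) - x), snd (snd p)))"
    have cm: "continuous_on UNIV m" unfolding m_def by (intro continuous_intros)
    have oT: "open (m -` D)" using cm oD by (simp add: open_vimage)
    have "Ck_on 0 (m -` D) (\<lambda>p. FD (\<lambda>z. A z w) (m p) (b, 0))"
      using continuous_on_compose2[OF cFA continuous_on_subset[OF cm]] by auto
    from Ck_on_integral(1)[OF oT oW _ this]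
    have "Ck_on 0 W (\<lambda>z. integral {0..1} (\<lambda>r. FD (\<lambda>z. A z w) (m (r, z)) (b, 0)))"
      using seg BX by (fastforce simp: m_def W_def)
    then show ?thesis by (simp add: G_def m_def)
  qed
  have Glin: "linear (G b q)" if qW: "q \<in> W" for b q
  proof -
    obtain y s where q: "q = (y, s)" "y \<in> B" "\<bar>s\<bar> < \<tau>" using qW by (cases q) (auto simp: W_def abs_less_iff)
    have qD: "(x + \<theta> *\<^sub>R (y - x), s) \<in> D" if "\<theta> \<in> {0..1}" for \<theta> using seg[OF q(2) that] q(3) BX by auto
    show ?thesis
    proof (rule linearI)
      fix u w and c :: real
      have "G b q (u + w) = integral {0..1} (\<lambda>\<theta>. FD (\<lambda>z. A z u) (x + \<theta> *\<^sub>R (y - x), s) (b, 0)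
          + FD (\<lambda>z. A z w) (x + \<theta> *\<^sub>R (y - x), s) (b, 0))"
        unfolding G_def q by (rule integral_cong) (simp add: linear_add[OF linFA[OF qD]])
      also have "\<dots> = G b q u + G b q w"
        unfolding G_def q using Gint[OF q(2,3)] by (subst integral_add) auto
      finally show "G b q (u + w) = G b q u + G b q w" .
      have "G b q (c *\<^sub>R w) = integral {0..1} (\<lambda>\<theta>. c *\<^sub>R FD (\<lambda>z. A z w) (x + \<theta> *\<^sub>R (y - x), s) (b, 0))"
        unfolding G_def q by (rule integral_cong) (simp add: linear_cmul[OF linFA[OF qD]])
      then show "G b q (c *\<^sub>R w) = c *\<^sub>R G b q w" by (simp add: G_def q)
    qed
  qed
  \<comment> \<open>The integrand of variation of constants for the difference of two solutions.
    \<open>J\<close> is its time integral, and \<open>P\<close> the particular solution with zero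
    initial value.\<close>
  define g where "g b q = inv (Z q) (G b q (Z (x, snd q) v))" for b q
  have linW: "linear (Z q)" "bij (Z q)" "linear (inv (Z q))" if "q \<in> W" for q
    using that BX linZ bijZ linZi by (auto simp: W_def)
  have cZx: "continuous_on W (\<lambda>q. Z (x, snd q) v)"
    by (rule continuous_on_compose2[OF cZ]) (use x in \<open>auto simp: W_def intro!: continuous_intros\<close>)
  have cZW: "Ck_on 0 W (\<lambda>q. Z q w)" for w using continuous_on_subset[OF cZ WD] by simp
  have gcont: "continuous_on W (g b)" for b
  proof -
    have "Ck_on 0 W (\<lambda>q. G b q (Z (x, snd q) v))"
      by (rule Ck_on_linfam[OF oW Glin, where a = "\<lambda>q. Z (x, snd q) v"]) (use Gcont cZx in auto)
    then have "Ck_on 0 W (\<lambda>q. inv (Z q) (G b q (Z (x, snd q) v)))"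
      by (intro Ck_on_linfam[of W "\<lambda>q. inv (Z q)", OF oW linW(3) Ck_on_inv_linfam[OF oW linW(1,2) cZW]])
    then show ?thesis by (simp add: g_def[abs_def])
  qed
  define J where "J b q = snd q *\<^sub>R integral {0..1} (\<lambda>r. g b (fst q, r * snd q))" for b q
  define P where "P b q = Z q (J b q)" for b q
  have rmem: "\<bar>r * s\<bar> < \<tau>" if "r \<in> {0..1}" "\<bar>s\<bar> < \<tau>" for r s :: real
  proof -
    have "\<bar>r * s\<bar> \<le> 1 * \<bar>s\<bar>" using that unfolding abs_mult by (intro mult_right_mono) auto
    then show ?thesis using that by simp
  qed
  have Jcont: "continuous_on W (J b)" for b
  proof -
    define m where "m = (\<lambda>p::real \<times> 'b \<times> real. (fst (snd p), fst p * snd (snd p)))"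
    have cm: "continuous_on UNIV m" unfolding m_def by (intro continuous_intros)
    have oT: "open (m -` W)" using cm oW by (simp add: open_vimage)
    have "Ck_on 0 (m -` W) (\<lambda>p. g b (m p))"
      using continuous_on_compose2[OF gcont continuous_on_subset[OF cm]] by auto
    from Ck_on_integral(1)[OF oT oW _ this]
    have "Ck_on 0 W (\<lambda>z. integral {0..1} (\<lambda>r. g b (m (r, z))))"
      using rmem by (fastforce simp: m_def W_def abs_less_iff)
    then have "continuous_on W (\<lambda>q. integral {0..1} (\<lambda>r. g b (fst q, r * snd q)))" by (simp add: m_def)
    then show ?thesis unfolding J_def[abs_def] by (intro continuous_intros)
  qed
  have Pcont: "continuous_on W (P b)" for b
  proof -
    have "Ck_on 0 W (\<lambda>q. Z q (J b q))"
      by (rule Ck_on_linfam[OF oW linW(1) cZW]) (use Jcont in auto)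
    then show ?thesis by (simp add: P_def[abs_def])
  qed
  have key: "Z (y, s) v - Z (x, s) v = (\<Sum>b\<in>Basis. ((y - x) \<bullet> b) *\<^sub>R P b (y, s))"
    if y: "y \<in> B" and s: "\<bar>s\<bar> < \<tau>" for y s
  proof -
    have yX: "y \<in> X" by (rule BX[OF y])
    define Q where "Q s = (\<Sum>b\<in>Basis. ((y - x) \<bullet> b) *\<^sub>R J b (y, s))" for s
    define Q' where "Q' s = (\<Sum>b\<in>Basis. ((y - x) \<bullet> b) *\<^sub>R g b (y, s))" for s
    have dQ: "(Q has_vector_derivative Q' s) (at s)" if s: "\<bar>s\<bar> < \<tau>" for s
    proof -
      have "continuous_on I (\<lambda>s. g b (y, s))" for b
        by (rule continuous_on_compose2[OF gcont]) (use y in \<open>auto simp: W_def intro!: continuous_intros\<close>)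
      from scaled_integral_has_vector_derivative[OF this s]
      have "((\<lambda>s. J b (y, s)) has_vector_derivative g b (y, s)) (at s)" for b by (simp add: J_def)
      then show ?thesis unfolding Q_def[abs_def] Q'_def
        by (intro has_vector_derivative_sum bounded_linear.has_vector_derivative[OF bounded_linear_scaleR_right])
    qed
    have Q': "Z (y, s) (Q' s) = A (y, s) (Z (x, s) v) - A (x, s) (Z (x, s) v)" if s: "\<bar>s\<bar> < \<tau>" for s
    proof -
      have yW: "(y, s) \<in> W" using y s by (auto simp: W_def)
      have "Z (y, s) (Q' s) = (\<Sum>b\<in>Basis. ((y - x) \<bullet> b) *\<^sub>R Z (y, s) (g b (y, s)))"
        unfolding Q'_def using linW(1)[OF yW] by (simp add: linear_sum linear_cmul)
      also have "\<dots> = (\<Sum>b\<in>Basis. ((y - x) \<bullet> b) *\<^sub>R G b (y, s) (Z (x, s) v))"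
        unfolding g_def using linW(2)[OF yW] by (simp add: bij_is_surj surj_f_inv_f)
      also have "\<dots> = A (y, s) (Z (x, s) v) - A (x, s) (Z (x, s) v)" using had[OF y s] by simp
      finally show ?thesis .
    qed
    have dW: "((\<lambda>s. Z (y, s) (Q s)) has_vector_derivative
        A (y, s) (Z (y, s) (Q s)) + (A (y, s) (Z (x, s) v) - A (x, s) (Z (x, s) v))) (at s)" if s: "\<bar>s\<bar> < \<tau>" for s
    proof -
      have "((\<lambda>s. Z (y, s) (Q s)) has_derivative (\<lambda>h. h *\<^sub>R A (y, s) (Z (y, s) (Q s)) + Z (y, s) (h *\<^sub>R Q' s))) (at s)"
        by (rule has_derivative_linfam[where S = I and A' = "\<lambda>v h. h *\<^sub>R A (y, s) (Z (y, s) v)"])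
          (use s derZ[OF yX s] dQ[OF s] linZ[OF yX] in \<open>auto simp: has_vector_derivative_def\<close>)
      then show ?thesis unfolding has_vector_derivative_def Q'[OF s, symmetric]
        by (simp add: linear_cmul[OF linZ[OF yX s]] scaleR_add_right)
    qed
    have "Z (y, s) v - Z (x, s) v - Z (y, s) (Q s) = 0"
    proof (rule unique[OF yX _ _ s, where r = "\<lambda>s. Z (y, s) v - Z (x, s) v - Z (y, s) (Q s)"])
      show "Z (y, 0) v - Z (x, 0) v - Z (y, 0) (Q 0) = 0"
        by (simp add: Z0 yX x Q_def J_def)
      fix s assume s: "\<bar>s\<bar> < \<tau>"
      have eq: "A (y, s) (Z (y, s) v - Z (x, s) v - Z (y, s) (Q s)) =
         A (y, s) (Z (y, s) v) - A (x, s) (Z (x, s) v) -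
         (A (y, s) (Z (y, s) (Q s)) + (A (y, s) (Z (x, s) v) - A (x, s) (Z (x, s) v)))"
        by (simp add: linear_diff[OF linA[OF yX s]])
      show "((\<lambda>s. Z (y, s) v - Z (x, s) v - Z (y, s) (Q s)) has_vector_derivative
          A (y, s) (Z (y, s) v - Z (x, s) v - Z (y, s) (Q s))) (at s)"
        unfolding eq by (intro has_vector_derivative_diff derZ dW yX x s)
    qed
    then have "Z (y, s) v - Z (x, s) v = Z (y, s) (Q s)" by simp
    also have "\<dots> = (\<Sum>b\<in>Basis. ((y - x) \<bullet> b) *\<^sub>R P b (y, s))"
      unfolding Q_def P_def using linZ[OF yX s] by (simp add: linear_sum linear_cmul)
    finally show ?thesis .
  qed
  have zW: "(x, s0) \<in> W" using xB s0 by (auto simp: W_def)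
  \<comment> \<open>P is only known to be continuous, but its coefficients, the coordinates of
    \<open>fst q - x\<close>, vanish at the base point, so the sum is differentiable there.\<close>
  have Pc: "isCont (P b) (x, s0)" for b using Pcont zW by (simp add: continuous_on_eq_continuous_at[OF oW])
  have "((\<lambda>q. \<Sum>b\<in>Basis. ((fst q - x) \<bullet> b) *\<^sub>R P b q) has_derivative
      (\<lambda>h. \<Sum>b\<in>Basis. (fst h \<bullet> b) *\<^sub>R P b (x, s0))) (at (x, s0))"
    by (intro has_derivative_sum has_derivative_scaleR_zero Pc)
      (auto intro!: derivative_eq_intros)
  moreover have "((\<lambda>q. Z (x, snd q) v) has_derivative (\<lambda>h. snd h *\<^sub>R A (x, s0) (Z (x, s0) v))) (at (x, s0))"
    using has_derivative_compose[OF has_derivative_snd[OF has_derivative_ident], of "\<lambda>s. Z (x, s) v" _ "(x, s0)" UNIV]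
      derZ[OF x s0, of v] unfolding has_vector_derivative_def by simp
  ultimately have "((\<lambda>q. (\<Sum>b\<in>Basis. ((fst q - x) \<bullet> b) *\<^sub>R P b q) + Z (x, snd q) v) has_derivative
      (\<lambda>h. (\<Sum>b\<in>Basis. (fst h \<bullet> b) *\<^sub>R P b (x, s0)) + snd h *\<^sub>R A (x, s0) (Z (x, s0) v))) (at (x, s0))"
    by (rule has_derivative_add)
  then have fin: "((\<lambda>q. Z q v) has_derivative
      (\<lambda>h. (\<Sum>b\<in>Basis. (fst h \<bullet> b) *\<^sub>R P b (x, s0)) + snd h *\<^sub>R A (x, s0) (Z (x, s0) v))) (at (x, s0))"
  proof (rule has_derivative_transform_within_open[OF _ oW zW])
    fix q assume "q \<in> W"
    then obtain y s where "q = (y, s)" "y \<in> B" "\<bar>s\<bar> < \<tau>" by (cases q) (auto simp: W_def abs_less_iff)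
    then show "(\<Sum>b\<in>Basis. ((fst q - x) \<bullet> b) *\<^sub>R P b q) + Z (x, snd q) v = Z q v"
      using key[of y s] by (simp add: algebra_simps)
  qed
  \<comment> \<open>At the base parameter the segment shrinks to a point, and Hadamard's average
    becomes the derivative itself.\<close>
  have "P b (x, s0) = dZ b v (x, s0)" for b
    by (simp add: P_def J_def g_def G_def dZ_def)
  then show ?thesis using fin xz by simp
qed

text \<open>A bootstrap on the order: \<open>dZ\<close> is built from Z, its inverse and first
  derivatives of A. If A is C^(k+1), the induction hypothesis makes all of these C^k, and they
  express the derivative of Z.\<close>

lemma CkZ: "(\<And>v. Ck_on k D (\<lambda>z. A z v)) \<Longrightarrow> Ck_on k D (\<lambda>z. Z z v)"
proof (induction k arbitrary: v)
  case 0
  then show ?case using contZ by simp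
next
  case (Suc k)
  have C1: "Ck_on (Suc 0) D (\<lambda>z. A z v)" for v by (rule Ck_on_le[OF _ Suc.prems]) simp
  have AC: "Ck_on k D (\<lambda>z. A z v)" for v by (rule Ck_on_SucD[OF Suc.prems])
  have ZC: "Ck_on k D (\<lambda>z. Z z v)" for v by (rule Suc.IH[OF AC])
  have lin: "linear (A q)" "linear (Z q)" "bij (Z q)" "linear (inv (Z q))" if "q \<in> D" for q
    using that linA linZ bijZ linZi by (auto simp: abs_less_iff)
  have dA: "(\<lambda>z. A z w) differentiable at q" if "q \<in> D" for w q
    by (rule Ck_on_Suc_differentiable[OF C1 that])
  have ZiC: "Ck_on k D (\<lambda>z. inv (Z z) v)" for v by (rule Ck_on_inv_linfam[OF oD lin(2,3) ZC])
  have FAC: "Ck_on k D (\<lambda>q. FD (\<lambda>z. A z w) q h)" for w h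
    using Suc.prems[of w] by (simp del: split_paired_All)
  have g: "Ck_on k D (\<lambda>q. inv (Z q) (FD (\<lambda>z. A z (Z q v)) q (b, 0)))" for b v
  proof -
    have "Ck_on k D (\<lambda>q. FD (\<lambda>z. A z (Z q v)) q (b, 0))"
      by (rule Ck_on_linfam[of D "\<lambda>q w. FD (\<lambda>z. A z w) q (b, 0)", OF oD linear_FD_parameter[OF oD _ lin(1) dA] FAC ZC])
    then show ?thesis by (intro Ck_on_linfam[of D "\<lambda>q. inv (Z q)", OF oD lin(4) ZiC])
  qed
  have dC: "Ck_on k D (dZ b v)" for b v
  proof -
    define m where "m = (\<lambda>p::real \<times> 'b \<times> real. (fst (snd p), fst p * snd (snd p)))"
    have cm: "continuous_on UNIV m" unfolding m_def by (intro continuous_intros)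
    have oT: "open (m -` D)" using cm oD by (simp add: open_vimage)
    have mC: "Ck_on k (m -` D) m"
      unfolding m_def
      by (intro Ck_on_Pair Ck_on_mult Ck_on_ident oT[unfolded m_def]
          Ck_on_bounded_linear[where L = "\<lambda>p. fst (snd p)"] Ck_on_bounded_linear[where L = "\<lambda>p. snd (snd p)"]
          Ck_on_bounded_linear[where L = fst] bounded_linear_fst
          bounded_linear_compose[OF bounded_linear_fst bounded_linear_snd]
          bounded_linear_compose[OF bounded_linear_snd bounded_linear_snd])
    define gg where "gg q = inv (Z q) (FD (\<lambda>z. A z (Z q v)) q (b, 0))" for q
    have gg: "Ck_on k D gg" unfolding gg_def by (rule g)
    have rmem: "\<bar>r * s\<bar> < \<tau>" if "r \<in> {0..1}" "\<bar>s\<bar> < \<tau>" for r s :: real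
    proof -
      have "\<bar>r * s\<bar> \<le> 1 * \<bar>s\<bar>" using that unfolding abs_mult by (intro mult_right_mono) auto
      then show ?thesis using that by simp
    qed
    have mem: "(r, z) \<in> m -` D" if "r \<in> {0..1}" "z \<in> D" for r z
      using rmem[of r "snd z"] that by (auto simp: m_def abs_less_iff)
    have "Ck_on k (m -` D) (\<lambda>p. gg (m p))"
      by (rule Ck_on_compose[OF oT oD _ mC gg]) auto
    from Ck_on_integral(1)[OF oT oD mem this]
    have "Ck_on k D (\<lambda>z. integral {0..1} (\<lambda>r. gg (m (r, z))))" .
    then have "Ck_on k D (\<lambda>z. snd z *\<^sub>R integral {0..1} (\<lambda>r. gg (m (r, z))))"
      by (intro Ck_on_scaleR oD Ck_on_bounded_linear[OF bounded_linear_snd] Ck_on_ident)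
    from Ck_on_linfam[of D Z, OF oD lin(2) ZC this]
    show ?thesis by (simp add: dZ_def[abs_def] gg_def m_def)
  qed
  show ?case
  proof (rule Ck_on_SucI[OF oD Z_has_derivative[OF C1]])
    fix h
    have "Ck_on k D (\<lambda>z. A z (Z z v))" by (rule Ck_on_linfam[OF oD lin(1) AC ZC])
    then show "Ck_on k D (\<lambda>z. (\<Sum>b\<in>Basis. (fst h \<bullet> b) *\<^sub>R dZ b v z) + snd h *\<^sub>R A z (Z z v))"
      by (intro Ck_on_add Ck_on_sum Ck_on_scaleR Ck_on_const oD dC)
  qed
qed

end

text \<open>The strict inequality \<tau> < T places the closed interval required by
  \<open>ode_exists\<close> inside the open one on which the coefficients are given.\<close>

lemma linear_flow_exists:
  fixes A :: "'b::euclidean_space \<times> real \<Rightarrow> 'a::euclidean_space \<Rightarrow> 'a"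
  assumes "open X" "0 < \<tau>" "\<tau> < T" "L \<ge> 0" "\<tau> * L \<le> 1/4"
    and lin: "\<And>x s. x \<in> X \<Longrightarrow> \<bar>s\<bar> < T \<Longrightarrow> linear (A (x, s))"
    and bnd: "\<And>x s v. x \<in> X \<Longrightarrow> \<bar>s\<bar> < T \<Longrightarrow> norm (A (x, s) v) \<le> L * norm v"
    and cont: "\<And>v. continuous_on (X \<times> {-T<..<T}) (\<lambda>z. A z v)"
  obtains Z where "linear_flow X \<tau> L A Z"
proof -
  have tL2: "\<tau> * L \<le> 1/2" using assms(5) by simp
  have "\<exists>y. y 0 = v \<and> (\<forall>s. \<bar>s\<bar> < \<tau> \<longrightarrow> (y has_vector_derivative A (x, s) (y s)) (at s))"
    if x: "x \<in> X" for x v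
  proof -
    define O' where "O' = {-T<..<T} \<times> (UNIV :: 'a set)"
    have oO: "open O'" unfolding O'_def by (intro open_Times) auto
    have "continuous_on O' (\<lambda>p. A (x, fst p) w)" for w
      by (rule continuous_on_compose2[OF cont]) (use x in \<open>auto simp: O'_def intro!: continuous_intros\<close>)
    moreover have "continuous_on O' snd" by (intro continuous_intros)
    ultimately have "Ck_on 0 O' (\<lambda>p. A (x, fst p) (snd p))"
      by (intro Ck_on_linfam[of O' "\<lambda>p. A (x, fst p)" 0 snd, OF oO]) (use lin x in \<open>auto simp: O'_def\<close>)
    then have "continuous_on O' (\<lambda>p. A (x, fst p) (snd p))" by simp
    then have c: "continuous_on ({-\<tau>..\<tau>} \<times> UNIV) (\<lambda>p. A (x, fst p) (snd p))"
      by (rule continuous_on_subset) (use assms(3) in \<open>auto simp: O'_def\<close>)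
    have lip: "norm (A (x, s) y - A (x, s) z) \<le> L * norm (y - z)" if "s \<in> {-\<tau>..\<tau>}" for s y z
    proof -
      have s: "\<bar>s\<bar> < T" using that assms(3) by auto
      show ?thesis using bnd[OF x s, of "y - z"] linear_diff[OF lin[OF x s], of y z] by simp
    qed
    show ?thesis by (rule ode_exists[OF assms(2,4) tL2 c lip, of v]) blast+
  qed
  then obtain Y where Y: "\<And>x v. x \<in> X \<Longrightarrow> Y x v 0 = v"
    "\<And>x v s. x \<in> X \<Longrightarrow> \<bar>s\<bar> < \<tau> \<Longrightarrow> (Y x v has_vector_derivative A (x, s) (Y x v s)) (at s)"
    by metis
  have "linear_flow X \<tau> L A (\<lambda>z v. Y (fst z) v (snd z))"
  proof (rule linear_flow.intro)
    show "linear (A (x, s))" "norm (A (x, s) v) \<le> L * norm v" if "x \<in> X" "\<bar>s\<bar> < \<tau>" for x s v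
      using lin bnd that assms(3) by auto
  qed (use assms Y in auto)
  then show thesis by (rule that)
qed

text \<open>For differentiability in the initial point, the difference of two solutions solves a
  linear equation whose coefficient is the average of the derivative of E over the segment between
  them. It therefore equals a fundamental solution applied to x' - x, and continuity of that
  fundamental solution identifies the derivative with the solution Z of the variational equation.
  Smoothness follows by induction, since the coefficient of that equation is \<open>FD E\<close>
  along the flow.\<close>

theorem smooth_flow_exists:
  fixes E :: "'a::euclidean_space \<Rightarrow> 'a"
  assumes Om: "open \<Omega>" "x0 \<in> \<Omega>" "smooth_on \<Omega> E"
  obtains R \<tau> \<phi> where "R > 0" "\<tau> > 0" "smooth_on (ball x0 R \<times> {-\<tau><..<\<tau>}) \<phi>"
    "\<And>x. x \<in> ball x0 R \<Longrightarrow> \<phi> (x, 0) = x"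
    "\<And>x s. x \<in> ball x0 R \<Longrightarrow> \<bar>s\<bar> < \<tau> \<Longrightarrow> \<phi> (x, s) \<in> \<Omega>"
    "\<And>x s. x \<in> ball x0 R \<Longrightarrow> \<bar>s\<bar> < \<tau> \<Longrightarrow> ((\<lambda>s. \<phi> (x, s)) has_vector_derivative E (\<phi> (x, s))) (at s)"
proof -
  obtain e where e: "e > 0" "cball x0 e \<subseteq> \<Omega>" using Om open_contains_cball by blast
  define R where "R = e / 2"
  have R: "R > 0" using e by (simp add: R_def)
  define C where "C = cball x0 e"
  have C: "compact C" "convex C" "closed C" "C \<noteq> {}" "C \<subseteq> \<Omega>" using e by (auto simp: C_def)
  have cE: "continuous_on C E" by (rule continuous_on_subset[OF smooth_on_continuous[OF Om(3)] C(5)])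
  have "bounded (E ` C)" by (rule compact_imp_bounded[OF compact_continuous_image[OF cE C(1)]])
  then obtain K where K: "K > 0" "\<And>z. z \<in> C \<Longrightarrow> norm (E z) \<le> K" unfolding bounded_pos by blast
  have "continuous_on C (\<lambda>z. \<Sum>b\<in>Basis. norm (FD E z b))"
    by (intro continuous_intros continuous_on_subset[OF smooth_on_continuous[OF smooth_on_FD[OF Om(3)]] C(5)])
  then have "bounded ((\<lambda>z. \<Sum>b\<in>Basis. norm (FD E z b)) ` C)"
    by (rule compact_imp_bounded[OF compact_continuous_image[OF _ C(1)]])
  then obtain L where L: "L > 0" "\<And>z. z \<in> C \<Longrightarrow> (\<Sum>b\<in>Basis. norm (FD E z b)) \<le> L"
    unfolding bounded_pos by (metis abs_le_D1 image_eqI real_norm_def)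
  have linE: "linear (FD E z)" if "z \<in> C" for z using that C(5) smooth_on_linear[OF Om(3)] by blast
  have LE: "norm (FD E z v) \<le> L * norm v" if "z \<in> C" for z v
    using linear_bound_Basis[OF linE[OF that], of v] mult_left_mono[OF L(2)[OF that] norm_ge_zero[of v]]
    by (simp add: mult.commute)
  have lipE: "norm (E y - E z) \<le> L * norm (y - z)" if "y \<in> C" "z \<in> C" for y z
  proof (rule differentiable_bound[OF C(2) _ _ that])
    show "(E has_derivative FD E x) (at x within C)" if "x \<in> C" for x
      using smooth_on_has_derivative[OF Om(3)] that C(5) has_derivative_at_withinI by blast
    show "onorm (FD E x) \<le> L" if "x \<in> C" for x by (rule onorm_le) (rule LE[OF that])
  qed
  \<comment> \<open>The first bound gives T L \<le> 1/4. The second gives 2 T K < R, so a solution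
    starting within R of x0 moves by less than R and stays in the ball of radius e = 2 R.\<close>
  define T where "T = min (1 / (4 * L)) (R / (4 * K))"
  have T0: "T > 0" using L K R by (simp add: T_def)
  have "T \<le> 1 / (4 * L)" "T \<le> R / (4 * K)" by (simp_all add: T_def)
  then have TL: "T * L \<le> 1/4" and TK: "2 * T * K < R" using L(1) K(1) R by (simp_all add: field_simps)
  have TL2: "T * L \<le> 1/2" using TL by simp
  \<comment> \<open>Composing E with the nearest point projection to the ball C makes it globally
    Lipschitz, as the fixed point theorem requires. Solutions starting in \<open>X\<close> stay in
    C, so for them the projection is invisible.\<close>
  define P where "P = closest_point C"
  have PC: "P y \<in> C" for y unfolding P_def by (rule closest_point_in_set[OF C(3,4)])
  have cP: "continuous_on UNIV P" unfolding P_def by (rule continuous_on_closest_point[OF C(2,3,4)])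
  have Plip: "norm (P y - P z) \<le> norm (y - z)" for y z
    using closest_point_lipschitz[OF C(2,3,4), of y z] by (simp add: P_def dist_norm)
  have "\<exists>y. y 0 = x \<and> (\<forall>s. \<bar>s\<bar> < T \<longrightarrow> (y has_vector_derivative E (P (y s))) (at s))" for x
  proof (rule ode_exists[OF T0 less_imp_le[OF L(1)] TL2, of "\<lambda>s y. E (P y)" x])
    show "continuous_on ({-T..T} \<times> UNIV) (\<lambda>p. E (P (snd p)))"
      by (rule continuous_on_compose2[OF cE])
        (use PC in \<open>auto intro!: continuous_on_compose2[OF cP] continuous_intros\<close>)
    show "norm (E (P y) - E (P z)) \<le> L * norm (y - z)" for y z
      using lipE[OF PC PC, of y z] mult_left_mono[OF Plip[of y z] less_imp_le[OF L(1)]] by linarith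
  qed blast
  then obtain Y where Y0: "\<And>x. Y x 0 = x"
    and dY': "\<And>x s. \<bar>s\<bar> < T \<Longrightarrow> (Y x has_vector_derivative E (P (Y x s))) (at s)" by metis
  define X where "X = ball x0 R"
  have oX: "open X" by (simp add: X_def)
  have Ynear: "norm (Y x s - x) \<le> 2 * T * K" if s: "\<bar>s\<bar> < T" for x s
  proof (rule short_time_bound[of 0, OF _ _ _ _ _ s, where r' = "\<lambda>s. E (P (Y x s))"])
    show "((\<lambda>s. Y x s - x) has_vector_derivative E (P (Y x s))) (at s)" if "\<bar>s\<bar> < T" for s
      using has_vector_derivative_diff[OF dY'[OF that] has_vector_derivative_const[of x]] by simp
  qed (use K PC Y0 in auto)
  have YC: "Y x s \<in> ball x0 e" if "x \<in> X" "\<bar>s\<bar> < T" for x s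
  proof -
    have "dist x0 (Y x s) \<le> dist x0 x + norm (Y x s - x)"
      using dist_triangle[of x0 "Y x s" x] by (simp add: dist_norm norm_minus_commute)
    also have "\<dots> < R + R" using that(1) Ynear[OF that(2), of x] TK by (auto simp: X_def)
    finally show ?thesis by (simp add: R_def)
  qed
  have YC': "Y x s \<in> C" if "x \<in> X" "\<bar>s\<bar> < T" for x s using YC[OF that] by (auto simp: C_def)
  have YOm: "Y x s \<in> \<Omega>" if "x \<in> X" "\<bar>s\<bar> < T" for x s using YC'[OF that] C(5) by blast
  have dY: "(Y x has_vector_derivative E (Y x s)) (at s)" if "x \<in> X" "\<bar>s\<bar> < T" for x s
    using dY'[OF that(2), of x] closest_point_self[OF YC'[OF that]] by (simp add: P_def)
  have Ylip: "norm (Y x' s - Y x s) \<le> 2 * norm (x' - x)" if x: "x \<in> X" "x' \<in> X" and s: "\<bar>s\<bar> < T" for x x' s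
  proof -
    have "norm (Y x' s - Y x s - (x' - x)) \<le> 2 * T * (L * norm (x' - x))"
    proof (rule short_time_bound[OF less_imp_le[OF L(1)] TL2 _ _ _ s, where r' = "\<lambda>s. E (Y x' s) - E (Y x s)"])
      fix s assume s: "\<bar>s\<bar> < T"
      have "((\<lambda>s. Y x' s - Y x s - (x' - x)) has_vector_derivative E (Y x' s) - E (Y x s) - 0) (at s)"
        by (intro has_vector_derivative_diff dY x s has_vector_derivative_const)
      then show "((\<lambda>s. Y x' s - Y x s - (x' - x)) has_vector_derivative E (Y x' s) - E (Y x s)) (at s)" by simp
      have "norm (E (Y x' s) - E (Y x s)) \<le> L * norm (Y x' s - Y x s)" by (intro lipE YC' x s)
      also have "\<dots> \<le> L * (norm (Y x' s - Y x s - (x' - x)) + norm (x' - x))"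
        using L(1) by (intro mult_left_mono) (auto simp: norm_triangle_sub add.commute)
      finally show "norm (E (Y x' s) - E (Y x s)) \<le> L * norm (Y x' s - Y x s - (x' - x)) + L * norm (x' - x)"
        by (simp add: distrib_left)
    qed (simp add: Y0)
    also have "\<dots> = 2 * (T * L) * norm (x' - x)" by simp
    also have "\<dots> \<le> 1/2 * norm (x' - x)" using TL by (intro mult_right_mono) auto
    finally show ?thesis using norm_triangle_sub[of "Y x' s - Y x s" "x' - x"] norm_ge_zero[of "x' - x"] by linarith
  qed
  define y where "y z = Y (fst z) (snd z)" for z
  define IT where "IT = {-T<..<T}"
  have IT: "s \<in> IT \<longleftrightarrow> \<bar>s\<bar> < T" for s by (auto simp: IT_def abs_less_iff)
  have oXT: "open (X \<times> IT)" unfolding IT_def by (intro open_Times oX) auto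
  have cy: "continuous_on (X \<times> IT) y"
  proof -
    have "isCont y (x, s)" if x: "x \<in> X" and s: "\<bar>s\<bar> < T" for x s
    proof -
      have t1: "((\<lambda>z. y z - Y x (snd z)) \<longlongrightarrow> 0) (at (x, s))"
      proof (rule Lim_null_comparison)
        have "\<forall>\<^sub>F z in at (x, s). z \<in> X \<times> IT" by (rule eventually_at_in_open'[OF oXT]) (use x s IT in auto)
        then show "\<forall>\<^sub>F z in at (x, s). norm (y z - Y x (snd z)) \<le> 2 * norm (fst z - x)"
          by eventually_elim (use Ylip[OF x] IT in \<open>auto simp: y_def\<close>)
        have "((\<lambda>z. 2 * norm (fst z - x)) \<longlongrightarrow> 2 * norm (fst (x, s) - x)) (at (x, s))"
          by (intro tendsto_intros)
        then show "((\<lambda>z. 2 * norm (fst z - x)) \<longlongrightarrow> 0) (at (x, s))" by simp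
      qed
      have c0: "isCont (Y x) s" using dY[OF x s] has_vector_derivative_continuous by blast
      have "isCont (\<lambda>z. Y x (snd z)) (x, s)"
        by (rule isCont_o2[where f = snd and g = "Y x"]) (simp_all add: c0 isCont_snd)
      then have t2: "((\<lambda>z. Y x (snd z)) \<longlongrightarrow> Y x s) (at (x, s))" by (simp add: isCont_def)
      show ?thesis unfolding isCont_def using tendsto_add[OF t1 t2] by (simp add: y_def[abs_def])
    qed
    then show ?thesis by (auto simp: continuous_on_eq_continuous_at[OF oXT] IT)
  qed
  have yOm: "y z \<in> \<Omega>" "y z \<in> C" if "z \<in> X \<times> IT" for z using that YOm YC' IT by (auto simp: y_def)
  \<comment> \<open>The variational equation is solved on an interval strictly inside the one on
    which the solutions, and hence its coefficients, are defined.\<close>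
  define \<tau> where "\<tau> = T / 2"
  have "0 < T * L" using T0 L(1) by simp
  moreover have "\<tau> * L = T * L / 2" by (simp add: \<tau>_def)
  ultimately have \<tau>: "0 < \<tau>" "\<tau> < T" "\<tau> * L \<le> 1/4"
    using T0 TL by (simp add: \<tau>_def, simp add: \<tau>_def, linarith)
  define A where "A z = FD E (y z)" for z
  have cFE: "continuous_on \<Omega> (\<lambda>z. FD E z v)" for v by (intro smooth_on_continuous smooth_on_FD Om)
  obtain Z where Z: "linear_flow X \<tau> L A Z"
  proof (rule linear_flow_exists[OF oX \<tau>(1,2) less_imp_le[OF L(1)] \<tau>(3), of A])
    fix x s v assume "x \<in> X" "\<bar>s\<bar> < T"
    then have "y (x, s) \<in> C" using yOm IT by auto
    then show "linear (A (x, s))" "norm (A (x, s) v) \<le> L * norm v" using linE LE by (auto simp: A_def)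
  next
    show "continuous_on (X \<times> {-T<..<T}) (\<lambda>z. A z v)" for v
      unfolding A_def IT_def[symmetric] by (rule continuous_on_compose2[OF cFE cy]) (use yOm in blast)
  qed blast
  interpret Z: linear_flow X \<tau> L A Z by (rule Z)
  have D_sub: "Z.D \<subseteq> X \<times> IT" using \<tau> by (auto simp: IT_def)
  have dy: "(y has_derivative (\<lambda>h. (\<Sum>b\<in>Basis. (fst h \<bullet> b) *\<^sub>R Z z b) + snd h *\<^sub>R E (y z))) (at z)"
    if z: "z \<in> Z.D" for z
  proof -
    obtain x s0 where xz: "z = (x, s0)" by (cases z)
    have x: "x \<in> X" and s0: "\<bar>s0\<bar> < \<tau>" using z xz by auto
    have sT: "\<bar>s\<bar> < T" if "\<bar>s\<bar> < \<tau>" for s using that \<tau>(2) by simp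
    have seg: "Y x s + \<theta> *\<^sub>R (Y x' s - Y x s) \<in> C" if "x' \<in> X" "\<bar>s\<bar> < T" "\<theta> \<in> {0..1}" for x' s \<theta>
    proof -
      have "Y x s + \<theta> *\<^sub>R (Y x' s - Y x s) = (1 - \<theta>) *\<^sub>R Y x s + \<theta> *\<^sub>R Y x' s" by (simp add: algebra_simps)
      also have "\<dots> \<in> C" using YC'[OF x that(2)] YC'[OF that(1,2)] that(3) C(2) unfolding convex_alt by auto
      finally show ?thesis .
    qed
    \<comment> \<open>The average of the derivative of E over the segment from the solution through
      x to the one through \<open>fst q\<close>. By the fundamental theorem it sends the difference
      of the solutions to the difference of the velocities.\<close>
    define B where "B q w = integral {0..1} (\<lambda>\<theta>. FD E (Y x (snd q) + \<theta> *\<^sub>R (y q - Y x (snd q))) w)" for q w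
    have Bint: "(\<lambda>\<theta>. FD E (Y x s + \<theta> *\<^sub>R (Y x' s - Y x s)) w) integrable_on {0..1}"
      and Bc: "continuous_on {0..1} (\<lambda>\<theta>. FD E (Y x s + \<theta> *\<^sub>R (Y x' s - Y x s)) w)"
      if "x' \<in> X" "\<bar>s\<bar> < T" for x' s w
    proof -
      show c: "continuous_on {0..1} (\<lambda>\<theta>. FD E (Y x s + \<theta> *\<^sub>R (Y x' s - Y x s)) w)"
        by (rule continuous_on_compose2[OF cFE, of "{0..1}" "\<lambda>\<theta>. Y x s + \<theta> *\<^sub>R (Y x' s - Y x s)"])
          (use seg that C(5) in \<open>auto intro!: continuous_intros\<close>)
      show "(\<lambda>\<theta>. FD E (Y x s + \<theta> *\<^sub>R (Y x' s - Y x s)) w) integrable_on {0..1}"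
        by (rule integrable_continuous_real[OF c])
    qed
    have Blin: "linear (B (x', s))" if q: "x' \<in> X" "\<bar>s\<bar> < T" for x' s
    proof (rule linearI)
      fix u w and c :: real
      have "B (x', s) (u + w) = integral {0..1} (\<lambda>\<theta>. FD E (Y x s + \<theta> *\<^sub>R (Y x' s - Y x s)) u
          + FD E (Y x s + \<theta> *\<^sub>R (Y x' s - Y x s)) w)"
        unfolding B_def y_def by (rule integral_cong) (simp add: linear_add[OF linE[OF seg[OF q]]])
      also have "\<dots> = B (x', s) u + B (x', s) w"
        unfolding B_def y_def using Bint[OF q] by (simp add: integral_add)
      finally show "B (x', s) (u + w) = B (x', s) u + B (x', s) w" .
      have "B (x', s) (c *\<^sub>R w) = integral {0..1} (\<lambda>\<theta>. c *\<^sub>R FD E (Y x s + \<theta> *\<^sub>R (Y x' s - Y x s)) w)"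
        unfolding B_def y_def by (rule integral_cong) (simp add: linear_cmul[OF linE[OF seg[OF q]]])
      then show "B (x', s) (c *\<^sub>R w) = c *\<^sub>R B (x', s) w" by (simp add: B_def y_def)
    qed
    have Bbnd: "norm (B (x', s) w) \<le> L * norm w" if q: "x' \<in> X" "\<bar>s\<bar> < T" for x' s w
    proof -
      have "norm (B (x', s) w) \<le> (L * norm w) * (1 - 0)"
        unfolding B_def y_def fst_conv snd_conv
        by (rule integral_bound) (use Bc[OF q] LE[OF seg[OF q]] in auto)
      then show ?thesis by simp
    qed
    have cYx: "continuous_on IT (Y x)"
      by (rule continuous_on_eq[OF continuous_on_compose2[OF cy, of IT "\<lambda>s. (x, s)"]])
        (use x in \<open>auto intro!: continuous_intros simp: y_def\<close>)
    have Bcont: "continuous_on (X \<times> IT) (\<lambda>q. B q w)" for w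
    proof -
      define m where "m = (\<lambda>p::real \<times> 'a \<times> real. Y x (snd (snd p)) + fst p *\<^sub>R (y (snd p) - Y x (snd (snd p))))"
      define S where "S = (UNIV :: real set) \<times> (X \<times> IT)"
      have cm: "continuous_on S m" unfolding m_def S_def
        by (intro continuous_intros continuous_on_compose2[OF cy] continuous_on_compose2[OF cYx]) auto
      have oS: "open S" unfolding S_def by (intro open_Times oXT) auto
      have oT: "open (S \<inter> m -` \<Omega>)" by (rule continuous_open_preimage[OF cm oS Om(1)])
      have "Ck_on 0 (S \<inter> m -` \<Omega>) (\<lambda>p. FD E (m p) w)"
        unfolding Ck_on.simps by (rule continuous_on_compose2[OF cFE continuous_on_subset[OF cm]]) auto
      moreover have "(r, z) \<in> S \<inter> m -` \<Omega>" if "r \<in> {0..1}" "z \<in> X \<times> IT" for r z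
        using seg[of "fst z" "snd z" r] that C(5) IT by (auto simp: S_def m_def y_def)
      ultimately have "Ck_on 0 (X \<times> IT) (\<lambda>z. integral {0..1} (\<lambda>r. FD E (m (r, z)) w))"
        using Ck_on_integral(1)[OF oT oXT] by blast
      then show ?thesis by (simp add: B_def m_def)
    qed
    obtain V where V: "linear_flow X \<tau> L B V"
      by (rule linear_flow_exists[OF oX \<tau>(1,2) less_imp_le[OF L(1)] \<tau>(3) Blin Bbnd Bcont[unfolded IT_def]])
    interpret V: linear_flow X \<tau> L B V by (rule V)
    have key: "Y x' s - Y x s = V (x', s) (x' - x)" if x': "x' \<in> X" and s: "\<bar>s\<bar> < \<tau>" for x' s
    proof -
      have "Y x' s - Y x s - V (x', s) (x' - x) = 0"
      proof (rule V.unique[OF x' _ _ s, where r = "\<lambda>s. Y x' s - Y x s - V (x', s) (x' - x)"])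
        fix s assume s: "\<bar>s\<bar> < \<tau>"
        have "E (Y x s + (Y x' s - Y x s)) - E (Y x s) = integral {0..1} (\<lambda>r. FD E (Y x s + r *\<^sub>R (Y x' s - Y x s)) (Y x' s - Y x s))"
          by (rule segment_integral[OF Om(1) smooth_onD[OF Om(3)]]) (use seg[OF x' sT[OF s]] C(5) in blast)
        then have EB: "E (Y x' s) - E (Y x s) = B (x', s) (Y x' s - Y x s)" by (simp add: B_def y_def)
        have eq: "B (x', s) (Y x' s - Y x s - V (x', s) (x' - x)) = E (Y x' s) - E (Y x s) - B (x', s) (V (x', s) (x' - x))"
          unfolding EB by (rule linear_diff[OF Blin[OF x' sT[OF s]]])
        show "((\<lambda>s. Y x' s - Y x s - V (x', s) (x' - x)) has_vector_derivative
            B (x', s) (Y x' s - Y x s - V (x', s) (x' - x))) (at s)"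
          unfolding eq by (intro has_vector_derivative_diff dY V.derZ x x' s sT)
      qed (simp add: Y0 V.Z0[OF x'])
      then show ?thesis by simp
    qed
    have Vc: "isCont (\<lambda>q. V q b) (x, s0)" for b
    proof -
      have "continuous_on V.D (\<lambda>q. V q b)"
        by (rule V.contZ) (rule continuous_on_subset[OF Bcont D_sub])
      then show ?thesis using x s0 by (auto simp: continuous_on_eq_continuous_at[OF V.oD] abs_less_iff)
    qed
    have zD: "(x, s0) \<in> V.D" using x s0 by (auto simp: abs_less_iff)
    have "((\<lambda>q. \<Sum>b\<in>Basis. ((fst q - x) \<bullet> b) *\<^sub>R V q b) has_derivative
        (\<lambda>h. \<Sum>b\<in>Basis. (fst h \<bullet> b) *\<^sub>R V (x, s0) b)) (at (x, s0))"
      by (intro has_derivative_sum has_derivative_scaleR_zero Vc) (auto intro!: derivative_eq_intros)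
    moreover have "((\<lambda>q. Y x (snd q)) has_derivative (\<lambda>h. snd h *\<^sub>R E (Y x s0))) (at (x, s0))"
      using has_derivative_compose[OF has_derivative_snd[OF has_derivative_ident], of "Y x" _ "(x, s0)" UNIV]
        dY[OF x sT[OF s0]] unfolding has_vector_derivative_def by simp
    ultimately have "((\<lambda>q. (\<Sum>b\<in>Basis. ((fst q - x) \<bullet> b) *\<^sub>R V q b) + Y x (snd q)) has_derivative
        (\<lambda>h. (\<Sum>b\<in>Basis. (fst h \<bullet> b) *\<^sub>R V (x, s0) b) + snd h *\<^sub>R E (Y x s0))) (at (x, s0))"
      by (rule has_derivative_add)
    then have fin: "(y has_derivative
        (\<lambda>h. (\<Sum>b\<in>Basis. (fst h \<bullet> b) *\<^sub>R V (x, s0) b) + snd h *\<^sub>R E (Y x s0))) (at (x, s0))"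
    proof (rule has_derivative_transform_within_open[OF _ V.oD zD])
      fix q assume "q \<in> V.D"
      then obtain x' s where q: "q = (x', s)" "x' \<in> X" "\<bar>s\<bar> < \<tau>" by (cases q) (auto simp: abs_less_iff)
      show "(\<Sum>b\<in>Basis. ((fst q - x) \<bullet> b) *\<^sub>R V q b) + Y x (snd q) = y q"
        using key[OF q(2,3)] linear_expand[OF V.linZ[OF q(2,3)], of "x' - x"] q(1)
        by (simp add: y_def algebra_simps)
    qed
    \<comment> \<open>For x' = x the averaged coefficient B is the coefficient A of the variational
      equation, so V and Z agree there by uniqueness. V depends on the base point x, whereas Z
      serves all points at once.\<close>
    have VZ: "V (x, s0) b = Z (x, s0) b" for b
    proof -
      have "V (x, s0) b - Z (x, s0) b = 0"
      proof (rule Z.unique[OF x _ _ s0, where r = "\<lambda>s. V (x, s) b - Z (x, s) b"])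
        fix s assume s: "\<bar>s\<bar> < \<tau>"
        have BA: "B (x, s) w = A (x, s) w" for w by (simp add: B_def A_def y_def)
        have "((\<lambda>s. V (x, s) b - Z (x, s) b) has_vector_derivative B (x, s) (V (x, s) b) - A (x, s) (Z (x, s) b)) (at s)"
          by (intro has_vector_derivative_diff V.derZ Z.derZ x s)
        then show "((\<lambda>s. V (x, s) b - Z (x, s) b) has_vector_derivative A (x, s) (V (x, s) b - Z (x, s) b)) (at s)"
          unfolding BA linear_diff[OF Z.linA[OF x s]] .
      qed (simp add: Z.Z0 V.Z0 x)
      then show ?thesis by simp
    qed
    show ?thesis using fin xz by (simp add: VZ y_def)
  qed
  \<comment> \<open>If the flow is C^k, then so are the coefficients \<open>FD E (y z)\<close>,
    hence also Z; the derivative of the flow consists of Z and E along the flow.\<close>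
  have "Ck_on k Z.D y" for k
  proof (induction k)
    case 0
    show ?case using continuous_on_subset[OF cy D_sub] by simp
  next
    case (Suc k)
    have im: "y ` Z.D \<subseteq> \<Omega>" using yOm D_sub by blast
    have AC: "Ck_on k Z.D (\<lambda>z. A z v)" for v
      unfolding A_def
      by (rule Ck_on_compose[OF Z.oD Om(1) im Suc smooth_onD[OF smooth_on_FD[OF Om(3)]]])
    have EC: "Ck_on k Z.D (\<lambda>z. E (y z))"
      by (rule Ck_on_compose[OF Z.oD Om(1) im Suc smooth_onD[OF Om(3)]])
    show ?case
    proof (rule Ck_on_SucI[OF Z.oD dy])
      show "Ck_on k Z.D (\<lambda>z. (\<Sum>b\<in>Basis. (fst h \<bullet> b) *\<^sub>R Z z b) + snd h *\<^sub>R E (y z))" for h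
        by (intro Ck_on_add Ck_on_sum Ck_on_scaleR Ck_on_const Z.oD Z.CkZ AC EC)
    qed
  qed
  then have "smooth_on (ball x0 R \<times> {-\<tau><..<\<tau>}) y" unfolding X_def[symmetric] by (rule smooth_onI)
  then show thesis
    by (rule that[OF R \<tau>(1)]) (use Y0 YOm dY \<tau>(2) in \<open>auto simp: y_def X_def\<close>)
qed

text \<open>The potential is the integral of \<theta> along the ray from x0. Closedness exchanges
  the two vectors in the differentiated integrand, which becomes the r-derivative of r times
  \<theta> at the moving point, applied to h; integrating it from 0 to 1 leaves
  \<open>\<theta> x h\<close>.\<close>

lemma poincare:
  fixes \<theta> :: "'a::euclidean_space \<Rightarrow> 'a \<Rightarrow> real"
  assumes B: "ball x0 e \<subseteq> \<Omega>" "open \<Omega>" "e > 0"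
    and lin: "\<And>q. q \<in> \<Omega> \<Longrightarrow> linear (\<theta> q)" and sm: "\<And>v. smooth_on \<Omega> (\<lambda>q. \<theta> q v)"
    and closed: "\<And>q u v. q \<in> \<Omega> \<Longrightarrow> FD (\<lambda>q. \<theta> q v) q u = FD (\<lambda>q. \<theta> q u) q v"
  obtains u where "smooth_on (ball x0 e) u" "\<And>x. x \<in> ball x0 e \<Longrightarrow> (u has_derivative \<theta> x) (at x)" "u x0 = 0"
proof -
  define m where "m = (\<lambda>p::real \<times> 'a. x0 + fst p *\<^sub>R (snd p - x0))"
  have cm: "continuous_on UNIV m" unfolding m_def by (intro continuous_intros)
  define T where "T = m -` \<Omega>"
  have oT: "open T" unfolding T_def using cm B(2) by (simp add: open_vimage)
  have sm_m: "smooth_on T m" unfolding m_def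
    by (intro smooth_on_add smooth_on_scaleR smooth_on_diff smooth_on_const smooth_on_fst smooth_on_snd smooth_on_ident oT)
  have mB: "m (r, x) \<in> ball x0 e" if "r \<in> {0..1}" "x \<in> ball x0 e" for r x
  proof -
    have "m (r, x) = (1 - r) *\<^sub>R x0 + r *\<^sub>R x" by (simp add: m_def algebra_simps)
    also have "\<dots> \<in> ball x0 e" using that B(3) convex_ball[of x0 e] unfolding convex_alt by auto
    finally show ?thesis .
  qed
  have mT: "(r, x) \<in> T" if "r \<in> {0..1}" "x \<in> ball x0 e" for r x using mB[OF that] B(1) by (auto simp: T_def)
  define K where "K p = \<theta> (m p) (snd p - x0)" for p
  have smK: "smooth_on T K" unfolding K_def
  proof (rule smooth_on_linfam[of T "\<lambda>p. \<theta> (m p)", OF oT])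
    show "smooth_on T (\<lambda>x. \<theta> (m x) v)" for v
      by (rule smooth_on_compose[OF oT B(2) _ sm_m sm]) (simp add: T_def)
    show "smooth_on T (\<lambda>x. snd x - x0)"
      by (intro smooth_on_diff smooth_on_snd smooth_on_ident smooth_on_const oT)
  qed (use lin T_def in auto)
  define u where "u x = integral {0..1} (\<lambda>r. K (r, x))" for x
  have s: "smooth_on (ball x0 e) u" unfolding u_def
    by (rule smooth_on_integral[OF oT open_ball mT smK])
  have d: "(u has_derivative \<theta> x) (at x)" if x: "x \<in> ball x0 e" for x
  proof -
    have 1: "(u has_derivative (\<lambda>h. integral {0..1} (\<lambda>r. FD K (r, x) (0, h)))) (at x)"
      unfolding u_def by (rule Ck_on_integral(2)[OF oT open_ball mT smooth_onD[OF smK] x])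
    have FDK: "FD K (r, x) (0, h) = FD (\<lambda>q. \<theta> q (x - x0)) (m (r, x)) (r *\<^sub>R h) + \<theta> (m (r, x)) h"
      if r: "r \<in> {0..1}" for r h
    proof -
      have dm: "(m has_derivative (\<lambda>h. fst h *\<^sub>R (x - x0) + r *\<^sub>R snd h)) (at (r, x))"
        unfolding m_def by (auto intro!: derivative_eq_intros simp: algebra_simps)
      have mO: "m (r, x) \<in> \<Omega>" using mT[OF r x] by (simp add: T_def)
      have "(K has_derivative (\<lambda>h. FD (\<lambda>q. \<theta> q (snd (r, x) - x0)) (m (r, x)) (fst h *\<^sub>R (x - x0) + r *\<^sub>R snd h) + \<theta> (m (r, x)) (snd h))) (at (r, x))"
        unfolding K_def
      proof (rule has_derivative_linfam[OF oT mT[OF r x], where A' = "\<lambda>v h. FD (\<lambda>q. \<theta> q v) (m (r, x)) (fst h *\<^sub>R (x - x0) + r *\<^sub>R snd h)"])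
        show "((\<lambda>y. \<theta> (m y) v) has_derivative (\<lambda>h. FD (\<lambda>q. \<theta> q v) (m (r, x)) (fst h *\<^sub>R (x - x0) + r *\<^sub>R snd h))) (at (r, x))" for v
          by (rule has_derivative_compose[OF dm smooth_on_has_derivative[OF sm mO]])
        show "((\<lambda>p. snd p - x0) has_derivative snd) (at (r, x))" by (auto intro!: derivative_eq_intros)
      qed (use lin in \<open>simp add: T_def\<close>)
      from FD_eq[OF this] show ?thesis by simp
    qed
    have "integral {0..1} (\<lambda>r. FD K (r, x) (0, h)) = \<theta> x h" for h
    proof -
      have "((\<lambda>r. FD K (r, x) (0, h)) has_integral (1 *\<^sub>R \<theta> (m (1, x)) h - 0 *\<^sub>R \<theta> (m (0, x)) h)) {0..1}"
      proof (rule fundamental_theorem_of_calculus)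
        fix r :: real assume r: "r \<in> {0..1}"
        have mO: "m (r, x) \<in> \<Omega>" using mT[OF r x] by (simp add: T_def)
        have dm: "((\<lambda>r. m (r, x)) has_derivative (\<lambda>s. s *\<^sub>R (x - x0))) (at r)"
          unfolding m_def by (auto intro!: derivative_eq_intros)
        note lF = smooth_on_linear[OF sm mO]
        \<comment> \<open>Here closedness acts: the derivative of \<theta> in direction h, applied
          to x - x0, is replaced by its derivative along the ray, applied to h.\<close>
        have FDK': "FD K (r, x) (0, h) = r * FD (\<lambda>q. \<theta> q h) (m (r, x)) (x - x0) + \<theta> (m (r, x)) h"
          unfolding FDK[OF r] using closed[OF mO, of "x - x0" h] by (simp add: linear_cmul[OF lF])
        have "((\<lambda>r. \<theta> (m (r, x)) h) has_derivative (\<lambda>s. FD (\<lambda>q. \<theta> q h) (m (r, x)) (s *\<^sub>R (x - x0)))) (at r)"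
          by (rule has_derivative_compose[OF dm smooth_on_has_derivative[OF sm mO]])
        from has_derivative_scaleR[OF has_derivative_ident this]
        have "((\<lambda>r. r *\<^sub>R \<theta> (m (r, x)) h) has_derivative (\<lambda>s. s *\<^sub>R FD K (r, x) (0, h))) (at r)"
          unfolding FDK'
          by (rule has_derivative_eq_rhs) (simp add: linear_cmul[OF lF] distrib_left mult.left_commute add.commute)
        then show "((\<lambda>r. r *\<^sub>R \<theta> (m (r, x)) h) has_vector_derivative FD K (r, x) (0, h)) (at r within {0..1})"
          unfolding has_vector_derivative_def by (rule has_derivative_at_withinI)
      qed simp
      from integral_unique[OF this] show ?thesis by (simp add: m_def)
    qed
    then show ?thesis using 1 by simp
  qed
  have "u x0 = 0" unfolding u_def K_def m_def using B lin[of x0] by (auto simp: linear_0 subset_eq)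
  with s d that show thesis by blast
qed

lemma pair_in_ball:
  fixes x a :: "'x::real_normed_vector" and s b :: "'y::real_normed_vector"
  assumes "dist a x < r / 2" "dist b s < r / 2" shows "(x, s) \<in> ball (a, b) r"
  using assms norm_Pair_le[of "a - x" "b - s"] by (simp add: dist_norm)

text \<open>The flow box of \<open>E\<close>, with the time parameter shifted so that the potential of the closed
  form \<open>\<theta>\<close> becomes the first coordinate.\<close>

lemma straightening:
  fixes E :: "'f::euclidean_space \<Rightarrow> 'f" and \<theta> :: "'f \<Rightarrow> 'f \<Rightarrow> real"
  assumes Om: "open \<Omega>" "x0 \<in> \<Omega>" and E: "smooth_on \<Omega> E"
    and lin: "\<And>q. q \<in> \<Omega> \<Longrightarrow> linear (\<theta> q)" and sm: "\<And>v. smooth_on \<Omega> (\<lambda>q. \<theta> q v)"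
    and closed: "\<And>q u v. q \<in> \<Omega> \<Longrightarrow> FD (\<lambda>q. \<theta> q v) q u = FD (\<lambda>q. \<theta> q u) q v"
    and one: "\<And>q. q \<in> \<Omega> \<Longrightarrow> \<theta> q (E q) = 1"
    and dim: "DIM('f) = DIM('k::euclidean_space) + 1"
  obtains U \<epsilon> and H :: "'f \<Rightarrow> real \<times> ('k::euclidean_space)" and \<Psi> where "open U" "x0 \<in> U" "U \<subseteq> \<Omega>" "\<epsilon> > 0"
    "\<Psi> ` ({-\<epsilon><..<\<epsilon>} \<times> ball 0 \<epsilon>) = U"
    "\<And>z. z \<in> {-\<epsilon><..<\<epsilon>} \<times> ball 0 \<epsilon> \<Longrightarrow> H (\<Psi> z) = z"
    "smooth_on ({-\<epsilon><..<\<epsilon>} \<times> ball 0 \<epsilon>) \<Psi>" "smooth_on U H"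
    "\<And>z. z \<in> {-\<epsilon><..<\<epsilon>} \<times> ball 0 \<epsilon> \<Longrightarrow> FD \<Psi> z (1, 0) = E (\<Psi> z)"
    "\<And>y. y \<in> U \<Longrightarrow> ((\<lambda>y. fst (H y)) has_derivative \<theta> y) (at y)"
proof -
  obtain R \<tau> \<phi> where R: "R > 0" "\<tau> > 0" and \<phi>: "smooth_on (ball x0 R \<times> {-\<tau><..<\<tau>}) \<phi>"
    and \<phi>0: "\<And>x. x \<in> ball x0 R \<Longrightarrow> \<phi> (x, 0) = x"
    and \<phi>d: "\<And>x s. x \<in> ball x0 R \<Longrightarrow> \<bar>s\<bar> < \<tau> \<Longrightarrow> ((\<lambda>s. \<phi> (x, s)) has_vector_derivative E (\<phi> (x, s))) (at s)"
    using smooth_flow_exists[OF Om E] by metis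
  obtain e where e: "e > 0" "ball x0 e \<subseteq> \<Omega>" using Om openE by blast
  obtain u where u: "smooth_on (ball x0 e) u" "\<And>x. x \<in> ball x0 e \<Longrightarrow> (u has_derivative \<theta> x) (at x)" "u x0 = 0"
    using poincare[OF e(2) Om(1) e(1) lin sm closed] by blast
  define W where "W = ball x0 R \<times> {-\<tau><..<\<tau>}"
  have oW: "open W" unfolding W_def by (intro open_Times) auto
  have c\<phi>: "continuous_on W \<phi>" using smooth_on_continuous[OF \<phi>] by (simp add: W_def)
  have oW': "open (W \<inter> \<phi> -` ball x0 e)" by (rule continuous_open_preimage[OF c\<phi> oW open_ball])
  moreover have "(x0, 0) \<in> W \<inter> \<phi> -` ball x0 e" using \<phi>0[of x0] R e by (auto simp: W_def)
  ultimately obtain d where d: "d > 0" "ball (x0, 0) d \<subseteq> W \<inter> \<phi> -` ball x0 e" using openE by blast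
  define \<delta> where "\<delta> = min (d / 2) e"
  have \<delta>: "\<delta> > 0" "\<delta> \<le> e" using d e by (auto simp: \<delta>_def)
  have in\<delta>: "(x, s) \<in> W" "\<phi> (x, s) \<in> ball x0 e" if "x \<in> ball x0 \<delta>" "\<bar>s\<bar> < \<delta>" for x s
  proof -
    have "(x, s) \<in> ball (x0, 0) d" by (rule pair_in_ball) (use that in \<open>auto simp: \<delta>_def\<close>)
    then show "(x, s) \<in> W" "\<phi> (x, s) \<in> ball x0 e" using d(2) by auto
  qed
  \<comment> \<open>Since \<theta> is 1 on E, the potential increases with unit speed along the
    flow. The estimate with L = 0 and \<epsilon> = 0 shows that a function with derivative zero
    stays zero.\<close>
  have u\<phi>: "u (\<phi> (x, s)) = u x + s" if x: "x \<in> ball x0 \<delta>" and s: "\<bar>s\<bar> < \<delta>" for x s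
  proof -
    have "norm (u (\<phi> (x, s)) - (u x + s)) \<le> 2 * \<delta> * 0"
    proof (rule short_time_bound[of 0, OF _ _ _ _ _ s, where r = "\<lambda>s. u (\<phi> (x, s)) - (u x + s)" and r' = "\<lambda>s. 0"])
      fix s assume s: "\<bar>s\<bar> < \<delta>"
      have W: "x \<in> ball x0 R" "\<bar>s\<bar> < \<tau>" using in\<delta>(1)[OF x s] by (auto simp: W_def)
      have \<phi>O: "\<phi> (x, s) \<in> \<Omega>" using in\<delta>(2)[OF x s] e(2) by blast
      have "((\<lambda>s. u (\<phi> (x, s))) has_derivative (\<lambda>h. \<theta> (\<phi> (x, s)) (h *\<^sub>R E (\<phi> (x, s))))) (at s)"
        using has_derivative_compose[OF \<phi>d[OF W, unfolded has_vector_derivative_def] u(2)[OF in\<delta>(2)[OF x s]]] .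
      then have "((\<lambda>s. u (\<phi> (x, s))) has_vector_derivative 1) (at s)"
        unfolding has_vector_derivative_def using one[OF \<phi>O] by (simp add: linear_cmul[OF lin[OF \<phi>O]])
      moreover have "((\<lambda>s. u x + s) has_vector_derivative 1) (at s)"
        by (auto intro!: derivative_eq_intros)
      ultimately have "((\<lambda>s. u (\<phi> (x, s)) - (u x + s)) has_vector_derivative 1 - 1) (at s)"
        by (rule has_vector_derivative_diff)
      then show "((\<lambda>s. u (\<phi> (x, s)) - (u x + s)) has_vector_derivative 0) (at s)" by simp
    next
      have "x \<in> ball x0 R" using in\<delta>(1)[OF x, of 0] \<delta> by (auto simp: W_def)
      then show "u (\<phi> (x, 0)) - (u x + 0) = 0" using \<phi>0 by simp
    qed auto
    then show ?thesis by simp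
  qed
  \<comment> \<open>The vector representing \<theta> at x0. Its orthogonal hyperplane is the kernel
    of \<theta> there; \<kappa> parametrises it by the type \<open>'k\<close> of one dimension
    less.\<close>
  define w where "w = (\<Sum>b\<in>Basis. \<theta> x0 b *\<^sub>R b)"
  have \<theta>w: "\<theta> x0 v = w \<bullet> v" for v
    using linear_expand[OF lin[OF Om(2)], of v] unfolding w_def inner_sum_left inner_scaleR_left real_scaleR_def
    by (simp add: inner_commute[of v] mult.commute)
  have w0: "w \<noteq> 0" using \<theta>w[of "E x0"] one[OF Om(2)] by auto
  have "dim {v. w \<bullet> v = 0} = dim (UNIV :: 'k set)"
    using dim_hyperplane[OF w0] dim by simp
  then obtain \<kappa> :: "'k \<Rightarrow> 'f" where \<kappa>: "linear \<kappa>" "range \<kappa> = {v. w \<bullet> v = 0}" "inj \<kappa>"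
    using subspace_isomorphism[OF subspace_UNIV subspace_hyperplane[of w]] by auto
  have \<theta>\<kappa>: "\<theta> x0 (\<kappa> t) = 0" for t using \<kappa>(2) \<theta>w by auto
  have bl\<kappa>: "bounded_linear \<kappa>" using \<kappa>(1) linear_conv_bounded_linear by blast
  define j where "j = (\<lambda>z::real \<times> 'k. x0 + \<kappa> (snd z))"
  \<comment> \<open>Start at the point \<open>j z\<close> of the affine hyperplane and flow for the
    time \<open>fst z - u (j z)\<close>. The potential at the end point is then exactly
    \<open>fst z\<close>.\<close>
  define m where "m = (\<lambda>z::real \<times> 'k. (j z, fst z - u (j z)))"
  have sj: "smooth_on S j" if "open S" for S unfolding j_def
    by (intro smooth_on_add smooth_on_const smooth_on_bounded_linear[OF bl\<kappa>] smooth_on_snd smooth_on_ident that)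
  define S1 where "S1 = j -` ball x0 \<delta>"
  have oS1: "open S1" unfolding S1_def using smooth_on_continuous[OF sj[OF open_UNIV]] by (simp add: open_vimage)
  have sm_m: "smooth_on S1 m" unfolding m_def
    by (intro smooth_on_Pair smooth_on_diff smooth_on_fst smooth_on_ident sj oS1
        smooth_on_compose[of S1 "ball x0 e" j u]) (use \<delta> u in \<open>auto simp: S1_def\<close>)
  define S0 where "S0 = S1 \<inter> m -` (ball x0 \<delta> \<times> {-\<delta><..<\<delta>})"
  have oS0: "open S0" unfolding S0_def
    by (rule continuous_open_preimage[OF smooth_on_continuous[OF sm_m] oS1]) (auto intro!: open_Times)
  have S0: "j z \<in> ball x0 \<delta>" "\<bar>fst z - u (j z)\<bar> < \<delta>" if "z \<in> S0" for z
    using that by (auto simp: S0_def m_def abs_less_iff)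
  define G where "G z = \<phi> (m z)" for z
  have mW: "m z \<in> W" if "z \<in> S0" for z using in\<delta>(1)[OF S0[OF that]] by (simp add: m_def)
  have sG: "smooth_on S0 G" unfolding G_def
    by (rule smooth_on_compose[OF oS0 oW mW smooth_on_subset[OF sm_m] \<phi>[folded W_def]]) (auto simp: S0_def)
  have uG: "u (G z) = fst z" "G z \<in> ball x0 e" if "z \<in> S0" for z
    using u\<phi>[OF S0[OF that]] in\<delta>(2)[OF S0[OF that]] by (simp_all add: G_def m_def)
  have j0: "j 0 = x0" using \<kappa>(1) by (simp add: j_def linear_0)
  have z0: "0 \<in> S0" using \<delta> by (auto simp: S0_def S1_def m_def j0 u(3))
  have G0: "G 0 = x0" unfolding G_def m_def j0 using u(3) \<phi>0[of x0] R by simp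
  have dG1: "FD G z (1, 0) = E (G z)" if z: "z \<in> S0" for z
  proof -
    obtain s t where st: "z = (s, t)" by (cases z)
    define c where "c = u (j z)"
    have jst: "j (s', t) = j z" for s' by (simp add: j_def st)
    have W: "j z \<in> ball x0 R" "\<bar>s - c\<bar> < \<tau>" using mW[OF z] by (auto simp: W_def m_def st c_def abs_less_iff)
    have "((\<lambda>s'. s' - c) has_derivative (\<lambda>h. h)) (at s)" by (auto intro!: derivative_eq_intros)
    from has_derivative_compose[OF this \<phi>d[OF W, unfolded has_vector_derivative_def]]
    have 1: "((\<lambda>s'. \<phi> (j z, s' - c)) has_derivative (\<lambda>h. h *\<^sub>R E (G z))) (at s)"
      by (simp add: G_def m_def c_def st)
    have "((\<lambda>s'. G (s', t)) has_derivative (\<lambda>h. FD G z (h, 0))) (at s)"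
      by (rule has_derivative_compose[OF has_derivative_Pair[OF has_derivative_ident has_derivative_const]])
        (use smooth_on_has_derivative[OF sG z] st in simp)
    moreover have "(\<lambda>s'. G (s', t)) = (\<lambda>s'. \<phi> (j z, s' - c))"
      by (rule ext) (simp add: G_def m_def jst c_def)
    ultimately have "(\<lambda>h. FD G z (h, 0)) = (\<lambda>h. h *\<^sub>R E (G z))" using has_derivative_unique[OF 1] by metis
    from fun_cong[OF this, of 1] show ?thesis by simp
  qed
  \<comment> \<open>The hyperplane is tangent to the kernel of \<theta> at x0, so the time shift
    \<open>u (j z)\<close> contributes nothing to first order and \<kappa> remains. Together with E,
    on which \<theta> is 1, this makes the derivative at 0 injective.\<close>
  have dG2: "FD G 0 (0, t) = \<kappa> t" for t
  proof -
    have "(j has_derivative (\<lambda>h. 0 + \<kappa> (snd h))) (at 0)" unfolding j_def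
      by (intro has_derivative_add has_derivative_const bounded_linear.has_derivative[OF bl\<kappa>]
          has_derivative_snd has_derivative_ident)
    then have dj: "(j has_derivative (\<lambda>h. \<kappa> (snd h))) (at 0)" by simp
    have "(u has_derivative \<theta> x0) (at (j 0))" unfolding j0 using u(2) e(1) by simp
    from has_derivative_compose[OF dj this]
    have "((\<lambda>z. u (j z)) has_derivative (\<lambda>h. 0)) (at 0)" by (simp add: \<theta>\<kappa>)
    from has_derivative_Pair[OF dj has_derivative_diff[OF has_derivative_fst[OF has_derivative_ident] this]]
    have dm: "(m has_derivative (\<lambda>h. (\<kappa> (snd h), fst h))) (at 0)" by (simp add: m_def)
    have m0: "m 0 = (x0, 0)" by (simp add: m_def j0 u(3))
    have x0W: "(x0, 0) \<in> W" using R by (simp add: W_def)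
    have d\<phi>: "(\<phi> has_derivative FD \<phi> (x0, 0)) (at (x0, 0))"
      using smooth_on_has_derivative[OF \<phi>[folded W_def] x0W] .
    have "((\<lambda>x. \<phi> (x, 0)) has_derivative (\<lambda>h. FD \<phi> (x0, 0) (h, 0))) (at x0)"
      by (rule has_derivative_compose[OF has_derivative_Pair[OF has_derivative_ident has_derivative_const] d\<phi>])
    then have "((\<lambda>x. x) has_derivative (\<lambda>h. FD \<phi> (x0, 0) (h, 0))) (at x0)"
      by (rule has_derivative_transform_within_open[where s = "ball x0 R"]) (use \<phi>0 R in auto)
    from has_derivative_unique[OF has_derivative_ident this]
    have \<phi>h: "FD \<phi> (x0, 0) (h, 0) = h" for h by metis
    have "(G has_derivative (\<lambda>h. FD \<phi> (x0, 0) (\<kappa> (snd h), fst h))) (at 0)"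
      unfolding G_def[abs_def] using has_derivative_compose[OF dm, of \<phi>] d\<phi> m0 by simp
    from FD_eq[OF this] show ?thesis by (simp add: \<phi>h)
  qed
  have lG: "linear (FD G 0)" by (rule smooth_on_linear[OF sG z0])
  have "v = 0" if "FD G 0 v = 0" for v
  proof -
    obtain s t where v: "v = (s, t)" by (cases v)
    have "v = s *\<^sub>R (1, 0) + (0, t)" by (simp add: v)
    then have "FD G 0 v = s *\<^sub>R E x0 + \<kappa> t"
      using linear_add[OF lG] linear_cmul[OF lG] dG1[OF z0] dG2 G0 by metis
    then have eq: "s *\<^sub>R E x0 + \<kappa> t = 0" using that by simp
    have "\<theta> x0 (s *\<^sub>R E x0 + \<kappa> t) = s"
      using one[OF Om(2)] \<theta>\<kappa> by (simp add: linear_add[OF lin[OF Om(2)]] linear_cmul[OF lin[OF Om(2)]])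
    then have "s = 0" using eq linear_0[OF lin[OF Om(2)]] by simp
    then have "\<kappa> t = 0" using eq by simp
    then have "t = 0" using \<kappa>(1,3) by (metis injD linear_0)
    with \<open>s = 0\<close> show ?thesis by (simp add: v zero_prod_def)
  qed
  then have injG: "inj (FD G 0)" using linear_injective_0[OF lG] by blast
  obtain U1 V1 g where UV: "open U1" "0 \<in> U1" "U1 \<subseteq> S0" "open V1" "G ` U1 = V1" "smooth_on V1 g"
    and gG: "\<And>z. z \<in> U1 \<Longrightarrow> g (G z) = z" and Gg: "\<And>y. y \<in> V1 \<Longrightarrow> g y \<in> U1 \<and> G (g y) = y"
    using smooth_inverse_function[OF oS0 z0 sG _ injG] dim by (auto simp: add.commute)
  obtain e' where e': "e' > 0" "ball 0 e' \<subseteq> U1" using UV(1,2) openE by blast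
  \<comment> \<open>Half the radius, because the norm of a pair is bounded by the sum of the norms
    of its components.\<close>
  define \<epsilon> where "\<epsilon> = e' / 2"
  define Q where "Q = {-\<epsilon><..<\<epsilon>} \<times> ball (0::'k) \<epsilon>"
  have QU: "Q \<subseteq> U1"
  proof
    fix z assume "z \<in> Q"
    then have "(fst z, snd z) \<in> ball (0, 0) e'"
      by (intro pair_in_ball) (auto simp: Q_def \<epsilon>_def dist_norm)
    then show "z \<in> U1" using e'(2) by (auto simp: zero_prod_def)
  qed
  have oQ: "open Q" unfolding Q_def by (intro open_Times) auto
  define U where "U = G ` Q"
  have UV1: "U \<subseteq> V1" using QU UV(5) by (auto simp: U_def)
  have Ueq: "U = V1 \<inter> g -` Q" using gG Gg QU UV(5) by (force simp: U_def)
  have oU: "open U" unfolding Ueq by (rule continuous_open_preimage[OF smooth_on_continuous[OF UV(6)] UV(4) oQ])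
  show thesis
  proof (rule that[of U \<epsilon> G g, folded Q_def])
    show "open U" by (rule oU)
    show "0 < \<epsilon>" using e' by (simp add: \<epsilon>_def)
    then have "0 \<in> Q" by (simp add: Q_def zero_prod_def)
    then show "x0 \<in> U" unfolding U_def using G0 by (metis image_eqI)
    show "U \<subseteq> \<Omega>" using uG(2) QU UV(3) e(2) by (force simp: U_def)
    show "G ` Q = U" by (simp add: U_def)
    show "g (G z) = z" if "z \<in> Q" for z using gG QU that by blast
    show "smooth_on Q G" by (rule smooth_on_subset[OF sG]) (use QU UV(3) in blast)
    show "smooth_on U g" by (rule smooth_on_subset[OF UV(6) UV1])
    show "FD G z (1, 0) = E (G z)" if "z \<in> Q" for z using dG1 that QU UV(3) by blast
    show "((\<lambda>y. fst (g y)) has_derivative \<theta> y) (at y)" if y: "y \<in> U" for y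
    proof -
      have Ue: "U \<subseteq> ball x0 e" using uG(2) QU UV(3) by (force simp: U_def)
      have yB: "y \<in> ball x0 e" using y Ue by blast
      have ug: "u y' = fst (g y')" if "y' \<in> U" for y'
        using that gG uG(1) QU UV(3) by (force simp: U_def)
      show ?thesis
        by (rule has_derivative_transform_within_open[OF u(2)[OF yB] oU y ug])
    qed
  qed
qed

section \<open>Riemannian metrics in coordinates\<close>

lemma smooth_on_bilfam:
  fixes A :: "'a::real_normed_vector \<Rightarrow> 'b::euclidean_space \<Rightarrow> 'c::euclidean_space \<Rightarrow> 'd::real_normed_vector"
  assumes "open S" "\<And>x. x \<in> S \<Longrightarrow> bilinear (A x)" "\<And>v w. smooth_on S (\<lambda>x. A x v w)"
    "smooth_on S a" "smooth_on S b"
  shows "smooth_on S (\<lambda>x. A x (a x) (b x))"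
proof (rule smooth_on_linfam[of S "\<lambda>x. A x (a x)" b])
  show "linear (A x (a x))" if "x \<in> S" for x using assms(2)[OF that] by (simp add: bilinear_def)
  show "smooth_on S (\<lambda>x. A x (a x) w)" for w
    by (rule smooth_on_linfam[of S "\<lambda>x v. A x v w" a])
      (use assms in \<open>auto simp: bilinear_def\<close>)
qed (use assms in auto)

lemma has_derivative_bilfam:
  fixes A :: "'a::real_normed_vector \<Rightarrow> 'b::euclidean_space \<Rightarrow> 'c::euclidean_space \<Rightarrow> 'd::real_normed_vector"
  assumes S: "open S" "x \<in> S" and bil: "\<And>y. y \<in> S \<Longrightarrow> bilinear (A y)"
    and A': "\<And>v w. ((\<lambda>y. A y v w) has_derivative A' v w) (at x)"
    and a: "(a has_derivative a') (at x)" and b: "(b has_derivative b') (at x)"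
  shows "((\<lambda>y. A y (a y) (b y)) has_derivative
    (\<lambda>h. A' (a x) (b x) h + A x (a' h) (b x) + A x (a x) (b' h))) (at x)"
proof -
  have "((\<lambda>y. A y (a y) w) has_derivative (\<lambda>h. A' (a x) w h + A x (a' h) w)) (at x)" for w
    by (rule has_derivative_linfam[where A = "\<lambda>y v. A y v w", OF S _ A' a])
      (use bil in \<open>auto simp: bilinear_def\<close>)
  note * = this
  have "linear (A y (a y))" if "y \<in> S" for y using bil[OF that] by (simp add: bilinear_def)
  from has_derivative_linfam[OF S this * b] show ?thesis .
qed

lemma bilinear_simps:
  assumes "bilinear B"
  shows "B (x + y) z = B x z + B y z" "B z (x + y) = B z x + B z y"
    "B (x - y) z = B x z - B y z" "B z (x - y) = B z x - B z y"
    "B (r *\<^sub>R x) z = r *\<^sub>R B x z" "B z (r *\<^sub>R x) = r *\<^sub>R B z x"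
    "B (- x) z = - B x z" "B z (- x) = - B z x" "B 0 z = 0" "B z 0 = 0"
  by (simp_all add: bilinear_ladd[OF assms] bilinear_radd[OF assms] bilinear_lsub[OF assms] bilinear_rsub[OF assms]
      bilinear_lmul[OF assms] bilinear_rmul[OF assms] bilinear_lneg[OF assms] bilinear_rneg[OF assms]
      bilinear_lzero[OF assms] bilinear_rzero[OF assms])

text \<open>Polarisation. Four Bianchi identities give symmetry under exchange of the two pairs.
  Polarising \<open>S u v v u = 0\<close> in the inner and then in the outer arguments makes S skew
  in the first and fourth, hence also in the second and third arguments. With the skewness in the
  first two, S is invariant under cyclic permutation of the first three, and Bianchi turns into
  three times S being zero.\<close>

lemma curvature_like_zero:
  fixes S :: "'a::real_vector \<Rightarrow> 'a \<Rightarrow> 'a \<Rightarrow> 'a \<Rightarrow> real"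
  assumes add1: "\<And>a b v w z. S (a + b) v w z = S a v w z + S b v w z"
    and add2: "\<And>u a b w z. S u (a + b) w z = S u a w z + S u b w z"
    and add3: "\<And>u v a b z. S u v (a + b) z = S u v a z + S u v b z"
    and add4: "\<And>u v w a b. S u v w (a + b) = S u v w a + S u v w b"
    and sk12: "\<And>u v w z. S u v w z = - S v u w z"
    and sk34: "\<And>u v w z. S u v w z = - S u v z w"
    and bianchi: "\<And>u v w z. S u v w z + S v w u z + S w u v z = 0"
    and sec: "\<And>u v. S u v v u = 0"
  shows "S u v w z = 0"
proof -
  have pair: "S u v w z = S w z u v" for u v w z
  proof -
    have "S v w z u = - S v w u z" "S w z v u = - S w z u v" "S z v w u = - S v z w u"
      "S z u w v = S u z v w" "S u w z v = S w u v z" "S z u v w = - S u z v w"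
      "S u v z w = - S u v w z" "S v z u w = - S v z w u"
      using sk34[of v w z u] sk34[of w z v u] sk12[of z v w u] sk12[of z u w v] sk34[of u z w v]
        sk12[of u w z v] sk34[of w u z v] sk12[of z u v w] sk34[of u v z w] sk34[of v z u w] by simp_all
    then show ?thesis
      using bianchi[of u v w z] bianchi[of v w z u] bianchi[of w z u v] bianchi[of z u v w] by simp
  qed
  have 1: "S u v w u = 0" for u v w
    using sec[of u "v + w"] sec[of u v] sec[of u w] pair[of u w v u] sk12[of v u u w] sk34[of u v u w]
    by (simp add: add2 add3)
  have 2: "S u v w z = - S z v w u" for u v w z
    using 1[of "u + z" v w] 1[of u v w] 1[of z v w] by (simp add: add1 add4)
  have 3: "S u v w z = - S u w v z" for u v w z
    using 2[of u v w z] pair[of z v w u] sk34[of w u z v] sk12[of w u v z] by linarith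
  have "S u v w z = S v w u z" for u v w z
    using 3[of v u w z] sk12[of u v w z] by simp
  from this[of u v w z] this[of v w u z] show ?thesis using bianchi[of u v w z] by simp
qed

lemma inner_functional: "linear l \<Longrightarrow> (\<Sum>b\<in>Basis. l b *\<^sub>R b) \<bullet> v = l v" for l :: "'x::euclidean_space \<Rightarrow> real"
  using linear_expand[of l v] by (simp add: inner_sum_left inner_commute[of v] mult.commute)

section \<open>Metric, Christoffel map and curvature on a coordinate domain\<close>

locale chart_metric =
  fixes \<Omega> :: "'e::euclidean_space set" and G :: "'e \<Rightarrow> 'e \<Rightarrow> 'e \<Rightarrow> real" and \<Gamma> :: "'e \<Rightarrow> 'e \<Rightarrow> 'e \<Rightarrow> 'e"
  assumes op: "open \<Omega>"
    and G_bil: "\<And>q. q \<in> \<Omega> \<Longrightarrow> bilinear (G q)" and G_sym: "\<And>q u v. q \<in> \<Omega> \<Longrightarrow> G q u v = G q v u"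
    and G_pos: "\<And>q u. q \<in> \<Omega> \<Longrightarrow> u \<noteq> 0 \<Longrightarrow> G q u u > 0"
    and G_smooth: "\<And>u v. smooth_on \<Omega> (\<lambda>q. G q u v)"
    and \<Gamma>_bil: "\<And>q. q \<in> \<Omega> \<Longrightarrow> bilinear (\<Gamma> q)" and \<Gamma>_sym: "\<And>q u v. q \<in> \<Omega> \<Longrightarrow> \<Gamma> q u v = \<Gamma> q v u"
    and \<Gamma>_smooth: "\<And>u v. smooth_on \<Omega> (\<lambda>q. \<Gamma> q u v)"
    and compat: "\<And>q u v w. q \<in> \<Omega> \<Longrightarrow> FD (\<lambda>q. G q v w) q u = G q (\<Gamma> q u v) w + G q v (\<Gamma> q u w)"
begin

lemma chart_metric_subset:
  assumes "open \<Omega>'" "\<Omega>' \<subseteq> \<Omega>" shows "chart_metric \<Omega>' G \<Gamma>"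
proof (rule chart_metric.intro)
  fix q u v w assume "q \<in> \<Omega>'"
  then have q: "q \<in> \<Omega>" using assms(2) by blast
  show "bilinear (G q)" by (rule G_bil[OF q])
  show "G q u v = G q v u" by (rule G_sym[OF q])
  show "u \<noteq> 0 \<Longrightarrow> 0 < G q u u" by (rule G_pos[OF q])
  show "bilinear (\<Gamma> q)" by (rule \<Gamma>_bil[OF q])
  show "\<Gamma> q u v = \<Gamma> q v u" by (rule \<Gamma>_sym[OF q])
  show "FD (\<lambda>q. G q v w) q u = G q (\<Gamma> q u v) w + G q v (\<Gamma> q u w)" by (rule compat[OF q])
qed (rule assms(1) smooth_on_subset[OF G_smooth assms(2)] smooth_on_subset[OF \<Gamma>_smooth assms(2)])+

lemma G_zero_iff: "q \<in> \<Omega> \<Longrightarrow> G q u u = 0 \<longleftrightarrow> u = 0"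
  using G_pos[of q u] bilinear_simps(9)[OF G_bil, of q 0] by force

lemma G_nondeg: "q \<in> \<Omega> \<Longrightarrow> (\<And>v. G q u v = 0) \<Longrightarrow> u = 0"
  using G_zero_iff by blast

text \<open>Compatibility for constant coordinate fields already implies the product rule for
  arbitrary fields along an arbitrary map f. With f the identity it serves fields on the domain;
  with f the immersion or a curve it serves fields along them.\<close>

lemma G_along:
  assumes S: "open S" "x \<in> S" and f: "\<And>y. y \<in> S \<Longrightarrow> f y \<in> \<Omega>" "(f has_derivative f') (at x)"
    and a: "(a has_derivative a') (at x)" and b: "(b has_derivative b') (at x)"
  shows "((\<lambda>y. G (f y) (a y) (b y)) has_derivative
    (\<lambda>h. G (f x) (a' h + \<Gamma> (f x) (f' h) (a x)) (b x) + G (f x) (a x) (b' h + \<Gamma> (f x) (f' h) (b x)))) (at x)"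
proof -
  have fx: "f x \<in> \<Omega>" using f(1) S(2) .
  have "((\<lambda>y. G (f y) v w) has_derivative (\<lambda>h. G (f x) (\<Gamma> (f x) (f' h) v) w + G (f x) v (\<Gamma> (f x) (f' h) w))) (at x)" for v w
    using has_derivative_compose[OF f(2) smooth_on_has_derivative[OF G_smooth fx]] unfolding compat[OF fx] .
  then have "((\<lambda>y. G (f y) (a y) (b y)) has_derivative
    (\<lambda>h. (G (f x) (\<Gamma> (f x) (f' h) (a x)) (b x) + G (f x) (a x) (\<Gamma> (f x) (f' h) (b x)))
      + G (f x) (a' h) (b x) + G (f x) (a x) (b' h))) (at x)"
    by (intro has_derivative_bilfam[OF S _ _ a b]) (rule G_bil[OF f(1)])
  then  show ?thesis
    by (rule has_derivative_eq_rhs, intro ext)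
      (simp add: bilinear_simps(1,2)[OF G_bil[OF fx]])
qed

lemma \<Gamma>_along:
  assumes S: "open S" "x \<in> S" and f: "\<And>y. y \<in> S \<Longrightarrow> f y \<in> \<Omega>" "(f has_derivative f') (at x)"
    and a: "(a has_derivative a') (at x)" and b: "(b has_derivative b') (at x)"
  shows "((\<lambda>y. \<Gamma> (f y) (a y) (b y)) has_derivative
    (\<lambda>h. FD (\<lambda>p. \<Gamma> p (a x) (b x)) (f x) (f' h) + \<Gamma> (f x) (a' h) (b x) + \<Gamma> (f x) (a x) (b' h))) (at x)"
proof -
  have fx: "f x \<in> \<Omega>" using f(1) S(2) .
  show ?thesis
    by (rule has_derivative_bilfam[OF S \<Gamma>_bil[OF f(1)] has_derivative_compose[OF f(2) smooth_on_has_derivative[OF \<Gamma>_smooth fx]] a b])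
qed

text \<open>The musical isomorphism, with covectors represented as vectors through the Euclidean
  inner product. As a smooth family of endomorphisms it has a smooth inverse family.\<close>

definition flat where "flat q u = (\<Sum>b\<in>Basis. G q u b *\<^sub>R b)"

lemma flat_inner: "q \<in> \<Omega> \<Longrightarrow> flat q u \<bullet> v = G q u v"
  unfolding flat_def by (rule inner_functional) (use G_bil[of q] in \<open>simp add: bilinear_def\<close>)

lemma flat_linear: assumes q: "q \<in> \<Omega>" shows "linear (flat q)"
  by (rule linearI)
    (simp_all add: flat_def bilinear_simps[OF G_bil[OF q]] scaleR_left_distrib sum.distrib scaleR_sum_right)

lemma flat_bij: assumes q: "q \<in> \<Omega>" shows "bij (flat q)"
proof -
  have "u = 0" if "flat q u = 0" for u
    using G_nondeg[OF q, of u] flat_inner[OF q, of u] that by simp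
  then have "inj (flat q)" using linear_injective_0[OF flat_linear[OF q]] by blast
  then show ?thesis using linear_inj_imp_surj[OF flat_linear[OF q]] by (simp add: bij_def)
qed

lemma riesz: assumes q: "q \<in> \<Omega>" and l: "linear l" shows "\<exists>t. \<forall>v. G q t v = l v"
proof -
  have "flat q (inv (flat q) (\<Sum>b\<in>Basis. l b *\<^sub>R b)) = (\<Sum>b\<in>Basis. l b *\<^sub>R b)"
    using flat_bij[OF q] by (simp add: bij_is_surj surj_f_inv_f)
  then show ?thesis using flat_inner[OF q] inner_functional[OF l] by metis
qed

text \<open>The curvature R(u,v)w of fields with constant components; their bracket vanishes, so no
  bracket term occurs.\<close>

definition curv :: "'e \<Rightarrow> 'e \<Rightarrow> 'e \<Rightarrow> 'e \<Rightarrow> 'e" where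
  "curv q u v w = FD (\<lambda>q. \<Gamma> q v w) q u - FD (\<lambda>q. \<Gamma> q u w) q v + \<Gamma> q u (\<Gamma> q v w) - \<Gamma> q v (\<Gamma> q u w)"

lemma FD_\<Gamma>_linear:
  assumes q: "q \<in> \<Omega>"
  shows "linear (\<lambda>u. FD (\<lambda>q. \<Gamma> q u w) q h)" "linear (\<lambda>w. FD (\<lambda>q. \<Gamma> q u w) q h)" "linear (FD (\<lambda>q. \<Gamma> q u w) q)"
proof -
  show "linear (\<lambda>u. FD (\<lambda>q. \<Gamma> q u w) q h)"
    by (rule linear_FD_parameter[OF op q, where A = "\<lambda>q u. \<Gamma> q u w"])
      (use \<Gamma>_bil smooth_on_differentiable[OF \<Gamma>_smooth q] in \<open>auto simp: bilinear_def\<close>)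
  show "linear (\<lambda>w. FD (\<lambda>q. \<Gamma> q u w) q h)"
    by (rule linear_FD_parameter[OF op q, where A = "\<lambda>q w. \<Gamma> q u w"])
      (use \<Gamma>_bil smooth_on_differentiable[OF \<Gamma>_smooth q] in \<open>auto simp: bilinear_def\<close>)
  show "linear (FD (\<lambda>q. \<Gamma> q u w) q)" by (rule smooth_on_linear[OF \<Gamma>_smooth q])
qed

lemma curv_add:
  assumes q: "q \<in> \<Omega>"
  shows "curv q (a + b) v w = curv q a v w + curv q b v w" "curv q v (a + b) w = curv q v a w + curv q v b w"
    "curv q u v (a + b) = curv q u v a + curv q u v b" "curv q (r *\<^sub>R a) v w = r *\<^sub>R curv q a v w"
  unfolding curv_def
  by (simp_all add: bilinear_simps[OF \<Gamma>_bil[OF q]] linear_add[OF FD_\<Gamma>_linear(1)[OF q]]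
      linear_add[OF FD_\<Gamma>_linear(2)[OF q]] linear_add[OF FD_\<Gamma>_linear(3)[OF q]]
      linear_cmul[OF FD_\<Gamma>_linear(1)[OF q]] linear_cmul[OF FD_\<Gamma>_linear(3)[OF q]] algebra_simps)

lemma curv_skew: "curv q u v w = - curv q v u w"
  by (simp add: curv_def)

lemma curv_bianchi:
  assumes q: "q \<in> \<Omega>" shows "curv q u v w + curv q v w u + curv q w u v = 0"
proof -
  have s: "FD (\<lambda>q. \<Gamma> q a b) q = FD (\<lambda>q. \<Gamma> q b a) q" for a b
    by (rule FD_cong[OF op q \<Gamma>_sym])
  show ?thesis unfolding curv_def
    using s[of u v] s[of v w] s[of u w] \<Gamma>_sym[OF q, of u v] \<Gamma>_sym[OF q, of v w] \<Gamma>_sym[OF q, of u w] by simp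
qed

text \<open>The second derivatives of the function \<open>G q w z\<close> commute. Expanding them by
  compatibility, the mixed products of Christoffel terms cancel and exactly the two curvature terms
  remain.\<close>

lemma curv_skew34:
  assumes q: "q \<in> \<Omega>" shows "G q (curv q u v w) z + G q w (curv q u v z) = 0"
proof -
  have D2: "FD (\<lambda>q. FD (\<lambda>q. G q w z) q b) q a =
     G q (FD (\<lambda>q. \<Gamma> q b w) q a + \<Gamma> q a (\<Gamma> q b w)) z + G q (\<Gamma> q b w) (\<Gamma> q a z)
     + (G q (\<Gamma> q a w) (\<Gamma> q b z) + G q w (FD (\<lambda>q. \<Gamma> q b z) q a + \<Gamma> q a (\<Gamma> q b z)))" for a b
  proof -
    have "FD (\<lambda>q. FD (\<lambda>q. G q w z) q b) q = FD (\<lambda>q. G q (\<Gamma> q b w) z + G q w (\<Gamma> q b z)) q"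
      by (rule FD_cong[OF op q compat])
    also have "\<dots> = (\<lambda>a. G q (FD (\<lambda>q. \<Gamma> q b w) q a + \<Gamma> q a (\<Gamma> q b w)) z + G q (\<Gamma> q b w) (0 + \<Gamma> q a z)
     + (G q (0 + \<Gamma> q a w) (\<Gamma> q b z) + G q w (FD (\<lambda>q. \<Gamma> q b z) q a + \<Gamma> q a (\<Gamma> q b z))))"
      by (intro FD_eq has_derivative_add G_along[OF op q, where f = "\<lambda>q. q"] has_derivative_const
          smooth_on_has_derivative[OF \<Gamma>_smooth q] has_derivative_ident)
    finally show ?thesis by simp
  qed
  have "FD (\<lambda>q. FD (\<lambda>q. G q w z) q v) q u = FD (\<lambda>q. FD (\<lambda>q. G q w z) q u) q v"
    by (rule smooth_FD_commute[OF op G_smooth q])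
  then show ?thesis unfolding D2 curv_def by (simp add: bilinear_simps[OF G_bil[OF q]])
qed

text \<open>The difference between the curvature and the model tensor is curvature-like. The
  assumption covers independent pairs; for dependent ones both sides of the sectional identity
  vanish, so all sectional values of the difference are zero.\<close>

lemma constant_curvature_tensor:
  assumes q: "q \<in> \<Omega>"
    and sec: "\<And>u v. u \<noteq> v \<Longrightarrow> independent {u, v} \<Longrightarrow>
      G q (curv q u v v) u = c * (G q u u * G q v v - (G q u v)\<^sup>2)"
  shows "G q (curv q u v w) z = c * (G q v w * G q u z - G q u w * G q v z)"
proof -
  note bG = bilinear_simps[OF G_bil[OF q]]
  have skew0: "curv q v v w = 0" for v w by (simp add: curv_def)
  have sec': "G q (curv q u v v) u = c * (G q u u * G q v v - (G q u v)\<^sup>2)" for u v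
  proof (cases "u \<noteq> v \<and> independent {u, v}")
    case False
    then consider r where "u = r *\<^sub>R v" | "v = 0"
    proof (cases "v = 0")
      case False
      assume *: "\<And>r. u = r *\<^sub>R v \<Longrightarrow> thesis" and "\<not> (u \<noteq> v \<and> independent {u, v})"
      then have "u = v \<or> u \<in> span {v}" using independent_insert[of u "{v}"] False
        by (auto split: if_splits)
      then show thesis using *[of 1] * by (auto simp: span_singleton)
    qed
    then show ?thesis
    proof cases
      case (1 r)
      then show ?thesis by (simp add: curv_add[OF q] skew0 bG power2_eq_square)
    next
      case 2
      have "curv q u 0 0 = 0" using curv_add(2)[OF q, of u 0 0 0] by simp
      then show ?thesis using 2 by (simp add: bG)
    qed
  qed (use sec in blast)
  define S where "S u v w z = G q (curv q u v w) z - c * (G q v w * G q u z - G q u w * G q v z)" for u v w z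
  have "S u v w z = 0"
  proof (rule curvature_like_zero[of S])
    show "S (a + b) v w z = S a v w z + S b v w z" "S u (a + b) w z = S u a w z + S u b w z"
      "S u v (a + b) z = S u v a z + S u v b z" "S u v w (a + b) = S u v w a + S u v w b" for a b u v w z
      unfolding S_def by (simp_all add: curv_add[OF q] bG algebra_simps)
    show "S u v w z = - S v u w z" for u v w z
      unfolding S_def using curv_skew[of q u v w] by (simp add: bG algebra_simps)
    show "S u v w z = - S u v z w" for u v w z
      unfolding S_def using curv_skew34[OF q, of u v w z] G_sym[OF q, of w "curv q u v z"] by (simp add: algebra_simps)
    show "S u v w z + S v w u z + S w u v z = 0" for u v w z
    proof -
      have "G q (curv q u v w) z + G q (curv q v w u) z + G q (curv q w u v) z = 0"
        using curv_bianchi[OF q, of u v w] bG(1,9) by metis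
      then show ?thesis unfolding S_def
        using G_sym[OF q, of u v] G_sym[OF q, of v w] G_sym[OF q, of u w] by (simp add: algebra_simps)
    qed
    show "S u v v u = 0" for u v
      unfolding S_def using sec'[of u v] G_sym[OF q, of u v] by (simp add: algebra_simps power2_eq_square)
  qed
  then show ?thesis by (simp add: S_def)
qed

end

section \<open>The second fundamental form in coordinates\<close>

locale chart_immersion = F: chart_metric \<Omega> G \<Gamma> + M: chart_metric \<Omega>' G' \<Gamma>'
  for \<Omega> :: "'f::euclidean_space set" and G \<Gamma> and \<Omega>' :: "'m::euclidean_space set" and G' \<Gamma>' +
  fixes f :: "'f \<Rightarrow> 'm"
  assumes f_smooth: "smooth_on \<Omega> f" and f_in: "\<And>q. q \<in> \<Omega> \<Longrightarrow> f q \<in> \<Omega>'"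
    and f_inj: "\<And>q. q \<in> \<Omega> \<Longrightarrow> inj (FD f q)"
    and f_isom: "\<And>q u v. q \<in> \<Omega> \<Longrightarrow> G q u v = G' (f q) (FD f q u) (FD f q v)"
begin

lemma chart_immersion_subset:
  assumes "open S" "S \<subseteq> \<Omega>" shows "chart_immersion S G \<Gamma> \<Omega>' G' \<Gamma>' f"
  using F.chart_metric_subset[OF assms] M.chart_metric_axioms
  by (intro chart_immersion.intro chart_immersion_axioms.intro)
    (use assms f_in f_inj f_isom smooth_on_subset[OF f_smooth assms(2)] in auto)

text \<open>The ambient covariant derivative of a field \<zeta> along the immersion, the same
  operation as \<open>conn_along\<close> but in coordinates and without a choice of
  extension.\<close>

definition nab :: "'f \<Rightarrow> 'f \<Rightarrow> ('f \<Rightarrow> 'm) \<Rightarrow> 'm" where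
  "nab q u \<zeta> = FD \<zeta> q u + \<Gamma>' (f q) (FD f q u) (\<zeta> q)"

definition B :: "'f \<Rightarrow> 'f \<Rightarrow> 'f \<Rightarrow> 'm" where
  "B q u v = nab q u (\<lambda>q. FD f q v) - FD f q (\<Gamma> q u v)"

definition normal :: "'f \<Rightarrow> 'm \<Rightarrow> bool" where
  "normal q \<xi> \<longleftrightarrow> (\<forall>u. G' (f q) \<xi> (FD f q u) = 0)"

lemma df: "q \<in> \<Omega> \<Longrightarrow> (f has_derivative FD f q) (at q)"
  by (rule smooth_on_has_derivative[OF f_smooth])
lemma Df_smooth: "smooth_on \<Omega> (\<lambda>q. FD f q v)" by (rule smooth_on_FD[OF f_smooth])
lemma Df_lin: "q \<in> \<Omega> \<Longrightarrow> linear (FD f q)" by (rule smooth_on_linear[OF f_smooth])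

lemma G'_along:
  assumes q: "q \<in> \<Omega>" and a: "(a has_derivative FD a q) (at q)" and b: "(b has_derivative FD b q) (at q)"
  shows "((\<lambda>q. G' (f q) (a q) (b q)) has_derivative
    (\<lambda>h. G' (f q) (nab q h a) (b q) + G' (f q) (a q) (nab q h b))) (at q)"
  unfolding nab_def by (rule M.G_along[OF F.op q f_in df[OF q] a b])

lemma nab_smooth:
  assumes S: "open S" "S \<subseteq> \<Omega>" and \<zeta>: "smooth_on S \<zeta>" shows "smooth_on S (\<lambda>q. nab q u \<zeta>)"
proof -
  have 1: "smooth_on S f" "smooth_on S (\<lambda>q. FD f q u)"
    using smooth_on_subset[OF f_smooth S(2)] smooth_on_subset[OF Df_smooth S(2)] by blast+
  have "smooth_on S (\<lambda>q. \<Gamma>' (f q) (FD f q u) (\<zeta> q))"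
  proof (rule smooth_on_bilfam[of S "\<lambda>q. \<Gamma>' (f q)", OF S(1) _ _ 1(2) \<zeta>])
    show "bilinear (\<Gamma>' (f q))" if "q \<in> S" for q using M.\<Gamma>_bil f_in S(2) that by blast
    show "smooth_on S (\<lambda>q. \<Gamma>' (f q) v w)" for v w
      by (rule smooth_on_compose[OF S(1) M.op _ 1(1) M.\<Gamma>_smooth]) (use f_in S(2) in blast)
  qed
  then show ?thesis unfolding nab_def by (intro smooth_on_add S smooth_on_FD \<zeta>)
qed

text \<open>Coordinate directions commute, so no bracket term appears. The second derivatives of
  \<zeta> and of f cancel by symmetry, and what is left is the ambient curvature evaluated on the
  image vectors.\<close>

lemma nab_commutator:
  assumes S: "open S" "S \<subseteq> \<Omega>" "q \<in> S" and \<zeta>: "smooth_on S \<zeta>"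
  shows "nab q u (\<lambda>q. nab q v \<zeta>) - nab q v (\<lambda>q. nab q u \<zeta>) =
    M.curv (f q) (FD f q u) (FD f q v) (\<zeta> q)"
proof -
  have q: "q \<in> \<Omega>" using S by blast
  note bil = bilinear_simps[OF M.\<Gamma>_bil[OF f_in[OF q]]]
  have d\<zeta>: "(\<zeta> has_derivative FD \<zeta> q) (at q)" by (rule smooth_on_has_derivative[OF \<zeta> S(3)])
  have D: "FD (\<lambda>q. nab q b \<zeta>) q a = FD (\<lambda>q. FD \<zeta> q b) q a + (FD (\<lambda>p. \<Gamma>' p (FD f q b) (\<zeta> q)) (f q) (FD f q a)
      + \<Gamma>' (f q) (FD (\<lambda>q. FD f q b) q a) (\<zeta> q) + \<Gamma>' (f q) (FD f q b) (FD \<zeta> q a))" for a b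
  proof -
    have "FD (\<lambda>q. nab q b \<zeta>) q = (\<lambda>a. FD (\<lambda>q. FD \<zeta> q b) q a + (FD (\<lambda>p. \<Gamma>' p (FD f q b) (\<zeta> q)) (f q) (FD f q a)
      + \<Gamma>' (f q) (FD (\<lambda>q. FD f q b) q a) (\<zeta> q) + \<Gamma>' (f q) (FD f q b) (FD \<zeta> q a)))"
      unfolding nab_def
      by (intro FD_eq has_derivative_add M.\<Gamma>_along[OF F.op q f_in df[OF q]] d\<zeta>
          smooth_on_has_derivative[OF smooth_on_FD[OF \<zeta>] S(3)] smooth_on_has_derivative[OF Df_smooth q])
    then show ?thesis by simp
  qed
  have c1: "FD (\<lambda>q. FD \<zeta> q v) q u = FD (\<lambda>q. FD \<zeta> q u) q v" by (rule smooth_FD_commute[OF S(1) \<zeta> S(3)])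
  have c2: "FD (\<lambda>q. FD f q v) q u = FD (\<lambda>q. FD f q u) q v" by (rule smooth_FD_commute[OF F.op f_smooth q])
  show ?thesis
    unfolding nab_def[of q u "\<lambda>q. nab q v \<zeta>"] nab_def[of q v "\<lambda>q. nab q u \<zeta>"] D M.curv_def
    using c1 c2 by (simp add: nab_def bil)
qed

lemma nab_add_field:
  assumes "(a has_derivative FD a q) (at q)" "(b has_derivative FD b q) (at q)" "q \<in> \<Omega>"
  shows "nab q u (\<lambda>q. a q + b q) = nab q u a + nab q u b"
  unfolding nab_def FD_eq[OF has_derivative_add[OF assms(1,2)]]
  by (simp add: bilinear_simps[OF M.\<Gamma>_bil[OF f_in[OF assms(3)]]])

lemma nab_cong:
  assumes "open S" "q \<in> S" "\<And>y. y \<in> S \<Longrightarrow> a y = b y" shows "nab q u a = nab q u b"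
  unfolding nab_def using FD_cong[OF assms] assms(2,3) by simp

text \<open>The Gauss formula for fields with variable components: the derivative of Y enters only
  tangentially, which is why B sees nothing but the value of Y at the point.\<close>

lemma nab_Df:
  assumes q: "q \<in> \<Omega>" and Y: "(Y has_derivative FD Y q) (at q)"
  shows "nab q u (\<lambda>q. FD f q (Y q)) = B q u (Y q) + FD f q (FD Y q u + \<Gamma> q u (Y q))"
proof -
  have "FD (\<lambda>q. FD f q (Y q)) q = (\<lambda>h. FD (\<lambda>p. FD f p (Y q)) q h + FD f q (FD Y q h))"
    by (rule FD_eq, rule has_derivative_linfam[OF F.op q Df_lin smooth_on_has_derivative[OF Df_smooth q] Y])
  then show ?thesis unfolding B_def nab_def by (simp add: linear_add[OF Df_lin[OF q]])
qed

lemma B_sym: "q \<in> \<Omega> \<Longrightarrow> B q u v = B q v u"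
  unfolding B_def nab_def using smooth_FD_commute[OF F.op f_smooth, of q v u]
  by (simp add: F.\<Gamma>_sym[of q u v] M.\<Gamma>_sym[OF f_in, of q "FD f q u"])

lemma B_smooth: "smooth_on \<Omega> (\<lambda>q. B q u v)"
  unfolding B_def
  by (intro smooth_on_diff F.op nab_smooth Df_smooth order_refl smooth_on_linfam[of \<Omega> "FD f"] Df_lin F.\<Gamma>_smooth)

text \<open>The Koszul argument: \<open>\<langle>B(u,v), df w\<rangle>\<close> is symmetric in \<open>u, v\<close> and skew in \<open>v, w\<close>.\<close>

lemma B_normal: assumes q: "q \<in> \<Omega>" shows "normal q (B q u v)"
proof -
  define T where "T u v w = G' (f q) (B q u v) (FD f q w)" for u v w
  note fq = f_in[OF q]
  note bG = bilinear_simps[OF M.G_bil[OF fq]]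
  have sym: "T u v w = T v u w" for u v w by (simp add: T_def B_sym[OF q, of u v])
  have skew: "T u v w = - T u w v" for u v w
  proof -
    have "((\<lambda>q. G' (f q) (FD f q v) (FD f q w)) has_derivative
      (\<lambda>h. G' (f q) (nab q h (\<lambda>q. FD f q v)) (FD f q w) + G' (f q) (FD f q v) (nab q h (\<lambda>q. FD f q w)))) (at q)"
      by (intro G'_along q smooth_on_has_derivative[OF Df_smooth q])
    then have "((\<lambda>q. G q v w) has_derivative
      (\<lambda>h. G' (f q) (nab q h (\<lambda>q. FD f q v)) (FD f q w) + G' (f q) (FD f q v) (nab q h (\<lambda>q. FD f q w)))) (at q)"
      by (rule has_derivative_transform_within_open[OF _ F.op q]) (simp add: f_isom)
    from fun_cong[OF FD_eq[OF this], of u] F.compat[OF q, of v w u]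
    have "G q (\<Gamma> q u v) w + G q v (\<Gamma> q u w) =
      G' (f q) (nab q u (\<lambda>q. FD f q v)) (FD f q w) + G' (f q) (FD f q v) (nab q u (\<lambda>q. FD f q w))" by simp
    moreover have "nab q u (\<lambda>q. FD f q x) = B q u x + FD f q (\<Gamma> q u x)" for x by (simp add: B_def)
    ultimately have "T u v w + G' (f q) (FD f q v) (B q u w) = 0"
      by (simp add: f_isom[OF q] bG T_def)
    then show ?thesis by (simp add: T_def M.G_sym[OF fq, of "FD f q v"])
  qed
  have "T u v w = 0" for w
    using skew[of u v w] sym[of u w v] skew[of w u v] sym[of w v u] skew[of v w u] sym[of v u w] by linarith
  then show ?thesis by (simp add: normal_def T_def)
qed

text \<open>The difference a - b is itself normal, so it may be tested against itself. In this way
  the scalar identities supplied by Codazzi and recurrence become equations between vectors.\<close>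

lemma normal_eqI:
  assumes q: "q \<in> \<Omega>" and "normal q a" "normal q b" "\<And>\<xi>. normal q \<xi> \<Longrightarrow> G' (f q) a \<xi> = G' (f q) b \<xi>"
  shows "a = b"
proof -
  note bG = bilinear_simps[OF M.G_bil[OF f_in[OF q]]]
  have "normal q (a - b)" using assms(2,3) by (simp add: normal_def bG)
  from assms(4)[OF this] have "G' (f q) (a - b) (a - b) = 0" by (simp add: bG(3))
  then show ?thesis using M.G_zero_iff[OF f_in[OF q]] by simp
qed

lemma normal_scaleR: "q \<in> \<Omega> \<Longrightarrow> normal q a \<Longrightarrow> normal q (r *\<^sub>R a)"
  unfolding normal_def by (simp add: bilinear_simps[OF M.G_bil[OF f_in]])

text \<open>Apply the commutator formula to \<open>FD f q w\<close> and take the product with \<xi>.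
  By the Gauss formula the tangential part of the inner derivative contributes only
  \<open>B q a (\<Gamma> q b w)\<close>, and the curvature term vanishes by assumption.\<close>

lemma codazzi:
  assumes q: "q \<in> \<Omega>" and \<xi>: "normal q \<xi>"
    and curv: "G' (f q) (M.curv (f q) (FD f q u) (FD f q v) (FD f q w)) \<xi> = 0"
  shows "G' (f q) (nab q u (\<lambda>q. B q v w) + B q u (\<Gamma> q v w)) \<xi> =
         G' (f q) (nab q v (\<lambda>q. B q u w) + B q v (\<Gamma> q u w)) \<xi>"
proof -
  note bG = bilinear_simps[OF M.G_bil[OF f_in[OF q]]]
  have tang: "G' (f q) (FD f q a) \<xi> = 0" for a using \<xi> M.G_sym[OF f_in[OF q]] by (metis normal_def)
  have 1: "G' (f q) (nab q a (\<lambda>q. nab q b (\<lambda>q. FD f q w))) \<xi> =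
      G' (f q) (nab q a (\<lambda>q. B q b w) + B q a (\<Gamma> q b w)) \<xi>" for a b
  proof -
    have "nab q a (\<lambda>q. nab q b (\<lambda>q. FD f q w)) = nab q a (\<lambda>q. B q b w + FD f q (\<Gamma> q b w))"
      by (rule nab_cong[OF F.op q]) (simp add: B_def)
    also have "\<dots> = nab q a (\<lambda>q. B q b w) + nab q a (\<lambda>q. FD f q (\<Gamma> q b w))"
    proof (rule nab_add_field[OF smooth_on_has_derivative[OF B_smooth q] smooth_on_has_derivative[OF _ q] q])
      show "smooth_on \<Omega> (\<lambda>q. FD f q (\<Gamma> q b w))"
        by (rule smooth_on_linfam[of \<Omega> "FD f", OF F.op Df_lin Df_smooth F.\<Gamma>_smooth])
    qed
    also have "nab q a (\<lambda>q. FD f q (\<Gamma> q b w)) = B q a (\<Gamma> q b w) + FD f q (FD (\<lambda>q. \<Gamma> q b w) q a + \<Gamma> q a (\<Gamma> q b w))"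
      by (rule nab_Df[OF q smooth_on_has_derivative[OF F.\<Gamma>_smooth q]])
    finally show ?thesis by (simp add: bG tang)
  qed
  have "nab q u (\<lambda>q. nab q v (\<lambda>q. FD f q w)) - nab q v (\<lambda>q. nab q u (\<lambda>q. FD f q w)) =
      M.curv (f q) (FD f q u) (FD f q v) (FD f q w)"
    by (rule nab_commutator[OF F.op order_refl q Df_smooth])
  then have "G' (f q) (nab q u (\<lambda>q. nab q v (\<lambda>q. FD f q w)) - nab q v (\<lambda>q. nab q u (\<lambda>q. FD f q w))) \<xi> = 0"
    using curv by simp
  then show ?thesis unfolding bG(3) 1 by simp
qed

end


section \<open>Recurrence\<close>

text \<open>The domain is small enough for \<mu> and B to vanish nowhere. \<open>rec\<close> is
  recurrence tested against normals, with the van der Waerden--Bortolotti derivative written out on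
  fields with constant components; \<open>curv0\<close> is what constant curvature
  contributes.\<close>

locale recurrent_immersion = chart_immersion +
  fixes \<mu>
  assumes \<mu>_lin: "\<And>q. q \<in> \<Omega> \<Longrightarrow> linear (\<mu> q)" and \<mu>_smooth: "\<And>v. smooth_on \<Omega> (\<lambda>q. \<mu> q v :: real)"
    and \<mu>_nz: "\<And>q. q \<in> \<Omega> \<Longrightarrow> \<exists>u. \<mu> q u \<noteq> 0"
    and B_nz: "\<And>q. q \<in> \<Omega> \<Longrightarrow> \<exists>u v. B q u v \<noteq> 0"
    and curv0: "\<And>q \<xi> u v w. q \<in> \<Omega> \<Longrightarrow> normal q \<xi> \<Longrightarrow>
      G' (f q) (M.curv (f q) (FD f q u) (FD f q v) (FD f q w)) \<xi> = 0"
    and rec: "\<And>q \<xi> u v w. q \<in> \<Omega> \<Longrightarrow> normal q \<xi> \<Longrightarrow> G' (f q) (nab q u (\<lambda>q. B q v w)) \<xi> =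
      G' (f q) (B q (\<Gamma> q u v) w + B q v (\<Gamma> q u w) + \<mu> q u *\<^sub>R B q v w) \<xi>"
begin

text \<open>Inserting recurrence into both sides of Codazzi, the Christoffel terms cancel by the
  symmetry of \<Gamma>, and the terms with \<mu> remain.\<close>

lemma \<mu>B: assumes q: "q \<in> \<Omega>" shows "\<mu> q u *\<^sub>R B q v w = \<mu> q v *\<^sub>R B q u w"
proof (rule normal_eqI[OF q])
  show "normal q (\<mu> q u *\<^sub>R B q v w)" "normal q (\<mu> q v *\<^sub>R B q u w)"
    by (intro normal_scaleR q B_normal)+
  fix \<xi> assume \<xi>: "normal q \<xi>"
  note bG = bilinear_simps[OF M.G_bil[OF f_in[OF q]]]
  show "G' (f q) (\<mu> q u *\<^sub>R B q v w) \<xi> = G' (f q) (\<mu> q v *\<^sub>R B q u w) \<xi>"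
    using codazzi[OF q \<xi> curv0[OF q \<xi>], of u v w] rec[OF q \<xi>, of u v w] rec[OF q \<xi>, of v u w]
      F.\<Gamma>_sym[OF q, of u v] by (simp add: bG)
qed

text \<open>Differentiate the identity \<open>\<mu>B\<close> in direction a and substitute
  recurrence for the derivatives of B. The terms containing \<open>B q (\<Gamma> q a u) w\<close>
  and its mate are rewritten by \<open>\<mu>B\<close> and complete the derivative of the components
  of \<mu> to the covariant derivative.\<close>

lemma \<mu>_parallel:
  assumes q: "q \<in> \<Omega>"
  shows "(FD (\<lambda>q. \<mu> q u) q a - \<mu> q (\<Gamma> q a u)) *\<^sub>R B q v w = (FD (\<lambda>q. \<mu> q v) q a - \<mu> q (\<Gamma> q a v)) *\<^sub>R B q u w"
proof (rule normal_eqI[OF q])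
  show "normal q ((FD (\<lambda>q. \<mu> q u) q a - \<mu> q (\<Gamma> q a u)) *\<^sub>R B q v w)"
    "normal q ((FD (\<lambda>q. \<mu> q v) q a - \<mu> q (\<Gamma> q a v)) *\<^sub>R B q u w)"
    by (intro normal_scaleR q B_normal)+
  fix \<xi> assume \<xi>: "normal q \<xi>"
  note bG = bilinear_simps[OF M.G_bil[OF f_in[OF q]]] and b\<Gamma> = bilinear_simps[OF M.\<Gamma>_bil[OF f_in[OF q]]]
  have D: "nab q a (\<lambda>q. \<mu> q x *\<^sub>R B q y w) = FD (\<lambda>q. \<mu> q x) q a *\<^sub>R B q y w + \<mu> q x *\<^sub>R nab q a (\<lambda>q. B q y w)" for x y
  proof -
    have "FD (\<lambda>q. \<mu> q x *\<^sub>R B q y w) q = (\<lambda>h. \<mu> q x *\<^sub>R FD (\<lambda>q. B q y w) q h + FD (\<lambda>q. \<mu> q x) q h *\<^sub>R B q y w)"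
      by (intro FD_eq has_derivative_scaleR smooth_on_has_derivative[OF \<mu>_smooth q] smooth_on_has_derivative[OF B_smooth q])
    then show ?thesis by (simp add: nab_def b\<Gamma> scaleR_add_right)
  qed
  have "nab q a (\<lambda>q. \<mu> q u *\<^sub>R B q v w) = nab q a (\<lambda>q. \<mu> q v *\<^sub>R B q u w)"
    by (rule nab_cong[OF F.op q \<mu>B])
  from arg_cong[OF this[unfolded D], of "\<lambda>z. G' (f q) z \<xi>"]
  have E: "FD (\<lambda>q. \<mu> q u) q a * G' (f q) (B q v w) \<xi> + \<mu> q u * G' (f q) (nab q a (\<lambda>q. B q v w)) \<xi> =
    FD (\<lambda>q. \<mu> q v) q a * G' (f q) (B q u w) \<xi> + \<mu> q v * G' (f q) (nab q a (\<lambda>q. B q u w)) \<xi>"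
    by (simp add: bG)
  have sw: "\<mu> q x * G' (f q) (B q y z) \<xi> = \<mu> q y * G' (f q) (B q x z) \<xi>" for x y z
    using arg_cong[OF \<mu>B[OF q, of x y z], of "\<lambda>z. G' (f q) z \<xi>"] by (simp add: bG)
  have R: "G' (f q) (nab q a (\<lambda>q. B q y w)) \<xi> = G' (f q) (B q (\<Gamma> q a y) w) \<xi> + G' (f q) (B q y (\<Gamma> q a w)) \<xi>
      + \<mu> q a * G' (f q) (B q y w) \<xi>" for y
    using rec[OF q \<xi>, of a y w] by (simp add: bG)
  \<comment> \<open>\<open>s1\<close> and \<open>s2\<close> move the Christoffel map from an
    argument of B into \<mu>. The terms in \<open>s3\<close> and \<open>s4\<close> are equal on the
    two sides and drop out.\<close>
  have s1: "\<mu> q u * G' (f q) (B q (\<Gamma> q a v) w) \<xi> = \<mu> q (\<Gamma> q a v) * G' (f q) (B q u w) \<xi>"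
    and s2: "\<mu> q v * G' (f q) (B q (\<Gamma> q a u) w) \<xi> = \<mu> q (\<Gamma> q a u) * G' (f q) (B q v w) \<xi>"
    and s3: "\<mu> q u * G' (f q) (B q v (\<Gamma> q a w)) \<xi> = \<mu> q v * G' (f q) (B q u (\<Gamma> q a w)) \<xi>"
    and s4: "\<mu> q u * (\<mu> q a * G' (f q) (B q v w) \<xi>) = \<mu> q v * (\<mu> q a * G' (f q) (B q u w) \<xi>)"
    using sw[of u "\<Gamma> q a v" w] sw[of v "\<Gamma> q a u" w] sw[of u v "\<Gamma> q a w"] sw[of u v w]
    by (simp_all add: mult.left_commute)
  show "G' (f q) ((FD (\<lambda>q. \<mu> q u) q a - \<mu> q (\<Gamma> q a u)) *\<^sub>R B q v w) \<xi> =
    G' (f q) ((FD (\<lambda>q. \<mu> q v) q a - \<mu> q (\<Gamma> q a v)) *\<^sub>R B q u w) \<xi>"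
    using E s1 s2 s3 s4 unfolding R by (simp add: bG left_diff_distrib distrib_left)
qed

text \<open>If \<mu> kills v, then \<open>\<mu>B\<close> with some u outside the kernel shows that B
  kills v as well. In \<open>\<mu>_parallel\<close> one side is then zero, and a nonzero value
  \<open>B q u0 w0\<close> forces the remaining coefficient to vanish.\<close>

lemma \<mu>_parallel_kernel:
  assumes q: "q \<in> \<Omega>" and v: "\<mu> q v = 0"
  shows "FD (\<lambda>q. \<mu> q v) q a - \<mu> q (\<Gamma> q a v) = 0"
proof -
  obtain u where u: "\<mu> q u \<noteq> 0" using \<mu>_nz[OF q] by blast
  obtain u0 w0 where B0: "B q u0 w0 \<noteq> 0" using B_nz[OF q] by blast
  have "\<mu> q u *\<^sub>R B q v w0 = 0" using \<mu>B[OF q, of u v w0] v by simp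
  then have "B q v w0 = 0" using u by simp
  then show ?thesis using \<mu>_parallel[OF q, of u0 a v w0] B0 by simp
qed

section \<open>The unit field dual to the recurrence form\<close>

definition sharp where "sharp q = inv (F.flat q) (\<Sum>b\<in>Basis. \<mu> q b *\<^sub>R b)"
definition \<nu> where "\<nu> q = sqrt (G q (sharp q) (sharp q))"
definition E where "E q = inverse (\<nu> q) *\<^sub>R sharp q"

lemma G_sharp: assumes q: "q \<in> \<Omega>" shows "G q (sharp q) v = \<mu> q v"
proof -
  have "F.flat q (sharp q) = (\<Sum>b\<in>Basis. \<mu> q b *\<^sub>R b)"
    unfolding sharp_def using F.flat_bij[OF q] by (simp add: bij_is_surj surj_f_inv_f)
  then show ?thesis using F.flat_inner[OF q, of "sharp q" v] inner_functional[OF \<mu>_lin[OF q]] by simp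
qed

lemma sharp_smooth: "smooth_on \<Omega> sharp"
proof -
  have fs: "smooth_on \<Omega> (\<lambda>q. F.flat q v)" for v unfolding F.flat_def
    by (intro smooth_on_sum smooth_on_scaleR F.G_smooth smooth_on_const F.op)
  have ms: "smooth_on \<Omega> (\<lambda>q. \<Sum>b\<in>Basis. \<mu> q b *\<^sub>R b)"
    by (intro smooth_on_sum smooth_on_scaleR \<mu>_smooth smooth_on_const F.op)
  show ?thesis unfolding sharp_def[abs_def]
    by (rule smooth_on_linfam[of \<Omega> "\<lambda>q. inv (F.flat q)", OF F.op linear_inv_bij[OF F.flat_linear F.flat_bij]
          smooth_on_inv_linfam[OF F.op F.flat_linear F.flat_bij fs] ms])
qed

lemma \<nu>_pos: assumes q: "q \<in> \<Omega>" shows "\<nu> q > 0" "\<nu> q * \<nu> q = G q (sharp q) (sharp q)" "G q (sharp q) (sharp q) > 0"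
proof -
  obtain u where "\<mu> q u \<noteq> 0" using \<mu>_nz[OF q] by blast
  then have "sharp q \<noteq> 0" using G_sharp[OF q, of u] bilinear_simps(9)[OF F.G_bil[OF q]] by auto
  then show *: "G q (sharp q) (sharp q) > 0" by (rule F.G_pos[OF q])
  then show "\<nu> q > 0" "\<nu> q * \<nu> q = G q (sharp q) (sharp q)" by (simp_all add: \<nu>_def)
qed

lemma \<nu>_inverse_smooth: "smooth_on \<Omega> (\<lambda>q. inverse (\<nu> q))"
proof -
  have "smooth_on \<Omega> (\<lambda>q. G q (sharp q) (sharp q))"
    by (rule smooth_on_bilfam[of \<Omega> G, OF F.op F.G_bil F.G_smooth sharp_smooth sharp_smooth])
  then have "smooth_on \<Omega> \<nu>" unfolding \<nu>_def[abs_def] by (intro smooth_on_sqrt F.op \<nu>_pos(3))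
  then show ?thesis by (intro smooth_on_inverse F.op) (use \<nu>_pos(1) in force)+
qed

lemma E_smooth: "smooth_on \<Omega> E"
  unfolding E_def[abs_def] by (intro smooth_on_scaleR F.op \<nu>_inverse_smooth sharp_smooth)

lemma G_E: assumes q: "q \<in> \<Omega>" shows "G q (E q) v = inverse (\<nu> q) * \<mu> q v"
  by (simp add: E_def bilinear_simps[OF F.G_bil[OF q]] G_sharp[OF q])

lemma G_E_E: assumes q: "q \<in> \<Omega>" shows "G q (E q) (E q) = 1"
  using \<nu>_pos(1)[OF q]
  by (simp add: E_def bilinear_simps[OF F.G_bil[OF q]] flip: \<nu>_pos(2)[OF q])
    (simp add: field_simps)

text \<open>W, the covariant derivative of E, is orthogonal to E because E has unit length. It is
  orthogonal to the kernel of \<mu> because there the product with E is zero and \<mu> has vanishing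
  covariant derivative. E and the kernel span, so W = 0.\<close>

lemma E_parallel: assumes q: "q \<in> \<Omega>" shows "FD E q a + \<Gamma> q a (E q) = 0"
proof -
  define W where "W = FD E q a + \<Gamma> q a (E q)"
  note bG = bilinear_simps[OF F.G_bil[OF q]]
  have dE: "(E has_derivative FD E q) (at q)" by (rule smooth_on_has_derivative[OF E_smooth q])
  have d1: "((\<lambda>q. G q (E q) (E q)) has_derivative
      (\<lambda>h. G q (FD E q h + \<Gamma> q h (E q)) (E q) + G q (E q) (FD E q h + \<Gamma> q h (E q)))) (at q)"
    by (rule F.G_along[OF F.op q, where f = "\<lambda>q. q"]) (auto intro: dE)
  have "((\<lambda>q. 1) has_derivative
      (\<lambda>h. G q (FD E q h + \<Gamma> q h (E q)) (E q) + G q (E q) (FD E q h + \<Gamma> q h (E q)))) (at q)"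
    by (rule has_derivative_transform_within_open[OF d1 F.op q]) (rule G_E_E)
  from fun_cong[OF has_derivative_unique[OF this has_derivative_const], of a]
  have WE: "G q W (E q) = 0" unfolding W_def[symmetric] using F.G_sym[OF q, of "E q" W] by simp
  have Wv: "G q W v = 0" if v: "\<mu> q v = 0" for v
  proof -
    have d2: "((\<lambda>q. G q (E q) v) has_derivative
        (\<lambda>h. G q (FD E q h + \<Gamma> q h (E q)) v + G q (E q) (0 + \<Gamma> q h v))) (at q)"
      by (rule F.G_along[OF F.op q, where f = "\<lambda>q. q"]) (auto intro: dE)
    \<comment> \<open>The vector v is constant in coordinates, and \<mu> v = 0 holds at q only.
      Hence \<mu> v must be differentiated, while the term with the derivative of
      \<open>inverse (\<nu> q)\<close> disappears at q.\<close>
    have d3: "((\<lambda>q. inverse (\<nu> q) * \<mu> q v) has_derivative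
        (\<lambda>h. inverse (\<nu> q) * FD (\<lambda>q. \<mu> q v) q h + FD (\<lambda>q. inverse (\<nu> q)) q h * \<mu> q v)) (at q)"
      by (intro has_derivative_mult smooth_on_has_derivative[OF \<nu>_inverse_smooth q] smooth_on_has_derivative[OF \<mu>_smooth q])
    have "((\<lambda>q. G q (E q) v) has_derivative
        (\<lambda>h. inverse (\<nu> q) * FD (\<lambda>q. \<mu> q v) q h + FD (\<lambda>q. inverse (\<nu> q)) q h * \<mu> q v)) (at q)"
      by (rule has_derivative_transform_within_open[OF d3 F.op q]) (simp add: G_E)
    from fun_cong[OF has_derivative_unique[OF d2 this], of a]
    have "G q W v + inverse (\<nu> q) * \<mu> q (\<Gamma> q a v) = inverse (\<nu> q) * FD (\<lambda>q. \<mu> q v) q a"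
      unfolding W_def[symmetric] using v by (simp add: G_E[OF q])
    then show ?thesis using \<mu>_parallel_kernel[OF q v, of a] by simp
  qed
  have "G q W v = 0" for v
  proof -
    have "\<mu> q (E q) = \<nu> q" using G_E[OF q, of "E q"] G_E_E[OF q] \<nu>_pos(1)[OF q] by (simp add: field_simps)
    then have "\<mu> q (v - (inverse (\<nu> q) * \<mu> q v) *\<^sub>R E q) = 0"
      using \<nu>_pos(1)[OF q] by (simp add: linear_diff[OF \<mu>_lin[OF q]] linear_cmul[OF \<mu>_lin[OF q]])
    from Wv[OF this] show ?thesis by (simp add: bG WE)
  qed
  then show ?thesis using F.G_nondeg[OF q] W_def by blast
qed

text \<open>Using E in one slot of \<open>\<mu>B\<close> replaces an argument of B by E at the price
  of its component along E; symmetry of B allows this in both slots.\<close>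

lemma B_rank_one: assumes q: "q \<in> \<Omega>" shows "B q u v = (G q (E q) u * G q (E q) v) *\<^sub>R B q (E q) (E q)"
proof -
  have \<mu>E: "\<mu> q (E q) = \<nu> q" using G_E[OF q, of "E q"] G_E_E[OF q] \<nu>_pos(1)[OF q] by (simp add: field_simps)
  have 1: "B q x y = G q (E q) x *\<^sub>R B q (E q) y" for x y
  proof -
    have "inverse (\<nu> q) *\<^sub>R \<nu> q *\<^sub>R B q x y = inverse (\<nu> q) *\<^sub>R \<mu> q x *\<^sub>R B q (E q) y"
      using \<mu>B[OF q, of "E q" x y] \<mu>E by simp
    then show ?thesis using \<nu>_pos(1)[OF q] by (simp add: G_E[OF q])
  qed
  show ?thesis using 1[of u v] 1[of v "E q"] B_sym[OF q, of "E q" v] by simp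
qed

end

text \<open>The covariant s-derivative of the field \<open>FD \<Psi> (s, t) (0, w)\<close> equals,
  by commuting second derivatives and symmetry of \<Gamma>, the covariant derivative of E in the
  direction of that field, which is zero. So the products of the transversal coordinate fields do
  not depend on s; E is a unit field orthogonal to them and contributes
  \<open>fst a * fst b\<close>.\<close>

lemma (in chart_metric) parallel_field_splits:
  fixes \<Psi> :: "real \<times> 'k::euclidean_space \<Rightarrow> 'e"
  assumes E: "smooth_on \<Omega> E" "\<And>q a. q \<in> \<Omega> \<Longrightarrow> FD E q a + \<Gamma> q a (E q) = 0" "\<And>q. q \<in> \<Omega> \<Longrightarrow> G q (E q) (E q) = 1"
    and I: "open I" "convex I" "0 \<in> I" and W: "open W"
    and \<Psi>: "smooth_on (I \<times> W) \<Psi>" "\<And>z. z \<in> I \<times> W \<Longrightarrow> \<Psi> z \<in> \<Omega>"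
    and \<Psi>1: "\<And>z. z \<in> I \<times> W \<Longrightarrow> FD \<Psi> z (1, 0) = E (\<Psi> z)"
    and \<Psi>2: "\<And>z t. z \<in> I \<times> W \<Longrightarrow> G (\<Psi> z) (E (\<Psi> z)) (FD \<Psi> z (0, t)) = 0"
    and z: "s \<in> I" "t \<in> W" and s': "s' \<in> I"
  shows "G (\<Psi> (s, t)) (FD \<Psi> (s, t) a) (FD \<Psi> (s, t) b) =
     fst a * fst b + G (\<Psi> (s', t)) (FD \<Psi> (s', t) (0, snd a)) (FD \<Psi> (s', t) (0, snd b))"
proof -
  have oQ: "open (I \<times> W)" by (intro open_Times I W)
  have mem: "(r, t) \<in> I \<times> W" if "r \<in> I" for r using that z by simp
  define h where "h r = G (\<Psi> (r, t)) (FD \<Psi> (r, t) (0, snd a)) (FD \<Psi> (r, t) (0, snd b))" for r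
  have dh: "(h has_derivative (\<lambda>x. 0)) (at r)" if r: "r \<in> I" for r
  proof -
    note m = mem[OF r] and \<Psi>m = \<Psi>(2)[OF mem[OF r]]
    have pair: "((\<lambda>r. (r, t)) has_derivative (\<lambda>x. (x, 0))) (at r)"
      by (intro has_derivative_Pair has_derivative_ident has_derivative_const)
    have d\<Psi>: "((\<lambda>r. \<Psi> (r, t)) has_derivative (\<lambda>x. FD \<Psi> (r, t) (x, 0))) (at r)"
      by (rule has_derivative_compose[OF pair smooth_on_has_derivative[OF \<Psi>(1) m]])
    have dF: "((\<lambda>r. FD \<Psi> (r, t) w) has_derivative (\<lambda>x. FD (\<lambda>z. FD \<Psi> z w) (r, t) (x, 0))) (at r)" for w
      by (rule has_derivative_compose[OF pair smooth_on_has_derivative[OF smooth_on_FD[OF \<Psi>(1)] m]])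
    have "(h has_derivative (\<lambda>x. G (\<Psi> (r, t))
         (FD (\<lambda>z. FD \<Psi> z (0, snd a)) (r, t) (x, 0) + \<Gamma> (\<Psi> (r, t)) (FD \<Psi> (r, t) (x, 0)) (FD \<Psi> (r, t) (0, snd a)))
         (FD \<Psi> (r, t) (0, snd b)) + G (\<Psi> (r, t)) (FD \<Psi> (r, t) (0, snd a))
         (FD (\<lambda>z. FD \<Psi> z (0, snd b)) (r, t) (x, 0) + \<Gamma> (\<Psi> (r, t)) (FD \<Psi> (r, t) (x, 0)) (FD \<Psi> (r, t) (0, snd b))))) (at r)"
      unfolding h_def[abs_def]
      by (rule G_along[OF I(1) r \<Psi>(2) d\<Psi> dF dF]) (rule mem)
    moreover have "FD (\<lambda>z. FD \<Psi> z (0, w)) (r, t) (x, 0) + \<Gamma> (\<Psi> (r, t)) (FD \<Psi> (r, t) (x, 0)) (FD \<Psi> (r, t) (0, w)) = 0" for w x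
    proof -
      have lin: "linear (FD (\<lambda>z. FD \<Psi> z (0, w)) (r, t))" by (rule smooth_on_linear[OF smooth_on_FD[OF \<Psi>(1)] m])
      have l\<Psi>: "linear (FD \<Psi> (r, t))" by (rule smooth_on_linear[OF \<Psi>(1) m])
      have x0: "(x, 0) = x *\<^sub>R ((1, 0) :: real \<times> 'k)" by simp
      have "FD (\<lambda>z. FD \<Psi> z (0, w)) (r, t) (1, 0) = FD (\<lambda>z. FD \<Psi> z (1, 0)) (r, t) (0, w)"
        by (rule smooth_FD_commute[OF oQ \<Psi>(1) m])
      also have "\<dots> = FD (\<lambda>z. E (\<Psi> z)) (r, t) (0, w)" by (rule fun_cong[OF FD_cong[OF oQ m \<Psi>1]])
      also have "\<dots> = FD E (\<Psi> (r, t)) (FD \<Psi> (r, t) (0, w))"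
        using FD_compose[OF smooth_on_differentiable[OF \<Psi>(1) m] smooth_on_differentiable[OF E(1) \<Psi>m]] by simp
      finally have "FD (\<lambda>z. FD \<Psi> z (0, w)) (r, t) (1, 0) + \<Gamma> (\<Psi> (r, t)) (FD \<Psi> (r, t) (1, 0)) (FD \<Psi> (r, t) (0, w)) = 0"
        using E(2)[OF \<Psi>m, of "FD \<Psi> (r, t) (0, w)"] \<Psi>1[OF m] \<Gamma>_sym[OF \<Psi>m] by simp
      then have "x *\<^sub>R (FD (\<lambda>z. FD \<Psi> z (0, w)) (r, t) (1, 0) + \<Gamma> (\<Psi> (r, t)) (FD \<Psi> (r, t) (1, 0)) (FD \<Psi> (r, t) (0, w))) = 0"
        by (simp only: scaleR_zero_right)
      then show ?thesis unfolding x0 linear_cmul[OF lin] linear_cmul[OF l\<Psi>] bilinear_simps(5)[OF \<Gamma>_bil[OF \<Psi>m]] scaleR_add_right .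
    qed
    ultimately show ?thesis by (simp add: bilinear_simps[OF G_bil[OF \<Psi>m]])
  qed
  have "h s = h s'"
    by (rule has_derivative_zero_unique[OF I(2) has_derivative_at_withinI[OF dh] z(1) s'])
  moreover have "G (\<Psi> (s, t)) (FD \<Psi> (s, t) a) (FD \<Psi> (s, t) b) = fst a * fst b + h s"
  proof -
    note m = mem[OF z(1)] and bG = bilinear_simps[OF G_bil[OF \<Psi>(2)[OF mem[OF z(1)]]]]
    have l\<Psi>: "linear (FD \<Psi> (s, t))" by (rule smooth_on_linear[OF \<Psi>(1) m])
    have dec: "FD \<Psi> (s, t) v = fst v *\<^sub>R E (\<Psi> (s, t)) + FD \<Psi> (s, t) (0, snd v)" for v
    proof -
      have "v = fst v *\<^sub>R (1, 0) + (0, snd v)" by (simp add: prod_eq_iff)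
      then have "FD \<Psi> (s, t) v = FD \<Psi> (s, t) (fst v *\<^sub>R (1, 0) + (0, snd v))" by (rule arg_cong)
      then show ?thesis by (simp only: linear_add[OF l\<Psi>] linear_cmul[OF l\<Psi>] \<Psi>1[OF m])
    qed
    show ?thesis unfolding dec[of a] dec[of b] h_def
      using \<Psi>2[OF m] G_sym[OF \<Psi>(2)[OF m], of "FD \<Psi> (s, t) (0, snd a)" "E (\<Psi> (s, t))"] E(3)[OF \<Psi>(2)[OF m]]
      by (simp add: bG)
  qed
  ultimately show ?thesis by (simp add: h_def)
qed

section \<open>Charts\<close>

abbreviation cmp :: "('p, 'e::euclidean_space, 'z) mfd_scheme \<Rightarrow> 'p set \<times> ('p \<Rightarrow> 'e) \<Rightarrow> 'p \<Rightarrow> 'e \<Rightarrow> 'e" where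
  "cmp M c y v \<equiv> vderiv M (snd c) y v"

text \<open>The part of being a smooth manifold that concerns charts and transitions, without
  separation axioms or homeomorphisms. Computing with components requires no more, and for products
  and open submanifolds only this much is established.\<close>

definition atlas_ok :: "('p, 'e::euclidean_space, 'z) mfd_scheme \<Rightarrow> bool" where
  "atlas_ok M \<longleftrightarrow> (\<Union>c\<in>mfd_atlas M. fst c) = points M \<and> (\<forall>c\<in>mfd_atlas M. inj_on (snd c) (fst c)) \<and>
     (\<forall>c\<in>mfd_atlas M. \<forall>d\<in>mfd_atlas M. open (snd c ` (fst c \<inter> fst d)) \<and>
        smooth_on (snd c ` (fst c \<inter> fst d)) (\<lambda>q. snd d (chart_inv c q)))"

lemma chart_inv_left: "inj_on (snd c) (fst c) \<Longrightarrow> y \<in> fst c \<Longrightarrow> chart_inv c (snd c y) = y"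
  by (simp add: chart_inv_def)

lemma chart_image_open:
  assumes M: "smooth_manifold M" "c \<in> mfd_atlas M" and U: "open_in M U"
  shows "open (snd c ` (U \<inter> fst c))"
proof -
  have h: "homeomorphic_map (subtopology (mfd_top M) (fst c)) (top_of_set (snd c ` fst c)) (snd c)"
    and o: "open (snd c ` fst c)" using M by (auto simp: smooth_manifold_def)
  have "openin (subtopology (mfd_top M) (fst c)) (U \<inter> fst c)"
    using U by (auto simp: openin_subtopology)
  then have "openin (top_of_set (snd c ` fst c)) (snd c ` (U \<inter> fst c))"
    using homeomorphic_imp_open_map[OF h] by (simp add: open_map_def)
  then show ?thesis using o openin_open_trans by blast
qed

lemma chart_preimage_open:
  assumes M: "smooth_manifold M" "c \<in> mfd_atlas M" and V: "open V"
  shows "open_in M {y \<in> fst c. snd c y \<in> V}"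
proof -
  have h: "homeomorphic_map (subtopology (mfd_top M) (fst c)) (top_of_set (snd c ` fst c)) (snd c)"
    and o: "open_in M (fst c)" using M by (auto simp: smooth_manifold_def)
  have c: "continuous_map (subtopology (mfd_top M) (fst c)) (top_of_set (snd c ` fst c)) (snd c)"
    by (rule homeomorphic_imp_continuous_map[OF h])
  have "openin (top_of_set (snd c ` fst c)) (snd c ` fst c \<inter> V)" using V by (auto simp: openin_open)
  from openin_continuous_map_preimage[OF c this]
  have "openin (subtopology (mfd_top M) (fst c)) {y \<in> fst c. snd c y \<in> V}"
    using openin_subset[OF o] by (simp add: Int_absorb1 inf.absorb2 cong: conj_cong)
  then show ?thesis using o by (rule openin_trans_full)
qed

lemma smooth_manifold_chart:
  assumes M: "smooth_manifold M" and c: "c \<in> mfd_atlas M"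
  shows "open_in M (fst c)" "open (snd c ` fst c)" "inj_on (snd c) (fst c)" "fst c \<subseteq> points M"
proof -
  show o: "open_in M (fst c)" and "open (snd c ` fst c)" using assms by (auto simp: smooth_manifold_def)
  show s: "fst c \<subseteq> points M" by (rule openin_subset[OF o])
  have "homeomorphic_map (subtopology (mfd_top M) (fst c)) (top_of_set (snd c ` fst c)) (snd c)"
    using assms by (auto simp: smooth_manifold_def)
  then show "inj_on (snd c) (fst c)" using s by (simp add: homeomorphic_map_def inf.absorb2)
qed

lemma smooth_manifold_atlas_ok: assumes M: "smooth_manifold M" shows "atlas_ok M"
  unfolding atlas_ok_def
proof (intro conjI ballI)
  show "(\<Union>c\<in>mfd_atlas M. fst c) = points M" using M by (simp add: smooth_manifold_def)
  fix c d assume c: "c \<in> mfd_atlas M" and d: "d \<in> mfd_atlas M"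
  show "inj_on (snd c) (fst c)" by (rule smooth_manifold_chart(3)[OF M c])
  show "open (snd c ` (fst c \<inter> fst d))"
    using chart_image_open[OF M c smooth_manifold_chart(1)[OF M d]] by (simp add: Int_commute)
  show "smooth_on (snd c ` (fst c \<inter> fst d)) (\<lambda>q. snd d (chart_inv c q))"
    using M c d by (auto simp: smooth_manifold_def o_def)
qed

context
  fixes M :: "('p, 'e::euclidean_space, 'z) mfd_scheme"
  assumes ok: "atlas_ok M"
begin

lemma atlas_inj: "c \<in> mfd_atlas M \<Longrightarrow> inj_on (snd c) (fst c)" using ok by (simp add: atlas_ok_def)

lemma atlas_left: "c \<in> mfd_atlas M \<Longrightarrow> y \<in> fst c \<Longrightarrow> chart_inv c (snd c y) = y"
  by (rule chart_inv_left[OF atlas_inj])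

lemma atlas_points: "c \<in> mfd_atlas M \<Longrightarrow> y \<in> fst c \<Longrightarrow> y \<in> points M"
  using ok by (auto simp: atlas_ok_def)

lemma atlas_transition:
  assumes "c \<in> mfd_atlas M" "d \<in> mfd_atlas M"
  shows "open (snd c ` (fst c \<inter> fst d))" "smooth_on (snd c ` (fst c \<inter> fst d)) (\<lambda>q. snd d (chart_inv c q))"
  using assms ok by (auto simp: atlas_ok_def)

lemma chart_at_in: assumes "y \<in> points M" shows "chart_at M y \<in> mfd_atlas M" "y \<in> fst (chart_at M y)"
proof -
  have "y \<in> (\<Union>c\<in>mfd_atlas M. fst c)" using assms ok by (simp add: atlas_ok_def)
  then have "\<exists>c. c \<in> mfd_atlas M \<and> y \<in> fst c" by blast
  then show "chart_at M y \<in> mfd_atlas M" "y \<in> fst (chart_at M y)"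
    unfolding chart_at_def by (metis (mono_tags, lifting) someI_ex)+
qed

lemma transition_inverse:
  assumes c: "c \<in> mfd_atlas M" and d: "d \<in> mfd_atlas M" and y: "y \<in> fst c" "y \<in> fst d"
  shows "FD (\<lambda>q. snd c (chart_inv d q)) (snd d y) (FD (\<lambda>q. snd d (chart_inv c q)) (snd c y) v) = v"
proof -
  let ?S = "snd c ` (fst c \<inter> fst d)" and ?f = "\<lambda>q. snd d (chart_inv c q)" and ?g = "\<lambda>q. snd c (chart_inv d q)"
  have yS: "snd c y \<in> ?S" using y by blast
  have fy: "?f (snd c y) = snd d y" using atlas_left[OF c y(1)] by simp
  have df: "?f differentiable (at (snd c y))" by (rule smooth_on_differentiable[OF atlas_transition(2)[OF c d] yS])
  have dg: "?g differentiable (at (?f (snd c y)))" unfolding fy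
    by (rule smooth_on_differentiable[OF atlas_transition(2)[OF d c]]) (use y in blast)
  have "FD (\<lambda>q. ?g (?f q)) (snd c y) = FD (\<lambda>q. q) (snd c y)"
    by (rule FD_cong[OF atlas_transition(1)[OF c d] yS]) (use atlas_left[OF c] atlas_left[OF d] in force)
  then have "(\<lambda>v. FD ?g (?f (snd c y)) (FD ?f (snd c y) v)) = (\<lambda>v. v)"
    unfolding FD_compose[OF df dg] by simp
  from fun_cong[OF this] show ?thesis by (simp add: fy)
qed

text \<open>\<open>vderiv\<close> is defined through the chart chosen at y. The chain rule with the
  transition to c makes the value computable in any chart around y.\<close>

lemma vderiv_chart:
  assumes c: "c \<in> mfd_atlas M" and y: "y \<in> fst c" and f: "(\<lambda>q. f (chart_inv c q)) differentiable (at (snd c y))"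
  shows "vderiv M f y v = FD (\<lambda>q. f (chart_inv c q)) (snd c y) (cmp M c y v)"
proof -
  define k where "k = chart_at M y"
  have k: "k \<in> mfd_atlas M" "y \<in> fst k" unfolding k_def using chart_at_in[OF atlas_points[OF c y]] by auto
  let ?S = "snd k ` (fst k \<inter> fst c)" and ?t = "\<lambda>q. snd c (chart_inv k q)"
  have yS: "snd k y \<in> ?S" using y k by blast
  have ty: "?t (snd k y) = snd c y" using atlas_left[OF k] by simp
  have dt: "?t differentiable (at (snd k y))" by (rule smooth_on_differentiable[OF atlas_transition(2)[OF k(1) c] yS])
  have "FD (\<lambda>q. f (chart_inv k q)) (snd k y) = FD (\<lambda>q. f (chart_inv c (?t q))) (snd k y)"
    by (rule FD_cong[OF atlas_transition(1)[OF k(1) c] yS]) (use atlas_left[OF k(1)] atlas_left[OF c] in force)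
  also have "\<dots> = (\<lambda>v. FD (\<lambda>q. f (chart_inv c q)) (?t (snd k y)) (FD ?t (snd k y) v))"
    by (rule FD_compose[OF dt]) (use f ty in simp)
  finally show ?thesis unfolding vderiv_def o_def k_def[symmetric] by (simp add: ty)
qed

lemma cmp_change:
  assumes c: "c \<in> mfd_atlas M" "y \<in> fst c" and d: "d \<in> mfd_atlas M" "y \<in> fst d"
  shows "cmp M d y v = FD (\<lambda>q. snd d (chart_inv c q)) (snd c y) (cmp M c y v)"
  by (rule vderiv_chart[OF c smooth_on_differentiable[OF atlas_transition(2)[OF c(1) d(1)]]]) (use c d in blast)

lemma cmp_linear: assumes c: "c \<in> mfd_atlas M" "y \<in> fst c" shows "linear (cmp M c y)"
proof -
  have k: "chart_at M y \<in> mfd_atlas M" "y \<in> fst (chart_at M y)" using chart_at_in[OF atlas_points[OF c]] by auto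
  show ?thesis unfolding vderiv_def o_def
    by (rule smooth_on_linear[OF atlas_transition(2)[OF k(1) c(1)]]) (use c k in blast)
qed

lemma cmp_bij: assumes c: "c \<in> mfd_atlas M" "y \<in> fst c" shows "bij (cmp M c y)"
proof -
  have k: "chart_at M y \<in> mfd_atlas M" "y \<in> fst (chart_at M y)" using chart_at_in[OF atlas_points[OF c]] by auto
  have "inj (cmp M c y)"
  proof (rule inj_on_inverseI)
    show "FD (\<lambda>q. snd (chart_at M y) (chart_inv c q)) (snd c y) (cmp M c y v) = v" for v
      unfolding vderiv_def o_def by (rule transition_inverse[OF k(1) c(1) k(2) c(2)])
  qed
  then show ?thesis using linear_inj_imp_surj[OF cmp_linear[OF c]] by (simp add: bij_def)
qed

lemma cmp_inv: assumes c: "c \<in> mfd_atlas M" "y \<in> fst c"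
  shows "cmp M c y (inv (cmp M c y) w) = w" "inv (cmp M c y) (cmp M c y v) = v" "linear (inv (cmp M c y))"
  using cmp_bij[OF c] linear_inv_bij[OF cmp_linear[OF c] cmp_bij[OF c]]
  by (auto simp: bij_is_surj surj_f_inv_f bij_is_inj)

lemma cmp_inject: "c \<in> mfd_atlas M \<Longrightarrow> y \<in> fst c \<Longrightarrow> cmp M c y u = cmp M c y v \<longleftrightarrow> u = v"
  using bij_is_inj[OF cmp_bij, of c y] by (auto dest: injD)

lemma smooth_fun_chart:
  assumes U: "\<And>c'. c' \<in> mfd_atlas M \<Longrightarrow> open (snd c' ` (U \<inter> fst c'))" and c: "c \<in> mfd_atlas M" "U \<subseteq> fst c"
  shows "smooth_fun M U f \<longleftrightarrow> smooth_on (snd c ` U) (\<lambda>q. f (chart_inv c q))"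
proof
  have Uc: "U \<inter> fst c = U" using c(2) by blast
  show "smooth_on (snd c ` U) (\<lambda>q. f (chart_inv c q))" if "smooth_fun M U f"
    using that c(1) Uc unfolding smooth_fun_def o_def by metis
  assume s: "smooth_on (snd c ` U) (\<lambda>q. f (chart_inv c q))"
  show "smooth_fun M U f" unfolding smooth_fun_def o_def
  proof
    fix k assume k: "k \<in> mfd_atlas M"
    have sub: "snd k ` (U \<inter> fst k) \<subseteq> snd k ` (fst k \<inter> fst c)" using c(2) by blast
    have "smooth_on (snd k ` (U \<inter> fst k)) (\<lambda>q. f (chart_inv c (snd c (chart_inv k q))))"
      by (rule smooth_on_compose[OF U[OF k] _ _ smooth_on_subset[OF atlas_transition(2)[OF k c(1)] sub] s])
        (use U[OF c(1)] Uc atlas_left[OF k] in auto)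
    then show "smooth_on (snd k ` (U \<inter> fst k)) (\<lambda>q. f (chart_inv k q))"
      by (rule smooth_on_cong[THEN iffD1, OF U[OF k], rotated]) (use atlas_left[OF k] atlas_left[OF c(1)] c(2) in force)
  qed
qed

end

text \<open>The assumption \<open>sm\<close> ranges over all charts of N around \<open>f y\<close>
  because \<open>mderiv\<close> is defined by the chosen one, about which nothing else is
  known.\<close>

lemma mderiv_chart:
  fixes M :: "('p, 'e::euclidean_space, 'y) mfd_scheme" and N :: "('q, 'd::euclidean_space, 'z) mfd_scheme"
  assumes M: "atlas_ok M" and N: "atlas_ok N" and c: "c \<in> mfd_atlas M" "y \<in> fst c" and d: "d \<in> mfd_atlas N" "f y \<in> fst d"
    and sm: "\<And>d. d \<in> mfd_atlas N \<Longrightarrow> f y \<in> fst d \<Longrightarrow> open (snd c ` (fst c \<inter> f -` fst d)) \<and>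
       smooth_on (snd c ` (fst c \<inter> f -` fst d)) (\<lambda>q. snd d (f (chart_inv c q)))"
  shows "cmp N d (f y) (mderiv M N f y v) = FD (\<lambda>q. snd d (f (chart_inv c q))) (snd c y) (cmp M c y v)"
proof -
  define k where "k = chart_at N (f y)"
  have k: "k \<in> mfd_atlas N" "f y \<in> fst k" unfolding k_def using chart_at_in[OF N atlas_points[OF N d]] by auto
  let ?S = "\<lambda>d. snd c ` (fst c \<inter> f -` fst d)"
  have yS: "snd c y \<in> ?S k" "snd c y \<in> ?S d" using c d k by auto
  have inv: "chart_inv c (snd c y) = y" by (rule atlas_left[OF M c])
  have dk: "(\<lambda>q. snd k (f (chart_inv c q))) differentiable (at (snd c y))"
    using smooth_on_differentiable sm[OF k] yS by blast
  have m: "mderiv M N f y v = FD (\<lambda>q. snd k (f (chart_inv c q))) (snd c y) (cmp M c y v)"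
    unfolding mderiv_def k_def[symmetric] using vderiv_chart[OF M c, of "snd k \<circ> f"] dk by (simp add: o_def)
  have mk: "cmp N d (f y) w = FD (\<lambda>q. snd d (chart_inv k q)) (snd k (f y)) w" for w
    unfolding vderiv_def o_def k_def ..
  have dt: "(\<lambda>q. snd d (chart_inv k q)) differentiable (at (snd k (f (chart_inv c (snd c y)))))"
    unfolding inv by (rule smooth_on_differentiable[OF atlas_transition(2)[OF N k(1) d(1)]]) (use d k in blast)
  have "FD (\<lambda>q. snd d (f (chart_inv c q))) (snd c y) = FD (\<lambda>q. snd d (chart_inv k (snd k (f (chart_inv c q))))) (snd c y)"
  proof (rule FD_cong)
    show "open (?S k \<inter> ?S d)" using sm[OF k] sm[OF d] by blast
    show "snd c y \<in> ?S k \<inter> ?S d" using yS by blast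
    fix q assume "q \<in> ?S k \<inter> ?S d"
    then obtain x where "q = snd c x" "x \<in> fst c" "f x \<in> fst k" by auto
    then show "snd d (f (chart_inv c q)) = snd d (chart_inv k (snd k (f (chart_inv c q))))"
      using atlas_left[OF M c(1), of x] atlas_left[OF N k(1)] by simp
  qed
  then show ?thesis unfolding m mk using FD_compose[OF dk dt] by (simp add: inv)
qed

text \<open>The case \<open>S = M\<close> is included, so that vector fields and sections along a submanifold are
  treated alike.\<close>

definition incl_ok :: "('p, 'f::euclidean_space, 'y) mfd_scheme \<Rightarrow> ('p, 'e::euclidean_space, 'z) mfd_scheme \<Rightarrow> bool" where
  "incl_ok S M \<longleftrightarrow> atlas_ok S \<and> atlas_ok M \<and> (\<forall>c\<in>mfd_atlas S. \<forall>d\<in>mfd_atlas M. open (snd c ` (fst c \<inter> fst d)) \<and>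
        smooth_on (snd c ` (fst c \<inter> fst d)) (\<lambda>q. snd d (chart_inv c q)))"

lemma incl_ok_refl: "atlas_ok M \<Longrightarrow> incl_ok M M"
  by (auto simp: incl_ok_def atlas_ok_def)

lemma submanifold_incl_ok: assumes "submanifold S M" shows "incl_ok S M"
proof -
  have S: "smooth_manifold S" and M: "smooth_manifold M" and sm: "smooth_map S M (\<lambda>z. z)"
    using assms by (auto simp: submanifold_def)
  show ?thesis unfolding incl_ok_def
  proof (intro conjI ballI smooth_manifold_atlas_ok S M)
    fix c d assume c: "c \<in> mfd_atlas S" and d: "d \<in> mfd_atlas M"
    have "open_in S {z \<in> points S. z \<in> fst d}"
      using sm smooth_manifold_chart(1)[OF M d] by (auto simp: smooth_map_def intro: openin_continuous_map_preimage)
    moreover have "{z \<in> points S. z \<in> fst d} \<inter> fst c = fst c \<inter> fst d"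
      using smooth_manifold_chart(4)[OF S c] by blast
    ultimately show "open (snd c ` (fst c \<inter> fst d))" using chart_image_open[OF S c] by metis
    have "smooth_on (snd c ` (fst c \<inter> (\<lambda>z. z) -` fst d)) (snd d \<circ> (\<lambda>z. z) \<circ> chart_inv c)"
      using sm c d by (auto simp: smooth_map_def)
    then show "smooth_on (snd c ` (fst c \<inter> fst d)) (\<lambda>q. snd d (chart_inv c q))" by (simp add: o_def vimage_def)
  qed
qed

lemma incl_deriv_chart:
  assumes i: "incl_ok S M" and c: "c \<in> mfd_atlas S" "y \<in> fst c" and d: "d \<in> mfd_atlas M" "y \<in> fst d"
  shows "cmp M d y (incl_deriv S M y v) = FD (\<lambda>q. snd d (chart_inv c q)) (snd c y) (cmp S c y v)"
proof (rule mderiv_chart[of S M c y d "\<lambda>z. z", OF _ _ c d])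
  show "open (snd c ` (fst c \<inter> (\<lambda>z. z) -` fst d)) \<and>
      smooth_on (snd c ` (fst c \<inter> (\<lambda>z. z) -` fst d)) (\<lambda>q. snd d (chart_inv c q))"
    if "d \<in> mfd_atlas M" for d
    using i c(1) that unfolding incl_ok_def vimage_def by simp
qed (use i in \<open>simp_all add: incl_ok_def\<close>)

text \<open>The definition asks for all pairs of charts, yet one pair containing U decides. A change
  of source chart is a composition; a change of target chart applies the derivative of the
  transition, a smooth linear family, to the components.\<close>

lemma smooth_section_chart:
  fixes S :: "('p, 'f::euclidean_space, 'y) mfd_scheme" and M :: "('p, 'e::euclidean_space, 'z) mfd_scheme"
  assumes i: "incl_ok S M" and U: "\<And>c. c \<in> mfd_atlas S \<Longrightarrow> open (snd c ` (U \<inter> fst c))"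
    and c: "c \<in> mfd_atlas S" "U \<subseteq> fst c" and d: "d \<in> mfd_atlas M" "U \<subseteq> fst d"
  shows "smooth_section S M U \<xi> \<longleftrightarrow> smooth_on (snd c ` U) (\<lambda>q. cmp M d (chart_inv c q) (\<xi> (chart_inv c q)))"
proof
  have S: "atlas_ok S" and M: "atlas_ok M" using i by (auto simp: incl_ok_def)
  have it: "open (snd c ` (fst c \<inter> fst d))" "smooth_on (snd c ` (fst c \<inter> fst d)) (\<lambda>q. snd d (chart_inv c q))"
    if "c \<in> mfd_atlas S" "d \<in> mfd_atlas M" for c d using i that by (auto simp: incl_ok_def)
  have Uc: "U \<inter> fst c \<inter> fst d = U" using c d by blast
  show "smooth_on (snd c ` U) (\<lambda>q. cmp M d (chart_inv c q) (\<xi> (chart_inv c q)))" if "smooth_section S M U \<xi>"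
    using that c(1) d(1) Uc unfolding smooth_section_def o_def by metis
  assume s: "smooth_on (snd c ` U) (\<lambda>q. cmp M d (chart_inv c q) (\<xi> (chart_inv c q)))"
  show "smooth_section S M U \<xi>" unfolding smooth_section_def o_def
  proof (intro ballI)
    fix c' d' assume c': "c' \<in> mfd_atlas S" and d': "d' \<in> mfd_atlas M"
    let ?T = "snd c' ` (U \<inter> fst c' \<inter> fst d')"
    have oT: "open ?T"
    proof -
      have "?T = snd c' ` (U \<inter> fst c') \<inter> snd c' ` (fst c' \<inter> fst d')"
        using inj_onD[OF atlas_inj[OF S c']] by fastforce
      then show ?thesis using U[OF c'] it(1)[OF c' d'] by auto
    qed
    have l': "chart_inv c' (snd c' x) = x" if "x \<in> fst c'" for x using atlas_left[OF S c' that] .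
    have l: "chart_inv c (snd c x) = x" if "x \<in> U" for x using atlas_left[OF S c(1)] c(2) that by blast
    have t: "smooth_on ?T (\<lambda>q. snd c (chart_inv c' q))"
      by (rule smooth_on_subset[OF atlas_transition(2)[OF S c' c(1)]]) (use c(2) in blast)
    have oU: "open (snd c ` U)" using U[OF c(1)] c(2) by (simp add: inf.absorb1)
    have s1: "smooth_on ?T (\<lambda>q. cmp M d (chart_inv c (snd c (chart_inv c' q))) (\<xi> (chart_inv c (snd c (chart_inv c' q)))))"
      by (rule smooth_on_compose[OF oT oU _ t s]) (use l' in auto)
    have s1: "smooth_on ?T (\<lambda>q. cmp M d (chart_inv c' q) (\<xi> (chart_inv c' q)))"
      by (rule smooth_on_cong[THEN iffD1, OF oT _ s1]) (use l l' in auto)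
    have t2: "smooth_on ?T (\<lambda>q. snd d (chart_inv c' q))"
      by (rule smooth_on_subset[OF it(2)[OF c' d(1)]]) (use d(2) in blast)
    have "smooth_on ?T (\<lambda>q. FD (\<lambda>q. snd d' (chart_inv d q)) (snd d (chart_inv c' q)) (cmp M d (chart_inv c' q) (\<xi> (chart_inv c' q))))"
      by (rule smooth_on_FD_compose[OF oT atlas_transition(1)[OF M d(1) d'] _ atlas_transition(2)[OF M d(1) d'] t2 s1])
        (use l' d(2) in auto)
    then show "smooth_on ?T (\<lambda>q. cmp M d' (chart_inv c' q) (\<xi> (chart_inv c' q)))"
      by (rule smooth_on_cong[THEN iffD1, OF oT, rotated]) (use l' cmp_change[OF M d(1) _ d'] d(2) in auto)
  qed
qed

section \<open>Connections in charts\<close>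

text \<open>\<open>crep M c X\<close> is the coordinate representation of the vector field \<open>X\<close> in the chart \<open>c\<close>,
  \<open>vfc M c X\<close> the vector field with coordinate representation \<open>X\<close>.\<close>

definition crep where "crep M c X = (\<lambda>q. cmp M c (chart_inv c q) (X (chart_inv c q)))"
definition vfc where "vfc M c X = (\<lambda>z. inv (cmp M c z) (X (snd c z)))"

lemma smooth_section_subset:
  assumes "smooth_section S M U \<xi>" "U' \<subseteq> U" shows "smooth_section S M U' \<xi>"
  unfolding smooth_section_def
proof (intro ballI)
  fix c d assume "c \<in> mfd_atlas S" "d \<in> mfd_atlas M"
  then have "smooth_on (snd c ` (U \<inter> fst c \<inter> fst d)) ((\<lambda>z. vderiv M (snd d) z (\<xi> z)) \<circ> chart_inv c)"
    using assms(1) by (simp add: smooth_section_def)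
  then show "smooth_on (snd c ` (U' \<inter> fst c \<inter> fst d)) ((\<lambda>z. vderiv M (snd d) z (\<xi> z)) \<circ> chart_inv c)"
    by (rule smooth_on_subset) (use assms(2) in blast)
qed

locale manifold =
  fixes M :: "('p, 'e::euclidean_space, 'z) mfd_scheme"
  assumes sm: "smooth_manifold M"
begin

lemmas ok = smooth_manifold_atlas_ok[OF sm]

lemma img: "c \<in> mfd_atlas M \<Longrightarrow> open_in M U \<Longrightarrow> U \<subseteq> fst c \<Longrightarrow> open (snd c ` U)"
  using chart_image_open[OF sm, of c U] by (simp add: inf.absorb1)

lemma chart_left: "c \<in> mfd_atlas M \<Longrightarrow> y \<in> fst c \<Longrightarrow> chart_inv c (snd c y) = y"
  by (rule atlas_left[OF ok])

lemma vector_field_chart: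
  assumes "c \<in> mfd_atlas M" "open_in M U" "U \<subseteq> fst c"
  shows "vector_field M U X \<longleftrightarrow> smooth_on (snd c ` U) (crep M c X)"
  unfolding crep_def
  by (rule smooth_section_chart[OF incl_ok_refl[OF ok] _ assms(1,3) assms(1,3)])
    (rule chart_image_open[OF sm _ assms(2)])

lemma smooth_fun_in_chart:
  assumes "c \<in> mfd_atlas M" "open_in M U" "U \<subseteq> fst c"
  shows "smooth_fun M U f \<longleftrightarrow> smooth_on (snd c ` U) (\<lambda>q. f (chart_inv c q))"
  by (rule smooth_fun_chart[OF ok _ assms(1,3)]) (rule chart_image_open[OF sm _ assms(2)])

lemma crep_at: "c \<in> mfd_atlas M \<Longrightarrow> y \<in> fst c \<Longrightarrow> crep M c X (snd c y) = cmp M c y (X y)"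
  by (simp add: crep_def chart_left)

lemma cmp_vfc: "c \<in> mfd_atlas M \<Longrightarrow> y \<in> fst c \<Longrightarrow> cmp M c y (vfc M c X y) = X (snd c y)"
  unfolding vfc_def by (rule cmp_inv(1)[OF ok])

lemma crep_vfc: "c \<in> mfd_atlas M \<Longrightarrow> y \<in> fst c \<Longrightarrow> crep M c (vfc M c X) (snd c y) = X (snd c y)"
  by (simp add: crep_at cmp_vfc)

lemma vfc_eqI: "c \<in> mfd_atlas M \<Longrightarrow> y \<in> fst c \<Longrightarrow> cmp M c y v = X (snd c y) \<Longrightarrow> vfc M c X y = v"
  using cmp_inject[OF ok, of c y "vfc M c X y" v] by (simp add: cmp_vfc)

lemma vfc_vector_field:
  assumes c: "c \<in> mfd_atlas M" "open_in M U" "U \<subseteq> fst c" and X: "smooth_on (snd c ` U) X"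
  shows "vector_field M U (vfc M c X)"
  unfolding vector_field_chart[OF c]
proof (rule smooth_on_cong[THEN iffD1, OF img[OF c] _ X])
  fix q assume "q \<in> snd c ` U"
  then obtain z where "q = snd c z" "z \<in> fst c" using c(3) by blast
  then show "X q = crep M c (vfc M c X) q" using crep_vfc[OF c(1)] by simp
qed

lemma vfc_linear: "c \<in> mfd_atlas M \<Longrightarrow> y \<in> fst c \<Longrightarrow> linear (\<lambda>w. vfc M c (\<lambda>q. w) y)"
  unfolding vfc_def by (rule cmp_inv(3)[OF ok])

lemma vfc_const_cmp: "c \<in> mfd_atlas M \<Longrightarrow> y \<in> fst c \<Longrightarrow> vfc M c (\<lambda>q. cmp M c y v) y = v"
  by (rule vfc_eqI) auto

lemma smooth_fun_const: "open_in M U \<Longrightarrow> (\<And>z. z \<in> U \<Longrightarrow> f z = r) \<Longrightarrow> smooth_fun M U f"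
  unfolding smooth_fun_def
proof
  fix c assume U: "open_in M U" "\<And>z. z \<in> U \<Longrightarrow> f z = r" and c: "c \<in> mfd_atlas M"
  show "smooth_on (snd c ` (U \<inter> fst c)) (f \<circ> chart_inv c)"
  proof (rule smooth_on_cong[THEN iffD1, OF chart_image_open[OF sm c U(1)] _ smooth_on_const[of _ r]])
    fix q assume "q \<in> snd c ` (U \<inter> fst c)"
    then obtain z where "q = snd c z" "z \<in> U" "z \<in> fst c" by blast
    then show "r = (f \<circ> chart_inv c) q" using U(2) chart_left[OF c] by simp
  qed
qed

lemma vderiv_const:
  assumes U: "open_in M U" "y \<in> U" "\<And>z. z \<in> U \<Longrightarrow> f z = r" shows "vderiv M f y v = 0"
proof -
  define k where "k = chart_at M y"
  have k: "k \<in> mfd_atlas M" "y \<in> fst k" unfolding k_def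
    using chart_at_in[OF ok] openin_subset[OF U(1)] U(2) by auto
  have "FD (\<lambda>q. f (chart_inv k q)) (snd k y) = FD (\<lambda>q. r) (snd k y)"
  proof (rule FD_cong[OF chart_image_open[OF sm k(1) U(1)]])
    show "snd k y \<in> snd k ` (U \<inter> fst k)" using U(2) k(2) by blast
    fix q assume "q \<in> snd k ` (U \<inter> fst k)"
    then obtain z where "q = snd k z" "z \<in> U" "z \<in> fst k" by blast
    then show "f (chart_inv k q) = r" using U(3) chart_left[OF k(1)] by simp
  qed
  then show ?thesis by (simp add: vderiv_def o_def k_def)
qed

end

locale conn_manifold = manifold M for M :: "('p, 'e::euclidean_space, 'z) mfd_scheme" +
  fixes nb :: "'p \<Rightarrow> 'e \<Rightarrow> ('p \<Rightarrow> 'e) \<Rightarrow> 'e"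
  assumes conn: "connection M nb"
begin

lemma nb_field: "open_in M U \<Longrightarrow> vector_field M U X \<Longrightarrow> vector_field M U Y \<Longrightarrow> vector_field M U (\<lambda>y. nb y (X y) Y)"
  by (rule conn[unfolded connection_def, THEN conjunct1, rule_format, OF conjI[OF _ conjI]])
lemma nb_linear: "open_in M U \<Longrightarrow> y \<in> U \<Longrightarrow> vector_field M U Y \<Longrightarrow> linear (\<lambda>v. nb y v Y)"
  by (rule conn[unfolded connection_def, THEN conjunct2, THEN conjunct1, rule_format, OF conjI[OF _ conjI]])
lemma nb_add: "open_in M U \<Longrightarrow> y \<in> U \<Longrightarrow> vector_field M U Y \<Longrightarrow> vector_field M U Z \<Longrightarrow>
    nb y v (\<lambda>z. Y z + Z z) = nb y v Y + nb y v Z"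
  by (rule conn[unfolded connection_def, THEN conjunct2, THEN conjunct2, THEN conjunct1, rule_format, OF conjI[OF _ conjI[OF _ conjI]]])
lemma nb_leibniz: "open_in M U \<Longrightarrow> y \<in> U \<Longrightarrow> smooth_fun M U f \<Longrightarrow> vector_field M U Y \<Longrightarrow>
    nb y v (\<lambda>z. f z *\<^sub>R Y z) = vderiv M f y v *\<^sub>R Y y + f y *\<^sub>R nb y v Y"
  by (rule conn[unfolded connection_def, THEN conjunct2, THEN conjunct2, THEN conjunct2, rule_format, OF conjI[OF _ conjI[OF _ conjI]]])

text \<open>The cutoff is the indicator function of U. Smoothness is tested on U only, where it is
  constant, so it is admissible and has derivative zero there. Multiplied by it, the two fields
  become equal as functions.\<close>

lemma nb_local:
  assumes U: "open_in M U" "y \<in> U" "vector_field M U Y" "vector_field M U Y'"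
    and eq: "\<And>z. z \<in> U \<Longrightarrow> Y z = Y' z"
  shows "nb y v Y = nb y v Y'"
proof -
  define f where "f z = (if z \<in> U then 1 else 0 :: real)" for z
  have sf: "smooth_fun M U f" by (rule smooth_fun_const[OF U(1)]) (simp add: f_def)
  have d0: "vderiv M f y v = 0" by (rule vderiv_const[OF U(1,2), of f 1]) (simp add: f_def)
  have "(\<lambda>z. f z *\<^sub>R Y z) = (\<lambda>z. f z *\<^sub>R Y' z)" by (auto simp: f_def eq)
  then show ?thesis
    using nb_leibniz[OF U(1,2) sf U(3), of v] nb_leibniz[OF U(1,2) sf U(4), of v] d0 U(2) by (simp add: f_def)
qed

lemma nb_zero: assumes "open_in M U" "y \<in> U" "vector_field M U (\<lambda>z. 0)" shows "nb y v (\<lambda>z. 0) = 0"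
  using nb_leibniz[OF assms(1,2) smooth_fun_const[OF assms(1), of "\<lambda>z. 0" 0] assms(3), of v]
    vderiv_const[OF assms(1,2), of "\<lambda>z. 0 :: real" 0] by simp

lemma nb_sum:
  assumes c: "c \<in> mfd_atlas M" "open_in M U" "U \<subseteq> fst c" and y: "y \<in> U"
    and "finite A" "\<And>i. i \<in> A \<Longrightarrow> smooth_fun M U (f i)" "\<And>i. i \<in> A \<Longrightarrow> vector_field M U (Y i)"
  shows "vector_field M U (\<lambda>z. \<Sum>i\<in>A. f i z *\<^sub>R Y i z) \<and> nb y v (\<lambda>z. \<Sum>i\<in>A. f i z *\<^sub>R Y i z) =
    (\<Sum>i\<in>A. vderiv M (f i) y v *\<^sub>R Y i y + f i y *\<^sub>R nb y v (Y i))"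
  using assms(5-)
proof (induction A rule: finite_induct)
  case empty
  have "vector_field M U (\<lambda>z. 0)"
    unfolding vector_field_chart[OF c]
  proof (rule smooth_on_cong[THEN iffD1, OF img[OF c] _ smooth_on_const[of _ 0]])
    fix q assume "q \<in> snd c ` U"
    then obtain z where z: "q = snd c z" "z \<in> fst c" using c(3) by blast
    then show "0 = crep M c (\<lambda>z. 0) q" using linear_0[OF cmp_linear[OF ok c(1) z(2)]] by (simp add: crep_at[OF c(1)])
  qed
  then show ?case using nb_zero[OF c(2) y] by simp
next
  case (insert i A)
  have add: "vector_field M U (\<lambda>z. X z + X' z)" if "vector_field M U X" "vector_field M U X'" for X X'
    unfolding vector_field_chart[OF c]
  proof (rule smooth_on_cong[THEN iffD1, OF img[OF c]])
    show "smooth_on (snd c ` U) (\<lambda>q. crep M c X q + crep M c X' q)"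
      using that unfolding vector_field_chart[OF c] by (intro smooth_on_add img[OF c])
    fix q assume "q \<in> snd c ` U"
    then obtain z where z: "q = snd c z" "z \<in> fst c" using c(3) by blast
    then show "crep M c X q + crep M c X' q = crep M c (\<lambda>z. X z + X' z) q"
      using linear_add[OF cmp_linear[OF ok c(1) z(2)]] by (simp add: crep_at[OF c(1)])
  qed
  have sc: "vector_field M U (\<lambda>z. f i z *\<^sub>R Y i z)"
    unfolding vector_field_chart[OF c]
  proof (rule smooth_on_cong[THEN iffD1, OF img[OF c]])
    show "smooth_on (snd c ` U) (\<lambda>q. f i (chart_inv c q) *\<^sub>R crep M c (Y i) q)"
      using insert.prems(1,2)[of i] unfolding vector_field_chart[OF c] smooth_fun_in_chart[OF c]
      by (intro smooth_on_scaleR img[OF c]) auto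
    fix q assume "q \<in> snd c ` U"
    then obtain z where z: "q = snd c z" "z \<in> fst c" using c(3) by blast
    then show "f i (chart_inv c q) *\<^sub>R crep M c (Y i) q = crep M c (\<lambda>z. f i z *\<^sub>R Y i z) q"
      using linear_cmul[OF cmp_linear[OF ok c(1) z(2)]] by (simp add: crep_at[OF c(1)] chart_left[OF c(1)])
  qed
  have IH: "vector_field M U (\<lambda>z. \<Sum>i\<in>A. f i z *\<^sub>R Y i z)"
    "nb y v (\<lambda>z. \<Sum>i\<in>A. f i z *\<^sub>R Y i z) = (\<Sum>i\<in>A. vderiv M (f i) y v *\<^sub>R Y i y + f i y *\<^sub>R nb y v (Y i))"
    using insert by auto
  have "nb y v (\<lambda>z. f i z *\<^sub>R Y i z) = vderiv M (f i) y v *\<^sub>R Y i y + f i y *\<^sub>R nb y v (Y i)"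
    by (rule nb_leibniz[OF c(2) y]) (use insert.prems in auto)
  then show ?case
    using add[OF sc IH(1)] nb_add[OF c(2) y sc IH(1), of v] IH(2) insert.hyps by simp
qed

text \<open>The Christoffel map of the chart c: the components of the derivative of a field with
  constant components w in the direction with components v.\<close>

definition Gam where
  "Gam c q v w = cmp M c (chart_inv c q) (nb (chart_inv c q) (vfc M c (\<lambda>p. v) (chart_inv c q)) (vfc M c (\<lambda>p. w)))"

lemma const_field: "c \<in> mfd_atlas M \<Longrightarrow> open_in M U \<Longrightarrow> U \<subseteq> fst c \<Longrightarrow> vector_field M U (vfc M c (\<lambda>p. w))"
  by (rule vfc_vector_field[OF _ _ _ smooth_on_const])

text \<open>Near y the field is a combination of basis fields with its components as coefficients;
  additivity and the Leibniz rule give the formula. The sum over the basis cannot yet be written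
  with \<open>Gam\<close>, whose linearity in the last argument is itself a consequence, through
  \<open>Gam_expand\<close>.\<close>

lemma nb_chart_Basis:
  assumes c: "c \<in> mfd_atlas M" "open_in M U" "U \<subseteq> fst c" and y: "y \<in> U" and Y: "vector_field M U Y"
  shows "cmp M c y (nb y v Y) = FD (crep M c Y) (snd c y) (cmp M c y v) +
    (\<Sum>b\<in>Basis. (crep M c Y (snd c y) \<bullet> b) *\<^sub>R cmp M c y (nb y v (vfc M c (\<lambda>p. b))))"
proof -
  have yc: "y \<in> fst c" using y c(3) by blast
  have sY: "smooth_on (snd c ` U) (crep M c Y)" using Y unfolding vector_field_chart[OF c] .
  define f where "f b z = crep M c Y (snd c z) \<bullet> b" for b z
  have sf: "smooth_fun M U (f b)" for b
    unfolding smooth_fun_in_chart[OF c]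
  proof (rule smooth_on_cong[THEN iffD1, OF img[OF c]])
    show "smooth_on (snd c ` U) (\<lambda>q. crep M c Y q \<bullet> b)" by (intro smooth_on_inner sY smooth_on_const img[OF c])
    show "crep M c Y q \<bullet> b = f b (chart_inv c q)" if "q \<in> snd c ` U" for q
      using that c(3) chart_left[OF c(1)] by (auto simp: f_def)
  qed
  have sumf: "vector_field M U (\<lambda>z. \<Sum>b\<in>Basis. f b z *\<^sub>R vfc M c (\<lambda>p. b) z) \<and>
    nb y v (\<lambda>z. \<Sum>b\<in>Basis. f b z *\<^sub>R vfc M c (\<lambda>p. b) z) =
    (\<Sum>b\<in>Basis. vderiv M (f b) y v *\<^sub>R vfc M c (\<lambda>p. b) y + f b y *\<^sub>R nb y v (vfc M c (\<lambda>p. b)))"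
    by (rule nb_sum[OF c y finite_Basis sf const_field[OF c]])
  have "nb y v Y = nb y v (\<lambda>z. \<Sum>b\<in>Basis. f b z *\<^sub>R vfc M c (\<lambda>p. b) z)"
  proof (rule nb_local[OF c(2) y Y])
    show "vector_field M U (\<lambda>z. \<Sum>b\<in>Basis. f b z *\<^sub>R vfc M c (\<lambda>p. b) z)" using sumf by blast
    fix z assume "z \<in> U"
    then have z: "z \<in> fst c" using c(3) by blast
    show "Y z = (\<Sum>b\<in>Basis. f b z *\<^sub>R vfc M c (\<lambda>p. b) z)"
      using linear_expand[OF vfc_linear[OF c(1) z], of "cmp M c z (Y z)"] vfc_const_cmp[OF c(1) z]
      by (simp add: f_def crep_at[OF c(1) z])
  qed
  also have "\<dots> = (\<Sum>b\<in>Basis. vderiv M (f b) y v *\<^sub>R vfc M c (\<lambda>p. b) y + f b y *\<^sub>R nb y v (vfc M c (\<lambda>p. b)))"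
    using sumf by blast
  finally have "cmp M c y (nb y v Y) = (\<Sum>b\<in>Basis. vderiv M (f b) y v *\<^sub>R b + f b y *\<^sub>R cmp M c y (nb y v (vfc M c (\<lambda>p. b))))"
    using cmp_linear[OF ok c(1) yc] by (simp add: linear_sum linear_add linear_cmul cmp_vfc[OF c(1) yc])
  moreover have "vderiv M (f b) y v = FD (crep M c Y) (snd c y) (cmp M c y v) \<bullet> b" for b
  proof -
    have d: "(crep M c Y has_derivative FD (crep M c Y) (snd c y)) (at (snd c y))"
      by (rule smooth_on_has_derivative[OF sY]) (use y in blast)
    have "((\<lambda>q. crep M c Y q \<bullet> b) has_derivative (\<lambda>h. FD (crep M c Y) (snd c y) h \<bullet> b)) (at (snd c y))"
      by (rule has_derivative_inner_left[OF d])
    then have d2: "((\<lambda>q. f b (chart_inv c q)) has_derivative (\<lambda>h. FD (crep M c Y) (snd c y) h \<bullet> b)) (at (snd c y))"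
      by (rule has_derivative_transform_within_open[OF _ img[OF c]])
        (use y c(3) chart_left[OF c(1)] in \<open>auto simp: f_def\<close>)
    show ?thesis using vderiv_chart[OF ok c(1) yc, of "f b" v] FD_eq[OF d2] d2
      by (auto simp: differentiable_def)
  qed
  ultimately show ?thesis by (simp add: sum.distrib euclidean_representation f_def)
qed

lemma Gam_expand:
  assumes c: "c \<in> mfd_atlas M" "y \<in> fst c"
  shows "(\<Sum>b\<in>Basis. (w \<bullet> b) *\<^sub>R cmp M c y (nb y v (vfc M c (\<lambda>p. b)))) = Gam c (snd c y) (cmp M c y v) w"
proof -
  note o = smooth_manifold_chart(1)[OF sm c(1)] smooth_manifold_chart(2)[OF sm c(1)]
  have yi: "snd c y \<in> snd c ` fst c" using c by blast
  have eq: "crep M c (vfc M c (\<lambda>p. w)) q = w" if "q \<in> snd c ` fst c" for q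
    using that crep_vfc[OF c(1)] by auto
  have "FD (crep M c (vfc M c (\<lambda>p. w))) (snd c y) = FD (\<lambda>q. w) (snd c y)"
    by (rule FD_cong[OF o(2) yi eq])
  then have "cmp M c y (nb y v (vfc M c (\<lambda>p. w))) = (\<Sum>b\<in>Basis. (w \<bullet> b) *\<^sub>R cmp M c y (nb y v (vfc M c (\<lambda>p. b))))"
    using nb_chart_Basis[OF c(1) o(1) order_refl c(2) const_field[OF c(1) o(1) order_refl], of v w] eq[OF yi] by simp
  then show ?thesis unfolding Gam_def chart_left[OF c] vfc_const_cmp[OF c] by simp
qed

lemma nb_chart:
  assumes c: "c \<in> mfd_atlas M" "open_in M U" "U \<subseteq> fst c" and y: "y \<in> U" and Y: "vector_field M U Y"
  shows "cmp M c y (nb y v Y) = FD (crep M c Y) (snd c y) (cmp M c y v) + Gam c (snd c y) (cmp M c y v) (crep M c Y (snd c y))"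
  using nb_chart_Basis[OF assms, of v] Gam_expand[OF c(1), of y] y c(3) by auto

lemma Gam_bil: assumes c: "c \<in> mfd_atlas M" "y \<in> fst c" shows "bilinear (Gam c (snd c y))"
  unfolding bilinear_def
proof (intro conjI allI)
  note o = smooth_manifold_chart(1)[OF sm c(1)]
  fix v w
  have "linear (\<lambda>v. cmp M c y (nb y (vfc M c (\<lambda>p. v) y) (vfc M c (\<lambda>p. w))))"
    using linear_compose[OF linear_compose[OF vfc_linear[OF c] nb_linear[OF o c(2) const_field[OF c(1) o order_refl, of w]]] cmp_linear[OF ok c]]
    by (simp add: o_def)
  then show "linear (\<lambda>v. Gam c (snd c y) v w)" by (simp add: Gam_def chart_left[OF c])
  have "Gam c (snd c y) v = (\<lambda>w. \<Sum>b\<in>Basis. (w \<bullet> b) *\<^sub>R cmp M c y (nb y (vfc M c (\<lambda>p. v) y) (vfc M c (\<lambda>p. b))))"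
    by (rule ext) (simp add: Gam_expand[OF c] cmp_vfc[OF c])
  moreover have "linear (\<lambda>w. \<Sum>b\<in>Basis. (w \<bullet> b) *\<^sub>R g b)" for g :: "'e \<Rightarrow> 'e"
    by (rule linearI) (simp_all add: inner_add_left scaleR_left_distrib sum.distrib scaleR_sum_right)
  ultimately show "linear (\<lambda>w. Gam c (snd c y) v w)" by simp
qed

lemma Gam_smooth: assumes c: "c \<in> mfd_atlas M" shows "smooth_on (snd c ` fst c) (\<lambda>q. Gam c q v w)"
proof -
  note o = smooth_manifold_chart(1)[OF sm c]
  have "vector_field M (fst c) (\<lambda>y. nb y (vfc M c (\<lambda>p. v) y) (vfc M c (\<lambda>p. w)))"
    by (rule nb_field[OF o const_field[OF c o order_refl] const_field[OF c o order_refl]])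
  then show ?thesis unfolding vector_field_chart[OF c o order_refl] by (simp add: crep_def Gam_def)
qed

end

text \<open>The bracket is defined in the chosen chart k, where a field with constant components a
  in c has as components the derivative of the transition in direction a. The bracket is thus a
  difference of mixed second derivatives of the transition.\<close>

lemma lie_bracket_const:
  fixes M :: "('p, 'e::euclidean_space, 'z) mfd_scheme"
  assumes M: "smooth_manifold M" and c: "c \<in> mfd_atlas M" "y \<in> fst c"
  shows "lie_bracket M (vfc M c (\<lambda>p. v)) (vfc M c (\<lambda>p. w)) y = 0"
proof -
  interpret manifold M by unfold_locales (rule M)
  define k where "k = chart_at M y"
  have k: "k \<in> mfd_atlas M" "y \<in> fst k" unfolding k_def using chart_at_in[OF ok atlas_points[OF ok c]] by auto
  let ?S = "snd c ` (fst c \<inter> fst k)" and ?t = "\<lambda>q. snd k (chart_inv c q)"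
  have oS: "open ?S" and sS: "smooth_on ?S ?t" using atlas_transition[OF ok c(1) k(1)] by auto
  have yS: "snd c y \<in> ?S" using c k by blast
  have D: "vderiv M (\<lambda>z. vderiv M (snd k) z (vfc M c (\<lambda>p. a) z)) y (vfc M c (\<lambda>p. b) y)
      = FD (\<lambda>q. FD ?t q a) (snd c y) b" for a b
  proof -
    have eq: "vderiv M (snd k) (chart_inv c q) (vfc M c (\<lambda>p. a) (chart_inv c q)) = FD ?t q a" if qS: "q \<in> ?S" for q
    proof -
      obtain z where z: "q = snd c z" "z \<in> fst c" "z \<in> fst k" using qS by blast
      then show ?thesis using cmp_change[OF ok c(1) z(2) k(1) z(3)] by (simp add: chart_left[OF c(1) z(2)] cmp_vfc[OF c(1) z(2)])
    qed
    have d: "(\<lambda>q. vderiv M (snd k) (chart_inv c q) (vfc M c (\<lambda>p. a) (chart_inv c q))) differentiable (at (snd c y))"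
      by (rule differentiable_cong_open[OF oS yS, where g = "\<lambda>q. FD ?t q a", THEN iffD2])
        (erule eq, rule smooth_on_differentiable[OF smooth_on_FD[OF sS] yS])
    show ?thesis using vderiv_chart[OF ok c d] FD_cong[OF oS yS eq] by (simp add: cmp_vfc[OF c])
  qed
  show ?thesis unfolding lie_bracket_def Let_def k_def[symmetric] D
    using smooth_FD_commute[OF oS sS yS] by simp
qed

section \<open>Riemannian manifolds in charts\<close>

locale riem_mfd =
  fixes M :: "('p, 'e::euclidean_space) riem"
  assumes rm: "riemannian_manifold M"

sublocale riem_mfd \<subseteq> conn_manifold M "conn M"
  using rm by unfold_locales (auto simp: riemannian_manifold_def levi_civita_def)

context riem_mfd
begin

definition Gm where "Gm c q v w = rmetric M (chart_inv c q) (vfc M c (\<lambda>p. v) (chart_inv c q)) (vfc M c (\<lambda>p. w) (chart_inv c q))"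

lemma Gm_cmp: "c \<in> mfd_atlas M \<Longrightarrow> y \<in> fst c \<Longrightarrow> Gm c (snd c y) (cmp M c y u) (cmp M c y v) = rmetric M y u v"
  by (simp add: Gm_def chart_left vfc_const_cmp)

lemma torsion_free: "open_in M U \<Longrightarrow> y \<in> U \<Longrightarrow> vector_field M U X \<Longrightarrow> vector_field M U Y \<Longrightarrow>
   conn M y (X y) Y - conn M y (Y y) X = lie_bracket M X Y y"
  by (rule rm[unfolded riemannian_manifold_def, THEN conjunct2, THEN conjunct2, unfolded levi_civita_def, THEN conjunct2, THEN conjunct1, rule_format, OF conjI[OF _ conjI[OF _ conjI]]])

lemma metric_compat: "open_in M U \<Longrightarrow> y \<in> U \<Longrightarrow> vector_field M U Y \<Longrightarrow> vector_field M U Z \<Longrightarrow>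
   vderiv M (\<lambda>z. rmetric M z (Y z) (Z z)) y v = rmetric M y (conn M y v Y) (Z y) + rmetric M y (Y y) (conn M y v Z)"
  by (rule rm[unfolded riemannian_manifold_def, THEN conjunct2, THEN conjunct2, unfolded levi_civita_def, THEN conjunct2, THEN conjunct2, rule_format, OF conjI[OF _ conjI[OF _ conjI]]])

lemma metric_at: assumes "y \<in> points M"
  shows "bilinear (rmetric M y)" "rmetric M y u v = rmetric M y v u" "u \<noteq> 0 \<Longrightarrow> rmetric M y u u > 0"
  using rm assms unfolding riemannian_manifold_def riemannian_metric_def by auto

lemma metric_smooth: "open_in M U \<Longrightarrow> vector_field M U X \<Longrightarrow> vector_field M U Y \<Longrightarrow> smooth_fun M U (\<lambda>y. rmetric M y (X y) (Y y))"
  by (rule rm[unfolded riemannian_manifold_def, THEN conjunct2, THEN conjunct1, unfolded riemannian_metric_def, THEN conjunct2, rule_format, OF conjI[OF _ conjI]])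

text \<open>All axioms are read off fields with constant components. Their bracket vanishes, so
  absence of torsion becomes symmetry of the Christoffel map, and metric compatibility becomes the
  derivative formula for the metric coefficients.\<close>

lemma chart_metric_chart:
  assumes c: "c \<in> mfd_atlas M" shows "chart_metric (snd c ` fst c) (Gm c) (Gam c)"
proof (rule chart_metric.intro)
  note o = smooth_manifold_chart(1)[OF sm c]
  note cf = const_field[OF c o order_refl]
  show "open (snd c ` fst c)" by (rule smooth_manifold_chart(2)[OF sm c])
  have sG: "smooth_on (snd c ` fst c) (\<lambda>q. Gm c q u v)" for u v
    using metric_smooth[OF o cf cf, of u v] unfolding smooth_fun_in_chart[OF c o order_refl] Gm_def .
  then show "smooth_on (snd c ` fst c) (\<lambda>q. Gm c q u v)" for u v .
  show "smooth_on (snd c ` fst c) (\<lambda>q. Gam c q u v)" for u v by (rule Gam_smooth[OF c])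
  fix q u v w assume "q \<in> snd c ` fst c"
  then obtain y where q: "q = snd c y" and y: "y \<in> fst c" by blast
  have yM: "y \<in> points M" by (rule atlas_points[OF ok c y])
  note left = chart_left[OF c y] and lin = vfc_linear[OF c y]
  show "bilinear (Gm c q)"
    unfolding bilinear_def Gm_def q left
  proof (intro conjI allI)
    fix x
    have "linear (rmetric M y (vfc M c (\<lambda>p. x) y))" "linear (\<lambda>z. rmetric M y z (vfc M c (\<lambda>p. x) y))"
      using metric_at(1)[OF yM] by (simp_all add: bilinear_def)
    from linear_compose[OF lin this(1)] linear_compose[OF lin this(2)]
    show "linear (\<lambda>z. rmetric M y (vfc M c (\<lambda>p. x) y) (vfc M c (\<lambda>p. z) y))"
      "linear (\<lambda>z. rmetric M y (vfc M c (\<lambda>p. z) y) (vfc M c (\<lambda>p. x) y))" by (simp_all add: o_def)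
  qed
  show "Gm c q u v = Gm c q v u" unfolding Gm_def q left by (rule metric_at(2)[OF yM])
  show "u \<noteq> 0 \<Longrightarrow> 0 < Gm c q u u"
  proof -
    assume "u \<noteq> 0"
    then have "vfc M c (\<lambda>p. u) y \<noteq> 0" using cmp_vfc[OF c y, of "\<lambda>p. u"] linear_0[OF cmp_linear[OF ok c y]] by metis
    then show ?thesis unfolding Gm_def q left by (rule metric_at(3)[OF yM])
  qed
  show "bilinear (Gam c q)" unfolding q by (rule Gam_bil[OF c y])
  have "conn M y (vfc M c (\<lambda>p. u) y) (vfc M c (\<lambda>p. v)) - conn M y (vfc M c (\<lambda>p. v) y) (vfc M c (\<lambda>p. u)) = 0"
    using torsion_free[OF o y cf cf] lie_bracket_const[OF sm c y] by simp
  then show "Gam c q u v = Gam c q v u" unfolding Gam_def q left by simp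
  have d: "(\<lambda>q. Gm c q v w) differentiable (at (snd c y))"
    by (rule smooth_on_differentiable[OF sG]) (use y in blast)
  have "vderiv M (\<lambda>z. rmetric M z (vfc M c (\<lambda>p. v) z) (vfc M c (\<lambda>p. w) z)) y (vfc M c (\<lambda>p. u) y) =
      FD (\<lambda>q. Gm c q v w) q u"
    using vderiv_chart[OF ok c y d[unfolded Gm_def]] unfolding Gm_def q by (simp add: cmp_vfc[OF c y])
  moreover have "vfc M c (\<lambda>p. Gam c q u x) y = conn M y (vfc M c (\<lambda>p. u) y) (vfc M c (\<lambda>p. x))" for x
    by (rule vfc_eqI[OF c y]) (simp add: Gam_def q left)
  ultimately show "FD (\<lambda>q. Gm c q v w) q u = Gm c q (Gam c q u v) w + Gm c q v (Gam c q u w)"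
    using metric_compat[OF o y cf cf, of v w "vfc M c (\<lambda>p. u) y"] unfolding Gm_def q left by simp
qed

lemma curvature_chart:
  assumes c: "c \<in> mfd_atlas M" "y \<in> fst c"
  shows "cmp M c y (curvature M (vfc M c (\<lambda>p. u)) (vfc M c (\<lambda>p. v)) (vfc M c (\<lambda>p. w)) y) =
     chart_metric.curv (Gam c) (snd c y) u v w"
proof -
  interpret C: chart_metric "snd c ` fst c" "Gm c" "Gam c" by (rule chart_metric_chart[OF c(1)])
  note o = smooth_manifold_chart(1)[OF sm c(1)] and lin = cmp_linear[OF ok c]
  note cf = const_field[OF c(1) o order_refl]
  have yi: "snd c y \<in> snd c ` fst c" using c by blast
  have 1: "cmp M c y (conn M y (vfc M c (\<lambda>p. a) y) (\<lambda>z. conn M z (vfc M c (\<lambda>p. b) z) (vfc M c (\<lambda>p. w)))) =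
     FD (\<lambda>q. Gam c q b w) (snd c y) a + Gam c (snd c y) a (Gam c (snd c y) b w)" for a b
  proof -
    have "crep M c (\<lambda>z. conn M z (vfc M c (\<lambda>p. b) z) (vfc M c (\<lambda>p. w))) = (\<lambda>q. Gam c q b w)"
      by (simp add: crep_def Gam_def)
    then show ?thesis
      using nb_chart[OF c(1) o order_refl c(2) nb_field[OF o cf cf], of "vfc M c (\<lambda>p. a) y" b w] by (simp add: cmp_vfc[OF c])
  qed
  have "conn M y 0 (vfc M c (\<lambda>p. w)) = 0" using linear_0[OF nb_linear[OF o c(2) cf]] .
  then show ?thesis unfolding curvature_def lie_bracket_const[OF sm c] C.curv_def
    by (simp add: linear_diff[OF lin] linear_0[OF lin] 1)
qed

lemma constant_curvature_chart:
  assumes cc: "constant_curvature M \<kappa>" and c: "c \<in> mfd_atlas M" and q: "q \<in> snd c ` fst c"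
  shows "Gm c q (chart_metric.curv (Gam c) q u v w) z = \<kappa> * (Gm c q v w * Gm c q u z - Gm c q u w * Gm c q v z)"
proof -
  interpret C: chart_metric "snd c ` fst c" "Gm c" "Gam c" by (rule chart_metric_chart[OF c])
  note bG = bilinear_simps[OF C.G_bil[OF q]]
  obtain y where y: "q = snd c y" "y \<in> fst c" using q by blast
  note o = smooth_manifold_chart(1)[OF sm c]
  show ?thesis
  proof (rule C.constant_curvature_tensor[OF q])
    fix u v :: 'e assume uv: "u \<noteq> v" "independent {u, v}"
    let ?u = "vfc M c (\<lambda>p. u)" and ?v = "vfc M c (\<lambda>p. v)"
    have inj: "inj (\<lambda>w. vfc M c (\<lambda>p. w) y)" by (metis (lifting) cmp_vfc[OF c y(2)] injI)
    have ne: "?u y \<noteq> ?v y" using inj uv(1) by (auto dest: injD)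
    have "independent ((\<lambda>w. vfc M c (\<lambda>p. w) y) ` {u, v})"
      by (rule linear_independent_injective_image[OF vfc_linear[OF c y(2)] uv(2)]) (use inj in \<open>auto intro: inj_on_subset\<close>)
    then have "independent {?u y, ?v y}" by simp
    then have "sectional_curvature M ?u ?v y = \<kappa>"
      by (intro cc[unfolded constant_curvature_def, rule_format, of "fst c"] conjI o y(2) const_field[OF c o order_refl] ne)
    moreover have "rmetric M y (curvature M ?u ?v ?v y) (?u y) = Gm c q (C.curv q u v v) u"
      using Gm_cmp[OF c y(2), of "curvature M ?u ?v ?v y" "?u y"] curvature_chart[OF c y(2), of u v v]
      by (simp add: y(1) cmp_vfc[OF c y(2)])
    moreover have "rmetric M y (vfc M c (\<lambda>p. a) y) (vfc M c (\<lambda>p. b) y) = Gm c q a b" for a b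
      by (simp add: Gm_def y(1) chart_left[OF c y(2)])
    ultimately have eq: "Gm c q (C.curv q u v v) u / (Gm c q u u * Gm c q v v - (Gm c q u v)\<^sup>2) = \<kappa>"
      unfolding sectional_curvature_def by simp
    have u0: "u \<noteq> 0" using uv(2) dependent_zero by blast
    have guu: "Gm c q u u > 0" by (rule C.G_pos[OF q u0])
    \<comment> \<open>The component of v orthogonal to u. The denominator of the sectional curvature
      equals \<open>Gm c q u u * Gm c q r r\<close>, which is positive, so it may be multiplied
      out.\<close>
    define r where "r = v - (Gm c q u v / Gm c q u u) *\<^sub>R u"
    have "r \<noteq> 0"
    proof
      assume "r = 0"
      then have "v = (Gm c q u v / Gm c q u u) *\<^sub>R u" by (simp add: r_def)
      then have "v \<in> span {u}" by (auto simp: span_singleton)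
      moreover have "v \<notin> span ({u, v} - {v})" using uv(2) unfolding dependent_def by blast
      ultimately show False using uv(1) by (simp add: insert_Diff_if)
    qed
    then have "Gm c q r r > 0" by (rule C.G_pos[OF q])
    then have "0 < Gm c q u u * Gm c q r r" using guu by simp
    also have "\<dots> = Gm c q u u * Gm c q v v - (Gm c q u v)\<^sup>2"
      using guu C.G_sym[OF q, of v u] by (simp add: r_def bG field_simps power2_eq_square)
    finally show "Gm c q (C.curv q u v v) u = \<kappa> * (Gm c q u u * Gm c q v v - (Gm c q u v)\<^sup>2)"
      using eq by (simp add: field_simps)
  qed
qed

end

section \<open>Riemannian submanifolds in charts\<close>

locale riem_sub = F: riem_mfd F + M: riem_mfd M
  for F :: "('p, 'f::euclidean_space) riem" and M :: "('p, 'm::euclidean_space) riem" +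
  assumes rs: "riemannian_submanifold F M"

locale riem_sub_chart = riem_sub F M for F :: "('p, 'f::euclidean_space) riem" and M :: "('p, 'm::euclidean_space) riem" +
  fixes c :: "'p set \<times> ('p \<Rightarrow> 'f)" and d :: "'p set \<times> ('p \<Rightarrow> 'm)"
  assumes c: "c \<in> mfd_atlas F" and d: "d \<in> mfd_atlas M"
begin

definition "W = fst c \<inter> fst d"
definition "\<Omega> = snd c ` W"
definition "f q = snd d (chart_inv c q)"
definition "srep \<xi> q = cmp M d (chart_inv c q) (\<xi> (chart_inv c q))"

lemma sub: "submanifold F M" using rs by (simp add: riemannian_submanifold_def)
lemma i: "incl_ok F M" by (rule submanifold_incl_ok[OF sub])

lemma W_open: "open_in F W"
proof -
  have "open_in F {z \<in> points F. z \<in> fst d}"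
    using sub smooth_manifold_chart(1)[OF M.sm d]
    by (auto simp: submanifold_def smooth_map_def intro: openin_continuous_map_preimage)
  then have "open_in F (fst c \<inter> {z \<in> points F. z \<in> fst d})"
    by (rule openin_Int[OF smooth_manifold_chart(1)[OF F.sm c]])
  moreover have "fst c \<inter> {z \<in> points F. z \<in> fst d} = W"
    using smooth_manifold_chart(4)[OF F.sm c] by (auto simp: W_def)
  ultimately show ?thesis by simp
qed

lemma W_sub: "W \<subseteq> fst c" "W \<subseteq> fst d" by (auto simp: W_def)

lemma inv_c: "y \<in> W \<Longrightarrow> chart_inv c (snd c y) = y"
  using F.chart_left[OF c] W_sub by blast

lemma f_at: "y \<in> W \<Longrightarrow> f (snd c y) = snd d y" by (simp add: f_def inv_c)
lemma srep_at: "y \<in> W \<Longrightarrow> srep \<xi> (snd c y) = cmp M d y (\<xi> y)" by (simp add: srep_def inv_c)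

lemma \<Omega>_obtain: assumes "q \<in> \<Omega>" obtains y where "q = snd c y" "y \<in> W" using assms by (auto simp: \<Omega>_def)

lemma \<Omega>_open: "open \<Omega>" unfolding \<Omega>_def by (rule F.img[OF c W_open W_sub(1)])
lemma \<Omega>_in: "y \<in> W \<Longrightarrow> snd c y \<in> \<Omega>" by (simp add: \<Omega>_def)

lemma incl_chart: "y \<in> W \<Longrightarrow> cmp M d y (incl_deriv F M y v) = FD f (snd c y) (cmp F c y v)"
  unfolding f_def[abs_def] by (rule incl_deriv_chart[OF i c _ d]) (auto simp: W_def)

lemmas cmpF_linear = cmp_linear[OF F.ok c subsetD[OF W_sub(1)]]
lemmas cmpM_linear = cmp_linear[OF M.ok d subsetD[OF W_sub(2)]]
lemmas cmpF_inject = cmp_inject[OF F.ok c subsetD[OF W_sub(1)]]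
lemmas cmpM_inject = cmp_inject[OF M.ok d subsetD[OF W_sub(2)]]
lemmas cmpF_vfc = F.cmp_vfc[OF c subsetD[OF W_sub(1)]]
lemma cmpF_surj: assumes "y \<in> W" obtains v where "a = cmp F c y v"
  using cmpF_vfc[OF assms, of "\<lambda>p. a"] that by metis

lemma metric_M: "y \<in> W \<Longrightarrow> rmetric M y u v = M.Gm d (snd d y) (cmp M d y u) (cmp M d y v)"
  using M.Gm_cmp[OF d] W_sub by (metis subsetD)
lemma metric_F: "y \<in> W \<Longrightarrow> rmetric F y u v = F.Gm c (snd c y) (cmp F c y u) (cmp F c y v)"
  using F.Gm_cmp[OF c] W_sub by (metis subsetD)

lemma immersion: "chart_immersion \<Omega> (F.Gm c) (F.Gam c) (snd d ` fst d) (M.Gm d) (M.Gam d) f"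
proof (intro chart_immersion.intro chart_immersion_axioms.intro)
  show "chart_metric \<Omega> (F.Gm c) (F.Gam c)"
    by (rule chart_metric.chart_metric_subset[OF F.chart_metric_chart[OF c] \<Omega>_open]) (use W_sub in \<open>auto simp: \<Omega>_def\<close>)
  show "chart_metric (snd d ` fst d) (M.Gm d) (M.Gam d)" by (rule M.chart_metric_chart[OF d])
  show "smooth_on \<Omega> f"
    using i c d unfolding incl_ok_def \<Omega>_def W_def f_def[abs_def] by blast
  fix q u v assume "q \<in> \<Omega>"
  then obtain y where y: "q = snd c y" "y \<in> W" by (rule \<Omega>_obtain)
  show "f q \<in> snd d ` fst d" using f_at[OF y(2)] y W_sub by auto
  have yF: "y \<in> points F" using y(2) openin_subset[OF W_open] by blast
  show "inj (FD f q)"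
  proof (rule injI)
    fix a b assume eq: "FD f q a = FD f q b"
    obtain a' b' where ab: "a = cmp F c y a'" "b = cmp F c y b'" using cmpF_surj[OF y(2)] by metis
    have "cmp M d y (incl_deriv F M y a') = cmp M d y (incl_deriv F M y b')"
      using eq by (simp add: incl_chart[OF y(2)] ab y(1))
    then have "incl_deriv F M y a' = incl_deriv F M y b'" using cmpM_inject[OF y(2)] by blast
    then have "a' = b'" using sub yF unfolding submanifold_def by (metis injD)
    then show "a = b" using ab by simp
  qed
  obtain u' v' where uv: "u = cmp F c y u'" "v = cmp F c y v'" using cmpF_surj[OF y(2)] by metis
  have "rmetric F y u' v' = rmetric M y (incl_deriv F M y u') (incl_deriv F M y v')"
    using rs yF by (auto simp: riemannian_submanifold_def induced_metric_def)
  then show "F.Gm c q u v = M.Gm d (f q) (FD f q u) (FD f q v)"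
    unfolding metric_M[OF y(2)] metric_F[OF y(2)] incl_chart[OF y(2)] uv y(1) f_at[OF y(2)] .
qed

sublocale I: chart_immersion \<Omega> "F.Gm c" "F.Gam c" "snd d ` fst d" "M.Gm d" "M.Gam d" f
  by (rule immersion)

lemma section_chart:
  assumes "open_in F U" "U \<subseteq> W"
  shows "smooth_section F M U \<xi> \<longleftrightarrow> smooth_on (snd c ` U) (srep \<xi>)"
  unfolding srep_def[abs_def]
  by (rule smooth_section_chart[OF i chart_image_open[OF F.sm _ assms(1)] c _ d]) (use assms W_sub in auto)

lemma U_open: "open_in F U \<Longrightarrow> U \<subseteq> W \<Longrightarrow> open (snd c ` U)" and U_sub: "U \<subseteq> W \<Longrightarrow> snd c ` U \<subseteq> \<Omega>"
  using F.img[OF c, of U] W_sub by (auto simp: \<Omega>_def)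

text \<open>The choice in \<open>conn_along\<close> needs an extension to exist. With P a linear
  left inverse of the derivative of f at q, \<open>P \<circ> f\<close> is a local diffeomorphism
  with inverse g. Then \<open>g \<circ> P\<close> retracts a neighbourhood in M onto the coordinates
  of F, and pulling \<xi> back along this retraction extends it.\<close>

lemma local_extension:
  assumes U: "open_in F U" "U \<subseteq> W" "y \<in> U" and \<xi>: "smooth_section F M U \<xi>"
  obtains U' V \<Xi> where "open_in F U'" "y \<in> U'" "open_in M V" "U' \<subseteq> V" "vector_field M V \<Xi>" "\<And>z. z \<in> U' \<Longrightarrow> \<Xi> z = \<xi> z"
proof -
  define q where "q = snd c y"
  have yW: "y \<in> W" using U by blast
  have qU: "q \<in> snd c ` U" and q: "q \<in> \<Omega>" using U yW \<Omega>_in by (auto simp: q_def)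
  note oU = U_open[OF U(1,2)]
  obtain P where P: "linear P" "P \<circ> FD f q = id"
    using linear_injective_left_inverse[OF I.Df_lin[OF q] I.f_inj[OF q]] by blast
  have blP: "bounded_linear P" using P(1) linear_conv_bounded_linear by blast
  have sf: "smooth_on (snd c ` U) f" by (rule smooth_on_subset[OF I.f_smooth U_sub[OF U(2)]])
  have sh: "smooth_on (snd c ` U) (\<lambda>x. P (f x))" by (rule smooth_on_bounded_linear[OF blP oU sf])
  have "FD (\<lambda>x. P (f x)) q = (\<lambda>v. P (FD f q v))"
    by (rule FD_eq[OF bounded_linear.has_derivative[OF blP I.df[OF q]]])
  also have "\<dots> = id" using P(2) by (simp add: o_def fun_eq_iff)
  finally have "inj (FD (\<lambda>x. P (f x)) q)" by simp
  from smooth_inverse_function[OF oU qU sh refl this]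
  obtain U1 V1 g where UV: "open U1" "q \<in> U1" "U1 \<subseteq> snd c ` U" "open V1" "(\<lambda>x. P (f x)) ` U1 = V1" "smooth_on V1 g"
    and gP: "\<And>x. x \<in> U1 \<Longrightarrow> g (P (f x)) = x" and Pg: "\<And>p. p \<in> V1 \<Longrightarrow> g p \<in> U1 \<and> P (f (g p)) = p"
    by blast
  define V where "V = {z \<in> fst d. snd d z \<in> P -` V1}"
  have oP: "open (P -` V1)" using UV(4) linear_continuous_on[OF blP] by (simp add: open_vimage)
  have oV: "open_in M V" unfolding V_def by (rule chart_preimage_open[OF M.sm d oP])
  have Vd: "V \<subseteq> fst d" by (auto simp: V_def)
  define \<Xi> where "\<Xi> = vfc M d (\<lambda>p. srep \<xi> (g (P p)))"
  have oVi: "open (snd d ` V)" by (rule M.img[OF d oV Vd])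
  have "smooth_on (snd d ` V) (\<lambda>p. g (P p))"
    by (rule smooth_on_compose[OF oVi UV(4) _ smooth_on_bounded_linear[OF blP oVi smooth_on_ident[OF oVi]] UV(6)])
      (auto simp: V_def)
  moreover have "smooth_on (snd c ` U) (srep \<xi>)" using \<xi> unfolding section_chart[OF U(1,2)] .
  moreover have "g (P p) \<in> snd c ` U" if "p \<in> snd d ` V" for p
    using that Pg UV(3) by (auto simp: V_def)
  ultimately have "smooth_on (snd d ` V) (\<lambda>p. srep \<xi> (g (P p)))"
    using smooth_on_compose[OF oVi oU, of "\<lambda>p. g (P p)" "srep \<xi>"] by simp
  then have v\<Xi>: "vector_field M V \<Xi>" unfolding \<Xi>_def by (rule M.vfc_vector_field[OF d oV Vd])
  define U' where "U' = {z \<in> fst c. snd c z \<in> U1}"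
  have oU': "open_in F U'" unfolding U'_def by (rule chart_preimage_open[OF F.sm c UV(1)])
  have yU': "y \<in> U'" using UV(2) yW W_sub by (auto simp: U'_def q_def)
  have U'U: "U' \<subseteq> U"
  proof
    fix z assume z: "z \<in> U'"
    then obtain z' where z': "snd c z = snd c z'" "z' \<in> U" using UV(3) by (auto simp: U'_def)
    then have "z = z'" using inj_onD[OF atlas_inj[OF F.ok c], of z z'] z U(2) W_sub by (auto simp: U'_def)
    then show "z \<in> U" using z' by simp
  qed
  show thesis
  proof (rule that[OF oU' yU' oV _ v\<Xi>])
    show "U' \<subseteq> V"
    proof
      fix z assume z: "z \<in> U'"
      have zW: "z \<in> W" using z U'U U(2) by blast
      have "P (f (snd c z)) \<in> V1" using z UV(5) by (auto simp: U'_def)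
      then show "z \<in> V" using f_at[OF zW] zW W_sub by (auto simp: V_def)
    qed
    fix z assume z: "z \<in> U'"
    have zW: "z \<in> W" using z U'U U(2) by blast
    show "\<Xi> z = \<xi> z" unfolding \<Xi>_def
    proof (rule M.vfc_eqI[OF d])
      show "z \<in> fst d" using zW W_sub by blast
      have "g (P (f (snd c z))) = snd c z" using gP z by (simp add: U'_def)
      then show "cmp M d z (\<xi> z) = srep \<xi> (g (P (snd d z)))" by (simp add: f_at[OF zW] srep_at[OF zW])
    qed
  qed
qed

text \<open>The extension picked by the choice operator is unknown, but it agrees with \<xi> near y
  on F. By the chain rule its derivative in a direction tangent to F depends only on these values,
  so every extension gives \<open>I.nab\<close>.\<close>

lemma conn_along_chart:
  assumes U: "open_in F U" "U \<subseteq> W" "y \<in> U" and \<xi>: "smooth_section F M U \<xi>"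
  shows "cmp M d y (conn_along F M y u \<xi>) = I.nab (snd c y) (cmp F c y u) (srep \<xi>)"
proof -
  have yW: "y \<in> W" using U by blast
  define P where "P w \<longleftrightarrow> (\<exists>U V \<Xi>. open_in F U \<and> y \<in> U \<and> open_in M V \<and> U \<subseteq> V \<and> vector_field M V \<Xi> \<and>
        (\<forall>z\<in>U. \<Xi> z = \<xi> z) \<and> w = conn M y (incl_deriv F M y u) \<Xi>)" for w
  obtain U' V' \<Xi>' where "open_in F U'" "y \<in> U'" "open_in M V'" "U' \<subseteq> V'" "vector_field M V' \<Xi>'" "\<And>z. z \<in> U' \<Longrightarrow> \<Xi>' z = \<xi> z"
    by (rule local_extension[OF U \<xi>], rule that)
  then have "P (conn M y (incl_deriv F M y u) \<Xi>')" unfolding P_def by blast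
  then have "P (conn_along F M y u \<xi>)" unfolding conn_along_def P_def[symmetric] by (rule someI)
  then obtain U1 V \<Xi> where e: "open_in F U1" "y \<in> U1" "open_in M V" "U1 \<subseteq> V" "vector_field M V \<Xi>" "\<forall>z\<in>U1. \<Xi> z = \<xi> z"
    and w: "conn_along F M y u \<xi> = conn M y (incl_deriv F M y u) \<Xi>" unfolding P_def by blast
  have oV: "open_in M (V \<inter> fst d)" by (rule openin_Int[OF e(3) smooth_manifold_chart(1)[OF M.sm d]])
  have v\<Xi>: "vector_field M (V \<inter> fst d) \<Xi>" by (rule smooth_section_subset[OF e(5)]) blast
  have yV: "y \<in> V \<inter> fst d" using e yW W_sub by blast
  have s\<Xi>: "smooth_on (snd d ` (V \<inter> fst d)) (crep M d \<Xi>)"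
    using v\<Xi> unfolding M.vector_field_chart[OF d oV Int_lower2] .
  have q: "snd c y \<in> \<Omega>" by (rule \<Omega>_in[OF yW])
  have d\<Xi>: "(crep M d \<Xi> has_derivative FD (crep M d \<Xi>) (f (snd c y))) (at (f (snd c y)))"
    unfolding f_at[OF yW] by (rule smooth_on_has_derivative[OF s\<Xi>]) (use yV in blast)
  have 1: "((\<lambda>q. crep M d \<Xi> (f q)) has_derivative (\<lambda>h. FD (crep M d \<Xi>) (f (snd c y)) (FD f (snd c y) h))) (at (snd c y))"
    by (rule has_derivative_compose[OF I.df[OF q] d\<Xi>])
  have oU1: "open_in F (U1 \<inter> U)" by (rule openin_Int[OF e(1) U(1)])
  have "(srep \<xi> has_derivative (\<lambda>h. FD (crep M d \<Xi>) (f (snd c y)) (FD f (snd c y) h))) (at (snd c y))"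
  proof (rule has_derivative_transform_within_open[OF 1])
    show "open (snd c ` (U1 \<inter> U))" by (rule U_open[OF oU1]) (use U in blast)
    show "snd c y \<in> snd c ` (U1 \<inter> U)" using e U by blast
    fix q' assume "q' \<in> snd c ` (U1 \<inter> U)"
    then obtain z where z: "q' = snd c z" "z \<in> U1" "z \<in> W" using U by blast
    have "crep M d \<Xi> (snd d z) = cmp M d z (\<Xi> z)" using M.crep_at[OF d] z W_sub by blast
    then show "crep M d \<Xi> (f q') = srep \<xi> q'" using z e(6) by (simp add: f_at srep_at)
  qed
  from FD_eq[OF this] have 2: "FD (srep \<xi>) (snd c y) = (\<lambda>h. FD (crep M d \<Xi>) (f (snd c y)) (FD f (snd c y) h))" .
  have "crep M d \<Xi> (snd d y) = srep \<xi> (snd c y)"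
    using M.crep_at[OF d] yV e by (simp add: srep_at[OF yW])
  then show ?thesis unfolding w I.nab_def 2
    using M.nb_chart[OF d oV Int_lower2 yV v\<Xi>, of "incl_deriv F M y u"] by (simp add: incl_chart[OF yW] f_at[OF yW])
qed

lemma sff_chart:
  assumes U: "open_in F U" "U \<subseteq> W" "y \<in> U" and Y: "vector_field F U Y"
  shows "cmp M d y (sff F M y u Y) = I.B (snd c y) (cmp F c y u) (crep F c Y (snd c y))"
proof -
  have yW: "y \<in> W" using U by blast
  have Uc: "U \<subseteq> fst c" using U(2) W_sub by blast
  note q = \<Omega>_in[OF yW] and oU = U_open[OF U(1,2)]
  have qU: "snd c y \<in> snd c ` U" using U by blast
  have sY: "smooth_on (snd c ` U) (crep F c Y)" using Y unfolding F.vector_field_chart[OF c U(1) Uc] .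
  have eq: "srep (\<lambda>z. incl_deriv F M z (Y z)) x = FD f x (crep F c Y x)" if x: "x \<in> snd c ` U" for x
  proof -
    obtain z where z: "x = snd c z" "z \<in> W" using x U by blast
    show ?thesis using F.crep_at[OF c, of z Y] z W_sub by (auto simp: srep_at incl_chart)
  qed
  have sD: "smooth_on (snd c ` U) (\<lambda>x. FD f x (crep F c Y x))"
    by (rule smooth_on_linfam[OF oU I.Df_lin[OF subsetD[OF U_sub[OF U(2)]]] smooth_on_subset[OF I.Df_smooth U_sub[OF U(2)]] sY])
  have "smooth_section F M U (\<lambda>z. incl_deriv F M z (Y z))"
    unfolding section_chart[OF U(1,2)] by (rule smooth_on_cong[THEN iffD2, OF oU eq sD])
  from conn_along_chart[OF U this, of u]
  have "cmp M d y (conn_along F M y u (\<lambda>z. incl_deriv F M z (Y z))) =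
      I.nab (snd c y) (cmp F c y u) (\<lambda>x. FD f x (crep F c Y x))"
    using I.nab_cong[OF oU qU eq] by simp
  also have "\<dots> = I.B (snd c y) (cmp F c y u) (crep F c Y (snd c y)) + FD f (snd c y) (cmp F c y (conn F y u Y))"
    unfolding F.nb_chart[OF c U(1) Uc U(3) Y]
    by (rule I.nab_Df[OF q smooth_on_has_derivative[OF sY qU]])
  finally show ?thesis unfolding sff_def by (simp add: linear_diff[OF cmpM_linear[OF yW]] incl_chart[OF yW])
qed

lemma const_field_W: "vector_field F W (vfc F c (\<lambda>p. w))"
  by (rule F.const_field[OF c W_open W_sub(1)])

lemma crep_const: "y \<in> W \<Longrightarrow> crep F c (vfc F c (\<lambda>p. w)) (snd c y) = w"
  using F.crep_vfc[OF c] W_sub by blast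

lemma sff_const: "y \<in> W \<Longrightarrow> cmp M d y (sff F M y u (vfc F c (\<lambda>p. w))) = I.B (snd c y) (cmp F c y u) w"
  by (simp add: sff_chart[OF W_open order_refl _ const_field_W] crep_const)

lemma normal_chart:
  assumes y: "y \<in> W" shows "\<xi> \<in> Defs.normal_space F M y \<longleftrightarrow> I.normal (snd c y) (cmp M d y \<xi>)"
proof -
  have "(\<forall>u. Q (cmp F c y u)) \<longleftrightarrow> (\<forall>u. Q u)" for Q using cmpF_surj[OF y] by metis
  from this[of "\<lambda>u. M.Gm d (snd d y) (cmp M d y \<xi>) (FD f (snd c y) u) = 0"] show ?thesis
    unfolding normal_space_def I.normal_def by (simp add: metric_M[OF y] incl_chart[OF y] f_at[OF y])
qed

text \<open>The normal connection differs from \<open>conn_along\<close> by a tangential correction.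
  Testing against a normal \<eta> removes it, so the shape operator never has to be computed
  here.\<close>

lemma sff_deriv_chart:
  assumes y: "y \<in> W" and n: "I.normal (snd c y) \<eta>"
  shows "M.Gm d (snd d y) (cmp M d y (sff_deriv F M (vfc F c (\<lambda>p. u)) (vfc F c (\<lambda>p. v)) (vfc F c (\<lambda>p. w)) y)) \<eta> =
    M.Gm d (snd d y) (I.nab (snd c y) u (\<lambda>q. I.B q v w) - I.B (snd c y) (F.Gam c (snd c y) u v) w
      - I.B (snd c y) v (F.Gam c (snd c y) u w)) \<eta>"
proof -
  define Y where "Y v = vfc F c (\<lambda>p. v)" for v
  note q = \<Omega>_in[OF y] and lin = cmpM_linear[OF y]
  have fq: "snd d y \<in> snd d ` fst d" using y W_sub by blast
  note bG = bilinear_simps[OF I.M.G_bil[OF fq]]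
  have eq: "srep (\<lambda>z. sff F M z (Y v z) (Y w)) x = I.B x v w" if x: "x \<in> \<Omega>" for x
  proof -
    obtain z where z: "x = snd c z" "z \<in> W" using x by (rule \<Omega>_obtain)
    then show ?thesis by (simp add: srep_at Y_def sff_const cmpF_vfc)
  qed
  have "smooth_section F M W (\<lambda>z. sff F M z (Y v z) (Y w))"
    unfolding section_chart[OF W_open order_refl] \<Omega>_def[symmetric]
    by (rule smooth_on_cong[THEN iffD2, OF \<Omega>_open eq I.B_smooth])
  from conn_along_chart[OF W_open order_refl y this, of "Y u y"]
  have ca: "cmp M d y (conn_along F M y (Y u y) (\<lambda>z. sff F M z (Y v z) (Y w))) = I.nab (snd c y) u (\<lambda>q. I.B q v w)"
    using I.nab_cong[OF \<Omega>_open q eq] by (simp add: Y_def cmpF_vfc[OF y])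
  have inv: "chart_inv c (snd c y) = y" by (rule inv_c[OF y])
  have 1: "cmp M d y (sff F M y (conn F y (Y u y) (Y v)) (Y w)) = I.B (snd c y) (F.Gam c (snd c y) u v) w"
    by (simp add: Y_def sff_const[OF y] F.Gam_def inv)
  have "vector_field F W (\<lambda>z. conn F z (Y u z) (Y w))"
    unfolding Y_def by (rule F.nb_field[OF W_open const_field_W const_field_W])
  from sff_chart[OF W_open order_refl y this, of "Y v y"]
  have 2: "cmp M d y (sff F M y (Y v y) (\<lambda>z. conn F z (Y u z) (Y w))) = I.B (snd c y) v (F.Gam c (snd c y) u w)"
    using F.crep_at[OF c subsetD[OF W_sub(1) y], of "\<lambda>z. conn F z (Y u z) (Y w)"]
    by (simp add: Y_def cmpF_vfc[OF y] F.Gam_def inv)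
  have tang: "M.Gm d (snd d y) (cmp M d y (incl_deriv F M y t)) \<eta> = 0" for t
    using n I.M.G_sym[OF fq] unfolding I.normal_def f_at[OF y] incl_chart[OF y] by metis
  show ?thesis unfolding sff_deriv_def normal_conn_def Y_def[symmetric]
    by (simp add: linear_diff[OF lin] linear_add[OF lin] ca 1 2 bG tang)
qed

text \<open>Weingarten's equation, obtained by differentiating the orthogonality of \<xi> to
  \<open>FD f q a\<close>. The Gauss formula replaces the derivative of the second factor by B plus
  a tangent vector, which \<xi> does not see.\<close>

lemma shape_chart:
  assumes U: "open_in F U" "U \<subseteq> W" "y \<in> U" and \<xi>: "normal_field F M U \<xi>"
  shows "F.Gm c (snd c y) (cmp F c y (shape_operator F M y \<xi> u)) v =
    M.Gm d (snd d y) (srep \<xi> (snd c y)) (I.B (snd c y) (cmp F c y u) v)"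
proof -
  have y: "y \<in> W" using U by blast
  define q where "q = snd c y"
  have q: "q \<in> \<Omega>" unfolding q_def by (rule \<Omega>_in[OF y])
  have fq: "f q = snd d y" unfolding q_def by (rule f_at[OF y])
  note bG = bilinear_simps[OF I.M.G_bil[OF I.f_in[OF q]]]
  note oU = U_open[OF U(1,2)]
  have qU: "q \<in> snd c ` U" using U by (simp add: q_def)
  have s: "smooth_section F M U \<xi>" using \<xi> by (simp add: normal_field_def)
  have s\<xi>: "smooth_on (snd c ` U) (srep \<xi>)" using s unfolding section_chart[OF U(1,2)] .
  have nrm: "I.normal x (srep \<xi> x)" if x: "x \<in> snd c ` U" for x
  proof -
    obtain z where z: "x = snd c z" "z \<in> U" using x by blast
    then have zW: "z \<in> W" using U by blast
    have "\<xi> z \<in> Defs.normal_space F M z" using \<xi> z by (simp add: normal_field_def)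
    then show ?thesis using normal_chart[OF zW] by (simp add: z srep_at[OF zW])
  qed
  define w where "w = conn_along F M y u \<xi>"
  have w: "cmp M d y w = I.nab q (cmp F c y u) (srep \<xi>)"
    unfolding w_def q_def by (rule conn_along_chart[OF U s])
  have wv: "M.Gm d (f q) (cmp M d y w) (FD f q a) = - M.Gm d (f q) (srep \<xi> q) (I.B q (cmp F c y u) a)" for a
  proof -
    have d1: "((\<lambda>q. M.Gm d (f q) (srep \<xi> q) (FD f q a)) has_derivative
      (\<lambda>h. M.Gm d (f q) (I.nab q h (srep \<xi>)) (FD f q a) + M.Gm d (f q) (srep \<xi> q) (I.nab q h (\<lambda>q. FD f q a)))) (at q)"
      by (intro I.G'_along q smooth_on_has_derivative[OF s\<xi> qU] smooth_on_has_derivative[OF I.Df_smooth q])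
    have "((\<lambda>q. 0) has_derivative
      (\<lambda>h. M.Gm d (f q) (I.nab q h (srep \<xi>)) (FD f q a) + M.Gm d (f q) (srep \<xi> q) (I.nab q h (\<lambda>q. FD f q a)))) (at q)"
      by (rule has_derivative_transform_within_open[OF d1 oU qU]) (use nrm in \<open>simp add: I.normal_def\<close>)
    from fun_cong[OF has_derivative_unique[OF this has_derivative_const], of "cmp F c y u"]
    have "M.Gm d (f q) (cmp M d y w) (FD f q a) + M.Gm d (f q) (srep \<xi> q) (I.nab q (cmp F c y u) (\<lambda>q. FD f q a)) = 0"
      unfolding w .
    moreover have "I.nab q (cmp F c y u) (\<lambda>q. FD f q a) = I.B q (cmp F c y u) a + FD f q (F.Gam c q (cmp F c y u) a)"
      by (simp add: I.B_def)
    ultimately show ?thesis using nrm[OF qU] by (simp add: bG I.normal_def)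
  qed
  have norm_iff: "w - incl_deriv F M y t \<in> Defs.normal_space F M y \<longleftrightarrow>
      (\<forall>a. F.Gm c q (cmp F c y t) a = M.Gm d (f q) (cmp M d y w) (FD f q a))" for t
    unfolding normal_chart[OF y] I.normal_def q_def[symmetric] linear_diff[OF cmpM_linear[OF y]] incl_chart[OF y]
    by (auto simp: bG I.f_isom[OF q])
  have "linear (\<lambda>a. M.Gm d (f q) (cmp M d y w) (FD f q a))"
    using linear_compose[OF I.Df_lin[OF q], of "M.Gm d (f q) (cmp M d y w)"] I.M.G_bil[OF I.f_in[OF q]]
    by (simp add: bilinear_def o_def)
  from I.F.riesz[OF q this] obtain t0 where t0: "\<And>a. F.Gm c q t0 a = M.Gm d (f q) (cmp M d y w) (FD f q a)" by blast
  obtain t where t: "t0 = cmp F c y t" using cmpF_surj[OF y] by blast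
  have tn: "w - incl_deriv F M y t \<in> Defs.normal_space F M y" unfolding norm_iff using t0 t by simp
  \<comment> \<open>\<open>tangent_part\<close> is a definite description: t was found by
    representing a linear functional through the metric, and it is unique because the metric is
    nondegenerate.\<close>
  have "tangent_part F M y w = t"
    unfolding tangent_part_def
  proof (rule the_equality)
    show "w - incl_deriv F M y t \<in> Defs.normal_space F M y" by (rule tn)
    fix t' assume "w - incl_deriv F M y t' \<in> Defs.normal_space F M y"
    then have "F.Gm c q (cmp F c y t') a = F.Gm c q (cmp F c y t) a" for a unfolding norm_iff using t0 t by simp
    then have "F.Gm c q (cmp F c y t' - cmp F c y t) a = 0" for a
      by (simp add: bilinear_simps[OF I.F.G_bil[OF q]])
    then have "cmp F c y t' - cmp F c y t = 0" by (rule I.F.G_nondeg[OF q])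
    then show "t' = t" using cmpF_inject[OF y] by simp
  qed
  then have "cmp F c y (shape_operator F M y \<xi> u) = - t0"
    unfolding shape_operator_def w_def[symmetric] by (simp add: linear_neg[OF cmpF_linear[OF y]] t)
  then show ?thesis unfolding q_def[symmetric] fq[symmetric]
    using t0[of v] wv[of v] by (simp add: bilinear_simps[OF I.F.G_bil[OF q]])
qed

end

section \<open>Submanifolds with a single chart\<close>

lemma (in manifold) chart_continuous:
  assumes c: "c \<in> mfd_atlas M" shows "continuous_map (subtopology (mfd_top M) (fst c)) (top_of_set (snd c ` fst c)) (snd c)"
  using sm c by (auto simp: smooth_manifold_def intro: homeomorphic_imp_continuous_map)

lemma (in manifold) chart_inv_continuous:
  assumes c: "c \<in> mfd_atlas M" shows "continuous_map (top_of_set (snd c ` fst c)) (mfd_top M) (chart_inv c)"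
proof -
  have "homeomorphic_map (subtopology (mfd_top M) (fst c)) (top_of_set (snd c ` fst c)) (snd c)"
    using sm c by (auto simp: smooth_manifold_def)
  then obtain g where g: "homeomorphic_maps (subtopology (mfd_top M) (fst c)) (top_of_set (snd c ` fst c)) (snd c) g"
    using homeomorphic_map_maps by blast
  have ts: "topspace (subtopology (mfd_top M) (fst c)) = fst c"
    using smooth_manifold_chart(4)[OF sm c] by auto
  have gl: "g (snd c y) = y" if "y \<in> fst c" for y using g that unfolding homeomorphic_maps_def ts by blast
  have "continuous_map (top_of_set (snd c ` fst c)) (mfd_top M) g"
    using g unfolding homeomorphic_maps_def continuous_map_in_subtopology by blast
  then show ?thesis
    by (rule continuous_map_eq) (use gl chart_left[OF c] in auto)
qed

text \<open>With one chart in the atlas nothing is left to choose at any point, so stored vectors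
  are their own components.\<close>

lemma single_chart:
  fixes S :: "('p, 'j::euclidean_space, 'z) mfd_scheme"
  assumes S: "atlas_ok S" "mfd_atlas S = {e}" "y \<in> fst e"
  shows "cmp S e y v = v" "chart_at S y = e"
proof -
  have e: "e \<in> mfd_atlas S" using S by simp
  show ch: "chart_at S y = e" using chart_at_in(1)[OF S(1) atlas_points[OF S(1) e S(3)]] S(2) by simp
  have "open (snd e ` fst e)" using atlas_transition(1)[OF S(1) e e] by simp
  then have "FD (\<lambda>q. snd e (chart_inv e q)) (snd e y) = FD (\<lambda>q. q) (snd e y)"
    by (rule FD_cong) (use S(3) atlas_left[OF S(1) e] in auto)
  then show "cmp S e y v = v" by (simp add: vderiv_def ch o_def)
qed

context manifold
begin

text \<open>P is an embedded slice of the chart domain: j parametrises it in the coordinates of c,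
  and \<rho> recovers the parameter from the point. S is P with the subspace topology and \<rho> as
  its only chart. Both factors of the product are obtained from this context.\<close>

context
  fixes c and P :: "'p set" and O' :: "'j::euclidean_space set" and j :: "'j \<Rightarrow> 'e" and \<rho> :: "'p \<Rightarrow> 'j" and S :: "('p, 'j) mfd"
  assumes c: "c \<in> mfd_atlas M" and P: "P \<subseteq> fst c" and O': "open O'" and sj: "smooth_on O' j"
    and jO: "\<And>s. s \<in> O' \<Longrightarrow> j s \<in> snd c ` fst c" "\<And>s. s \<in> O' \<Longrightarrow> chart_inv c (j s) \<in> P"
      "\<And>s. s \<in> O' \<Longrightarrow> \<rho> (chart_inv c (j s)) = s"
    and \<rho>P: "\<And>y. y \<in> P \<Longrightarrow> \<rho> y \<in> O'" "\<And>y. y \<in> P \<Longrightarrow> j (\<rho> y) = snd c y"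
    and cont: "continuous_map (subtopology (mfd_top M) P) euclidean \<rho>"
    and inj: "\<And>s. s \<in> O' \<Longrightarrow> inj (FD j s)"
    and S: "S = \<lparr>mfd_top = subtopology (mfd_top M) P, mfd_atlas = {(P, \<rho>)}\<rparr>"
begin

lemma slice_points: "points S = P"
  using P smooth_manifold_chart(4)[OF sm c] by (auto simp: S)

lemma slice_image: "\<rho> ` P = O'"
  using jO(2,3) \<rho>P(1) by force

lemma slice_inj: "inj_on \<rho> P"
proof (rule inj_onI)
  fix y z assume "y \<in> P" "z \<in> P" "\<rho> y = \<rho> z"
  then have "snd c y = snd c z" using \<rho>P(2) by metis
  then show "y = z" using inj_onD[OF atlas_inj[OF ok c]] P \<open>y \<in> P\<close> \<open>z \<in> P\<close> by blast
qed

lemma slice_inv: "s \<in> O' \<Longrightarrow> chart_inv (P, \<rho>) s = chart_inv c (j s)"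
  unfolding chart_inv_def[of "(P, \<rho>)"] by (simp add: inv_into_f_eq[OF slice_inj jO(2) jO(3)])

lemma slice_homeo: "homeomorphic_map (subtopology (mfd_top M) P) (top_of_set O') \<rho>"
proof -
  have "continuous_map (subtopology (mfd_top M) P) (top_of_set O') \<rho>"
    using cont \<rho>P(1) by (auto simp: continuous_map_in_subtopology)
  moreover have "continuous_map (top_of_set O') (subtopology (mfd_top M) P) (\<lambda>s. chart_inv c (j s))"
  proof -
    have "continuous_map (top_of_set O') (top_of_set (snd c ` fst c)) j"
      using smooth_on_continuous[OF sj] jO(1) by auto
    from continuous_map_compose[OF this chart_inv_continuous[OF c]]
    show ?thesis using jO(2) by (auto simp: continuous_map_in_subtopology o_def)
  qed
  moreover have "chart_inv c (j (\<rho> y)) = y" if "y \<in> P" for y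
    using that \<rho>P(2) P chart_left[OF c] by (metis subsetD)
  ultimately have "homeomorphic_maps (subtopology (mfd_top M) P) (top_of_set O') \<rho> (\<lambda>s. chart_inv c (j s))"
    unfolding homeomorphic_maps_def using jO(3) by auto
  then show ?thesis using homeomorphic_map_maps by blast
qed

lemma slice_smooth_manifold: "smooth_manifold S"
  unfolding smooth_manifold_def
proof (intro conjI)
  show "Hausdorff_space (mfd_top S)" "second_countable (mfd_top S)"
    using sm by (simp_all add: S smooth_manifold_def Hausdorff_space_subtopology second_countable_subtopology)
  show "(\<Union>c\<in>mfd_atlas S. fst c) = points S" unfolding slice_points by (simp add: S)
  have pp: "open_in S P" using slice_points openin_topspace[of "mfd_top S"] by simp
  have ss: "subtopology (mfd_top S) P = subtopology (mfd_top M) P" by (simp add: S subtopology_subtopology)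
  show "\<forall>c\<in>mfd_atlas S. open_in S (fst c) \<and> open (snd c ` fst c) \<and>
        homeomorphic_map (subtopology (mfd_top S) (fst c)) (top_of_set (snd c ` fst c)) (snd c)"
    using pp O' slice_homeo ss by (simp add: S slice_image)
  have "smooth_on O' (\<rho> \<circ> chart_inv (P, \<rho>))"
    by (rule smooth_on_cong[THEN iffD1, OF O' _ smooth_on_ident[OF O']]) (simp add: slice_inv jO)
  then show "\<forall>c\<in>mfd_atlas S. \<forall>d\<in>mfd_atlas S. smooth_on (snd c ` (fst c \<inter> fst d)) (snd d \<circ> chart_inv c)"
    by (simp add: S slice_image)
qed

lemma slice_chart_domain:
  assumes d: "d \<in> mfd_atlas M"
  shows "open (\<rho> ` (P \<inter> fst d))" "smooth_on (\<rho> ` (P \<inter> fst d)) (\<lambda>s. snd d (chart_inv (P, \<rho>) s))"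
proof -
  have eq: "\<rho> ` (P \<inter> fst d) = O' \<inter> j -` (snd c ` (fst c \<inter> fst d))"
  proof
    show "\<rho> ` (P \<inter> fst d) \<subseteq> O' \<inter> j -` (snd c ` (fst c \<inter> fst d))" using \<rho>P P by auto
    show "O' \<inter> j -` (snd c ` (fst c \<inter> fst d)) \<subseteq> \<rho> ` (P \<inter> fst d)"
    proof
      fix s assume s: "s \<in> O' \<inter> j -` (snd c ` (fst c \<inter> fst d))"
      then obtain y where y: "j s = snd c y" "y \<in> fst c" "y \<in> fst d" by auto
      then have "chart_inv c (j s) = y" using chart_left[OF c] by simp
      then show "s \<in> \<rho> ` (P \<inter> fst d)" using jO(2,3)[of s] s y by force
    qed
  qed
  show o: "open (\<rho> ` (P \<inter> fst d))" unfolding eq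
    by (rule continuous_open_preimage[OF smooth_on_continuous[OF sj] O' atlas_transition(1)[OF ok c d]])
  have "smooth_on (\<rho> ` (P \<inter> fst d)) (\<lambda>s. snd d (chart_inv c (j s)))"
    by (rule smooth_on_compose[OF o atlas_transition(1)[OF ok c d] _ smooth_on_subset[OF sj] atlas_transition(2)[OF ok c d]])
      (use eq in auto)
  then show "smooth_on (\<rho> ` (P \<inter> fst d)) (\<lambda>s. snd d (chart_inv (P, \<rho>) s))"
    by (rule smooth_on_cong[THEN iffD1, OF o, rotated]) (use \<rho>P slice_inv in auto)
qed

lemma slice_ok: "atlas_ok S" by (rule smooth_manifold_atlas_ok[OF slice_smooth_manifold])
lemma slice_atlas: "mfd_atlas S = {(P, \<rho>)}" by (simp add: S)

lemma slice_incl_ok: "incl_ok S M"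
  unfolding incl_ok_def using slice_ok ok slice_chart_domain by (simp add: slice_atlas)

lemma slice_incl:
  assumes y: "y \<in> P" shows "cmp M c y (incl_deriv S M y v) = FD j (\<rho> y) v"
proof -
  have yc: "y \<in> fst c" using y P by blast
  have "cmp M c y (incl_deriv S M y v) = FD (\<lambda>q. snd c (chart_inv (P, \<rho>) q)) (\<rho> y) (cmp S (P, \<rho>) y v)"
    using incl_deriv_chart[OF slice_incl_ok, of "(P, \<rho>)" y c v] slice_atlas y c yc by simp
  also have "cmp S (P, \<rho>) y v = v" using single_chart(1)[OF slice_ok slice_atlas, of y v] y by simp
  also have "FD (\<lambda>q. snd c (chart_inv (P, \<rho>) q)) (\<rho> y) = FD j (\<rho> y)"
  proof (rule FD_cong[OF O' \<rho>P(1)[OF y]])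
    fix s assume s: "s \<in> O'"
    then obtain z where "j s = snd c z" "z \<in> fst c" using jO(1) by blast
    then show "snd c (chart_inv (P, \<rho>) s) = j s" using slice_inv[OF s] chart_left[OF c] by simp
  qed
  finally show ?thesis .
qed

lemma slice_submanifold: "submanifold S M"
  unfolding submanifold_def
proof (intro conjI ballI)
  show "smooth_manifold S" by (rule slice_smooth_manifold)
  show "smooth_manifold M" by (rule sm)
  show "points S \<subseteq> points M" unfolding slice_points using P smooth_manifold_chart(4)[OF sm c] by blast
  show "smooth_map S M (\<lambda>z. z)"
    unfolding smooth_map_def
    using slice_chart_domain by (auto simp: S o_def vimage_def intro: continuous_map_from_subtopology continuous_map_id[unfolded id_def])
  fix y assume "y \<in> points S"
  then have y: "y \<in> P" by (simp add: slice_points)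
  show "inj (incl_deriv S M y)"
  proof (rule injI)
    fix a b assume "incl_deriv S M y a = incl_deriv S M y b"
    then have "FD j (\<rho> y) a = FD j (\<rho> y) b" using slice_incl[OF y] by metis
    then show "a = b" using inj[OF \<rho>P(1)[OF y]] by (auto dest: injD)
  qed
qed

end

text \<open>Yields maximality of the integral submanifolds: the transversal coordinate of a product
  chart is constant on each of them.\<close>

lemma constant_on_connected_submanifold:
  fixes S :: "('p, 'j::euclidean_space) mfd" and g :: "'e \<Rightarrow> 'b::euclidean_space"
  assumes S: "submanifold S M" "connected_space (mfd_top S)" and c: "c \<in> mfd_atlas M"
    and Uc: "open Uc" "\<And>y. y \<in> points S \<Longrightarrow> y \<in> fst c \<and> snd c y \<in> Uc" and g: "smooth_on Uc g"
    and zero: "\<And>y v. y \<in> points S \<Longrightarrow> FD g (snd c y) (cmp M c y (incl_deriv S M y v)) = 0"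
    and y: "y \<in> points S" and z: "z \<in> points S"
  shows "g (snd c y) = g (snd c z)"
proof -
  have smS: "smooth_manifold S" using S by (simp add: submanifold_def)
  interpret S: manifold S by unfold_locales (rule smS)
  note io = submanifold_incl_ok[OF S(1)]
  \<comment> \<open>In a coordinate ball of S the chain rule turns the assumption into a vanishing
    derivative; balls are convex, so g is constant there.\<close>
  have loc: "\<exists>N. open_in S N \<and> x \<in> N \<and> (\<forall>x'\<in>N. g (snd c x') = g (snd c x))" if x: "x \<in> points S" for x
  proof -
    obtain e where e: "e \<in> mfd_atlas S" "x \<in> fst e" using chart_at_in[OF S.ok x] by blast
    have ec: "fst e \<subseteq> fst c" using Uc(2) smooth_manifold_chart(4)[OF smS e(1)] by blast
    have oe: "open (snd e ` fst e)" by (rule smooth_manifold_chart(2)[OF smS e(1)])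
    have st: "smooth_on (snd e ` fst e) (\<lambda>q. snd c (chart_inv e q))"
      using io e(1) c ec unfolding incl_ok_def by (metis inf.absorb1)
    obtain r where r: "r > 0" "ball (snd e x) r \<subseteq> snd e ` fst e" using oe e(2) openE by (metis imageI)
    define G where "G q = g (snd c (chart_inv e q))" for q
    have dG: "(G has_derivative (\<lambda>h. 0)) (at q)" if qB: "q \<in> ball (snd e x) r" for q
    proof -
      obtain x' where x': "q = snd e x'" "x' \<in> fst e" using r(2) qB by blast
      have x'S: "x' \<in> points S" using x' smooth_manifold_chart(4)[OF smS e(1)] by blast
      have inv: "chart_inv e q = x'" using S.chart_left[OF e(1)] x' by simp
      have qe: "q \<in> snd e ` fst e" using x' by blast
      have "(G has_derivative (\<lambda>h. FD g (snd c x') (FD (\<lambda>q. snd c (chart_inv e q)) q h))) (at q)"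
        unfolding G_def[abs_def]
        using has_derivative_compose[OF smooth_on_has_derivative[OF st qe], of g "FD g (snd c x')"]
          smooth_on_has_derivative[OF g, of "snd c x'"] Uc(2)[OF x'S] by (simp add: inv)
      moreover have "FD g (snd c x') (FD (\<lambda>q. snd c (chart_inv e q)) q h) = 0" for h
      proof -
        obtain v where v: "h = cmp S e x' v" using S.cmp_vfc[OF e(1) x'(2), of "\<lambda>p. h"] by metis
        have "cmp M c x' (incl_deriv S M x' v) = FD (\<lambda>q. snd c (chart_inv e q)) (snd e x') (cmp S e x' v)"
          by (rule incl_deriv_chart[OF io e(1) x'(2) c]) (use Uc(2)[OF x'S] in blast)
        then show ?thesis using zero[OF x'S, of v] v x'(1) by simp
      qed
      ultimately show ?thesis by simp
    qed
    have Gc: "G q = G (snd e x)" if q: "q \<in> ball (snd e x) r" for q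
      by (rule has_derivative_zero_unique[OF convex_ball has_derivative_at_withinI[OF dG] q]) (use r in auto)
    define N where "N = {x' \<in> fst e. snd e x' \<in> ball (snd e x) r}"
    have "open_in S N" unfolding N_def by (rule chart_preimage_open[OF smS e(1) open_ball])
    moreover have "x \<in> N" using e r by (simp add: N_def)
    moreover have "g (snd c x') = g (snd c x)" if "x' \<in> N" for x'
      using Gc[of "snd e x'"] that e S.chart_left[OF e(1)] by (auto simp: N_def G_def)
    ultimately show ?thesis by blast
  qed
  \<comment> \<open>The level set through z. Local constancy makes both the set and its complement
    open, and connectedness finishes.\<close>
  define A where "A = {x \<in> points S. g (snd c x) = g (snd c z)}"
  have oA: "open_in S A"
  proof (subst openin_subopen, intro ballI)
    fix x assume x: "x \<in> A"
    then have xS: "x \<in> points S" and gx: "g (snd c x) = g (snd c z)" by (auto simp: A_def)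
    obtain N where N: "open_in S N" "x \<in> N" "\<forall>x'\<in>N. g (snd c x') = g (snd c x)" using loc[OF xS] by blast
    have "N \<subseteq> A" using openin_subset[OF N(1)] N(3) gx by (auto simp: A_def)
    then show "\<exists>T. open_in S T \<and> x \<in> T \<and> T \<subseteq> A" using N(1,2) by blast
  qed
  have "open_in S (points S - A)"
  proof (subst openin_subopen, intro ballI)
    fix x assume x: "x \<in> points S - A"
    then have xS: "x \<in> points S" and gx: "g (snd c x) \<noteq> g (snd c z)" by (auto simp: A_def)
    obtain N where N: "open_in S N" "x \<in> N" "\<forall>x'\<in>N. g (snd c x') = g (snd c x)" using loc[OF xS] by blast
    have "N \<subseteq> points S - A" using openin_subset[OF N(1)] N(3) gx by (auto simp: A_def)
    then show "\<exists>T. open_in S T \<and> x \<in> T \<and> T \<subseteq> points S - A" using N(1,2) by blast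
  qed
  then have "closedin (mfd_top S) A" by (auto simp: closedin_def A_def)
  then have "A = {} \<or> A = points S" using S(2) oA connected_space_clopen_in by blast
  then show ?thesis using y z by (auto simp: A_def)
qed

text \<open>The family J sends a basis of its source to a smooth frame. Injectivity gives the rank,
  and the same frame works on the whole of U.\<close>

lemma smooth_distribution_chart:
  fixes J :: "'e \<Rightarrow> 'j::euclidean_space \<Rightarrow> 'e"
  assumes c: "c \<in> mfd_atlas M" and U: "open_in M U" "U \<subseteq> fst c"
    and J: "\<And>q. q \<in> snd c ` U \<Longrightarrow> linear (J q)" "\<And>q. q \<in> snd c ` U \<Longrightarrow> inj (J q)"
      "\<And>t. smooth_on (snd c ` U) (\<lambda>q. J q t)"
    and L: "\<And>y. y \<in> U \<Longrightarrow> L y = {v. cmp M c y v \<in> range (J (snd c y))}"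
  shows "smooth_distribution M U DIM('j) L"
proof -
  define l where "l y t = vfc M c (\<lambda>q. J q t) y" for y t
  have lL: "L y = range (l y)" and ll: "linear (l y)" and li: "inj (l y)" if y: "y \<in> U" for y
  proof -
    have yc: "y \<in> fst c" using y U by blast
    have yU: "snd c y \<in> snd c ` U" using y by blast
    have cl: "cmp M c y (l y t) = J (snd c y) t" for t by (simp add: l_def cmp_vfc[OF c yc])
    show "L y = range (l y)"
      unfolding L[OF y] using cl cmp_inject[OF ok c yc] by (auto simp: image_iff) metis+
    show "linear (l y)" unfolding l_def vfc_def
      using linear_compose[OF J(1)[OF yU] cmp_inv(3)[OF ok c yc]] by (simp add: o_def)
    show "inj (l y)" using cl J(2)[OF yU] by (metis injD injI)
  qed
  show ?thesis unfolding smooth_distribution_def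
  proof (intro conjI ballI)
    fix y assume y: "y \<in> U"
    show "subspace (L y)" unfolding lL[OF y] by (rule linear_subspace_image[OF ll[OF y] subspace_UNIV])
    show "dim (L y) = DIM('j)" unfolding lL[OF y]
      using dim_image_eq[OF ll[OF y], of UNIV] li[OF y] by (simp add: inj_on_subset)
    obtain e where e: "bij_betw e {0..<DIM('j)} (Basis :: 'j set)"
      using ex_bij_betw_nat_finite[OF finite_Basis] by blast
    then have eB: "e ` {..<DIM('j)} = Basis" by (simp add: bij_betw_def atLeast0LessThan)
    have "L z = span ((\<lambda>i. l z (e i)) ` {..<DIM('j)})" if z: "z \<in> U" for z
    proof -
      have 1: "(\<lambda>i. l z (e i)) ` {..<DIM('j)} = l z ` Basis"
        using arg_cong[OF eB, of "image (l z)"] by (simp only: image_image)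
      have "span (l z ` Basis) = l z ` span Basis" by (rule linear_span_image[OF ll[OF z]])
      then show ?thesis unfolding 1 lL[OF z] by (simp only: span_Basis)
    qed
    moreover have "vector_field M U (\<lambda>z. l z (e i))" for i
      unfolding l_def by (rule vfc_vector_field[OF c U J(3)])
    ultimately show "\<exists>V E. open_in M V \<and> y \<in> V \<and> V \<subseteq> U \<and>
        (\<forall>i<DIM('j). vector_field M V (E i)) \<and> (\<forall>z\<in>V. L z = span ((\<lambda>i. E i z) ` {..<DIM('j)}))"
      using U(1) y by (intro exI[of _ U] exI[of _ "\<lambda>i z. l z (e i)"]) auto
  qed
qed

end

section \<open>Product charts\<close>

text \<open>Coordinates (s, t) on an interval times a convex set. The product form of the metric
  lies in \<open>h\<close> not receiving the first coordinate. Convexity of both factors provides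
  connectedness of the domain and of the slices.\<close>

locale product_chart = riem_mfd F for F :: "('p, 'f::euclidean_space) riem" +
  fixes c :: "'p set \<times> ('p \<Rightarrow> 'f)" and Uc :: "'f set" and I :: "real set" and K :: "'k::euclidean_space set"
    and H :: "'f \<Rightarrow> real \<times> 'k" and \<Psi> :: "real \<times> 'k \<Rightarrow> 'f" and h :: "'k \<Rightarrow> 'k \<Rightarrow> 'k \<Rightarrow> real"
  assumes c: "c \<in> mfd_atlas F" and Uc: "open Uc" "Uc \<subseteq> snd c ` fst c"
    and I: "open I" "convex I" and K: "open K" "convex K"
    and \<Psi>_im: "\<Psi> ` (I \<times> K) = Uc" and H\<Psi>: "\<And>z. z \<in> I \<times> K \<Longrightarrow> H (\<Psi> z) = z"
    and s\<Psi>: "smooth_on (I \<times> K) \<Psi>" and sH: "smooth_on Uc H"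
    and metric: "\<And>z a b. z \<in> I \<times> K \<Longrightarrow>
      Gm c (\<Psi> z) (FD \<Psi> z a) (FD \<Psi> z b) = fst a * fst b + h (snd z) (snd a) (snd b)"
begin

definition "U = {y \<in> fst c. snd c y \<in> Uc}"
definition "\<kappa> y = H (snd c y)"
definition "\<kappa>i z = chart_inv c (\<Psi> z)"
definition "L1 y = {v. cmp F c y v \<in> range (\<lambda>s. FD \<Psi> (\<kappa> y) (s, 0))}"
definition "L2 y = {v. cmp F c y v \<in> range (\<lambda>t. FD \<Psi> (\<kappa> y) (0, t))}"

lemma oQ: "open (I \<times> K)" by (intro open_Times I K)
lemma \<Psi>_Uc: "z \<in> I \<times> K \<Longrightarrow> \<Psi> z \<in> Uc" using \<Psi>_im by blast
lemma Uc_obtain: assumes "q \<in> Uc" obtains z where "z \<in> I \<times> K" "q = \<Psi> z" using assms \<Psi>_im by blast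
lemma H_Uc: "q \<in> Uc \<Longrightarrow> H q \<in> I \<times> K" "q \<in> Uc \<Longrightarrow> \<Psi> (H q) = q"
  using H\<Psi> by (auto elim!: Uc_obtain)

lemma U_sub: "U \<subseteq> fst c" by (auto simp: U_def)
lemma U_open: "open_in F U" unfolding U_def by (rule chart_preimage_open[OF sm c Uc(1)])
lemma U_points: "U \<subseteq> points F" using openin_subset[OF U_open] .
lemma cU: "y \<in> U \<Longrightarrow> snd c y \<in> Uc" "y \<in> U \<Longrightarrow> y \<in> fst c" by (auto simp: U_def)

lemma \<kappa>: assumes "y \<in> U" shows "\<kappa> y \<in> I \<times> K" "\<kappa>i (\<kappa> y) = y" "\<Psi> (\<kappa> y) = snd c y"
  using H_Uc[OF cU(1)[OF assms]] chart_left[OF c cU(2)[OF assms]] by (auto simp: \<kappa>_def \<kappa>i_def)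

lemma \<kappa>i: assumes "z \<in> I \<times> K" shows "\<kappa>i z \<in> U" "\<kappa> (\<kappa>i z) = z" "snd c (\<kappa>i z) = \<Psi> z"
proof -
  obtain y where y: "\<Psi> z = snd c y" "y \<in> fst c" using \<Psi>_Uc[OF assms] Uc by blast
  then have k: "\<kappa>i z = y" using chart_left[OF c] by (simp add: \<kappa>i_def)
  show "\<kappa>i z \<in> U" "\<kappa> (\<kappa>i z) = z" "snd c (\<kappa>i z) = \<Psi> z"
    using k y \<Psi>_Uc[OF assms] H\<Psi>[OF assms] by (auto simp: U_def \<kappa>_def)
qed

lemma cU_image: "snd c ` U = Uc"
  using Uc by (auto simp: U_def)

lemma U_image: "\<kappa>i ` (I \<times> K) = U"
proof
  show "\<kappa>i ` (I \<times> K) \<subseteq> U" using \<kappa>i(1) by blast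
  show "U \<subseteq> \<kappa>i ` (I \<times> K)"
  proof
    fix y assume "y \<in> U"
    then show "y \<in> \<kappa>i ` (I \<times> K)" using \<kappa>(1,2)[of y] by (metis imageI)
  qed
qed

lemma \<kappa>_cont: "continuous_map (subtopology (mfd_top F) U) euclidean \<kappa>"
proof -
  have "continuous_map (subtopology (mfd_top F) U) euclidean (snd c)"
    by (rule continuous_map_into_fulltopology[OF continuous_map_from_subtopology_mono[OF chart_continuous[OF c] U_sub]])
  then have 1: "continuous_map (subtopology (mfd_top F) U) (top_of_set Uc) (snd c)"
    by (rule continuous_map_into_subtopology) (use cU(1) in simp)
  have 2: "continuous_map (top_of_set Uc) euclidean H" using smooth_on_continuous[OF sH] by simp
  show ?thesis using continuous_map_compose[OF 1 2] by (simp add: \<kappa>_def[abs_def] o_def)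
qed

lemma \<kappa>i_cont: "continuous_map (top_of_set (I \<times> K)) (mfd_top F) \<kappa>i"
proof -
  have "continuous_map (top_of_set (I \<times> K)) (top_of_set (snd c ` fst c)) \<Psi>"
    using smooth_on_continuous[OF s\<Psi>] \<Psi>_Uc Uc(2) by auto
  from continuous_map_compose[OF this chart_inv_continuous[OF c]]
  show ?thesis by (simp add: \<kappa>i_def[abs_def] o_def)
qed

lemma connected_image: assumes "connected A" "A \<subseteq> I \<times> K" shows "connectedin (mfd_top F) (\<kappa>i ` A)"
  by (rule connectedin_continuous_map_image[OF \<kappa>i_cont]) (use assms in \<open>simp add: connectedin_subtopology\<close>)

lemma U_domain: "domain_in F U"
  unfolding domain_in_def using U_open connected_image[OF _ order_refl] convex_connected[OF convex_Times[OF I(2) K(2)]]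
  by (simp add: U_image)

lemma d\<Psi>: "z \<in> I \<times> K \<Longrightarrow> (\<Psi> has_derivative FD \<Psi> z) (at z)" by (rule smooth_on_has_derivative[OF s\<Psi>])
lemma l\<Psi>: "z \<in> I \<times> K \<Longrightarrow> linear (FD \<Psi> z)" by (rule smooth_on_linear[OF s\<Psi>])

lemma FD_H\<Psi>: assumes z: "z \<in> I \<times> K" shows "FD H (\<Psi> z) (FD \<Psi> z v) = v"
proof -
  have "FD (\<lambda>z. H (\<Psi> z)) z = FD (\<lambda>z. z) z" by (rule FD_cong[OF oQ z H\<Psi>])
  then have "(\<lambda>v. FD H (\<Psi> z) (FD \<Psi> z v)) = (\<lambda>v. v)"
    using FD_compose[OF smooth_on_differentiable[OF s\<Psi> z] smooth_on_differentiable[OF sH \<Psi>_Uc[OF z]]] by simp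
  from fun_cong[OF this] show ?thesis by simp
qed

lemma FD_\<Psi>H: assumes z: "z \<in> I \<times> K" shows "FD \<Psi> z (FD H (\<Psi> z) v) = v"
proof -
  have "FD (\<lambda>q. \<Psi> (H q)) (\<Psi> z) = FD (\<lambda>q. q) (\<Psi> z)" by (rule FD_cong[OF Uc(1) \<Psi>_Uc[OF z]]) (rule H_Uc(2))
  then have "(\<lambda>v. FD \<Psi> (H (\<Psi> z)) (FD H (\<Psi> z) v)) = (\<lambda>v. v)"
    using FD_compose[OF smooth_on_differentiable[OF sH \<Psi>_Uc[OF z]], of \<Psi>] smooth_on_differentiable[OF s\<Psi> z] by (simp add: H\<Psi>[OF z])
  from fun_cong[OF this] show ?thesis by (simp add: H\<Psi>[OF z])
qed

section \<open>Coordinate slices as maximal integral submanifolds\<close>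

definition "P1 a = {y \<in> U. snd (\<kappa> y) = snd (\<kappa> a)}"
definition "P2 a = {y \<in> U. fst (\<kappa> y) = fst (\<kappa> a)}"
definition "\<rho>1 y = fst (\<kappa> y)"
definition "\<rho>2 y = snd (\<kappa> y)"
definition S1 :: "'p \<Rightarrow> ('p, real) mfd" where
  "S1 a = \<lparr>mfd_top = subtopology (mfd_top F) (P1 a), mfd_atlas = {(P1 a, \<rho>1)}\<rparr>"
definition S2 :: "'p \<Rightarrow> ('p, 'k) mfd" where
  "S2 a = \<lparr>mfd_top = subtopology (mfd_top F) (P2 a), mfd_atlas = {(P2 a, \<rho>2)}\<rparr>"

lemma P_sub: "P1 a \<subseteq> U" "P2 a \<subseteq> U" by (auto simp: P1_def P2_def)

lemma j1_has_derivative: assumes "s \<in> I" "t \<in> K"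
  shows "((\<lambda>s. \<Psi> (s, t)) has_derivative (\<lambda>x. FD \<Psi> (s, t) (x, 0))) (at s)"
  by (rule has_derivative_compose[OF has_derivative_Pair[OF has_derivative_ident has_derivative_const] d\<Psi>]) (use assms in auto)

lemma j2_has_derivative: assumes "s \<in> I" "t \<in> K"
  shows "((\<lambda>t. \<Psi> (s, t)) has_derivative (\<lambda>x. FD \<Psi> (s, t) (0, x))) (at t)"
  by (rule has_derivative_compose[OF has_derivative_Pair[OF has_derivative_const has_derivative_ident] d\<Psi>]) (use assms in auto)

lemma FD_\<Psi>_inj: "z \<in> I \<times> K \<Longrightarrow> inj (FD \<Psi> z)"
  by (rule inj_on_inverseI[of _ "FD H (\<Psi> z)"]) (rule FD_H\<Psi>)

context
  fixes a assumes a: "a \<in> U"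
begin

lemma \<kappa>a: "fst (\<kappa> a) \<in> I" "snd (\<kappa> a) \<in> K" using \<kappa>(1)[OF a] by (auto simp: mem_Times_iff)

lemma slice1:
  shows "submanifold (S1 a) F" "points (S1 a) = P1 a" "atlas_ok (S1 a)"
    "\<And>y v. y \<in> P1 a \<Longrightarrow> cmp F c y (incl_deriv (S1 a) F y v) = FD \<Psi> (\<kappa> y) (v, 0)"
    "\<rho>1 ` P1 a = I" "\<And>s. s \<in> I \<Longrightarrow> chart_inv (P1 a, \<rho>1) s = \<kappa>i (s, snd (\<kappa> a))"
proof -
  let ?j = "\<lambda>s. \<Psi> (s, snd (\<kappa> a))"
  have m: "(s, snd (\<kappa> a)) \<in> I \<times> K" if "s \<in> I" for s using that \<kappa>a by simp
  have 1: "P1 a \<subseteq> fst c" using P_sub U_sub by blast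
  have 2: "smooth_on I ?j"
    by (rule smooth_on_compose[OF I(1) oQ m smooth_on_Pair[OF I(1) smooth_on_ident[OF I(1)] smooth_on_const] s\<Psi>])
  have 3: "?j s \<in> snd c ` fst c" if "s \<in> I" for s using \<Psi>_Uc[OF m[OF that]] Uc(2) by blast
  have 4: "chart_inv c (?j s) \<in> P1 a" "\<rho>1 (chart_inv c (?j s)) = s" if "s \<in> I" for s
    using \<kappa>i[OF m[OF that]] by (simp_all add: P1_def \<rho>1_def flip: \<kappa>i_def)
  have 5: "\<rho>1 y \<in> I" "?j (\<rho>1 y) = snd c y" if "y \<in> P1 a" for y
  proof -
    have y: "y \<in> U" "snd (\<kappa> y) = snd (\<kappa> a)" using that by (auto simp: P1_def)
    show "\<rho>1 y \<in> I" using \<kappa>(1)[OF y(1)] by (auto simp: \<rho>1_def mem_Times_iff)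
    show "?j (\<rho>1 y) = snd c y" using \<kappa>(3)[OF y(1)] y(2) by (simp add: \<rho>1_def flip: y(2))
  qed
  have 6: "continuous_map (subtopology (mfd_top F) (P1 a)) euclidean \<rho>1"
    using continuous_map_compose[OF continuous_map_from_subtopology_mono[OF \<kappa>_cont P_sub(1)[of a]], of euclidean fst]
    by (simp add: \<rho>1_def[abs_def] o_def continuous_on_fst)
  have j': "FD ?j s = (\<lambda>x. FD \<Psi> (s, snd (\<kappa> a)) (x, 0))" if "s \<in> I" for s
    by (rule FD_eq[OF j1_has_derivative[OF that \<kappa>a(2)]])
  have 7: "inj (FD ?j s)" if "s \<in> I" for s
    unfolding j'[OF that] by (rule injI) (use FD_\<Psi>_inj[OF m[OF that]] in \<open>auto dest: injD\<close>)
  note sl = c 1 I(1) 2 3 4 5 6 7 S1_def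
  show "submanifold (S1 a) F" by (rule slice_submanifold[OF sl])
  show "points (S1 a) = P1 a" by (rule slice_points[OF sl])
  show "atlas_ok (S1 a)" by (rule slice_ok[OF sl])
  show "\<rho>1 ` P1 a = I" by (rule slice_image[OF sl])
  show "chart_inv (P1 a, \<rho>1) s = \<kappa>i (s, snd (\<kappa> a))" if "s \<in> I" for s
    unfolding \<kappa>i_def by (rule slice_inv[OF sl that])
  show "cmp F c y (incl_deriv (S1 a) F y v) = FD \<Psi> (\<kappa> y) (v, 0)" if y: "y \<in> P1 a" for y v
  proof -
    have "cmp F c y (incl_deriv (S1 a) F y v) = FD ?j (\<rho>1 y) v" by (rule slice_incl[OF sl y])
    moreover have "(\<rho>1 y, snd (\<kappa> a)) = \<kappa> y" using y by (simp add: P1_def \<rho>1_def prod_eq_iff)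
    ultimately show ?thesis using j'[OF 5(1)[OF y]] by simp
  qed
qed

lemma slice2:
  shows "submanifold (S2 a) F" "points (S2 a) = P2 a" "atlas_ok (S2 a)"
    "\<And>y v. y \<in> P2 a \<Longrightarrow> cmp F c y (incl_deriv (S2 a) F y v) = FD \<Psi> (\<kappa> y) (0, v)"
    "\<rho>2 ` P2 a = K" "\<And>t. t \<in> K \<Longrightarrow> chart_inv (P2 a, \<rho>2) t = \<kappa>i (fst (\<kappa> a), t)"
proof -
  let ?j = "\<lambda>t. \<Psi> (fst (\<kappa> a), t)"
  have m: "(fst (\<kappa> a), t) \<in> I \<times> K" if "t \<in> K" for t using that \<kappa>a by simp
  have 1: "P2 a \<subseteq> fst c" using P_sub U_sub by blast
  have 2: "smooth_on K ?j"
    by (rule smooth_on_compose[OF K(1) oQ m smooth_on_Pair[OF K(1) smooth_on_const smooth_on_ident[OF K(1)]] s\<Psi>])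
  have 3: "?j t \<in> snd c ` fst c" if "t \<in> K" for t using \<Psi>_Uc[OF m[OF that]] Uc(2) by blast
  have 4: "chart_inv c (?j t) \<in> P2 a" "\<rho>2 (chart_inv c (?j t)) = t" if "t \<in> K" for t
    using \<kappa>i[OF m[OF that]] by (simp_all add: P2_def \<rho>2_def flip: \<kappa>i_def)
  have 5: "\<rho>2 y \<in> K" "?j (\<rho>2 y) = snd c y" if "y \<in> P2 a" for y
  proof -
    have y: "y \<in> U" "fst (\<kappa> y) = fst (\<kappa> a)" using that by (auto simp: P2_def)
    show "\<rho>2 y \<in> K" using \<kappa>(1)[OF y(1)] by (auto simp: \<rho>2_def mem_Times_iff)
    show "?j (\<rho>2 y) = snd c y" using \<kappa>(3)[OF y(1)] y(2) by (simp add: \<rho>2_def flip: y(2))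
  qed
  have 6: "continuous_map (subtopology (mfd_top F) (P2 a)) euclidean \<rho>2"
    using continuous_map_compose[OF continuous_map_from_subtopology_mono[OF \<kappa>_cont P_sub(2)[of a]], of euclidean snd]
    by (simp add: \<rho>2_def[abs_def] o_def continuous_on_snd)
  have j': "FD ?j t = (\<lambda>x. FD \<Psi> (fst (\<kappa> a), t) (0, x))" if "t \<in> K" for t
    by (rule FD_eq[OF j2_has_derivative[OF \<kappa>a(1) that]])
  have 7: "inj (FD ?j t)" if "t \<in> K" for t
    unfolding j'[OF that] by (rule injI) (use FD_\<Psi>_inj[OF m[OF that]] in \<open>auto dest: injD\<close>)
  note sl = c 1 K(1) 2 3 4 5 6 7 S2_def
  show "submanifold (S2 a) F" by (rule slice_submanifold[OF sl])
  show "points (S2 a) = P2 a" by (rule slice_points[OF sl])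
  show "atlas_ok (S2 a)" by (rule slice_ok[OF sl])
  show "\<rho>2 ` P2 a = K" by (rule slice_image[OF sl])
  show "chart_inv (P2 a, \<rho>2) t = \<kappa>i (fst (\<kappa> a), t)" if "t \<in> K" for t
    unfolding \<kappa>i_def by (rule slice_inv[OF sl that])
  show "cmp F c y (incl_deriv (S2 a) F y v) = FD \<Psi> (\<kappa> y) (0, v)" if y: "y \<in> P2 a" for y v
  proof -
    have "cmp F c y (incl_deriv (S2 a) F y v) = FD ?j (\<rho>2 y) v" by (rule slice_incl[OF sl y])
    moreover have "(fst (\<kappa> a), \<rho>2 y) = \<kappa> y" using y by (simp add: P2_def \<rho>2_def prod_eq_iff)
    ultimately show ?thesis using j'[OF 5(1)[OF y]] by simp
  qed
qed

lemma range_cmp: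
  assumes y: "y \<in> U" and l: "\<And>v. cmp F c y (l v) = m v" shows "range l = {v. cmp F c y v \<in> range m}"
proof (intro set_eqI iffI)
  fix v assume "v \<in> {v. cmp F c y v \<in> range m}"
  then obtain x where "cmp F c y v = cmp F c y (l x)" using l by auto
  then have "v = l x" using cmp_inject[OF ok c cU(2)[OF y]] by blast
  then show "v \<in> range l" by blast
qed (use l in auto)

lemma integral1: "integral_submanifold F U L1 (S1 a)"
  unfolding integral_submanifold_def
proof (intro conjI ballI)
  show "submanifold (S1 a) F" by (rule slice1(1))
  show "points (S1 a) \<subseteq> U" unfolding slice1(2) by (rule P_sub)
  show "points (S1 a) \<noteq> {}" unfolding slice1(2) using a by (auto simp: P1_def)
  have "P1 a = \<kappa>i ` (I \<times> {snd (\<kappa> a)})"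
  proof
    show "P1 a \<subseteq> \<kappa>i ` (I \<times> {snd (\<kappa> a)})"
    proof
      fix y assume y: "y \<in> P1 a"
      then have yU: "y \<in> U" using P_sub by blast
      have "\<kappa> y \<in> I \<times> {snd (\<kappa> a)}" using \<kappa>(1)[OF yU] y by (auto simp: P1_def mem_Times_iff)
      from imageI[OF this, of \<kappa>i] show "y \<in> \<kappa>i ` (I \<times> {snd (\<kappa> a)})" unfolding \<kappa>(2)[OF yU] .
    qed
    show "\<kappa>i ` (I \<times> {snd (\<kappa> a)}) \<subseteq> P1 a"
    proof (rule image_subsetI)
      fix z assume z: "z \<in> I \<times> {snd (\<kappa> a)}"
      then have "z \<in> I \<times> K" using \<kappa>a(2) by auto
      from \<kappa>i(1,2)[OF this] z show "\<kappa>i z \<in> P1 a" by (auto simp: P1_def)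
    qed
  qed
  moreover have "connectedin (mfd_top F) (\<kappa>i ` (I \<times> {snd (\<kappa> a)}))"
    by (rule connected_image) (use \<kappa>a in \<open>auto intro!: connected_Times convex_connected I\<close>)
  ultimately show "connected_space (mfd_top (S1 a))" by (simp add: connectedin_def S1_def)
  fix y assume "y \<in> points (S1 a)"
  then have y: "y \<in> P1 a" unfolding slice1(2) .
  show "range (incl_deriv (S1 a) F y) = L1 y"
    unfolding L1_def by (rule range_cmp[OF _ slice1(4)[OF y]]) (use y P_sub in blast)
qed

lemma integral2: "integral_submanifold F U L2 (S2 a)"
  unfolding integral_submanifold_def
proof (intro conjI ballI)
  show "submanifold (S2 a) F" by (rule slice2(1))
  show "points (S2 a) \<subseteq> U" unfolding slice2(2) by (rule P_sub)
  show "points (S2 a) \<noteq> {}" unfolding slice2(2) using a by (auto simp: P2_def)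
  have "P2 a = \<kappa>i ` ({fst (\<kappa> a)} \<times> K)"
  proof
    show "P2 a \<subseteq> \<kappa>i ` ({fst (\<kappa> a)} \<times> K)"
    proof
      fix y assume y: "y \<in> P2 a"
      then have yU: "y \<in> U" using P_sub by blast
      have "\<kappa> y \<in> {fst (\<kappa> a)} \<times> K" using \<kappa>(1)[OF yU] y by (auto simp: P2_def mem_Times_iff)
      from imageI[OF this, of \<kappa>i] show "y \<in> \<kappa>i ` ({fst (\<kappa> a)} \<times> K)" unfolding \<kappa>(2)[OF yU] .
    qed
    show "\<kappa>i ` ({fst (\<kappa> a)} \<times> K) \<subseteq> P2 a"
    proof (rule image_subsetI)
      fix z assume z: "z \<in> {fst (\<kappa> a)} \<times> K"
      then have "z \<in> I \<times> K" using \<kappa>a(1) by auto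
      from \<kappa>i(1,2)[OF this] z show "\<kappa>i z \<in> P2 a" by (auto simp: P2_def)
    qed
  qed
  moreover have "connectedin (mfd_top F) (\<kappa>i ` ({fst (\<kappa> a)} \<times> K))"
    by (rule connected_image) (use \<kappa>a in \<open>auto intro!: connected_Times convex_connected K\<close>)
  ultimately show "connected_space (mfd_top (S2 a))" by (simp add: connectedin_def S2_def)
  fix y assume "y \<in> points (S2 a)"
  then have y: "y \<in> P2 a" unfolding slice2(2) .
  show "range (incl_deriv (S2 a) F y) = L2 y"
    unfolding L2_def by (rule range_cmp[OF _ slice2(4)[OF y]]) (use y P_sub in blast)
qed

text \<open>With \<pi> the projection to the complementary coordinate, the assumption
  \<open>L\<close> says that the differential of \<pi> composed with H vanishes on L. A connected
  integral submanifold thus lies in one slice, which is why the slices are maximal.\<close>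

lemma integral_constant:
  fixes S' :: "('p, 'j::euclidean_space) mfd" and \<pi> :: "real \<times> 'k \<Rightarrow> 'b::euclidean_space"
  assumes S': "integral_submanifold F U L S'" and \<pi>: "bounded_linear \<pi>"
    and L: "\<And>y v. y \<in> U \<Longrightarrow> v \<in> L y \<Longrightarrow> \<exists>w. cmp F c y v = FD \<Psi> (\<kappa> y) w \<and> \<pi> w = 0"
    and y: "y \<in> points S'" "z \<in> points S'"
  shows "\<pi> (\<kappa> y) = \<pi> (\<kappa> z)"
proof -
  have sub: "submanifold S' F" and con: "connected_space (mfd_top S')" and pU: "points S' \<subseteq> U"
    and rg: "\<And>y. y \<in> points S' \<Longrightarrow> range (incl_deriv S' F y) = L y"
    using S' by (auto simp: integral_submanifold_def)
  have s: "smooth_on Uc (\<lambda>q. \<pi> (H q))" by (rule smooth_on_bounded_linear[OF \<pi> Uc(1) sH])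
  have zero: "FD (\<lambda>q. \<pi> (H q)) (snd c x) (cmp F c x (incl_deriv S' F x v)) = 0" if x: "x \<in> points S'" for x v
  proof -
    have xU: "x \<in> U" using x pU by blast
    have "incl_deriv S' F x v \<in> L x" using rg[OF x] by blast
    then obtain w where w: "cmp F c x (incl_deriv S' F x v) = FD \<Psi> (\<kappa> x) w" "\<pi> w = 0" using L[OF xU] by blast
    have "FD (\<lambda>q. \<pi> (H q)) (snd c x) = (\<lambda>v. \<pi> (FD H (snd c x) v))"
      by (rule FD_eq[OF bounded_linear.has_derivative[OF \<pi> smooth_on_has_derivative[OF sH cU(1)[OF xU]]]])
    then show ?thesis using w FD_H\<Psi>[OF \<kappa>(1)[OF xU], of w] by (simp add: \<kappa>(3)[OF xU])
  qed
  show ?thesis unfolding \<kappa>_def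
    by (rule constant_on_connected_submanifold[OF sub con c Uc(1) _ s zero y]) (use pU cU in blast)+
qed

lemma maximal1: "maximal_integral_submanifold F U L1 (S1 a)"
  unfolding maximal_integral_submanifold_def
proof (intro conjI allI impI integral1)
  fix S' :: "('p, real) mfd" assume S': "integral_submanifold F U L1 S' \<and> points (S1 a) \<subseteq> points S'"
  have aS: "a \<in> points S'" using S' a unfolding slice1(2) by (auto simp: P1_def)
  have "points S' \<subseteq> P1 a"
  proof
    fix y assume y: "y \<in> points S'"
    have "snd (\<kappa> y) = snd (\<kappa> a)"
      by (rule integral_constant[OF conjunct1[OF S'] bounded_linear_snd _ y aS]) (auto simp: L1_def)
    then show "y \<in> P1 a" using y S' by (auto simp: P1_def integral_submanifold_def)
  qed
  then show "points S' = points (S1 a)" using S' unfolding slice1(2) by blast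
qed

lemma maximal2: "maximal_integral_submanifold F U L2 (S2 a)"
  unfolding maximal_integral_submanifold_def
proof (intro conjI allI impI integral2)
  fix S' :: "('p, 'k) mfd" assume S': "integral_submanifold F U L2 S' \<and> points (S2 a) \<subseteq> points S'"
  have aS: "a \<in> points S'" using S' a unfolding slice2(2) by (auto simp: P2_def)
  have "points S' \<subseteq> P2 a"
  proof
    fix y assume y: "y \<in> points S'"
    have "fst (\<kappa> y) = fst (\<kappa> a)"
      by (rule integral_constant[OF conjunct1[OF S'] bounded_linear_fst _ y aS]) (auto simp: L2_def)
    then show "y \<in> P2 a" using y S' by (auto simp: P2_def integral_submanifold_def)
  qed
  then show "points S' = points (S2 a)" using S' unfolding slice2(2) by blast
qed

end

end

section \<open>Charts of an open submanifold\<close>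

context manifold
begin

lemma restrict_chart_inv:
  assumes "c \<in> mfd_atlas M" "y \<in> fst c" "y \<in> U" shows "chart_inv (fst c \<inter> U, snd c) (snd c y) = y"
proof -
  have "inj_on (snd c) (fst c \<inter> U)" by (rule inj_on_subset[OF atlas_inj[OF ok assms(1)]]) blast
  then show ?thesis using assms by (simp add: chart_inv_def)
qed

lemma restrict_transition:
  assumes U: "open_in M U" and c: "c \<in> mfd_atlas M" and d: "d \<in> mfd_atlas M"
  shows "open (snd c ` (fst c \<inter> U \<inter> fst d))"
    "smooth_on (snd c ` (fst c \<inter> U \<inter> fst d)) (\<lambda>q. snd d (chart_inv (fst c \<inter> U, snd c) q))"
proof -
  have "open (snd c ` (U \<inter> fst d \<inter> fst c))"
    by (rule chart_image_open[OF sm c openin_Int[OF U smooth_manifold_chart(1)[OF sm d]]])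
  moreover have "U \<inter> fst d \<inter> fst c = fst c \<inter> U \<inter> fst d" by blast
  ultimately show o: "open (snd c ` (fst c \<inter> U \<inter> fst d))" by simp
  have "smooth_on (snd c ` (fst c \<inter> U \<inter> fst d)) (\<lambda>q. snd d (chart_inv c q))"
    by (rule smooth_on_subset[OF atlas_transition(2)[OF ok c d]]) blast
  then show "smooth_on (snd c ` (fst c \<inter> U \<inter> fst d)) (\<lambda>q. snd d (chart_inv (fst c \<inter> U, snd c) q))"
    by (rule smooth_on_cong[THEN iffD1, OF o, rotated]) (auto simp: restrict_chart_inv[OF c] chart_left[OF c])
qed

lemma open_submfd_ok: assumes U: "open_in M U" shows "atlas_ok (open_submfd M U)"
  unfolding atlas_ok_def
proof (intro conjI ballI)
  show "(\<Union>c\<in>mfd_atlas (open_submfd M U). fst c) = points (open_submfd M U)"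
    using ok by (auto simp: atlas_ok_def open_submfd_def)
  fix c' d' assume "c' \<in> mfd_atlas (open_submfd M U)" "d' \<in> mfd_atlas (open_submfd M U)"
  then obtain c d where c: "c' = (fst c \<inter> U, snd c)" "c \<in> mfd_atlas M" and d: "d' = (fst d \<inter> U, snd d)" "d \<in> mfd_atlas M"
    by (auto simp: open_submfd_def)
  show "inj_on (snd c') (fst c')" using inj_on_subset[OF atlas_inj[OF ok c(2)]] by (simp add: c(1))
  have "fst c' \<inter> fst d' = fst c \<inter> U \<inter> fst d" by (auto simp: c d)
  then show "open (snd c' ` (fst c' \<inter> fst d'))" "smooth_on (snd c' ` (fst c' \<inter> fst d')) (\<lambda>q. snd d' (chart_inv c' q))"
    using restrict_transition[OF U c(2) d(2)] by (simp_all add: c(1) d(1))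
qed

lemma open_submfd_incl_ok: assumes U: "open_in M U" shows "incl_ok (open_submfd M U) M"
  unfolding incl_ok_def
proof (intro conjI ballI open_submfd_ok[OF U] ok)
  fix c' d assume "c' \<in> mfd_atlas (open_submfd M U)" and d: "d \<in> mfd_atlas M"
  then obtain c where c: "c' = (fst c \<inter> U, snd c)" "c \<in> mfd_atlas M" by (auto simp: open_submfd_def)
  show "open (snd c' ` (fst c' \<inter> fst d))" "smooth_on (snd c' ` (fst c' \<inter> fst d)) (\<lambda>q. snd d (chart_inv c' q))"
    using restrict_transition[OF U c(2) d] by (simp_all add: c(1))
qed

lemma open_submfd_incl:
  assumes U: "open_in M U" and c: "c \<in> mfd_atlas M" and y: "y \<in> fst c" "y \<in> U"
  shows "cmp M c y (incl_deriv (open_submfd M U) M y v) = cmp (open_submfd M U) (fst c \<inter> U, snd c) y v"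
proof -
  have c': "(fst c \<inter> U, snd c) \<in> mfd_atlas (open_submfd M U)" using c by (auto simp: open_submfd_def)
  have "cmp M c y (incl_deriv (open_submfd M U) M y v) =
     FD (\<lambda>q. snd c (chart_inv (fst c \<inter> U, snd c) q)) (snd c y) (cmp (open_submfd M U) (fst c \<inter> U, snd c) y v)"
    using incl_deriv_chart[OF open_submfd_incl_ok[OF U] c' _ c y(1)] y by simp
  moreover have "FD (\<lambda>q. snd c (chart_inv (fst c \<inter> U, snd c) q)) (snd c y) = FD (\<lambda>q. q) (snd c y)"
  proof (rule FD_cong[OF chart_image_open[OF sm c U]])
    show "snd c y \<in> snd c ` (U \<inter> fst c)" using y by blast
    fix q assume "q \<in> snd c ` (U \<inter> fst c)"
    then obtain z where "q = snd c z" "z \<in> fst c" "z \<in> U" by blast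
    then show "snd c (chart_inv (fst c \<inter> U, snd c) q) = q" using restrict_chart_inv[OF c] by simp
  qed
  ultimately show ?thesis by simp
qed

end

section \<open>The product isometry\<close>

context product_chart
begin

text \<open>The factors use as charts the two components of the coordinates of U, so in coordinates
  this map is the identity of \<open>I \<times> K\<close>. Read in the chart c of F it is \<Psi>,
  which reduces its smoothness and its differential to those of \<Psi>.\<close>

definition "Phi yz = \<kappa>i (\<rho>1 (fst yz), \<rho>2 (snd yz))"

context
  fixes a assumes a: "a \<in> U"
begin

definition "PM = prod_mfd (S1 a) (S2 a)"
definition "pc = (P1 a \<times> P2 a, map_prod \<rho>1 \<rho>2)"
definition "OM = open_submfd F U"
definition "PhiI y = (\<kappa>i (fst (\<kappa> y), snd (\<kappa> a)), \<kappa>i (fst (\<kappa> a), snd (\<kappa> y)))"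

lemma PM_atlas: "mfd_atlas PM = {pc}"
  by (auto simp: PM_def pc_def prod_mfd_def S1_def S2_def)

lemma PM_points: "points PM = P1 a \<times> P2 a"
  using slice1(2)[OF a] slice2(2)[OF a] by (simp add: PM_def prod_mfd_def)

lemma OM_points: "points OM = U" using U_points by (auto simp: OM_def open_submfd_def)

lemma P_\<kappa>: "y \<in> P1 a \<Longrightarrow> \<kappa> y = (\<rho>1 y, snd (\<kappa> a))" "z \<in> P2 a \<Longrightarrow> \<kappa> z = (fst (\<kappa> a), \<rho>2 z)"
  by (auto simp: P1_def P2_def \<rho>1_def \<rho>2_def prod_eq_iff)

lemma \<rho>_in: "y \<in> P1 a \<Longrightarrow> \<rho>1 y \<in> I" "z \<in> P2 a \<Longrightarrow> \<rho>2 z \<in> K"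
  using slice1(5)[OF a] slice2(5)[OF a] by blast+

lemma PhiI_in: assumes "z \<in> I \<times> K" shows "(\<kappa>i (fst z, snd (\<kappa> a)), \<kappa>i (fst (\<kappa> a), snd z)) \<in> P1 a \<times> P2 a"
   "map_prod \<rho>1 \<rho>2 (\<kappa>i (fst z, snd (\<kappa> a)), \<kappa>i (fst (\<kappa> a), snd z)) = z"
proof -
  have m: "(fst z, snd (\<kappa> a)) \<in> I \<times> K" "(fst (\<kappa> a), snd z) \<in> I \<times> K" using assms \<kappa>a[OF a] by auto
  show "(\<kappa>i (fst z, snd (\<kappa> a)), \<kappa>i (fst (\<kappa> a), snd z)) \<in> P1 a \<times> P2 a"
    using \<kappa>i(1,2)[OF m(1)] \<kappa>i(1,2)[OF m(2)] by (simp add: P1_def P2_def)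
  show "map_prod \<rho>1 \<rho>2 (\<kappa>i (fst z, snd (\<kappa> a)), \<kappa>i (fst (\<kappa> a), snd z)) = z"
    using \<kappa>i(2)[OF m(1)] \<kappa>i(2)[OF m(2)] by (simp add: \<rho>1_def \<rho>2_def)
qed

lemma pc_inj: "inj_on (map_prod \<rho>1 \<rho>2) (P1 a \<times> P2 a)"
proof (rule inj_onI)
  fix y z assume y: "y \<in> P1 a \<times> P2 a" and z: "z \<in> P1 a \<times> P2 a" and eq: "map_prod \<rho>1 \<rho>2 y = map_prod \<rho>1 \<rho>2 z"
  have m: "fst y \<in> P1 a" "snd y \<in> P2 a" "fst z \<in> P1 a" "snd z \<in> P2 a" using y z by (auto simp: mem_Times_iff)
  then have u: "fst y \<in> U" "snd y \<in> U" "fst z \<in> U" "snd z \<in> U" using P_sub by blast+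
  have "\<rho>1 (fst y) = \<rho>1 (fst z)" "\<rho>2 (snd y) = \<rho>2 (snd z)" using eq by (auto simp: map_prod_def split_beta)
  then have "\<kappa> (fst y) = \<kappa> (fst z)" "\<kappa> (snd y) = \<kappa> (snd z)" using P_\<kappa> m by metis+
  then have "fst y = fst z" "snd y = snd z" using \<kappa>(2)[OF u(1)] \<kappa>(2)[OF u(3)] \<kappa>(2)[OF u(2)] \<kappa>(2)[OF u(4)] by metis+
  then show "y = z" by (simp add: prod_eq_iff)
qed

lemma pc_image: "map_prod \<rho>1 \<rho>2 ` (P1 a \<times> P2 a) = I \<times> K"
  using slice1(5)[OF a] slice2(5)[OF a] by (simp add: map_prod_surj_on)

lemma pc_inv: assumes "z \<in> I \<times> K"
  shows "chart_inv pc z = (\<kappa>i (fst z, snd (\<kappa> a)), \<kappa>i (fst (\<kappa> a), snd z))"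
  unfolding chart_inv_def pc_def fst_conv snd_conv
  by (rule inv_into_f_eq[OF pc_inj PhiI_in[OF assms]])

lemma pc_coord: "z \<in> P1 a \<times> P2 a \<Longrightarrow> snd pc z \<in> I \<times> K" using pc_image by (auto simp: pc_def)

lemma PM_ok: "atlas_ok PM"
  unfolding atlas_ok_def PM_points PM_atlas
proof (intro conjI ballI)
  fix e d assume "e \<in> {pc}" "d \<in> {pc}"
  then have ed: "e = pc" "d = pc" by auto
  show "inj_on (snd e) (fst e)" using pc_inj by (simp add: ed pc_def)
  show "open (snd e ` (fst e \<inter> fst d))" using oQ by (simp add: ed pc_def pc_image)
  have inv: "q = snd pc (chart_inv pc q)" if "q \<in> I \<times> K" for q
    unfolding pc_inv[OF that] using PhiI_in(2)[OF that] by (simp add: pc_def)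
  have "smooth_on (I \<times> K) (\<lambda>q. snd pc (chart_inv pc q))"
    by (rule smooth_on_cong[THEN iffD1, OF oQ inv smooth_on_ident[OF oQ]])
  then show "smooth_on (snd e ` (fst e \<inter> fst d)) (\<lambda>q. snd d (chart_inv e q))"
    by (simp add: ed) (simp add: pc_def pc_image)
qed (simp add: pc_def)

lemma Phi_pc: assumes "z \<in> I \<times> K" shows "Phi (chart_inv pc z) = \<kappa>i z"
  unfolding pc_inv[OF assms] Phi_def
  using arg_cong[OF PhiI_in(2)[OF assms], of fst] arg_cong[OF PhiI_in(2)[OF assms], of snd] by simp

lemma Phi_coord: assumes "yz \<in> P1 a \<times> P2 a"
  shows "Phi yz = \<kappa>i (snd pc yz)" "Phi yz \<in> U" "\<kappa> (Phi yz) = snd pc yz"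
proof -
  show 1: "Phi yz = \<kappa>i (snd pc yz)" by (simp add: Phi_def pc_def map_prod_def split_beta)
  show "Phi yz \<in> U" "\<kappa> (Phi yz) = snd pc yz" unfolding 1 using \<kappa>i(1,2)[OF pc_coord[OF assms]] by auto
qed

lemma PhiI_inverse: assumes "yz \<in> P1 a \<times> P2 a" shows "PhiI (Phi yz) = yz"
proof -
  have "PhiI (Phi yz) = chart_inv pc (snd pc yz)"
    unfolding PhiI_def Phi_coord(3)[OF assms] using pc_inv[OF pc_coord[OF assms]] by simp
  also have "\<dots> = yz" using assms pc_inj by (simp add: chart_inv_def pc_def)
  finally show ?thesis .
qed

lemma PhiI: assumes "y \<in> U" shows "PhiI y \<in> P1 a \<times> P2 a" "Phi (PhiI y) = y" "snd pc (PhiI y) = \<kappa> y"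
proof -
  note m = \<kappa>(1)[OF assms]
  show 1: "PhiI y \<in> P1 a \<times> P2 a" "snd pc (PhiI y) = \<kappa> y"
    using PhiI_in[OF m] by (auto simp: PhiI_def pc_def)
  show "Phi (PhiI y) = y" using Phi_coord(1)[OF 1(1)] 1(2) \<kappa>(2)[OF assms] by simp
qed

lemma Phi_bij: "bij_betw Phi (P1 a \<times> P2 a) U"
  by (rule bij_betw_byWitness[where f' = PhiI]) (use PhiI_inverse PhiI Phi_coord(2) in blast)+

lemma Phi_inv_into: "y \<in> U \<Longrightarrow> inv_into (P1 a \<times> P2 a) Phi y = PhiI y"
  by (rule inv_into_f_eq[OF bij_betw_imp_inj_on[OF Phi_bij] PhiI(1,2)])

lemma mfd_tops: "mfd_top PM = prod_topology (subtopology (mfd_top F) (P1 a)) (subtopology (mfd_top F) (P2 a))"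
  "mfd_top OM = subtopology (mfd_top F) U"
  by (simp_all add: PM_def OM_def prod_mfd_def open_submfd_def S1_def S2_def)

lemma continuous_map_euclidean_Pair:
  fixes f :: "'w \<Rightarrow> 'x::topological_space" and g :: "'w \<Rightarrow> 'y::topological_space"
  assumes "continuous_map T euclidean f" "continuous_map T euclidean g"
  shows "continuous_map T euclidean (\<lambda>x. (f x, g x))"
  using continuous_map_pairedI[OF assms] by simp

lemma Phi_cont: "continuous_map (mfd_top PM) (mfd_top OM) Phi"
proof -
  have 1: "continuous_map (mfd_top PM) euclidean (\<lambda>yz. \<kappa> (fst yz))"
    unfolding mfd_tops
    using continuous_map_compose[OF continuous_map_fst continuous_map_from_subtopology_mono[OF \<kappa>_cont P_sub(1)[of a]]]
    by (simp add: o_def)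
  have 2: "continuous_map (mfd_top PM) euclidean (\<lambda>yz. \<kappa> (snd yz))"
    unfolding mfd_tops
    using continuous_map_compose[OF continuous_map_snd continuous_map_from_subtopology_mono[OF \<kappa>_cont P_sub(2)[of a]]]
    by (simp add: o_def)
  have 3: "continuous_map (mfd_top PM) euclidean (\<lambda>yz. fst (\<kappa> (fst yz)))"
    using continuous_map_compose[OF 1, of euclidean fst] by (simp add: o_def continuous_on_fst)
  have 4: "continuous_map (mfd_top PM) euclidean (\<lambda>yz. snd (\<kappa> (snd yz)))"
    using continuous_map_compose[OF 2, of euclidean snd] by (simp add: o_def continuous_on_snd)
  have "continuous_map (mfd_top PM) euclidean (\<lambda>yz. (fst (\<kappa> (fst yz)), snd (\<kappa> (snd yz))))"
    by (rule continuous_map_euclidean_Pair[OF 3 4])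
  then have "continuous_map (mfd_top PM) (top_of_set (I \<times> K)) (\<lambda>yz. (fst (\<kappa> (fst yz)), snd (\<kappa> (snd yz))))"
    by (rule continuous_map_into_subtopology) (use \<rho>_in in \<open>auto simp: PM_points \<rho>1_def \<rho>2_def\<close>)
  from continuous_map_compose[OF this \<kappa>i_cont]
  have "continuous_map (mfd_top PM) (mfd_top F) Phi" by (simp add: Phi_def[abs_def] \<rho>1_def \<rho>2_def o_def)
  then show ?thesis unfolding mfd_tops(2)
    by (rule continuous_map_into_subtopology) (use Phi_coord(2) in \<open>auto simp: PM_points\<close>)
qed

lemma PhiI_cont: "continuous_map (mfd_top OM) (mfd_top PM) PhiI"
proof -
  have 3: "continuous_map (mfd_top OM) euclidean (\<lambda>y. fst (\<kappa> y))"
    using continuous_map_compose[OF \<kappa>_cont, of euclidean fst] by (simp add: o_def continuous_on_fst mfd_tops)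
  have 4: "continuous_map (mfd_top OM) euclidean (\<lambda>y. snd (\<kappa> y))"
    using continuous_map_compose[OF \<kappa>_cont, of euclidean snd] by (simp add: o_def continuous_on_snd mfd_tops)
  have k: "continuous_map (mfd_top OM) (mfd_top F) (\<lambda>y. \<kappa>i (g y))"
    if g: "continuous_map (mfd_top OM) euclidean g" "\<And>y. y \<in> U \<Longrightarrow> g y \<in> I \<times> K" for g
  proof -
    have "continuous_map (mfd_top OM) (top_of_set (I \<times> K)) g"
      by (rule continuous_map_into_subtopology) (use g in \<open>simp_all add: OM_points\<close>)
    from continuous_map_compose[OF this \<kappa>i_cont] show ?thesis by (simp add: o_def)
  qed
  have "continuous_map (mfd_top OM) (mfd_top F) (\<lambda>y. \<kappa>i (fst (\<kappa> y), snd (\<kappa> a)))"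
    by (rule k) (use \<kappa>(1) \<kappa>a[OF a] in \<open>auto intro!: continuous_map_euclidean_Pair 3 simp: mem_Times_iff\<close>)
  then have 5: "continuous_map (mfd_top OM) (subtopology (mfd_top F) (P1 a)) (\<lambda>y. \<kappa>i (fst (\<kappa> y), snd (\<kappa> a)))"
    by (rule continuous_map_into_subtopology) (use PhiI(1) in \<open>auto simp: OM_points PhiI_def\<close>)
  have "continuous_map (mfd_top OM) (mfd_top F) (\<lambda>y. \<kappa>i (fst (\<kappa> a), snd (\<kappa> y)))"
    by (rule k) (use \<kappa>(1) \<kappa>a[OF a] in \<open>auto intro!: continuous_map_euclidean_Pair 4 simp: mem_Times_iff\<close>)
  then have 6: "continuous_map (mfd_top OM) (subtopology (mfd_top F) (P2 a)) (\<lambda>y. \<kappa>i (fst (\<kappa> a), snd (\<kappa> y)))"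
    by (rule continuous_map_into_subtopology) (use PhiI(1) in \<open>auto simp: OM_points PhiI_def\<close>)
  show ?thesis unfolding mfd_tops(1) PhiI_def[abs_def] using 5 6 by (simp add: continuous_map_pairwise o_def)
qed

lemma OM_atlas: "d' \<in> mfd_atlas OM \<longleftrightarrow> (\<exists>d\<in>mfd_atlas F. d' = (fst d \<inter> U, snd d))"
  by (auto simp: OM_def open_submfd_def)

lemma Phi_chart:
  assumes d: "d \<in> mfd_atlas F"
  shows "open (snd pc ` (fst pc \<inter> Phi -` (fst d \<inter> U)))"
    "smooth_on (snd pc ` (fst pc \<inter> Phi -` (fst d \<inter> U))) (\<lambda>q. snd d (Phi (chart_inv pc q)))"
proof -
  let ?T = "snd pc ` (fst pc \<inter> Phi -` (fst d \<inter> U))"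
  have eq: "?T = (I \<times> K) \<inter> \<Psi> -` (snd c ` (fst c \<inter> fst d))"
  proof
    show "?T \<subseteq> (I \<times> K) \<inter> \<Psi> -` (snd c ` (fst c \<inter> fst d))"
    proof
      fix q assume "q \<in> ?T"
      then obtain x where x: "x \<in> P1 a \<times> P2 a" "q = snd pc x" "Phi x \<in> fst d" by (auto simp: pc_def)
      have "\<Psi> q = snd c (Phi x)" using Phi_coord(1)[OF x(1)] \<kappa>i(3)[OF pc_coord[OF x(1)]] x(2) by simp
      then show "q \<in> (I \<times> K) \<inter> \<Psi> -` (snd c ` (fst c \<inter> fst d))"
        using x pc_coord[OF x(1)] Phi_coord(2)[OF x(1)] U_sub by blast
    qed
    show "(I \<times> K) \<inter> \<Psi> -` (snd c ` (fst c \<inter> fst d)) \<subseteq> ?T"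
    proof
      fix q assume q: "q \<in> (I \<times> K) \<inter> \<Psi> -` (snd c ` (fst c \<inter> fst d))"
      then have qI: "q \<in> I \<times> K" by blast
      obtain y where y: "\<Psi> q = snd c y" "y \<in> fst c" "y \<in> fst d" using q by blast
      have "\<kappa>i q = y" using y chart_left[OF c] by (simp add: \<kappa>i_def)
      then have "Phi (chart_inv pc q) \<in> fst d \<inter> U" using Phi_pc[OF qI] \<kappa>i(1)[OF qI] y by simp
      moreover have "chart_inv pc q \<in> fst pc" "snd pc (chart_inv pc q) = q"
        using PhiI_in[OF qI] unfolding pc_inv[OF qI] by (simp_all add: pc_def)
      ultimately show "q \<in> ?T" by (metis IntI image_eqI vimageI)
    qed
  qed
  show o: "open ?T" unfolding eq
    by (rule continuous_open_preimage[OF smooth_on_continuous[OF s\<Psi>] oQ atlas_transition(1)[OF ok c d]])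
  have "smooth_on ?T (\<lambda>q. snd d (chart_inv c (\<Psi> q)))"
    by (rule smooth_on_compose[OF o atlas_transition(1)[OF ok c d] _ smooth_on_subset[OF s\<Psi>] atlas_transition(2)[OF ok c d]])
      (use eq in auto)
  then show "smooth_on ?T (\<lambda>q. snd d (Phi (chart_inv pc q)))"
  proof (rule smooth_on_cong[THEN iffD1, OF o, rotated])
    fix q assume "q \<in> ?T"
    then have "q \<in> I \<times> K" unfolding eq by blast
    then show "snd d (chart_inv c (\<Psi> q)) = snd d (Phi (chart_inv pc q))" by (simp add: Phi_pc \<kappa>i_def)
  qed
qed

lemma Phi_smooth: "smooth_map PM OM Phi"
  unfolding smooth_map_def
proof (intro conjI ballI Phi_cont)
  fix e d' assume "e \<in> mfd_atlas PM" "d' \<in> mfd_atlas OM"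
  then obtain d where d: "d \<in> mfd_atlas F" "d' = (fst d \<inter> U, snd d)" and e: "e = pc" unfolding OM_atlas PM_atlas by blast
  show "smooth_on (snd e ` (fst e \<inter> Phi -` fst d')) (snd d' \<circ> Phi \<circ> chart_inv e)"
    using Phi_chart(2)[OF d(1)] by (simp add: d(2) e o_def)
qed

lemma PhiI_smooth: "smooth_map OM PM (inv_into (points PM) Phi)"
  unfolding smooth_map_def PM_points
proof (intro conjI ballI)
  show "continuous_map (mfd_top OM) (mfd_top PM) (inv_into (P1 a \<times> P2 a) Phi)"
    by (rule continuous_map_eq[OF PhiI_cont]) (simp add: OM_points Phi_inv_into)
  fix d' e assume "d' \<in> mfd_atlas OM" "e \<in> mfd_atlas PM"
  then obtain d where d: "d \<in> mfd_atlas F" "d' = (fst d \<inter> U, snd d)" and e: "e = pc" unfolding OM_atlas PM_atlas by blast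
  let ?f = "inv_into (P1 a \<times> P2 a) Phi"
  have dom: "fst d' \<inter> ?f -` fst e = U \<inter> fst d" using PhiI(1) Phi_inv_into by (auto simp: d(2) e pc_def)
  have o: "open (snd d ` (U \<inter> fst d))" by (rule chart_image_open[OF sm d(1) U_open])
  have s: "smooth_on (snd d ` (U \<inter> fst d)) (\<lambda>q. H (snd c (chart_inv d q)))"
  proof (rule smooth_on_compose[OF o Uc(1) _ _ sH])
    show "smooth_on (snd d ` (U \<inter> fst d)) (\<lambda>q. snd c (chart_inv d q))"
      by (rule smooth_on_subset[OF atlas_transition(2)[OF ok d(1) c]]) (use U_sub in blast)
    show "snd c (chart_inv d q) \<in> Uc" if "q \<in> snd d ` (U \<inter> fst d)" for q
      using that cU(1) chart_left[OF d(1)] by auto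
  qed
  have "smooth_on (snd d ` (U \<inter> fst d)) (snd pc \<circ> ?f \<circ> chart_inv d')"
  proof (rule smooth_on_cong[THEN iffD1, OF o _ s])
    fix q assume "q \<in> snd d ` (U \<inter> fst d)"
    then obtain y where y: "q = snd d y" "y \<in> U" "y \<in> fst d" by blast
    have "chart_inv d' q = y" using restrict_chart_inv[OF d(1) y(3,2)] by (simp add: d(2) y(1))
    then show "H (snd c (chart_inv d q)) = (snd pc \<circ> ?f \<circ> chart_inv d') q"
      using Phi_inv_into[OF y(2)] PhiI(3)[OF y(2)] chart_left[OF d(1) y(3)] by (simp add: y(1) \<kappa>_def)
  qed
  then show "smooth_on (snd d' ` (fst d' \<inter> ?f -` fst e)) (snd e \<circ> ?f \<circ> chart_inv d')"
    unfolding dom by (simp add: e d(2))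
qed

lemma cmp_PM: "z \<in> P1 a \<times> P2 a \<Longrightarrow> cmp PM pc z v = v"
  by (rule single_chart(1)[OF PM_ok PM_atlas]) (simp add: pc_def)

lemma Phi_deriv:
  assumes z: "z \<in> P1 a \<times> P2 a"
  shows "cmp F c (Phi z) (incl_deriv OM F (Phi z) (mderiv PM OM Phi z v)) = FD \<Psi> (snd pc z) v"
proof -
  note PU = Phi_coord(2)[OF z]
  have pcA: "pc \<in> mfd_atlas PM" by (simp add: PM_atlas)
  have zp: "z \<in> fst pc" using z by (simp add: pc_def)
  have oc: "(fst c \<inter> U, snd c) \<in> mfd_atlas OM" using c OM_atlas by blast
  have "cmp F c (Phi z) (incl_deriv OM F (Phi z) (mderiv PM OM Phi z v)) = cmp OM (fst c \<inter> U, snd c) (Phi z) (mderiv PM OM Phi z v)"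
    unfolding OM_def by (rule open_submfd_incl[OF U_open c cU(2)[OF PU] PU])
  also have "\<dots> = FD (\<lambda>q. snd (fst c \<inter> U, snd c) (Phi (chart_inv pc q))) (snd pc z) (cmp PM pc z v)"
  proof (rule mderiv_chart[OF PM_ok open_submfd_ok[OF U_open, folded OM_def] pcA zp oc])
    show "Phi z \<in> fst (fst c \<inter> U, snd c)" using PU cU(2) by simp
    fix d' assume "d' \<in> mfd_atlas OM" "Phi z \<in> fst d'"
    then obtain d where d: "d \<in> mfd_atlas F" "d' = (fst d \<inter> U, snd d)" unfolding OM_atlas by blast
    show "open (snd pc ` (fst pc \<inter> Phi -` fst d')) \<and> smooth_on (snd pc ` (fst pc \<inter> Phi -` fst d')) (\<lambda>q. snd d' (Phi (chart_inv pc q)))"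
      using Phi_chart[OF d(1)] by (simp add: d(2))
  qed
  also have "FD (\<lambda>q. snd (fst c \<inter> U, snd c) (Phi (chart_inv pc q))) (snd pc z) = FD \<Psi> (snd pc z)"
    by (rule FD_cong[OF oQ pc_coord[OF z]]) (simp add: Phi_pc \<kappa>i(3))
  finally show ?thesis by (simp add: cmp_PM[OF z])
qed

lemma proj_deriv:
  assumes z: "z \<in> P1 a \<times> P2 a"
  shows "mderiv PM (S1 a) fst z v = fst v" "mderiv PM (S2 a) snd z v = snd v"
proof -
  have pcA: "pc \<in> mfd_atlas PM" by (simp add: PM_atlas)
  have zp: "z \<in> fst pc" using z by (simp add: pc_def)
  have at: "mfd_atlas (S1 a) = {(P1 a, \<rho>1)}" "mfd_atlas (S2 a) = {(P2 a, \<rho>2)}" by (simp_all add: S1_def S2_def)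
  have d1: "fst pc \<inter> fst -` P1 a = fst pc" "fst pc \<inter> snd -` P2 a = fst pc" by (auto simp: pc_def)
  have im: "snd pc ` fst pc = I \<times> K" by (simp add: pc_def pc_image)
  have e1: "\<rho>1 (fst (chart_inv pc q)) = fst q" and e2: "\<rho>2 (snd (chart_inv pc q)) = snd q" if "q \<in> I \<times> K" for q
    using arg_cong[OF PhiI_in(2)[OF that], of fst] arg_cong[OF PhiI_in(2)[OF that], of snd] by (simp_all add: pc_inv[OF that])
  have s1: "smooth_on (I \<times> K) (\<lambda>q. \<rho>1 (fst (chart_inv pc q)))"
    by (rule smooth_on_cong[THEN iffD1, OF oQ e1[symmetric] smooth_on_fst[OF oQ smooth_on_ident[OF oQ]]])
  have s2: "smooth_on (I \<times> K) (\<lambda>q. \<rho>2 (snd (chart_inv pc q)))"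
    by (rule smooth_on_cong[THEN iffD1, OF oQ e2[symmetric] smooth_on_snd[OF oQ smooth_on_ident[OF oQ]]])
  have "cmp (S1 a) (P1 a, \<rho>1) (fst z) (mderiv PM (S1 a) fst z v) = FD (\<lambda>q. snd (P1 a, \<rho>1) (fst (chart_inv pc q))) (snd pc z) (cmp PM pc z v)"
    by (rule mderiv_chart[OF PM_ok slice1(3)[OF a] pcA zp]) (use z oQ s1 in \<open>auto simp: at d1 im mem_Times_iff\<close>)
  also have "FD (\<lambda>q. snd (P1 a, \<rho>1) (fst (chart_inv pc q))) (snd pc z) = FD fst (snd pc z)"
    by (rule FD_cong[OF oQ pc_coord[OF z]]) (simp add: e1)
  also have "FD fst (snd pc z) = fst" by (rule FD_eq[OF bounded_linear_imp_has_derivative[OF bounded_linear_fst]])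
  also have "cmp (S1 a) (P1 a, \<rho>1) (fst z) w = w" for w
    by (rule single_chart(1)[OF slice1(3)[OF a] at(1)]) (use z in auto)
  finally show "mderiv PM (S1 a) fst z v = fst v" by (simp add: cmp_PM[OF z])
  have "cmp (S2 a) (P2 a, \<rho>2) (snd z) (mderiv PM (S2 a) snd z v) = FD (\<lambda>q. snd (P2 a, \<rho>2) (snd (chart_inv pc q))) (snd pc z) (cmp PM pc z v)"
    by (rule mderiv_chart[OF PM_ok slice2(3)[OF a] pcA zp]) (use z oQ s2 in \<open>auto simp: at d1 im mem_Times_iff\<close>)
  also have "FD (\<lambda>q. snd (P2 a, \<rho>2) (snd (chart_inv pc q))) (snd pc z) = FD snd (snd pc z)"
    by (rule FD_cong[OF oQ pc_coord[OF z]]) (simp add: e2)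
  also have "FD snd (snd pc z) = snd" by (rule FD_eq[OF bounded_linear_imp_has_derivative[OF bounded_linear_snd]])
  also have "cmp (S2 a) (P2 a, \<rho>2) (snd z) w = w" for w
    by (rule single_chart(1)[OF slice2(3)[OF a] at(2)]) (use z in auto)
  finally show "mderiv PM (S2 a) snd z v = snd v" by (simp add: cmp_PM[OF z])
qed

lemma metric_chart: "y \<in> U \<Longrightarrow> rmetric F y u v = Gm c (snd c y) (cmp F c y u) (cmp F c y v)"
  using Gm_cmp[OF c cU(2)] by simp

lemma Phi_isometry:
  "isometry (prod_mfd (S1 a) (S2 a))
     (prod_metric (S1 a) (induced_metric (S1 a) F (rmetric F)) (S2 a) (induced_metric (S2 a) F (rmetric F)))
     (open_submfd F U) (induced_metric (open_submfd F U) F (rmetric F)) Phi"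
  unfolding isometry_def diffeomorphism_def PM_def[symmetric] OM_def[symmetric]
proof (intro conjI ballI allI)
  show "bij_betw Phi (points PM) (points OM)" unfolding PM_points OM_points by (rule Phi_bij)
  show "smooth_map PM OM Phi" by (rule Phi_smooth)
  show "smooth_map OM PM (inv_into (points PM) Phi)" by (rule PhiI_smooth)
  fix z u v assume "z \<in> points PM"
  then have z: "z \<in> P1 a \<times> P2 a" unfolding PM_points .
  have z12: "fst z \<in> P1 a" "snd z \<in> P2 a" using z by auto
  have zU: "fst z \<in> U" "snd z \<in> U" "Phi z \<in> U" using z12 P_sub Phi_coord(2)[OF z] by blast+
  have co: "snd pc z = (\<rho>1 (fst z), \<rho>2 (snd z))" by (simp add: pc_def map_prod_def split_beta)
  have "induced_metric OM F (rmetric F) (Phi z) (mderiv PM OM Phi z u) (mderiv PM OM Phi z v) =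
      Gm c (\<Psi> (snd pc z)) (FD \<Psi> (snd pc z) u) (FD \<Psi> (snd pc z) v)"
    unfolding induced_metric_def metric_chart[OF zU(3)] Phi_deriv[OF z]
    using \<kappa>i(3)[OF pc_coord[OF z]] Phi_coord(1)[OF z] by simp
  also have "\<dots> = fst u * fst v + h (\<rho>2 (snd z)) (snd u) (snd v)"
    using metric[OF pc_coord[OF z]] by (simp add: co)
  finally have L: "induced_metric OM F (rmetric F) (Phi z) (mderiv PM OM Phi z u) (mderiv PM OM Phi z v) =
      fst u * fst v + h (\<rho>2 (snd z)) (snd u) (snd v)" .
  \<comment> \<open>Nothing is assumed about \<open>h\<close> except through the metric formula;
    evaluating that at zero vectors yields this value. It is needed since vectors tangent to the
    first factor have second component 0.\<close>
  have h0: "h t 0 0 = 0" if "t \<in> K" for t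
    using metric[of "(fst (\<kappa> a), t)" 0 0] that \<kappa>a[OF a] linear_0[OF l\<Psi>]
      bilinear_simps(9)[OF chart_metric.G_bil[OF chart_metric_chart[OF c]]] \<Psi>_Uc Uc(2)
    by (metis (no_types, lifting) SigmaI add_0 fst_conv fst_zero mult_zero_left snd_conv snd_zero subsetD)
  have 1: "induced_metric (S1 a) F (rmetric F) (fst z) (fst u) (fst v) = fst u * fst v"
    unfolding induced_metric_def metric_chart[OF zU(1)] slice1(4)[OF a z12(1)] \<kappa>(3)[OF zU(1), symmetric]
    using metric[OF \<kappa>(1)[OF zU(1)], of "(fst u, 0)" "(fst v, 0)"] h0[of "snd (\<kappa> (fst z))"] \<kappa>(1)[OF zU(1)]
    by (simp add: mem_Times_iff)
  have 2: "induced_metric (S2 a) F (rmetric F) (snd z) (snd u) (snd v) = h (\<rho>2 (snd z)) (snd u) (snd v)"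
    unfolding induced_metric_def metric_chart[OF zU(2)] slice2(4)[OF a z12(2)] \<kappa>(3)[OF zU(2), symmetric]
    using metric[OF \<kappa>(1)[OF zU(2)], of "(0, snd u)" "(0, snd v)"] by (simp add: \<rho>2_def)
  show "induced_metric OM F (rmetric F) (Phi z) (mderiv PM OM Phi z u) (mderiv PM OM Phi z v) =
    prod_metric (S1 a) (induced_metric (S1 a) F (rmetric F)) (S2 a) (induced_metric (S2 a) F (rmetric F)) z u v"
    unfolding prod_metric_def PM_def[symmetric] proj_deriv[OF z] L 1 2 ..
qed

lemma Phi_partial1:
  assumes y: "y \<in> P1 a" and z: "z \<in> P2 a"
  shows "range (mderiv (S1 a) F (\<lambda>y'. Phi (y', z)) y) = L1 (Phi (y, z))"
proof -
  have m: "(y, z) \<in> P1 a \<times> P2 a" using y z by simp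
  note PU = Phi_coord(2)[OF m]
  let ?f = "\<lambda>y'. Phi (y', z)" and ?e = "(P1 a, \<rho>1)"
  have at: "mfd_atlas (S1 a) = {?e}" by (simp add: S1_def)
  have mI: "(s, \<rho>2 z) \<in> I \<times> K" if "s \<in> I" for s using that \<rho>_in(2)[OF z] by simp
  have co: "?f (chart_inv ?e s) = \<kappa>i (s, \<rho>2 z)" if s: "s \<in> I" for s
  proof -
    have "(s, snd (\<kappa> a)) \<in> I \<times> K" using s \<kappa>a[OF a] by simp
    from \<kappa>i(2)[OF this] show ?thesis unfolding Phi_def slice1(6)[OF a s] by (simp add: \<rho>1_def)
  qed
  \<comment> \<open>The chart d is arbitrary. In the coordinate of the slice, its domain is the
    preimage of an overlap of charts under a smooth curve, which shows that it is open.\<close>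
  have dom: "\<rho>1 ` (P1 a \<inter> ?f -` fst d) = I \<inter> (\<lambda>s. \<Psi> (s, \<rho>2 z)) -` (snd c ` (fst c \<inter> fst d))" for d
  proof (intro set_eqI iffI)
    fix s assume "s \<in> \<rho>1 ` (P1 a \<inter> ?f -` fst d)"
    then obtain x where x: "s = \<rho>1 x" "x \<in> P1 a" "?f x \<in> fst d" by blast
    have xm: "(x, z) \<in> P1 a \<times> P2 a" using x z by simp
    have "?f x = \<kappa>i (s, \<rho>2 z)" by (simp add: Phi_def x)
    then have "\<Psi> (s, \<rho>2 z) = snd c (?f x)" using \<kappa>i(3)[OF mI] \<rho>_in(1)[OF x(2)] x(1) by simp
    then show "s \<in> I \<inter> (\<lambda>s. \<Psi> (s, \<rho>2 z)) -` (snd c ` (fst c \<inter> fst d))"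
      using \<rho>_in(1)[OF x(2)] x(1,3) Phi_coord(2)[OF xm] U_sub by blast
  next
    fix s assume s: "s \<in> I \<inter> (\<lambda>s. \<Psi> (s, \<rho>2 z)) -` (snd c ` (fst c \<inter> fst d))"
    then obtain x where x: "\<Psi> (s, \<rho>2 z) = snd c x" "x \<in> fst c" "x \<in> fst d" by blast
    then have "\<kappa>i (s, \<rho>2 z) = x" using chart_left[OF c] by (simp add: \<kappa>i_def)
    then have "?f (chart_inv ?e s) \<in> fst d" using co s x by simp
    moreover have "chart_inv ?e s \<in> P1 a" "\<rho>1 (chart_inv ?e s) = s"
      using PhiI_in[of "(s, snd (\<kappa> a))"] s \<kappa>a[OF a] slice1(6)[OF a, of s] by auto
    ultimately show "s \<in> \<rho>1 ` (P1 a \<inter> ?f -` fst d)" by force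
  qed
  have sj: "smooth_on I (\<lambda>s. \<Psi> (s, \<rho>2 z))"
    by (rule smooth_on_compose[OF I(1) oQ mI smooth_on_Pair[OF I(1) smooth_on_ident[OF I(1)] smooth_on_const] s\<Psi>])
  have ch: "open (snd ?e ` (fst ?e \<inter> ?f -` fst d)) \<and> smooth_on (snd ?e ` (fst ?e \<inter> ?f -` fst d)) (\<lambda>q. snd d (?f (chart_inv ?e q)))"
    if d: "d \<in> mfd_atlas F" for d
  proof -
    let ?T = "I \<inter> (\<lambda>s. \<Psi> (s, \<rho>2 z)) -` (snd c ` (fst c \<inter> fst d))"
    have o: "open ?T" by (rule continuous_open_preimage[OF smooth_on_continuous[OF sj] I(1) atlas_transition(1)[OF ok c d]])
    have "smooth_on ?T (\<lambda>s. snd d (chart_inv c (\<Psi> (s, \<rho>2 z))))"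
      by (rule smooth_on_compose[OF o atlas_transition(1)[OF ok c d] _ smooth_on_subset[OF sj] atlas_transition(2)[OF ok c d]]) auto
    then have "smooth_on ?T (\<lambda>s. snd d (?f (chart_inv ?e s)))"
      by (rule smooth_on_cong[THEN iffD1, OF o, rotated]) (simp add: co \<kappa>i_def)
    then show ?thesis unfolding fst_conv snd_conv dom using o by blast
  qed
  have "cmp F c (?f y) (mderiv (S1 a) F ?f y v) = FD \<Psi> (\<kappa> (Phi (y, z))) (v, 0)" for v
  proof -
    have "cmp F c (?f y) (mderiv (S1 a) F ?f y v) = FD (\<lambda>q. snd c (?f (chart_inv ?e q))) (snd ?e y) (cmp (S1 a) ?e y v)"
      by (rule mderiv_chart[OF slice1(3)[OF a] ok _ _ c _ ch]) (use at y PU cU in auto)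
    also have "cmp (S1 a) ?e y v = v" by (rule single_chart(1)[OF slice1(3)[OF a] at]) (use y in simp)
    also have "FD (\<lambda>q. snd c (?f (chart_inv ?e q))) (snd ?e y) = FD (\<lambda>s. \<Psi> (s, \<rho>2 z)) (\<rho>1 y)"
      unfolding snd_conv by (rule FD_cong[OF I(1) \<rho>_in(1)[OF y]]) (simp add: co \<kappa>i(3)[OF mI])
    also have "\<dots> = (\<lambda>x. FD \<Psi> (\<rho>1 y, \<rho>2 z) (x, 0))"
      by (rule FD_eq[OF j1_has_derivative[OF \<rho>_in(1)[OF y] \<rho>_in(2)[OF z]]])
    finally show ?thesis using Phi_coord(3)[OF m] by (simp add: pc_def)
  qed
  then show ?thesis unfolding L1_def by (rule range_cmp[OF a PU])
qed

lemma Phi_partial2: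
  assumes y: "y \<in> P1 a" and z: "z \<in> P2 a"
  shows "range (mderiv (S2 a) F (\<lambda>z'. Phi (y, z')) z) = L2 (Phi (y, z))"
proof -
  have m: "(y, z) \<in> P1 a \<times> P2 a" using y z by simp
  note PU = Phi_coord(2)[OF m]
  let ?f = "\<lambda>z'. Phi (y, z')" and ?e = "(P2 a, \<rho>2)"
  have at: "mfd_atlas (S2 a) = {?e}" by (simp add: S2_def)
  have mI: "(\<rho>1 y, t) \<in> I \<times> K" if "t \<in> K" for t using that \<rho>_in(1)[OF y] by simp
  have co: "?f (chart_inv ?e t) = \<kappa>i (\<rho>1 y, t)" if t: "t \<in> K" for t
  proof -
    have "(fst (\<kappa> a), t) \<in> I \<times> K" using t \<kappa>a[OF a] by simp
    from \<kappa>i(2)[OF this] show ?thesis unfolding Phi_def slice2(6)[OF a t] by (simp add: \<rho>2_def)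
  qed
  have dom: "\<rho>2 ` (P2 a \<inter> ?f -` fst d) = K \<inter> (\<lambda>t. \<Psi> (\<rho>1 y, t)) -` (snd c ` (fst c \<inter> fst d))" for d
  proof (intro set_eqI iffI)
    fix t assume "t \<in> \<rho>2 ` (P2 a \<inter> ?f -` fst d)"
    then obtain x where x: "t = \<rho>2 x" "x \<in> P2 a" "?f x \<in> fst d" by blast
    have xm: "(y, x) \<in> P1 a \<times> P2 a" using x y by simp
    have "?f x = \<kappa>i (\<rho>1 y, t)" by (simp add: Phi_def x)
    then have "\<Psi> (\<rho>1 y, t) = snd c (?f x)" using \<kappa>i(3)[OF mI] \<rho>_in(2)[OF x(2)] x(1) by simp
    then show "t \<in> K \<inter> (\<lambda>t. \<Psi> (\<rho>1 y, t)) -` (snd c ` (fst c \<inter> fst d))"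
      using \<rho>_in(2)[OF x(2)] x(1,3) Phi_coord(2)[OF xm] U_sub by blast
  next
    fix t assume t: "t \<in> K \<inter> (\<lambda>t. \<Psi> (\<rho>1 y, t)) -` (snd c ` (fst c \<inter> fst d))"
    then obtain x where x: "\<Psi> (\<rho>1 y, t) = snd c x" "x \<in> fst c" "x \<in> fst d" by blast
    then have "\<kappa>i (\<rho>1 y, t) = x" using chart_left[OF c] by (simp add: \<kappa>i_def)
    then have "?f (chart_inv ?e t) \<in> fst d" using co t x by simp
    moreover have "chart_inv ?e t \<in> P2 a" "\<rho>2 (chart_inv ?e t) = t"
      using PhiI_in[of "(fst (\<kappa> a), t)"] t \<kappa>a[OF a] slice2(6)[OF a, of t] by auto
    ultimately show "t \<in> \<rho>2 ` (P2 a \<inter> ?f -` fst d)" by force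
  qed
  have sj: "smooth_on K (\<lambda>t. \<Psi> (\<rho>1 y, t))"
    by (rule smooth_on_compose[OF K(1) oQ mI smooth_on_Pair[OF K(1) smooth_on_const smooth_on_ident[OF K(1)]] s\<Psi>])
  have ch: "open (snd ?e ` (fst ?e \<inter> ?f -` fst d)) \<and> smooth_on (snd ?e ` (fst ?e \<inter> ?f -` fst d)) (\<lambda>q. snd d (?f (chart_inv ?e q)))"
    if d: "d \<in> mfd_atlas F" for d
  proof -
    let ?T = "K \<inter> (\<lambda>t. \<Psi> (\<rho>1 y, t)) -` (snd c ` (fst c \<inter> fst d))"
    have o: "open ?T" by (rule continuous_open_preimage[OF smooth_on_continuous[OF sj] K(1) atlas_transition(1)[OF ok c d]])
    have "smooth_on ?T (\<lambda>t. snd d (chart_inv c (\<Psi> (\<rho>1 y, t))))"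
      by (rule smooth_on_compose[OF o atlas_transition(1)[OF ok c d] _ smooth_on_subset[OF sj] atlas_transition(2)[OF ok c d]]) auto
    then have "smooth_on ?T (\<lambda>t. snd d (?f (chart_inv ?e t)))"
      by (rule smooth_on_cong[THEN iffD1, OF o, rotated]) (simp add: co \<kappa>i_def)
    then show ?thesis unfolding fst_conv snd_conv dom using o by blast
  qed
  have "cmp F c (?f z) (mderiv (S2 a) F ?f z v) = FD \<Psi> (\<kappa> (Phi (y, z))) (0, v)" for v
  proof -
    have "cmp F c (?f z) (mderiv (S2 a) F ?f z v) = FD (\<lambda>q. snd c (?f (chart_inv ?e q))) (snd ?e z) (cmp (S2 a) ?e z v)"
      by (rule mderiv_chart[OF slice2(3)[OF a] ok _ _ c _ ch]) (use at z PU cU in auto)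
    also have "cmp (S2 a) ?e z v = v" by (rule single_chart(1)[OF slice2(3)[OF a] at]) (use z in simp)
    also have "FD (\<lambda>q. snd c (?f (chart_inv ?e q))) (snd ?e z) = FD (\<lambda>t. \<Psi> (\<rho>1 y, t)) (\<rho>2 z)"
      unfolding snd_conv by (rule FD_cong[OF K(1) \<rho>_in(2)[OF z]]) (simp add: co \<kappa>i(3)[OF mI])
    also have "\<dots> = (\<lambda>x. FD \<Psi> (\<rho>1 y, \<rho>2 z) (0, x))"
      by (rule FD_eq[OF j2_has_derivative[OF \<rho>_in(1)[OF y] \<rho>_in(2)[OF z]]])
    finally show ?thesis using Phi_coord(3)[OF m] by (simp add: pc_def)
  qed
  then show ?thesis unfolding L2_def by (rule range_cmp[OF a PU])
qed

lemma product: "riemannian_product_at F U L1 L2 a (S1 a) (S2 a)"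
  unfolding riemannian_product_at_def slice1(2)[OF a] slice2(2)[OF a]
proof (intro conjI exI[of _ Phi] ballI Phi_isometry Phi_partial1 Phi_partial2)
  show "a \<in> P1 a" "a \<in> P2 a" using a by (auto simp: P1_def P2_def)
  fix y assume y: "y \<in> P1 a"
  then have "y \<in> U" using P_sub by blast
  then show "Phi (y, a) = y" using P_\<kappa>(1)[OF y] \<kappa>(2)[of y] by (simp add: Phi_def \<rho>2_def)
next
  fix z assume z: "z \<in> P2 a"
  then have "z \<in> U" using P_sub by blast
  then show "Phi (a, z) = z" using P_\<kappa>(2)[OF z] \<kappa>(2)[of z] by (simp add: Phi_def \<rho>1_def)
qed

end

end

section \<open>The product structure defined by the recurrence form\<close>

text \<open>Joins the product coordinates with the recurrent immersion. The equation for
  \<open>FD \<Psi> z (1, 0)\<close> ties the two together: the first coordinate lines are integral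
  curves of E.\<close>

locale recurrent_product_chart = riem_sub_chart F M c d + P: product_chart F c Uc I K H \<Psi> h +
  R: recurrent_immersion \<Omega>0 "riem_mfd.Gm F c" "conn_manifold.Gam F (conn F) c" "snd d ` fst d"
    "riem_mfd.Gm M d" "conn_manifold.Gam M (conn M) d" "riem_sub_chart.f c d" \<mu>
  for F :: "('p, 'f::euclidean_space) riem" and M :: "('p, 'm::euclidean_space) riem" and c d Uc I
    and K :: "'k::euclidean_space set" and H \<Psi> h \<Omega>0 \<mu> +
  assumes \<Omega>0_sub: "\<Omega>0 \<subseteq> \<Omega>" and Uc_sub: "Uc \<subseteq> \<Omega>0"
    and \<Psi>1: "\<And>z. z \<in> I \<times> K \<Longrightarrow> FD \<Psi> z (1, 0) = R.E (\<Psi> z)"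
begin

abbreviation G where "G \<equiv> F.Gm c"
abbreviation E where "E \<equiv> R.E"

lemma U\<Omega>: assumes "y \<in> P.U" shows "snd c y \<in> \<Omega>0" "y \<in> W"
proof -
  show 1: "snd c y \<in> \<Omega>0" using P.cU(1)[OF assms] Uc_sub by blast
  then obtain z where z: "snd c y = snd c z" "z \<in> W" using \<Omega>0_sub \<Omega>_obtain by blast
  then have "y = z" using inj_onD[OF atlas_inj[OF F.ok c] z(1)] P.cU(2)[OF assms] W_sub by blast
  then show "y \<in> W" using z by simp
qed

lemma U_W: "P.U \<subseteq> W" using U\<Omega>(2) by blast

lemma FD\<Psi>_fst: assumes "z \<in> I \<times> K" shows "FD \<Psi> z (s, 0) = s *\<^sub>R E (\<Psi> z)"
  using linear_scale[OF P.l\<Psi>[OF assms], of s "(1, 0)"] \<Psi>1[OF assms] by simp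

lemma L1_iff: assumes "y \<in> P.U" shows "v \<in> P.L1 y \<longleftrightarrow> (\<exists>s. cmp F c y v = s *\<^sub>R E (snd c y))"
  unfolding P.L1_def using FD\<Psi>_fst[OF P.\<kappa>(1)[OF assms]] by (auto simp: P.\<kappa>(3)[OF assms])

text \<open>E is the image of (1, 0), so the metric formula applies. Its h-term has a zero argument
  and vanishes, as the same formula for the zero vector shows. Thus the product with E reads off the
  first coordinate, and \<open>L2\<close> is the orthogonal complement of E.\<close>

lemma G_E_FD\<Psi>: assumes z: "z \<in> I \<times> K" shows "G (\<Psi> z) (E (\<Psi> z)) (FD \<Psi> z (s, t)) = s"
proof -
  have q: "\<Psi> z \<in> \<Omega>0" using P.\<Psi>_Uc[OF z] Uc_sub by blast
  have "h (snd z) 0 t = 0"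
    using P.metric[OF z, of 0 "(0, t)"] bilinear_simps[OF R.F.G_bil[OF q]] linear_0[OF P.l\<Psi>[OF z]] by simp
  then show ?thesis using P.metric[OF z, of "(1, 0)" "(s, t)"] unfolding \<Psi>1[OF z] by simp
qed

lemma L2_iff: assumes y: "y \<in> P.U" shows "v \<in> P.L2 y \<longleftrightarrow> G (snd c y) (E (snd c y)) (cmp F c y v) = 0"
proof -
  note z = P.\<kappa>(1)[OF y]
  obtain s t where st: "FD H (\<Psi> (P.\<kappa> y)) (cmp F c y v) = (s, t)" by fastforce
  have v: "cmp F c y v = FD \<Psi> (P.\<kappa> y) (s, t)" using P.FD_\<Psi>H[OF z, of "cmp F c y v"] st by simp
  have "G (snd c y) (E (snd c y)) (cmp F c y v) = s"
    using G_E_FD\<Psi>[OF z, of s t] unfolding v P.\<kappa>(3)[OF y] .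
  moreover have "v \<in> P.L2 y \<longleftrightarrow> s = 0"
  proof -
    have "v \<in> P.L2 y \<longleftrightarrow> FD \<Psi> (P.\<kappa> y) (s, t) \<in> range (\<lambda>t. FD \<Psi> (P.\<kappa> y) (0, t))" by (simp add: P.L2_def v)
    also have "\<dots> \<longleftrightarrow> s = 0" by (auto simp: inj_eq[OF P.FD_\<Psi>_inj[OF z]])
    finally show ?thesis .
  qed
  ultimately show ?thesis by simp
qed

lemma GE: assumes "y \<in> P.U" shows "G (snd c y) (E (snd c y)) (s *\<^sub>R E (snd c y)) = s"
  using R.G_E_E[OF U\<Omega>(1)[OF assms]] by (simp add: bilinear_simps[OF R.F.G_bil[OF U\<Omega>(1)[OF assms]]])

lemma direct: assumes y: "y \<in> P.U"
  shows "\<exists>a\<in>P.L1 y. \<exists>b\<in>P.L2 y. v = a + b"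
    and "a \<in> P.L1 y \<Longrightarrow> a' \<in> P.L1 y \<Longrightarrow> b \<in> P.L2 y \<Longrightarrow> b' \<in> P.L2 y \<Longrightarrow> a + b = a' + b' \<Longrightarrow> a = a' \<and> b = b'"
proof -
  note W = U\<Omega>(2)[OF y]
  note lin = cmpF_linear[OF W] and bG = bilinear_simps[OF R.F.G_bil[OF U\<Omega>(1)[OF y]]]
  let ?q = "snd c y"
  obtain a where a: "G ?q (E ?q) (cmp F c y v) *\<^sub>R E ?q = cmp F c y a" by (rule cmpF_surj[OF W])
  have "a \<in> P.L1 y" unfolding L1_iff[OF y] using a[symmetric] by blast
  moreover have "v - a \<in> P.L2 y"
    unfolding L2_iff[OF y] linear_diff[OF lin] a[symmetric] by (simp add: bG R.G_E_E[OF U\<Omega>(1)[OF y]])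
  ultimately show "\<exists>a\<in>P.L1 y. \<exists>b\<in>P.L2 y. v = a + b" by (metis add_diff_cancel_left' diff_add_cancel add.commute)
next
  note W = U\<Omega>(2)[OF y]
  note lin = cmpF_linear[OF W] and bG = bilinear_simps[OF R.F.G_bil[OF U\<Omega>(1)[OF y]]]
  let ?q = "snd c y"
  assume m: "a \<in> P.L1 y" "a' \<in> P.L1 y" "b \<in> P.L2 y" "b' \<in> P.L2 y" "a + b = a' + b'"
  obtain s s' where s: "cmp F c y a = s *\<^sub>R E ?q" "cmp F c y a' = s' *\<^sub>R E ?q" using m(1,2) unfolding L1_iff[OF y] by blast
  have "G ?q (E ?q) (cmp F c y (a + b)) = s" "G ?q (E ?q) (cmp F c y (a' + b')) = s'"
    using m(3,4) unfolding L2_iff[OF y] linear_add[OF lin] s by (simp_all add: bG R.G_E_E[OF U\<Omega>(1)[OF y]])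
  then have "cmp F c y a = cmp F c y a'" using m(5) s by simp
  then have "a = a'" using cmpF_inject[OF W] by blast
  then show "a = a' \<and> b = b'" using m(5) by simp
qed

lemma orthogonal: assumes y: "y \<in> P.U" and m: "u \<in> P.L1 y" "v \<in> P.L2 y"
  shows "rmetric F y u v = 0" "rmetric F y v u = 0"
proof -
  obtain s where "cmp F c y u = s *\<^sub>R E (snd c y)" using m(1) unfolding L1_iff[OF y] by blast
  then show 1: "rmetric F y u v = 0"
    using m(2) unfolding metric_F[OF U\<Omega>(2)[OF y]] L2_iff[OF y] by (simp add: bilinear_simps[OF R.F.G_bil[OF U\<Omega>(1)[OF y]]])
  then show "rmetric F y v u = 0" using F.metric_at(2)[of y v u] P.U_points y by force
qed

lemma distribution1: "smooth_distribution F P.U 1 P.L1"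
proof -
  have "smooth_distribution F P.U DIM(real) P.L1"
  proof (rule F.smooth_distribution_chart[OF c P.U_open P.U_sub, where J = "\<lambda>q s. s *\<^sub>R E q"])
    show "linear (\<lambda>s. s *\<^sub>R E q)" for q by (rule linearI) (simp_all add: scaleR_left_distrib)
    have "E q \<noteq> 0" if "q \<in> \<Omega>0" for q
      using R.G_E_E[OF that] bilinear_simps[OF R.F.G_bil[OF that]] by force
    then show "inj (\<lambda>s. s *\<^sub>R E q)" if "q \<in> snd c ` P.U" for q using that U\<Omega>(1) by (auto intro!: injI)
    have "smooth_on Uc E" by (rule smooth_on_subset[OF R.E_smooth Uc_sub])
    then show "smooth_on (snd c ` P.U) (\<lambda>q. t *\<^sub>R E q)" for t
      unfolding P.cU_image using smooth_on_bounded_linear[OF bounded_linear_scaleR_right P.Uc(1)] by blast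
    show "P.L1 y = {v. cmp F c y v \<in> range (\<lambda>s. s *\<^sub>R E (snd c y))}" if "y \<in> P.U" for y
      using L1_iff[OF that] by blast
  qed
  then show ?thesis by simp
qed

lemma distribution2: "smooth_distribution F P.U DIM('k) P.L2"
proof (rule F.smooth_distribution_chart[OF c P.U_open P.U_sub, where J = "\<lambda>q t. FD \<Psi> (H q) (0, t)"])
  have HI: "H q \<in> I \<times> K" if "q \<in> snd c ` P.U" for q using that P.H_Uc(1) unfolding P.cU_image by blast
  show "linear (\<lambda>t. FD \<Psi> (H q) (0, t))" if "q \<in> snd c ` P.U" for q
    using linear_compose[OF _ P.l\<Psi>[OF HI[OF that]], of "\<lambda>t. (0, t)"] by (simp add: o_def linear_iff)
  show "inj (\<lambda>t. FD \<Psi> (H q) (0, t))" if "q \<in> snd c ` P.U" for q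
    by (rule injI) (use injD[OF P.FD_\<Psi>_inj[OF HI[OF that]]] in blast)
  show "smooth_on (snd c ` P.U) (\<lambda>q. FD \<Psi> (H q) (0, t))" for t
    unfolding P.cU_image
    by (rule smooth_on_FD_compose[OF P.Uc(1) P.oQ P.H_Uc(1) P.s\<Psi> P.sH smooth_on_const])
  show "P.L2 y = {v. cmp F c y v \<in> range (\<lambda>t. FD \<Psi> (H (snd c y)) (0, t))}" for y
    by (simp add: P.L2_def P.\<kappa>_def)
qed

lemma field_chart:
  assumes V: "open_in F V" "V \<subseteq> P.U" and y: "y \<in> V" and Y: "vector_field F V Y"
  shows "open (snd c ` V)" "snd c y \<in> snd c ` V" "smooth_on (snd c ` V) (crep F c Y)"
    "((\<lambda>q. G q (E q) (crep F c Y q)) has_derivative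
       (\<lambda>a. G (snd c y) (E (snd c y)) (FD (crep F c Y) (snd c y) a + F.Gam c (snd c y) a (crep F c Y (snd c y))))) (at (snd c y))"
proof -
  have Vc: "V \<subseteq> fst c" using V(2) P.U_sub by blast
  show o: "open (snd c ` V)" by (rule F.img[OF c V(1) Vc])
  show m: "snd c y \<in> snd c ` V" using y by blast
  show s: "smooth_on (snd c ` V) (crep F c Y)" using Y unfolding F.vector_field_chart[OF c V(1) Vc] .
  have q: "snd c y \<in> \<Omega>0" using U\<Omega>(1) V(2) y by blast
  have "((\<lambda>q. G q (E q) (crep F c Y q)) has_derivative
    (\<lambda>a. G (snd c y) (FD E (snd c y) a + F.Gam c (snd c y) a (E (snd c y))) (crep F c Y (snd c y)) +
      G (snd c y) (E (snd c y)) (FD (crep F c Y) (snd c y) a + F.Gam c (snd c y) a (crep F c Y (snd c y))))) (at (snd c y))"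
    by (rule R.F.G_along[OF R.F.op q _ has_derivative_ident smooth_on_has_derivative[OF R.E_smooth q] smooth_on_has_derivative[OF s m]])
  then show "((\<lambda>q. G q (E q) (crep F c Y q)) has_derivative
       (\<lambda>a. G (snd c y) (E (snd c y)) (FD (crep F c Y) (snd c y) a + F.Gam c (snd c y) a (crep F c Y (snd c y))))) (at (snd c y))"
    unfolding R.E_parallel[OF q] by (simp add: bilinear_simps[OF R.F.G_bil[OF q]])
qed

text \<open>A field in \<open>L1\<close> is g E with g its product with E. Since E is parallel, only
  g is differentiated and the result is again a multiple of E. This holds in every direction v,
  which is more than involutivity requires.\<close>

lemma parallel1:
  assumes V: "open_in F V" "V \<subseteq> P.U" and y: "y \<in> V" and Y: "tangent_field F V P.L1 Y"
  shows "conn F y v Y \<in> P.L1 y"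
proof -
  have Vc: "V \<subseteq> fst c" and yU: "y \<in> P.U" using V(2) P.U_sub y by blast+
  have vY: "vector_field F V Y" using Y by (simp add: tangent_field_def)
  note fc = field_chart[OF V y vY]
  let ?q = "snd c y" and ?a = "cmp F c y v"
  define g where "g q = G q (E q) (crep F c Y q)" for q
  define g' where "g' = (\<lambda>a. G ?q (E ?q) (FD (crep F c Y) ?q a + F.Gam c ?q a (crep F c Y ?q)))"
  have dg: "(g has_derivative g') (at ?q)" using fc(4) unfolding g_def[abs_def] g'_def .
  have gE: "crep F c Y q = g q *\<^sub>R E q" if qV: "q \<in> snd c ` V" for q
  proof -
    obtain z where z: "q = snd c z" "z \<in> V" using qV by blast
    have zU: "z \<in> P.U" using z V by blast
    have "Y z \<in> P.L1 z" using Y z by (simp add: tangent_field_def)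
    then obtain s where s: "cmp F c z (Y z) = s *\<^sub>R E q" unfolding L1_iff[OF zU] z(1) by blast
    have cr: "crep F c Y q = s *\<^sub>R E q" using F.crep_at[OF c P.cU(2)[OF zU], of Y] s by (simp add: z(1))
    show ?thesis using GE[OF zU, of s] by (simp add: g_def cr z(1)[symmetric])
  qed
  have q: "?q \<in> \<Omega>0" by (rule U\<Omega>(1)[OF yU])
  have "((\<lambda>q. g q *\<^sub>R E q) has_derivative (\<lambda>a. g ?q *\<^sub>R FD E ?q a + g' a *\<^sub>R E ?q)) (at ?q)"
    by (rule has_derivative_scaleR[OF dg smooth_on_has_derivative[OF R.E_smooth q]])
  then have "(crep F c Y has_derivative (\<lambda>a. g ?q *\<^sub>R FD E ?q a + g' a *\<^sub>R E ?q)) (at ?q)"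
    by (rule has_derivative_transform_within_open[OF _ fc(1,2)]) (simp add: gE)
  from FD_eq[OF this] have "cmp F c y (conn F y v Y) = g ?q *\<^sub>R (FD E ?q ?a + F.Gam c ?q ?a (E ?q)) + g' ?a *\<^sub>R E ?q"
    unfolding F.nb_chart[OF c V(1) Vc y vY]
    by (simp add: gE[OF fc(2)] bilinear_simps[OF R.F.\<Gamma>_bil[OF q]] algebra_simps)
  then have "cmp F c y (conn F y v Y) = g' ?a *\<^sub>R E ?q" unfolding R.E_parallel[OF q] by simp
  then show ?thesis unfolding L1_iff[OF yU] by blast
qed

text \<open>The product of Y with E is identically zero; differentiating it, with E parallel, leaves
  the product of E with the derivative of Y.\<close>

lemma parallel2:
  assumes V: "open_in F V" "V \<subseteq> P.U" and y: "y \<in> V" and Y: "tangent_field F V P.L2 Y"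
  shows "conn F y v Y \<in> P.L2 y"
proof -
  have Vc: "V \<subseteq> fst c" and yU: "y \<in> P.U" using V(2) P.U_sub y by blast+
  have vY: "vector_field F V Y" using Y by (simp add: tangent_field_def)
  note fc = field_chart[OF V y vY]
  have "G q (E q) (crep F c Y q) = 0" if qV: "q \<in> snd c ` V" for q
  proof -
    obtain z where z: "q = snd c z" "z \<in> V" using qV by blast
    have zU: "z \<in> P.U" using z V by blast
    have "Y z \<in> P.L2 z" using Y z by (simp add: tangent_field_def)
    then show ?thesis unfolding L2_iff[OF zU] using F.crep_at[OF c P.cU(2)[OF zU], of Y] by (simp add: z(1))
  qed
  then have "((\<lambda>q. 0) has_derivative
      (\<lambda>a. G (snd c y) (E (snd c y)) (FD (crep F c Y) (snd c y) a + F.Gam c (snd c y) a (crep F c Y (snd c y))))) (at (snd c y))"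
    by (intro has_derivative_transform_within_open[OF fc(4) fc(1,2)])
  from fun_cong[OF has_derivative_unique[OF this has_derivative_const], of "cmp F c y v"]
  show ?thesis unfolding L2_iff[OF yU] F.nb_chart[OF c V(1) Vc y vY] by simp
qed

text \<open>Absence of torsion writes the bracket as a difference of two covariant derivatives, both
  of which stay in a parallel distribution.\<close>

lemma involutive:
  assumes par: "\<And>V y Y v. open_in F V \<Longrightarrow> V \<subseteq> P.U \<Longrightarrow> y \<in> V \<Longrightarrow> tangent_field F V L Y \<Longrightarrow> conn F y v Y \<in> L y"
    and sub: "\<And>y. y \<in> P.U \<Longrightarrow> subspace (L y)"
  shows "Defs.involutive F P.U L"
  unfolding involutive_def
proof (intro allI impI ballI)
  fix V X Y y assume a: "open_in F V \<and> V \<subseteq> P.U \<and> tangent_field F V L X \<and> tangent_field F V L Y" and y: "y \<in> V"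
  have "lie_bracket F X Y y = conn F y (X y) Y - conn F y (Y y) X"
    using F.torsion_free[of V y X Y] a y by (simp add: tangent_field_def)
  moreover have "conn F y (X y) Y \<in> L y" "conn F y (Y y) X \<in> L y" using par a y by blast+
  ultimately show "lie_bracket F X Y y \<in> L y" using subspace_diff[OF sub] a y by (metis subsetD)
qed

text \<open>By \<open>R.B_rank_one\<close> the second fundamental form contains both products with E
  as factors, and an argument in \<open>L2\<close> annihilates one of them. Hence the two
  distributions are conjugate.\<close>

lemma sff_zero:
  assumes V: "open_in F V" "V \<subseteq> P.U" and y: "y \<in> V" and Y: "vector_field F V Y"
    and z: "u \<in> P.L2 y \<or> Y y \<in> P.L2 y"
  shows "sff F M y u Y = 0"
proof -
  have yU: "y \<in> P.U" and VW: "V \<subseteq> W" using V y U_W by blast+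
  note W = U\<Omega>(2)[OF yU]
  have cr: "crep F c Y (snd c y) = cmp F c y (Y y)" by (rule F.crep_at[OF c P.cU(2)[OF yU]])
  have "cmp M d y (sff F M y u Y) = 0"
    using z R.B_rank_one[OF U\<Omega>(1)[OF yU], of "cmp F c y u" "cmp F c y (Y y)"]
    unfolding sff_chart[OF V(1) VW y Y] cr L2_iff[OF yU] by (metis mult_zero_left mult_zero_right scaleR_zero_left)
  then have "cmp M d y (sff F M y u Y) = cmp M d y 0" by (simp add: linear_0[OF cmpM_linear[OF W]])
  then show ?thesis using cmpM_inject[OF W] by blast
qed

lemma conjugate_L: "conjugate F M P.U P.L1 P.L2" "conjugate F M P.U P.L2 P.L1"
  unfolding conjugate_def by (auto intro!: sff_zero simp: tangent_field_def)

text \<open>Weingarten's equation and the rank one form of B give the shape operator on u as the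
  product of u with E, times k, times E. On multiples of E this is multiplication by k, and on the
  complement it is zero.\<close>

lemma shape_eigen:
  assumes U': "open_in F U'" "y \<in> U'" and \<xi>: "normal_field F M U' \<xi>" and y: "y \<in> P.U"
  shows "u \<in> P.L1 y \<Longrightarrow> shape_operator F M y \<xi> u = M.Gm d (snd d y) (srep \<xi> (snd c y)) (I.B (snd c y) (E (snd c y)) (E (snd c y))) *\<^sub>R u"
    and "u \<in> P.L2 y \<Longrightarrow> shape_operator F M y \<xi> u = 0"
proof -
  note W = U\<Omega>(2)[OF y]
  note q = U\<Omega>(1)[OF y]
  note bG = bilinear_simps[OF R.F.G_bil[OF q]]
  have fq: "snd d y \<in> snd d ` fst d" using W W_sub by blast
  note bM = bilinear_simps[OF I.M.G_bil[OF fq]]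
  let ?q = "snd c y"
  define k where "k = M.Gm d (snd d y) (srep \<xi> ?q) (I.B ?q (E ?q) (E ?q))"
  have o: "open_in F (U' \<inter> P.U)" by (rule openin_Int[OF U'(1) P.U_open])
  have n: "normal_field F M (U' \<inter> P.U) \<xi>"
    using \<xi> smooth_section_subset[of F M U' \<xi> "U' \<inter> P.U"] by (auto simp: normal_field_def)
  have "G ?q (cmp F c y (shape_operator F M y \<xi> u)) v = G ?q ((G ?q (E ?q) (cmp F c y u) * k) *\<^sub>R E ?q) v" for v
  proof -
    have "G ?q (cmp F c y (shape_operator F M y \<xi> u)) v = M.Gm d (snd d y) (srep \<xi> ?q) (I.B ?q (cmp F c y u) v)"
      by (rule shape_chart[OF o _ _ n]) (use U' y U_W in auto)
    also have "I.B ?q (cmp F c y u) v = (G ?q (E ?q) (cmp F c y u) * G ?q (E ?q) v) *\<^sub>R I.B ?q (E ?q) (E ?q)"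
      by (rule R.B_rank_one[OF q])
    finally show ?thesis by (simp add: bG bM k_def)
  qed
  then have "G ?q (cmp F c y (shape_operator F M y \<xi> u) - (G ?q (E ?q) (cmp F c y u) * k) *\<^sub>R E ?q) v = 0" for v
    by (simp add: bG(3))
  from R.F.G_nondeg[OF q this]
  have s: "cmp F c y (shape_operator F M y \<xi> u) = (G ?q (E ?q) (cmp F c y u) * k) *\<^sub>R E ?q" by simp
  show "shape_operator F M y \<xi> u = k *\<^sub>R u" if u: "u \<in> P.L1 y"
  proof -
    obtain r where r: "cmp F c y u = r *\<^sub>R E ?q" using u unfolding L1_iff[OF y] by blast
    have "cmp F c y (shape_operator F M y \<xi> u) = cmp F c y (k *\<^sub>R u)"
      unfolding s linear_scale[OF cmpF_linear[OF W]] r GE[OF y] by simp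
    then show ?thesis using cmpF_inject[OF W] by blast
  qed
  show "shape_operator F M y \<xi> u = 0" if u: "u \<in> P.L2 y"
  proof -
    have "cmp F c y (shape_operator F M y \<xi> u) = cmp F c y 0"
      using s u unfolding L2_iff[OF y] by (simp add: linear_0[OF cmpF_linear[OF W]])
    then show ?thesis using cmpF_inject[OF W] by blast
  qed
qed

text \<open>Only the tangent spaces of S enter, so every integral submanifold of either distribution
  is covered, not just the slices constructed above.\<close>

lemma curvature_surface:
  assumes S: "integral_submanifold F P.U L S" and L: "L = P.L1 \<or> L = P.L2"
  shows "surface_of_curvature F M S"
  unfolding surface_of_curvature_def
proof (intro conjI ballI allI impI)
  show "submanifold S F" using S by (simp add: integral_submanifold_def)
  fix y U' \<xi> assume y: "y \<in> points S" and a: "open_in F U' \<and> y \<in> U' \<and> normal_field F M U' \<xi>"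
  have yU: "y \<in> P.U" and r: "range (incl_deriv S F y) = L y" using S y by (auto simp: integral_submanifold_def)
  have e: "u \<in> P.L1 y \<Longrightarrow> shape_operator F M y \<xi> u = M.Gm d (snd d y) (srep \<xi> (snd c y)) (I.B (snd c y) (E (snd c y)) (E (snd c y))) *\<^sub>R u"
    "u \<in> P.L2 y \<Longrightarrow> shape_operator F M y \<xi> u = 0 *\<^sub>R u" for u
    using shape_eigen[of U' y \<xi> u] a yU by auto
  show "\<exists>\<kappa>. \<forall>u\<in>range (incl_deriv S F y). shape_operator F M y \<xi> u = \<kappa> *\<^sub>R u"
    unfolding r using L e by blast
qed

lemma orthogonal_system:
  assumes "DIM('f) = n" "DIM('k) = n - 1" "n \<ge> 2"
  shows "orthogonal_conjugate_system F M P.U [P.L1, P.L2] [1, n - 1]"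
proof -
  have sub: "y \<in> P.U \<Longrightarrow> subspace (P.L1 y)" "y \<in> P.U \<Longrightarrow> subspace (P.L2 y)" for y
    using distribution1 distribution2 by (auto simp: smooth_distribution_def)
  have ds: "direct_sum [P.L1 y, P.L2 y]" if y: "y \<in> P.U" for y
    unfolding direct_sum_def
  proof
    fix v
    obtain a b where ab: "a \<in> P.L1 y" "b \<in> P.L2 y" "v = a + b" using direct(1)[OF y] by blast
    show "\<exists>!vs. length vs = length [P.L1 y, P.L2 y] \<and> (\<forall>i<length [P.L1 y, P.L2 y]. vs ! i \<in> [P.L1 y, P.L2 y] ! i) \<and> v = sum_list vs"
    proof (rule ex1I[of _ "[a, b]"])
      show "length [a, b] = length [P.L1 y, P.L2 y] \<and> (\<forall>i<length [P.L1 y, P.L2 y]. [a, b] ! i \<in> [P.L1 y, P.L2 y] ! i) \<and> v = sum_list [a, b]"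
        using ab by (auto simp: less_Suc_eq)
      fix vs assume vs: "length vs = length [P.L1 y, P.L2 y] \<and> (\<forall>i<length [P.L1 y, P.L2 y]. vs ! i \<in> [P.L1 y, P.L2 y] ! i) \<and> v = sum_list vs"
      then obtain a' b' where v': "vs = [a', b']" by (auto simp: length_Suc_conv numeral_2_eq_2)
      have "a' \<in> P.L1 y" "b' \<in> P.L2 y" "v = a' + b'"
        using vs[THEN conjunct2, THEN conjunct1, rule_format, of 0] vs[THEN conjunct2, THEN conjunct1, rule_format, of 1] vs
        by (auto simp: v')
      then show "vs = [a, b]" using direct(2)[OF y, of a a' b b'] ab by (simp add: v')
    qed
  qed
  have two: "(\<forall>i<length [P.L1, P.L2]. Q i) \<longleftrightarrow> Q 0 \<and> Q 1" for Q by (auto simp: less_Suc_eq)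
  show ?thesis
    unfolding orthogonal_conjugate_system_def conjugate_system_def two
    using assms distribution1 distribution2 involutive[OF parallel1 sub(1)] involutive[OF parallel2 sub(2)] conjugate_L ds orthogonal
    by auto
qed

end

section \<open>The recurrence form in charts and the choice of the neighbourhood\<close>

context riem_sub_chart
begin

definition form_chart where "form_chart \<mu> q u = \<mu> (chart_inv c q) (vfc F c (\<lambda>p. u) (chart_inv c q))"

lemma form_chart_at: "y \<in> W \<Longrightarrow> form_chart \<mu> (snd c y) u = \<mu> y (vfc F c (\<lambda>p. u) y)"
  by (simp add: form_chart_def inv_c)

lemma form_chart_cmp: "y \<in> W \<Longrightarrow> form_chart \<mu> (snd c y) (cmp F c y u) = \<mu> y u"
  using F.vfc_const_cmp[OF c, of y u] W_sub by (auto simp: form_chart_at)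

lemma form_chart_linear: assumes "one_form F \<mu>" "q \<in> \<Omega>" shows "linear (form_chart \<mu> q)"
proof -
  obtain y where y: "q = snd c y" "y \<in> W" using assms(2) by (rule \<Omega>_obtain)
  have "y \<in> points F" using y(2) openin_subset[OF W_open] by blast
  then have "linear (\<mu> y)" using assms(1) by (simp add: one_form_def)
  from linear_compose[OF F.vfc_linear[OF c subsetD[OF W_sub(1) y(2)]] this]
  show ?thesis by (simp add: o_def y(1) form_chart_at[OF y(2), abs_def])
qed

lemma form_chart_smooth: assumes "one_form F \<mu>" shows "smooth_on \<Omega> (\<lambda>q. form_chart \<mu> q u)"
proof -
  have "smooth_fun F W (\<lambda>y. \<mu> y (vfc F c (\<lambda>p. u) y))"
    using assms W_open const_field_W unfolding one_form_def by blast
  then show ?thesis unfolding F.smooth_fun_in_chart[OF c W_open W_sub(1)] form_chart_def \<Omega>_def .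
qed

lemma recurrence_chart:
  assumes rec: "\<And>U X Y Z y. open_in F U \<Longrightarrow> y \<in> U \<Longrightarrow> vector_field F U X \<Longrightarrow> vector_field F U Y \<Longrightarrow> vector_field F U Z \<Longrightarrow>
      sff_deriv F M X Y Z y = \<mu> y (X y) *\<^sub>R sff F M y (Y y) Z"
    and q: "q \<in> \<Omega>" and n: "I.normal q \<xi>"
  shows "M.Gm d (f q) (I.nab q u (\<lambda>q. I.B q v w)) \<xi> =
    M.Gm d (f q) (I.B q (F.Gam c q u v) w + I.B q v (F.Gam c q u w) + form_chart \<mu> q u *\<^sub>R I.B q v w) \<xi>"
proof -
  obtain y where y: "q = snd c y" "y \<in> W" using q by (rule \<Omega>_obtain)
  note bG = bilinear_simps[OF I.M.G_bil[OF I.f_in[OF q]]]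
  have "sff_deriv F M (vfc F c (\<lambda>p. u)) (vfc F c (\<lambda>p. v)) (vfc F c (\<lambda>p. w)) y =
      form_chart \<mu> q u *\<^sub>R sff F M y (vfc F c (\<lambda>p. v) y) (vfc F c (\<lambda>p. w))"
    unfolding y(1) form_chart_at[OF y(2)] by (rule rec[OF W_open y(2) const_field_W const_field_W const_field_W])
  then have "cmp M d y (sff_deriv F M (vfc F c (\<lambda>p. u)) (vfc F c (\<lambda>p. v)) (vfc F c (\<lambda>p. w)) y) =
      form_chart \<mu> q u *\<^sub>R I.B q v w"
    by (simp add: linear_scale[OF cmpM_linear[OF y(2)]] sff_const[OF y(2)] cmpF_vfc[OF y(2)] y(1))
  with sff_deriv_chart[OF y(2), of \<xi> u v w] n show ?thesis
    unfolding y(1) f_at[OF y(2), symmetric] by (simp add: bG[unfolded y(1)] algebra_simps)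
qed

text \<open>By recurrence the nonzero derivative at x is a value of \<mu> times a value of b, so
  both are nonzero at x. The vectors a, b, e that witness this are kept fixed in coordinates, and by
  continuity the two values stay nonzero on the open set \<open>\<Omega>0\<close>.\<close>

lemma recurrent_neighbourhood:
  assumes cc: "constant_curvature M \<kappa>" and x: "x \<in> W" and nz: "sff_deriv_nonzero_at F M x" and \<mu>: "one_form F \<mu>"
    and rec: "\<And>U X Y Z y. open_in F U \<Longrightarrow> y \<in> U \<Longrightarrow> vector_field F U X \<Longrightarrow> vector_field F U Y \<Longrightarrow> vector_field F U Z \<Longrightarrow>
      sff_deriv F M X Y Z y = \<mu> y (X y) *\<^sub>R sff F M y (Y y) Z"
  obtains \<Omega>0 where "\<Omega>0 \<subseteq> \<Omega>" "snd c x \<in> \<Omega>0"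
    "recurrent_immersion \<Omega>0 (F.Gm c) (F.Gam c) (snd d ` fst d) (M.Gm d) (M.Gam d) f (form_chart \<mu>)"
proof -
  obtain U X Y Z where U: "open_in F U" "x \<in> U" and XYZ: "vector_field F U X" "vector_field F U Y" "vector_field F U Z"
    and ne: "sff_deriv F M X Y Z x \<noteq> 0" using nz unfolding sff_deriv_nonzero_at_def by blast
  have ne': "\<mu> x (X x) \<noteq> 0" "sff F M x (Y x) Z \<noteq> 0" using ne unfolding rec[OF U XYZ] by auto
  have o: "open_in F (U \<inter> W)" by (rule openin_Int[OF U(1) W_open])
  define a b e where "a = cmp F c x (X x)" and "b = cmp F c x (Y x)" and "e = crep F c Z (snd c x)"
  have a: "form_chart \<mu> (snd c x) a \<noteq> 0" unfolding a_def form_chart_cmp[OF x] by (rule ne'(1))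
  have "cmp M d x (sff F M x (Y x) Z) = I.B (snd c x) b e"
    unfolding b_def e_def by (rule sff_chart[OF o]) (use U x smooth_section_subset[OF XYZ(3)] in auto)
  moreover have "cmp M d x (sff F M x (Y x) Z) \<noteq> cmp M d x 0" using cmpM_inject[OF x] ne'(2) by blast
  ultimately have be: "I.B (snd c x) b e \<noteq> 0" by (simp add: linear_0[OF cmpM_linear[OF x]])
  define \<Omega>0 where "\<Omega>0 = (\<Omega> \<inter> (\<lambda>q. form_chart \<mu> q a) -` (- {0})) \<inter> (\<Omega> \<inter> (\<lambda>q. I.B q b e) -` (- {0}))"
  have op: "open \<Omega>0" unfolding \<Omega>0_def
    by (intro open_Int continuous_open_preimage[OF _ \<Omega>_open] smooth_on_continuous form_chart_smooth[OF \<mu>] I.B_smooth) auto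
  have sub: "\<Omega>0 \<subseteq> \<Omega>" by (auto simp: \<Omega>0_def)
  show thesis
  proof (rule that[OF sub])
    show "snd c x \<in> \<Omega>0" using a be \<Omega>_in[OF x] by (simp add: \<Omega>0_def)
    show "recurrent_immersion \<Omega>0 (F.Gm c) (F.Gam c) (snd d ` fst d) (M.Gm d) (M.Gam d) f (form_chart \<mu>)"
    proof (rule recurrent_immersion.intro[OF I.chart_immersion_subset[OF op sub]], rule recurrent_immersion_axioms.intro)
      fix q assume q0: "q \<in> \<Omega>0"
      then have q: "q \<in> \<Omega>" using sub by blast
      show "linear (form_chart \<mu> q)" by (rule form_chart_linear[OF \<mu> q])
      show "\<exists>u. form_chart \<mu> q u \<noteq> 0" "\<exists>u v. I.B q u v \<noteq> 0" using q0 by (auto simp: \<Omega>0_def)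
      fix \<xi> u v w assume n: "I.normal q \<xi>"
      \<comment> \<open>For constant curvature, the curvature of three tangent vectors paired with
        \<xi> is a sum of products, each containing the pairing of a tangent vector with the normal
        \<xi>.\<close>
      have "M.Gm d (f q) (FD f q t) \<xi> = 0" for t using n I.M.G_sym[OF I.f_in[OF q]] by (metis I.normal_def)
      then show "M.Gm d (f q) (I.M.curv (f q) (FD f q u) (FD f q v) (FD f q w)) \<xi> = 0"
        by (simp add: M.constant_curvature_chart[OF cc d I.f_in[OF q]])
      show "M.Gm d (f q) (I.nab q u (\<lambda>q. I.B q v w)) \<xi> =
        M.Gm d (f q) (I.B q (F.Gam c q u v) w + I.B q v (F.Gam c q u w) + form_chart \<mu> q u *\<^sub>R I.B q v w) \<xi>"
        by (rule recurrence_chart[OF rec q n])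
    qed (rule smooth_on_subset[OF form_chart_smooth[OF \<mu>] sub])
  qed
qed

text \<open>The form \<theta> dual to E is closed because E is parallel: its derivative is the
  product of E with \<open>F.Gam c q u v\<close>, symmetric in u and v. Straightening gives
  coordinates in which E is the first coordinate field and \<theta> the differential of the first
  coordinate.\<close>

lemma recurrent_product_neighbourhood:
  assumes ri: "recurrent_immersion \<Omega>0 (F.Gm c) (F.Gam c) (snd d ` fst d) (M.Gm d) (M.Gam d) f \<mu>"
    and sub: "\<Omega>0 \<subseteq> \<Omega>" and x: "q0 \<in> \<Omega>0" and dim: "DIM('f) = DIM('k::euclidean_space) + 1"
  obtains Uc I and K :: "('k::euclidean_space) set" and H \<Psi> h where "q0 \<in> Uc" "recurrent_product_chart F M c d Uc I K H \<Psi> h \<Omega>0 \<mu>"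
proof -
  interpret R: recurrent_immersion \<Omega>0 "F.Gm c" "F.Gam c" "snd d ` fst d" "M.Gm d" "M.Gam d" f \<mu> by (rule ri)
  define \<theta> where "\<theta> q v = F.Gm c q (R.E q) v" for q v
  have d\<theta>: "FD (\<lambda>q. \<theta> q v) q u = F.Gm c q (R.E q) (F.Gam c q u v)" if q: "q \<in> \<Omega>0" for q u v
  proof -
    have "((\<lambda>q. F.Gm c q (R.E q) v) has_derivative
      (\<lambda>h. F.Gm c q (FD R.E q h + F.Gam c q h (R.E q)) v + F.Gm c q (R.E q) (0 + F.Gam c q h v))) (at q)"
      by (rule R.F.G_along[OF R.F.op q _ has_derivative_ident smooth_on_has_derivative[OF R.E_smooth q] has_derivative_const])
    from FD_eq[OF this] show ?thesis
      unfolding \<theta>_def[abs_def] R.E_parallel[OF q] by (simp add: bilinear_simps[OF R.F.G_bil[OF q]])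
  qed
  have \<theta>lin: "linear (\<theta> q)" if "q \<in> \<Omega>0" for q
    using R.F.G_bil[OF that] unfolding \<theta>_def[abs_def] bilinear_def by simp
  have \<theta>sm: "smooth_on \<Omega>0 (\<lambda>q. \<theta> q v)" for v
    unfolding \<theta>_def by (rule smooth_on_bilfam[OF R.F.op R.F.G_bil R.F.G_smooth R.E_smooth smooth_on_const])
  have closed: "FD (\<lambda>q. \<theta> q v) q u = FD (\<lambda>q. \<theta> q u) q v" if "q \<in> \<Omega>0" for q u v
    unfolding d\<theta>[OF that] using R.F.\<Gamma>_sym[OF that] by metis
  have one: "\<theta> q (R.E q) = 1" if "q \<in> \<Omega>0" for q unfolding \<theta>_def by (rule R.G_E_E[OF that])
  obtain U \<epsilon> and H :: "'f \<Rightarrow> real \<times> 'k" and \<Psi> where U: "open U" "q0 \<in> U" "U \<subseteq> \<Omega>0" and \<epsilon>: "\<epsilon> > 0"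
    and \<Psi>U: "\<Psi> ` ({-\<epsilon><..<\<epsilon>} \<times> ball 0 \<epsilon>) = U"
    and H\<Psi>: "\<And>z. z \<in> {-\<epsilon><..<\<epsilon>} \<times> ball 0 \<epsilon> \<Longrightarrow> H (\<Psi> z) = z"
    and s: "smooth_on ({-\<epsilon><..<\<epsilon>} \<times> ball 0 \<epsilon>) \<Psi>" "smooth_on U H"
    and \<Psi>1: "\<And>z. z \<in> {-\<epsilon><..<\<epsilon>} \<times> ball 0 \<epsilon> \<Longrightarrow> FD \<Psi> z (1, 0) = R.E (\<Psi> z)"
    and d1: "\<And>y. y \<in> U \<Longrightarrow> ((\<lambda>y. fst (H y)) has_derivative \<theta> y) (at y)"
    by (rule straightening[OF R.F.op x R.E_smooth \<theta>lin \<theta>sm closed one dim]) (assumption | rule that)+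
  define I where "I = {-\<epsilon><..<\<epsilon>}"
  define K where "K = ball (0::'k) \<epsilon>"
  note IK = I_def[symmetric] K_def[symmetric]
  note \<Psi>U = \<Psi>U[unfolded IK] and H\<Psi> = H\<Psi>[unfolded IK] and s = s[unfolded IK] and \<Psi>1 = \<Psi>1[unfolded IK]
  have I: "open I" "convex I" "0 \<in> I" and K: "open K" "convex K" using \<epsilon> by (auto simp: I_def K_def)
  have oQ: "open (I \<times> K)" by (intro open_Times I K)
  have \<Psi>in: "\<Psi> z \<in> U" "\<Psi> z \<in> \<Omega>0" if "z \<in> I \<times> K" for z using that \<Psi>U U by blast+
  \<comment> \<open>The first coordinate of \<open>H (\<Psi> z)\<close> is \<open>fst z\<close>, and
    \<theta> is the differential of that coordinate. So \<theta> vanishes on vectors coming from the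
    second factor, that is, they are orthogonal to E.\<close>
  have \<Psi>2: "F.Gm c (\<Psi> z) (R.E (\<Psi> z)) (FD \<Psi> z (0, t)) = 0" if z: "z \<in> I \<times> K" for z t
  proof -
    have "((\<lambda>z. fst (H (\<Psi> z))) has_derivative (\<lambda>v. \<theta> (\<Psi> z) (FD \<Psi> z v))) (at z)"
      by (rule has_derivative_compose[OF smooth_on_has_derivative[OF s(1) z] d1[OF \<Psi>in(1)[OF z]]])
    then have "(fst has_derivative (\<lambda>v. \<theta> (\<Psi> z) (FD \<Psi> z v))) (at z)"
      by (rule has_derivative_transform_within_open[OF _ oQ z]) (simp add: H\<Psi>)
    from fun_cong[OF has_derivative_unique[OF this bounded_linear_imp_has_derivative[OF bounded_linear_fst]], of "(0, t)"]
    show ?thesis by (simp add: \<theta>_def)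
  qed
  \<comment> \<open>The metric induced on the level s = 0; by \<open>parallel_field_splits\<close>
    every other level carries the same one.\<close>
  define h where "h t a b = F.Gm c (\<Psi> (0, t)) (FD \<Psi> (0, t) (0, a)) (FD \<Psi> (0, t) (0, b))" for t a b
  have metric: "F.Gm c (\<Psi> z) (FD \<Psi> z a) (FD \<Psi> z b) = fst a * fst b + h (snd z) (snd a) (snd b)" if z: "z \<in> I \<times> K" for z a b
  proof -
    have m: "fst z \<in> I" "snd z \<in> K" using z by (auto simp: mem_Times_iff)
    show ?thesis
      using R.F.parallel_field_splits[OF R.E_smooth R.E_parallel R.G_E_E I K(1) s(1) \<Psi>in(2) \<Psi>1 \<Psi>2 m I(3), of a b]
      by (simp add: h_def)
  qed
  have Uc: "U \<subseteq> snd c ` fst c" using U(3) sub W_sub(1) unfolding \<Omega>_def by blast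
  have "product_chart F c U I K H \<Psi> h"
    by (rule product_chart.intro[OF F.riem_mfd_axioms product_chart_axioms.intro[OF c U(1) Uc I(1,2) K \<Psi>U H\<Psi> s metric]])
  then have "recurrent_product_chart F M c d U I K H \<Psi> h \<Omega>0 \<mu>"
    by (rule recurrent_product_chart.intro[OF riem_sub_chart_axioms _ ri recurrent_product_chart_axioms.intro[OF sub U(3) \<Psi>1]])
  with U(2) show thesis by (rule that)
qed

end


theorem theorem1:
  fixes n p :: nat and c :: real
    and M :: "('p, 'm::euclidean_space) riem"
    and F :: "('p, 'f::euclidean_space) riem"
    and x :: 'p
  assumes "n \<ge> 2" and "p \<ge> 2"
    and "DIM('m) = n + p" and "DIM('f) = n" and "DIM('k::euclidean_space) = n - 1"
    and "riemannian_manifold M" and "constant_curvature M c"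
    and "riemannian_submanifold F M" and "recurrent_sff F M"
    and "x \<in> points F" and "sff_deriv_nonzero_at F M x"
  shows "\<exists>U L1 L2. domain_in F U \<and> x \<in> U \<and>
    orthogonal_conjugate_system F M U [L1, L2] [1, n - 1] \<and>
    (\<forall>a\<in>U. \<exists>(F1 :: ('p, real) mfd) (F2 :: ('p, 'k) mfd).
       maximal_integral_submanifold F U L1 F1 \<and>
       maximal_integral_submanifold F U L2 F2 \<and>
       riemannian_product_at F U L1 L2 a F1 F2) \<and>
    (\<forall>F1 :: ('p, real) mfd. maximal_integral_submanifold F U L1 F1 \<longrightarrow>
       line_of_curvature F M F1) \<and>
    (\<forall>F2 :: ('p, 'k) mfd. maximal_integral_submanifold F U L2 F2 \<longrightarrow>
       (n = 2 \<longrightarrow> line_of_curvature F M F2) \<and> (n > 2 \<longrightarrow> surface_of_curvature F M F2))"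
proof -
  have F: "riemannian_manifold F" and sub: "submanifold F M"
    using assms(8) by (simp_all add: riemannian_submanifold_def)
  have sF: "smooth_manifold F" and sM: "smooth_manifold M" and xM: "x \<in> points M"
    using sub assms(10) by (auto simp: submanifold_def)
  define k d where "k = chart_at F x" and "d = chart_at M x"
  have k: "k \<in> mfd_atlas F" "x \<in> fst k"
    unfolding k_def by (rule chart_at_in[OF smooth_manifold_atlas_ok[OF sF] assms(10)])+
  have d: "d \<in> mfd_atlas M" "x \<in> fst d"
    unfolding d_def by (rule chart_at_in[OF smooth_manifold_atlas_ok[OF sM] xM])+
  interpret S: riem_sub_chart F M k d
    by unfold_locales (use F assms(6,8) k(1) d(1) in auto)
  have xW: "x \<in> S.W" using k(2) d(2) by (simp add: S.W_def)
  obtain \<mu> where \<mu>: "one_form F \<mu>" and rec0: "\<forall>U X Y Z y. open_in F U \<and> y \<in> U \<and>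
      vector_field F U X \<and> vector_field F U Y \<and> vector_field F U Z \<longrightarrow>
      sff_deriv F M X Y Z y = \<mu> y (X y) *\<^sub>R sff F M y (Y y) Z"
    using assms(9)[unfolded recurrent_sff_def, THEN conjunct2] by (elim exE conjE)
  have rec: "sff_deriv F M X Y Z y = \<mu> y (X y) *\<^sub>R sff F M y (Y y) Z"
    if "open_in F U" "y \<in> U" "vector_field F U X" "vector_field F U Y" "vector_field F U Z" for U X Y Z y
    by (rule rec0[rule_format, OF conjI[OF that(1) conjI[OF that(2) conjI[OF that(3) conjI[OF that(4,5)]]]]])
  obtain \<Omega>0 where \<Omega>0: "\<Omega>0 \<subseteq> S.\<Omega>" "snd k x \<in> \<Omega>0"
    and ri: "recurrent_immersion \<Omega>0 (S.F.Gm k) (S.F.Gam k) (snd d ` fst d) (S.M.Gm d) (S.M.Gam d) S.f (S.form_chart \<mu>)"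
    by (rule S.recurrent_neighbourhood[OF assms(7) xW assms(11) \<mu> rec]) (assumption | rule that)+
  \<comment> \<open>The subtraction \<open>n - 1\<close> is truncated; n \<ge> 2 makes adding 1 give
    back n.\<close>
  have dim: "DIM('f) = DIM('k) + 1" using assms(1,4,5) by simp
  obtain Uc I and K :: "'k set" and H \<Psi> h where x: "snd k x \<in> Uc"
    and rp: "recurrent_product_chart F M k d Uc I K H \<Psi> h \<Omega>0 (S.form_chart \<mu>)"
    by (rule S.recurrent_product_neighbourhood[OF ri \<Omega>0 dim])
  interpret R: recurrent_product_chart F M k d Uc I K H \<Psi> h \<Omega>0 "S.form_chart \<mu>" by (rule rp)
  show ?thesis
  proof (rule exI[of _ R.P.U], rule exI[of _ R.P.L1], rule exI[of _ R.P.L2], intro conjI ballI allI impI)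
    show "domain_in F R.P.U" by (rule R.P.U_domain)
    show "x \<in> R.P.U" using x k(2) by (simp add: R.P.U_def)
    show "orthogonal_conjugate_system F M R.P.U [R.P.L1, R.P.L2] [1, n - 1]"
      by (rule R.orthogonal_system[OF assms(4,5,1)])
  next
    fix a assume "a \<in> R.P.U"
    then show "\<exists>(F1 :: ('p, real) mfd) (F2 :: ('p, 'k) mfd).
       maximal_integral_submanifold F R.P.U R.P.L1 F1 \<and>
       maximal_integral_submanifold F R.P.U R.P.L2 F2 \<and>
       riemannian_product_at F R.P.U R.P.L1 R.P.L2 a F1 F2"
      using R.P.maximal1 R.P.maximal2 R.P.product by blast
  next
    fix F1 :: "('p, real) mfd" assume "maximal_integral_submanifold F R.P.U R.P.L1 F1"
    then show "line_of_curvature F M F1"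
      using R.curvature_surface[of R.P.L1 F1] by (simp add: line_of_curvature_def maximal_integral_submanifold_def)
  next
    fix F2 :: "('p, 'k) mfd" assume m: "maximal_integral_submanifold F R.P.U R.P.L2 F2"
    then have s: "surface_of_curvature F M F2"
      using R.curvature_surface[of R.P.L2 F2] by (simp add: maximal_integral_submanifold_def)
    then show "surface_of_curvature F M F2" .
    assume "n = 2"
    then show "line_of_curvature F M F2" using s assms(5) by (simp add: line_of_curvature_def)
  qed
qed

end
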